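(* Let $G$ and $H$ be possibly non-ground $\rho df_\bot$-graphs. Then: 1. Deciding whether $G\models H$ is an NP-complete problem. 2. If $H$ is ground, then $G\models H$ if and only if $H\subseteq\mathrm{Cl}_B(G)$. 3. The size $|\mathrm{Cl}_B(G)|$ is $O(|G|^2)$.
   Context: **Syntax.** $U$ (URI references), $L$ (literals, plain or typed) and $B$ (blank nodes) are pairwise disjoint sets; $UL=U\cup L$, $UBL=U\cup B\cup L$. The reserved vocabulary is $\rho df_\bot=\{\mathsf{sp},\mathsf{sc},\mathsf{type},\mathsf{dom},\mathsf{range},\bot_c,\bot_p\}\subseteq U$. A (possibly non-ground) triple is $(s,p,o)\in UBL\times U\times UBL$ with $s,o\notin\rho df_\bot$. A graph is a finite set of triples; it is ground if no blank node occurs in it. $\mathrm{uni}(G)$ is the set of elements of $UL$ occurring in $G$; $|G|$ is the number of triples. **Semantics.** An interpretation over a vocabulary $V\subseteq UL$ is a tuple $\mathcal I=\langle\Delta_R,\Delta_P,\Delta_C,\Delta_L,P[\cdot],C[\cdot],\cdot^{\mathcal I}\rangle$ where the $\Delta$'s are finite non-empty sets, $\Delta_C\subseteq\Delta_R$, $L\cap V\subseteq\Delta_L\subseteq\Delta_R$, $P:\Delta_P\to2^{\Delta_R\times\Delta_R}$, $C:\Delta_C\to2^{\Delta_R}$, and $\cdot^{\mathcal I}$ maps each $t\in UL\cap V$ to an element of $\Delta_R\cup\Delta_P$, is the identity on plain literals and maps literals into $\Delta_R$. Blank nodes are existential: $\mathcal I$ is a model of $G$ iff it interprets (at least) $\rho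 df_\bot\cup\mathrm{uni}(G)$ and $\cdot^{\mathcal I}$ can be extended by some function $B\to\Delta_R$ so that, writing $P_e$ for $P[e^{\mathcal I}]$: - for each $(s,p,o)\in G$: $p^{\mathcal I}\in\Delta_P$ and $(s^{\mathcal I},o^{\mathcal I})\in P[p^{\mathcal I}]$; and $e^{\mathcal I}\in\Delta_P$ for each $e\in\rho df_\bot$; - $P_{\mathsf{sp}}$ is transitive over $\Delta_P$, and $(p,q)\in P_{\mathsf{sp}}$ implies $p,q\in\Delta_P$, $P[p]\subseteq P[q]$; - $P_{\mathsf{sc}}$ is transitive over $\Delta_C$, and $(c,d)\in P_{\mathsf{sc}}$ implies $c,d\in\Delta_C$, $C[c]\subseteq C[d]$; - $x\in C[c]$ iff $(x,c)\in P_{\mathsf{type}}$; $(x,c)\in P_{\mathsf{type}}$ implies $c\in\Delta_C$; - $(p,c)\in P_{\mathsf{dom}}$ implies $p\in\Delta_P$, $c\in\Delta_C$, and $x\in C[c]$ whenever $(x,y)\in P[p]$; $(p,c)\in P_{\mathsf{range}}$ implies $p\in\Delta_P$, $c\in\Delta_C$, and $y\in C[c]$ whenever $(x,y)\in P[p]$; - $P_{\bot_c}$ is a symmetric relation on $\Delta_C$; $(c,d)\in P_{\bot_c}$, $(e,c)\in P_{\mathsf{sc}}$ imply $(e,d)\in P_{\bot_c}$; $(c,c)\in P_{\bot_c}$, $d\in\Delta_C$ imply $(c,d)\in P_{\bot_c}$; - $P_{\bot_p}$ is a symmetric relation on $\Delta_P$; $(p,q)\in P_{\bot_p}$, $(r,p)\in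 P_{\mathsf{sp}}$ imply $(r,q)\in P_{\bot_p}$; $(p,p)\in P_{\bot_p}$, $q\in\Delta_P$ imply $(p,q)\in P_{\bot_p}$; - if $(p,c),(q,d)\in P_{\mathsf{dom}}$ and $(c,d)\in P_{\bot_c}$, then $(p,q)\in P_{\bot_p}$; likewise with $\mathsf{range}$ in place of $\mathsf{dom}$. $G\models H$ iff every model of $G$ is a model of $H$. **Closure.** $\mathrm{Cl}_B(G)$ is the closure of $G$ under the following rules (metavariables range over $UBL$; instances must consist of triples): (2a) $(A,\mathsf{sp},B),(B,\mathsf{sp},C)\Rightarrow(A,\mathsf{sp},C)$; (2b) $(D,\mathsf{sp},E),(X,D,Y)\Rightarrow(X,E,Y)$; (3a) $(A,\mathsf{sc},B),(B,\mathsf{sc},C)\Rightarrow(A,\mathsf{sc},C)$; (3b) $(A,\mathsf{sc},B),(X,\mathsf{type},A)\Rightarrow(X,\mathsf{type},B)$; (4a) $(D,\mathsf{dom},B),(X,D,Y)\Rightarrow(X,\mathsf{type},B)$; (4b) $(D,\mathsf{range},B),(X,D,Y)\Rightarrow(Y,\mathsf{type},B)$; (5a) $(A,\bot_c,B)\Rightarrow(B,\bot_c,A)$; (5b) $(A,\bot_c,B),(C,\mathsf{sc},A)\Rightarrow(C,\bot_c,B)$; (5c) $(A,\bot_c,A)\Rightarrow(A,\bot_c,B)$; (6a) $(A,\bot_p,B)\Rightarrow(B,\bot_p,A)$; (6b) $(A,\bot_p,B),(C,\mathsf{sp},A)\Rightarrow(C,\bot_p,B)$; (6c) $(A,\bot_p,A)\Rightarrow(A,\bot_p,B)$;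 (7a) $(A,\mathsf{dom},C),(B,\mathsf{dom},D),(C,\bot_c,D)\Rightarrow(A,\bot_p,B)$; (7b) $(A,\mathsf{range},C),(B,\mathsf{range},D),(C,\bot_c,D)\Rightarrow(A,\bot_p,B)$; (8a) $(A,\mathsf{dom},B),(D,\mathsf{sp},A),(X,D,Y)\Rightarrow(X,\mathsf{type},B)$; (8b) $(A,\mathsf{range},B),(D,\mathsf{sp},A),(X,D,Y)\Rightarrow(Y,\mathsf{type},B)$.
   Formalization: In rules (5c), (6c) the free metavariable B ranges only over terms G uses as classes, resp. properties (over all of UBL, parts 2 and 3 fail, e.g. for G={(a,⊥c,a)}); domains of interpretations consist of literals and countably many other objects, which covers all up to isomorphism. *)

theory Defs
  imports "HOL-Computational_Algebra.Polynomial"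
begin

section \<open>Syntax\<close>

text \<open>
  The type parameters \<open>'u\<close>, \<open>'b\<close>, \<open>'l\<close> are the names used for the non-reserved URI references,
  the blank nodes and the literals; a typed literal's name stands for the lexical form together
  with the datatype.
\<close>

datatype 'u uri = Sp | Sc | Type | Dom | Range | BotC | BotP | Uri 'u

datatype 'l literal = Plain 'l | Typed 'l

datatype ('u, 'b, 'l) rdf_term = URI "'u uri" | BNode 'b | Lit "'l literal"

type_synonym ('u, 'b, 'l) triple =
  "('u, 'b, 'l) rdf_term \<times> 'u uri \<times> ('u, 'b, 'l) rdf_term"

type_synonym ('u, 'b, 'l) triples = "('u, 'b, 'l) triple set"

definition UL :: "('u, 'b, 'l) rdf_term set" where
  "UL = range URI \<union> range Lit"

definition reserved :: "'u uri set" where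
  "reserved = {Sp, Sc, Type, Dom, Range, BotC, BotP}"

fun is_triple :: "('u, 'b, 'l) triple \<Rightarrow> bool" where
  "is_triple (s, p, o') \<longleftrightarrow> s \<notin> URI ` reserved \<and> o' \<notin> URI ` reserved"

definition is_graph :: "('u, 'b, 'l) triples \<Rightarrow> bool" where
  "is_graph G \<longleftrightarrow> finite G \<and> (\<forall>t\<in>G. is_triple t)"

definition terms_of :: "('u, 'b, 'l) triples \<Rightarrow> ('u, 'b, 'l) rdf_term set" where
  "terms_of G = (\<Union>(s, p, o')\<in>G. {s, URI p, o'})"

definition uni :: "('u, 'b, 'l) triples \<Rightarrow> ('u, 'b, 'l) rdf_term set" where
  "uni G = terms_of G \<inter> UL"

definition ground :: "('u, 'b, 'l) triples \<Rightarrow> bool" where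
  "ground G \<longleftrightarrow> terms_of G \<inter> range BNode = {}"


section \<open>Semantics\<close>

text \<open>
  Interpretations fix plain literals, so the literals have to be available as elements of
  domains. All other elements are taken from a countable supply: as the components of an
  interpretation are finite, every interpretation is, up to a renaming of its non-literal
  elements, one over this type.
\<close>

datatype 'l elem = ELit "'l literal" | Obj nat

record ('u, 'b, 'l) interp =
  Res  :: "'l elem set"
  Prop :: "'l elem set"
  Cls  :: "'l elem set"
  Lits :: "'l elem set"
  PExt :: "'l elem \<Rightarrow> ('l elem \<times> 'l elem) set"
  CExt :: "'l elem \<Rightarrow> 'l elem set"
  den  :: "('u, 'b, 'l) rdf_term \<Rightarrow> 'l elem"

text \<open>
  \<open>PExt\<close>, \<open>CExt\<close> and \<open>den\<close> are total functions of which only the restrictions to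
  \<open>Prop\<close>, \<open>Cls\<close> and the vocabulary \<open>V\<close> matter.
\<close>

definition is_interp :: "('u, 'b, 'l) rdf_term set \<Rightarrow> ('u, 'b, 'l) interp \<Rightarrow> bool" where
  "is_interp V I \<longleftrightarrow>
     V \<subseteq> UL \<and>
     finite (Res I) \<and> Res I \<noteq> {} \<and> finite (Prop I) \<and> Prop I \<noteq> {} \<and>
     finite (Cls I) \<and> Cls I \<noteq> {} \<and> finite (Lits I) \<and> Lits I \<noteq> {} \<and>
     Cls I \<subseteq> Res I \<and> Lits I \<subseteq> Res I \<and>
     (\<forall>l. Lit l \<in> V \<longrightarrow> ELit l \<in> Lits I) \<and>
     (\<forall>p\<in>Prop I. PExt I p \<subseteq> Res I \<times> Res I) \<and>
     (\<forall>c\<in>Cls I. CExt I c \<subseteq> Res I) \<and>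
     (\<forall>t\<in>V. den I t \<in> Res I \<union> Prop I) \<and>
     (\<forall>l. Lit (Plain l) \<in> V \<longrightarrow> den I (Lit (Plain l)) = ELit (Plain l)) \<and>
     (\<forall>l. Lit l \<in> V \<longrightarrow> den I (Lit l) \<in> Res I)"

fun eval_term :: "('u, 'b, 'l) interp \<Rightarrow> ('b \<Rightarrow> 'l elem) \<Rightarrow> ('u, 'b, 'l) rdf_term \<Rightarrow> 'l elem" where
  "eval_term I \<alpha> (BNode b) = \<alpha> b"
| "eval_term I \<alpha> (URI u) = den I (URI u)"
| "eval_term I \<alpha> (Lit l) = den I (Lit l)"

definition pext_of :: "('u, 'b, 'l) interp \<Rightarrow> 'u uri \<Rightarrow> ('l elem \<times> 'l elem) set" where
  "pext_of I e = PExt I (den I (URI e))"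

definition simple_cond ::
    "('u, 'b, 'l) interp \<Rightarrow> ('b \<Rightarrow> 'l elem) \<Rightarrow> ('u, 'b, 'l) triples \<Rightarrow> bool" where
  "simple_cond I \<alpha> G \<longleftrightarrow>
     (\<forall>(s, p, o')\<in>G. den I (URI p) \<in> Prop I \<and>
        (eval_term I \<alpha> s, eval_term I \<alpha> o') \<in> pext_of I p) \<and>
     (\<forall>e\<in>reserved. den I (URI e) \<in> Prop I)"

definition subproperty_cond :: "('u, 'b, 'l) interp \<Rightarrow> bool" where
  "subproperty_cond I \<longleftrightarrow>
     trans_on (Prop I) (pext_of I Sp) \<and>
     (\<forall>(p, q)\<in>pext_of I Sp. p \<in> Prop I \<and> q \<in> Prop I \<and> PExt I p \<subseteq> PExt I q)"

definition subclass_cond :: "('u, 'b, 'l) interp \<Rightarrow> bool" where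
  "subclass_cond I \<longleftrightarrow>
     trans_on (Cls I) (pext_of I Sc) \<and>
     (\<forall>(c, d)\<in>pext_of I Sc. c \<in> Cls I \<and> d \<in> Cls I \<and> CExt I c \<subseteq> CExt I d)"

definition typing_cond :: "('u, 'b, 'l) interp \<Rightarrow> bool" where
  "typing_cond I \<longleftrightarrow>
     (\<forall>c\<in>Cls I. \<forall>x. x \<in> CExt I c \<longleftrightarrow> (x, c) \<in> pext_of I Type) \<and>
     (\<forall>(x, c)\<in>pext_of I Type. c \<in> Cls I) \<and>
     (\<forall>(p, c)\<in>pext_of I Dom. p \<in> Prop I \<and> c \<in> Cls I \<and> (\<forall>(x, y)\<in>PExt I p. x \<in> CExt I c)) \<and>
     (\<forall>(p, c)\<in>pext_of I Range. p \<in> Prop I \<and> c \<in> Cls I \<and> (\<forall>(x, y)\<in>PExt I p. y \<in> CExt I c))"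

definition class_disj_cond :: "('u, 'b, 'l) interp \<Rightarrow> bool" where
  "class_disj_cond I \<longleftrightarrow>
     pext_of I BotC \<subseteq> Cls I \<times> Cls I \<and> sym (pext_of I BotC) \<and>
     (\<forall>c d e. (c, d) \<in> pext_of I BotC \<and> (e, c) \<in> pext_of I Sc \<longrightarrow> (e, d) \<in> pext_of I BotC) \<and>
     (\<forall>c d. (c, c) \<in> pext_of I BotC \<and> d \<in> Cls I \<longrightarrow> (c, d) \<in> pext_of I BotC)"

definition prop_disj_cond :: "('u, 'b, 'l) interp \<Rightarrow> bool" where
  "prop_disj_cond I \<longleftrightarrow>
     pext_of I BotP \<subseteq> Prop I \<times> Prop I \<and> sym (pext_of I BotP) \<and>
     (\<forall>p q r. (p, q) \<in> pext_of I BotP \<and> (r, p) \<in> pext_of I Sp \<longrightarrow> (r, q) \<in> pext_of I BotP) \<and>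
     (\<forall>p q. (p, p) \<in> pext_of I BotP \<and> q \<in> Prop I \<longrightarrow> (p, q) \<in> pext_of I BotP) \<and>
     (\<forall>p q c d. (p, c) \<in> pext_of I Dom \<and> (q, d) \<in> pext_of I Dom \<and> (c, d) \<in> pext_of I BotC
        \<longrightarrow> (p, q) \<in> pext_of I BotP) \<and>
     (\<forall>p q c d. (p, c) \<in> pext_of I Range \<and> (q, d) \<in> pext_of I Range \<and> (c, d) \<in> pext_of I BotC
        \<longrightarrow> (p, q) \<in> pext_of I BotP)"

definition is_model ::
    "('u, 'b, 'l) rdf_term set \<Rightarrow> ('u, 'b, 'l) interp \<Rightarrow> ('u, 'b, 'l) triples \<Rightarrow> bool" where
  "is_model V I G \<longleftrightarrow>
     is_interp V I \<and> URI ` reserved \<union> uni G \<subseteq> V \<and>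
     (\<exists>\<alpha>. range \<alpha> \<subseteq> Res I \<and> simple_cond I \<alpha> G) \<and>
     subproperty_cond I \<and> subclass_cond I \<and> typing_cond I \<and>
     class_disj_cond I \<and> prop_disj_cond I"

definition entails :: "('u, 'b, 'l) triples \<Rightarrow> ('u, 'b, 'l) triples \<Rightarrow> bool" where
  "entails G H \<longleftrightarrow> (\<forall>V I. is_model V I G \<longrightarrow> is_model V I H)"


section \<open>Closure\<close>

text \<open>
  The rules deriving \<open>(A, BotC, B)\<close> from \<open>(A, BotC, A)\<close> and \<open>(A, BotP, B)\<close> from \<open>(A, BotP, A)\<close>
  have a metavariable that does not occur in their premise. Instantiating it by arbitrary
  elements makes the closure infinite, and instantiating it by arbitrary elements occurring in
  the graph makes the rules unsound: in their semantic counterparts the second component ranges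
  over the classes, respectively the properties, of the interpretation. It is therefore
  restricted to the elements that the graph uses as classes, respectively as properties.
\<close>

definition class_terms :: "('u, 'b, 'l) triples \<Rightarrow> ('u, 'b, 'l) rdf_term set" where
  "class_terms G =
     {c. \<exists>x. (c, Sc, x) \<in> G \<or> (x, Sc, c) \<in> G \<or> (x, Type, c) \<in> G \<or> (x, Dom, c) \<in> G \<or>
             (x, Range, c) \<in> G \<or> (c, BotC, x) \<in> G \<or> (x, BotC, c) \<in> G}"

definition prop_terms :: "('u, 'b, 'l) triples \<Rightarrow> ('u, 'b, 'l) rdf_term set" where
  "prop_terms G =
     {p. \<exists>x. (p, Sp, x) \<in> G \<or> (x, Sp, p) \<in> G \<or> (p, Dom, x) \<in> G \<or> (p, Range, x) \<in> G \<or>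
             (p, BotP, x) \<in> G \<or> (x, BotP, p) \<in> G} \<union>
     {URI p | p. \<exists>s o'. (s, p, o') \<in> G}"

text \<open>
  In the remaining rules the conclusion is a triple whenever the premises are; using a
  metavariable in predicate position forces it to be a URI reference.
\<close>

inductive_set Cl_B :: "('u, 'b, 'l) triples \<Rightarrow> ('u, 'b, 'l) triples"
  for G :: "('u, 'b, 'l) triples" where
  base: "t \<in> G \<Longrightarrow> t \<in> Cl_B G"
| r2a: "\<lbrakk>(A, Sp, B) \<in> Cl_B G; (B, Sp, C) \<in> Cl_B G\<rbrakk> \<Longrightarrow> (A, Sp, C) \<in> Cl_B G"
| r2b: "\<lbrakk>(URI D, Sp, URI E) \<in> Cl_B G; (X, D, Y) \<in> Cl_B G\<rbrakk> \<Longrightarrow> (X, E, Y) \<in> Cl_B G"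
| r3a: "\<lbrakk>(A, Sc, B) \<in> Cl_B G; (B, Sc, C) \<in> Cl_B G\<rbrakk> \<Longrightarrow> (A, Sc, C) \<in> Cl_B G"
| r3b: "\<lbrakk>(A, Sc, B) \<in> Cl_B G; (X, Type, A) \<in> Cl_B G\<rbrakk> \<Longrightarrow> (X, Type, B) \<in> Cl_B G"
| r4a: "\<lbrakk>(URI D, Dom, B) \<in> Cl_B G; (X, D, Y) \<in> Cl_B G\<rbrakk> \<Longrightarrow> (X, Type, B) \<in> Cl_B G"
| r4b: "\<lbrakk>(URI D, Range, B) \<in> Cl_B G; (X, D, Y) \<in> Cl_B G\<rbrakk> \<Longrightarrow> (Y, Type, B) \<in> Cl_B G"
| r5a: "(A, BotC, B) \<in> Cl_B G \<Longrightarrow> (B, BotC, A) \<in> Cl_B G"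
| r5b: "\<lbrakk>(A, BotC, B) \<in> Cl_B G; (C, Sc, A) \<in> Cl_B G\<rbrakk> \<Longrightarrow> (C, BotC, B) \<in> Cl_B G"
| r5c: "\<lbrakk>(A, BotC, A) \<in> Cl_B G; B \<in> class_terms G; is_triple (A, BotC, B)\<rbrakk>
         \<Longrightarrow> (A, BotC, B) \<in> Cl_B G"
| r6a: "(A, BotP, B) \<in> Cl_B G \<Longrightarrow> (B, BotP, A) \<in> Cl_B G"
| r6b: "\<lbrakk>(A, BotP, B) \<in> Cl_B G; (C, Sp, A) \<in> Cl_B G\<rbrakk> \<Longrightarrow> (C, BotP, B) \<in> Cl_B G"
| r6c: "\<lbrakk>(A, BotP, A) \<in> Cl_B G; B \<in> prop_terms G; is_triple (A, BotP, B)\<rbrakk>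
         \<Longrightarrow> (A, BotP, B) \<in> Cl_B G"
| r7a: "\<lbrakk>(A, Dom, C) \<in> Cl_B G; (B, Dom, D) \<in> Cl_B G; (C, BotC, D) \<in> Cl_B G\<rbrakk>
         \<Longrightarrow> (A, BotP, B) \<in> Cl_B G"
| r7b: "\<lbrakk>(A, Range, C) \<in> Cl_B G; (B, Range, D) \<in> Cl_B G; (C, BotC, D) \<in> Cl_B G\<rbrakk>
         \<Longrightarrow> (A, BotP, B) \<in> Cl_B G"
| r8a: "\<lbrakk>(A, Dom, B) \<in> Cl_B G; (URI D, Sp, A) \<in> Cl_B G; (X, D, Y) \<in> Cl_B G\<rbrakk>
         \<Longrightarrow> (X, Type, B) \<in> Cl_B G"
| r8b: "\<lbrakk>(A, Range, B) \<in> Cl_B G; (URI D, Sp, A) \<in> Cl_B G; (X, D, Y) \<in> Cl_B G\<rbrakk>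
         \<Longrightarrow> (Y, Type, B) \<in> Cl_B G"


section \<open>Polynomial time and NP\<close>

text \<open>
  Deterministic Turing machines with a fixed number of two-way infinite tapes, over the tape
  symbols \<open>{0..<symbols}\<close>, of which 0 is the blank and 1, 2 are the two letters of the binary
  alphabet. The start state is 0, the states \<open>{0..<states}\<close> are running, and the number
  \<open>states\<close> itself is the halting state.
\<close>

datatype move = MoveLeft | Stay | MoveRight

record tm =
  tapes   :: nat
  symbols :: nat
  states  :: nat
  delta   :: "nat \<Rightarrow> nat list \<Rightarrow> nat \<times> (nat \<times> move) list"

definition is_tm :: "tm \<Rightarrow> bool" where
  "is_tm M \<longleftrightarrow>
     1 \<le> tapes M \<and> 3 \<le> symbols M \<and>
     (\<forall>q rs. q < states M \<and> length rs = tapes M \<and> set rs \<subseteq> {..<symbols M} \<longrightarrow>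
        fst (delta M q rs) \<le> states M \<and>
        length (snd (delta M q rs)) = tapes M \<and>
        (\<forall>(w, m)\<in>set (snd (delta M q rs)). w < symbols M))"

text \<open>A tape is a head position with the contents of the cells.\<close>

type_synonym tape = "int \<times> (int \<Rightarrow> nat)"

type_synonym config = "nat \<times> tape list"

fun act :: "nat \<times> move \<Rightarrow> tape \<Rightarrow> tape" where
  "act (w, m) (h, c) =
     ((case m of MoveLeft \<Rightarrow> h - 1 | Stay \<Rightarrow> h | MoveRight \<Rightarrow> h + 1), c(h := w))"

definition step :: "tm \<Rightarrow> config \<Rightarrow> config" where
  "step M = (\<lambda>(q, ts).
     if q < states M
     then (let (q', as) = delta M q (map (\<lambda>(h, c). c h) ts) in (q', map2 act as ts))
     else (q, ts))"

definition cells :: "bool list \<Rightarrow> int \<Rightarrow> nat" where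
  "cells w = (\<lambda>i. if 0 \<le> i \<and> i < int (length w) then (if w ! nat i then 2 else 1) else 0)"

text \<open>
  The input words are on the first tapes, the other tapes are blank; the output is the contents
  of the last tape in the halting configuration.
\<close>

definition init :: "tm \<Rightarrow> bool list list \<Rightarrow> config" where
  "init M ws = (0, map (\<lambda>i. (0, cells (if i < length ws then ws ! i else []))) [0..<tapes M])"

definition yields_in :: "tm \<Rightarrow> bool list list \<Rightarrow> nat \<Rightarrow> bool list \<Rightarrow> bool" where
  "yields_in M ws t y \<longleftrightarrow>
     (let (q, ts) = (step M ^^ t) (init M ws) in q = states M \<and> snd (last ts) = cells y)"

definition polytime :: "nat \<Rightarrow> (bool list list \<Rightarrow> bool list) \<Rightarrow> bool" where
  "polytime n f \<longleftrightarrow>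
     (\<exists>M (p :: nat poly). is_tm M \<and> n \<le> tapes M \<and>
        (\<forall>ws. length ws = n \<longrightarrow>
           (\<exists>t \<le> poly p (sum_list (map length ws)). yields_in M ws t (f ws))))"

definition NP :: "bool list set set" where
  "NP = {A. \<exists>R (q :: nat poly).
           polytime 2 (\<lambda>ws. [R (ws ! 0) (ws ! 1)]) \<and>
           (\<forall>x. x \<in> A \<longleftrightarrow> (\<exists>y. length y \<le> poly q (length x) \<and> R x y))}"

definition poly_reducible :: "bool list set \<Rightarrow> bool list set \<Rightarrow> bool" where
  "poly_reducible A B \<longleftrightarrow>
     (\<exists>f. polytime 1 (\<lambda>ws. f (ws ! 0)) \<and> (\<forall>x. x \<in> A \<longleftrightarrow> f x \<in> B))"

definition NP_complete :: "bool list set \<Rightarrow> bool" where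
  "NP_complete B \<longleftrightarrow> B \<in> NP \<and> (\<forall>A\<in>NP. poly_reducible A B)"


section \<open>The entailment problem as a language\<close>

text \<open>
  Names are binary words. All codes are prefix-free: numbers are written in unary, and every
  element of a list is announced by a bit.
\<close>

definition enc_list :: "('a \<Rightarrow> bool list) \<Rightarrow> 'a list \<Rightarrow> bool list" where
  "enc_list e xs = concat (map (\<lambda>x. True # e x) xs) @ [False]"

definition enc_tag :: "nat \<Rightarrow> bool list" where
  "enc_tag n = replicate n True @ [False]"

definition enc_name :: "bool list \<Rightarrow> bool list" where
  "enc_name w = enc_list (\<lambda>b. [b]) w"

fun enc_uri :: "bool list uri \<Rightarrow> bool list" where
  "enc_uri Sp = enc_tag 0"
| "enc_uri Sc = enc_tag 1"
| "enc_uri Type = enc_tag 2"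
| "enc_uri Dom = enc_tag 3"
| "enc_uri Range = enc_tag 4"
| "enc_uri BotC = enc_tag 5"
| "enc_uri BotP = enc_tag 6"
| "enc_uri (Uri w) = enc_tag 7 @ enc_name w"

type_synonym name_term = "(bool list, bool list, bool list) rdf_term"
type_synonym name_triple = "(bool list, bool list, bool list) triple"

fun enc_term :: "name_term \<Rightarrow> bool list" where
  "enc_term (URI u) = enc_tag 0 @ enc_uri u"
| "enc_term (BNode w) = enc_tag 1 @ enc_name w"
| "enc_term (Lit (Plain w)) = enc_tag 2 @ enc_name w"
| "enc_term (Lit (Typed w)) = enc_tag 3 @ enc_name w"

fun enc_triple :: "name_triple \<Rightarrow> bool list" where
  "enc_triple (s, p, o') = enc_term s @ enc_uri p @ enc_term o'"

text \<open>A graph is represented by any list of its triples.\<close>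

definition enc_instance :: "name_triple list \<Rightarrow> name_triple list \<Rightarrow> bool list" where
  "enc_instance gs hs = enc_list enc_triple gs @ enc_list enc_triple hs"

definition entailment_problem :: "bool list set" where
  "entailment_problem =
     {enc_instance gs hs | gs hs.
        is_graph (set gs) \<and> is_graph (set hs) \<and> entails (set gs) (set hs)}"

end

theory Submission
  imports Defs "HOL-Library.Countable"
begin

text \<open>Entailment is characterised by homomorphisms: \<open>G\<close> entails \<open>H\<close> iff some map of the blank nodes of \<open>H\<close>
  to terms sends \<open>H\<close> into \<open>Cl_B G\<close>. Soundness of the rules gives one direction; the other one reads the
  map off the model whose elements are the terms of \<open>G\<close> and whose relations are given by the closure.
  For a ground \<open>H\<close> the only image is \<open>H\<close> itself. Rules with a non-reserved predicate in the conclusion keep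
  subject and object, so a closure triple with such a predicate is given by a triple of \<open>G\<close> and one of the at
  most \<open>3 |G|\<close> terms of \<open>G\<close>; with a reserved predicate it is given by two terms.

  Membership in NP: parsing the instance, the closure and the homomorphism are described by one finite
  rule system over words, a certificate is a derivation, and one Turing machine checks derivations of
  any such system. Hardness: the computations of a fixed verifier are the tilings of a rectangle, the
  possible tiles with their adjacency relations form a fixed ground graph \<open>G\<close> on which no closure rule
  applies, and the positions of the rectangle form \<open>H\<close>, with one blank node each; homomorphisms from \<open>H\<close>
  to \<open>G\<close> are exactly the tilings.\<close>

section \<open>A stack language for multitape Turing machines\<close>

text \<open>Since \<open>polytime\<close> speaks of concrete machines, every claim of polynomial
  time ends in a program with a counted running time. Only two substantial programs are needed: a
  checker generic in the rules, and a generator of constraints. What is specific to entailment is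
  settled by a soundness invariant and by counting words; the number of facts bounds a certificate,
  whatever the shape of the derivation.

  In the model construction the obstacle is self-disjointness of properties. Semantically it extends
  to all of \<open>Prop\<close>, which contains the reserved names, yet no triple has a reserved
  name as subject or object. The model thus has \<open>BotP\<close> pairs that the closure lacks,
  and an assignment using one must be redirected. Blank nodes and literals as properties depend on
  (8a) and (8b), because (2b), (4a) and (4b) need a reference as predicate.

  Hardness starts from an arbitrary verifier. With positions numbered row by row, adjacency is
  addition of 1 or of the row width, which a program with unary counters can write.\<close>

text \<open>Register \<open>r > 0\<close> is a stack on tape \<open>r - 1\<close> with the head on its top, so that an input word is a stack
  from the start; register 0 is the output, which is only ever extended, on the last tape.\<close>

datatype com =
    Skip
  | Push nat bool
  | Pop nat
  | Out bool
  | Seq com com  (infixr ";;" 60)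
  | Test nat com com com
  | While nat com

type_synonym regs = "nat \<Rightarrow> bool list"

inductive exec :: "com \<Rightarrow> regs \<Rightarrow> nat \<Rightarrow> regs \<Rightarrow> bool" where
  Skip: "exec Skip s 0 s"
| Push: "exec (Push r b) s 2 (s(r := b # s r))"
| Pop: "exec (Pop r) s 1 (s(r := tl (s r)))"
| Out: "exec (Out b) s 1 (s(0 := s 0 @ [b]))"
| Seq: "\<lbrakk>exec c1 s t1 s1; exec c2 s1 t2 s2\<rbrakk> \<Longrightarrow> exec (c1 ;; c2) s (t1 + t2) s2"
| TestNil: "\<lbrakk>s r = []; exec c0 s t s'\<rbrakk> \<Longrightarrow> exec (Test r c0 c1 c2) s (Suc t) s'"
| TestTrue: "\<lbrakk>s r = True # xs; exec c1 s t s'\<rbrakk> \<Longrightarrow> exec (Test r c0 c1 c2) s (Suc t) s'"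
| TestFalse: "\<lbrakk>s r = False # xs; exec c2 s t s'\<rbrakk> \<Longrightarrow> exec (Test r c0 c1 c2) s (Suc t) s'"
| WhileNil: "s r = [] \<Longrightarrow> exec (While r c) s 1 s"
| WhileCons: "\<lbrakk>s r \<noteq> []; exec c s t1 s1; exec (While r c) s1 t2 s2\<rbrakk>
    \<Longrightarrow> exec (While r c) s (Suc (t1 + t2)) s2"

fun len :: "com \<Rightarrow> nat" where
  "len Skip = 0"
| "len (Push r b) = 2"
| "len (Pop r) = 1"
| "len (Out b) = 1"
| "len (c1 ;; c2) = len c1 + len c2"
| "len (Test r c0 c1 c2) = Suc (len c0 + len c1 + len c2)"
| "len (While r c) = Suc (len c)"

definition letter :: "bool \<Rightarrow> nat" where
  "letter b = (if b then 2 else 1)"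

definition keep :: "nat list \<Rightarrow> (nat \<times> move) list" where
  "keep rs = map (\<lambda>x. (x, Stay)) rs"

text \<open>The states of a command \<open>c\<close> are \<open>{0..<len c}\<close>, it is left in state \<open>len c\<close>. A push moves the head
  to the left first and writes then. A popped cell is erased, so everything outside of the stack is blank.\<close>

fun code :: "com \<Rightarrow> nat \<Rightarrow> nat list \<Rightarrow> nat \<times> (nat \<times> move) list" where
  "code Skip q rs = (0, keep rs)"
| "code (Push r b) q rs =
     (Suc q, (keep rs)[r - 1 := if q = 0 then (rs ! (r - 1), MoveLeft) else (letter b, Stay)])"
| "code (Pop r) q rs = (1, (keep rs)[r - 1 := (0, MoveRight)])"
| "code (Out b) q rs = (1, (keep rs)[length rs - 1 := (letter b, MoveRight)])"
| "code (c1 ;; c2) q rs =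
     (if q < len c1 then code c1 q rs
      else apfst (\<lambda>q. q + len c1) (code c2 (q - len c1) rs))"
| "code (Test r c0 c1 c2) q rs =
     (let e = Suc (len c0 + len c1 + len c2);
          f0 = (\<lambda>q. if q = len c0 then e else Suc q);
          f1 = (\<lambda>q. if q = len c1 then e else Suc (len c0 + q));
          f2 = (\<lambda>q. Suc (len c0 + len c1 + q))
      in if q = 0
         then (if rs ! (r - 1) = 0 then f0 0 else if rs ! (r - 1) = 2 then f1 0 else f2 0, keep rs)
         else if q \<le> len c0 then apfst f0 (code c0 (q - 1) rs)
         else if q \<le> len c0 + len c1 then apfst f1 (code c1 (q - 1 - len c0) rs)
         else apfst f2 (code c2 (q - 1 - len c0 - len c1) rs))"
| "code (While r c) q rs =
     (let f = (\<lambda>q. if q = len c then 0 else Suc q)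
      in if q = 0 then (if rs ! (r - 1) = 0 then Suc (len c) else f 0, keep rs)
         else apfst f (code c (q - 1) rs))"

fun wf_com :: "nat \<Rightarrow> com \<Rightarrow> bool" where
  "wf_com K Skip \<longleftrightarrow> True"
| "wf_com K (Push r b) \<longleftrightarrow> 0 < r \<and> r < K"
| "wf_com K (Pop r) \<longleftrightarrow> 0 < r \<and> r < K"
| "wf_com K (Out b) \<longleftrightarrow> True"
| "wf_com K (c1 ;; c2) \<longleftrightarrow> wf_com K c1 \<and> wf_com K c2"
| "wf_com K (Test r c0 c1 c2) \<longleftrightarrow> 0 < r \<and> r < K \<and> wf_com K c0 \<and> wf_com K c1 \<and> wf_com K c2"
| "wf_com K (While r c) \<longleftrightarrow> 0 < r \<and> r < K \<and> wf_com K c"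

section \<open>Registers on tapes, and the simulation of commands by machine states\<close>

definition stack_tape :: "bool list \<Rightarrow> tape \<Rightarrow> bool" where
  "stack_tape xs ta \<longleftrightarrow> snd ta = (\<lambda>i. cells xs (i - fst ta))"

text \<open>Register numbers are shifted by one against tape numbers, so \<open>K\<close> registers
  fill \<open>K\<close> tapes with the last tape left for register 0. Its head stands on the blank
  behind the word, ready for the next letter.\<close>

definition rep :: "nat \<Rightarrow> regs \<Rightarrow> tape list \<Rightarrow> bool" where
  "rep K s ts \<longleftrightarrow> 0 < K \<and> length ts = K \<and> (\<forall>r. 0 < r \<and> r < K \<longrightarrow> stack_tape (s r) (ts ! (r - 1))) \<and>
     ts ! (K - 1) = (int (length (s 0)), cells (s 0))"

definition reads :: "tape list \<Rightarrow> nat list" where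
  "reads ts = map (\<lambda>(h, c). c h) ts"

lemma length_reads [simp]: "length (reads ts) = length ts"
  by (simp add: reads_def)

lemma length_keep [simp]: "length (keep rs) = length rs"
  by (simp add: keep_def)

lemma act_keep: "map2 act (keep (reads ts)) ts = ts"
  by (rule nth_equalityI) (auto simp: keep_def reads_def split: prod.split)

lemma act_keep_upd: "i < length ts \<Longrightarrow>
  map2 act ((keep (reads ts))[i := a]) ts = ts[i := act a (ts ! i)]"
proof -
  assume "i < length ts"
  have "map2 act ((keep (reads ts))[i := a]) (ts[i := ts ! i]) = (map2 act (keep (reads ts)) ts)[i := act a (ts ! i)]"
    by (simp only: zip_update map_update case_prod_conv)
  then show ?thesis by (simp add: act_keep)
qed

lemma step_run:
  "\<lbrakk>q < states M; delta M q (reads ts) = (q', as)\<rbrakk> \<Longrightarrow> step M (q, ts) = (q', map2 act as ts)"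
  by (simp add: step_def reads_def)

lemma reads_rep:
  assumes "rep K s ts" "0 < r" "r < K"
  shows "reads ts ! (r - 1) = (case s r of [] \<Rightarrow> 0 | b # _ \<Rightarrow> letter b)"
proof -
  obtain h c where hc: "ts ! (r - 1) = (h, c)" by fastforce
  have "stack_tape (s r) (h, c)" using assms hc by (auto simp: rep_def)
  then have "c h = cells (s r) 0" by (simp add: stack_tape_def)
  moreover have "r - 1 < length ts" using assms by (auto simp: rep_def)
  ultimately show ?thesis using hc
    by (auto simp: reads_def cells_def letter_def split: list.split)
qed

lemma rep_upd:
  assumes "rep K s ts" "0 < r" "r < K" "stack_tape xs ta"
  shows "rep K (s(r := xs)) (ts[r - 1 := ta])"
  using assms by (auto simp: rep_def nth_list_update)

lemma cells_Nil: "cells [] = (\<lambda>_. 0)"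
  by (auto simp: cells_def)

lemma cells_tl: "cells (tl xs) i = (if i = -1 then 0 else cells xs (i + 1))"
  by (cases xs) (auto simp: cells_def nth_Cons' nat_add_distrib)

lemma cells_Cons: "cells (b # xs) i = (if i = 0 then letter b else cells xs (i - 1))"
proof (cases "i > 0")
  case True
  then have "nat i = Suc (nat (i - 1))" by simp
  then show ?thesis using True by (auto simp: cells_def letter_def)
qed (auto simp: cells_def letter_def)

lemma cells_snoc: "cells (xs @ [b]) = (cells xs)(int (length xs) := letter b)"
  by (rule ext) (auto simp: cells_def letter_def nth_append)

lemma code_bound: "q < len c \<Longrightarrow> fst (code c q rs) \<le> len c"
proof (induction c arbitrary: q)
  case (Seq c1 c2)
  show ?case
  proof (cases "q < len c1")
    case True then show ?thesis using Seq.IH(1)[OF True] by simp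
  next
    case False
    then have "q - len c1 < len c2" using Seq.prems by simp
    then show ?thesis using Seq.IH(2)[of "q - len c1"] False by simp
  qed
next
  case (Test r c0 c1 c2)
  have "q - 1 < len c0" if "q \<noteq> 0" "q \<le> len c0" using that by simp
  moreover have "q - 1 - len c0 < len c1" if "\<not> q \<le> len c0" "q \<le> len c0 + len c1" using that by simp
  moreover have "q - 1 - len c0 - len c1 < len c2" if "\<not> q \<le> len c0 + len c1" using that Test.prems by simp
  ultimately show ?case using Test.IH(1)[of "q-1"] Test.IH(2)[of "q-1-len c0"] Test.IH(3)[of "q-1-len c0-len c1"]
    by (auto simp: Let_def)
next
  case (While r c)
  then show ?case using While.IH[of "q - 1"] by (auto simp: Let_def)
qed auto

lemma keep_ok: "(w, m) \<in> set (keep rs) \<Longrightarrow> set rs \<subseteq> {..<k} \<Longrightarrow> w < k"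
  by (auto simp: keep_def)

lemma code_actions:
  assumes "wf_com K c" "length rs = K" "set rs \<subseteq> {..<3}"
  shows "length (snd (code c q rs)) = K \<and> (\<forall>(w, m) \<in> set (snd (code c q rs)). w < 3)"
  using assms
proof (induction c arbitrary: q)
  case (Push r b)
  have "rs ! (r - 1) \<in> set rs" using Push.prems by (intro nth_mem) auto
  then have "rs ! (r - 1) < 3" using Push.prems by auto
  then show ?case using Push
    by (auto simp: letter_def dest!: keep_ok[where k = 3] set_update_subset_insert[THEN subsetD])
next
  case (Out b)
  then show ?case
    by (auto simp: letter_def dest!: keep_ok[where k = 3] set_update_subset_insert[THEN subsetD])
next
  case (Pop r)
  then show ?case
    by (auto simp: letter_def dest!: keep_ok[where k = 3] set_update_subset_insert[THEN subsetD])
qed (auto simp: Let_def dest!: keep_ok[where k = 3])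

definition machine :: "nat \<Rightarrow> com \<Rightarrow> tm" where
  "machine K c = \<lparr>tapes = K, symbols = 3, states = len c, delta = code c\<rparr>"

lemma is_tm_machine: "wf_com K c \<Longrightarrow> 0 < K \<Longrightarrow> is_tm (machine K c)"
  using code_bound code_actions by (fastforce simp: is_tm_def machine_def)

text \<open>The map \<open>f\<close> places the states of \<open>c\<close> inside a larger machine,
  so that the induction covers subcommands sitting anywhere. The exit \<open>len c\<close> may be
  sent to any state, running or not: that is how branches meet in a common exit and how the body of
  a loop returns to its head.\<close>

lemma exec_sim:
  assumes "exec c s t s'" "wf_com K c"
    "\<forall>q<len c. f q < states M"
    "\<forall>q<len c. \<forall>rs. delta M (f q) rs = apfst f (code c q rs)"
    "rep K s ts"
  shows "\<exists>ts'. rep K s' ts' \<and> (step M ^^ t) (f 0, ts) = (f (len c), ts')"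
  using assms
proof (induction arbitrary: f ts rule: exec.induct)
  case (Skip s)
  then show ?case by auto
next
  case (Push r b s)
  from Push have K: "0 < r" "r < K" "r - 1 < length ts" by (auto simp: rep_def)
  obtain h cs where hc: "ts ! (r - 1) = (h, cs)" by fastforce
  have cs: "cs = (\<lambda>i. cells (s r) (i - h))" using Push.prems(4) K hc by (auto simp: rep_def stack_tape_def)
  define ts1 where "ts1 = ts[r - 1 := (h - 1, cs)]"
  have rd: "reads ts ! (r - Suc 0) = cs h" using K hc by (simp add: reads_def)
  have s1: "step M (f 0, ts) = (f 1, ts1)"
    using Push.prems K hc
    by (subst step_run[where q' = "f 1" and as = "(keep (reads ts))[r - 1 := (cs h, MoveLeft)]"])
       (auto simp: rd act_keep_upd ts1_def)
  have s2: "step M (f 1, ts1) = (f 2, ts[r - 1 := (h - 1, cs(h - 1 := letter b))])"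
    using Push.prems K hc
    by (subst step_run[where q' = "f 2" and as = "(keep (reads ts1))[r - 1 := (letter b, Stay)]"])
       (auto simp: act_keep_upd ts1_def numeral_2_eq_2)
  have "stack_tape (b # s r) (h - 1, cs(h - 1 := letter b))"
    by (auto simp: stack_tape_def cs cells_Cons fun_eq_iff)
  from rep_upd[OF Push.prems(4) K(1,2) this] s1 s2 show ?case
    by (auto simp: numeral_2_eq_2 fun_upd_def)
next
  case (Pop r s)
  from Pop have K: "0 < r" "r < K" "r - 1 < length ts" by (auto simp: rep_def)
  obtain h cs where hc: "ts ! (r - 1) = (h, cs)" by fastforce
  have cs: "cs = (\<lambda>i. cells (s r) (i - h))" using Pop.prems(4) K hc by (auto simp: rep_def stack_tape_def)
  have s1: "step M (f 0, ts) = (f 1, ts[r - 1 := (h + 1, cs(h := 0))])"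
    using Pop.prems K hc
    by (subst step_run[where q' = "f 1" and as = "(keep (reads ts))[r - 1 := (0, MoveRight)]"])
       (auto simp: act_keep_upd)
  have "stack_tape (tl (s r)) (h + 1, cs(h := 0))"
    by (auto simp: stack_tape_def cs cells_tl fun_eq_iff)
  from rep_upd[OF Pop.prems(4) K(1,2) this] s1 show ?case by (auto simp: fun_upd_def)
next
  case (Out b s)
  from Out have K: "0 < K" "length ts = K" "ts ! (K - 1) = (int (length (s 0)), cells (s 0))" by (auto simp: rep_def)
  have s1: "step M (f 0, ts) = (f 1, ts[K - 1 := (int (length (s 0)) + 1, cells (s 0 @ [b]))])"
    using Out.prems K
    by (subst step_run[where q' = "f 1" and as = "(keep (reads ts))[K - 1 := (letter b, MoveRight)]"])
       (auto simp: act_keep_upd cells_snoc)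
  have "rep K (s(0 := s 0 @ [b])) (ts[K - 1 := (int (length (s 0)) + 1, cells (s 0 @ [b]))])"
    using Out.prems K by (auto simp: rep_def nth_list_update)
  then show ?case using s1 by (auto simp: fun_upd_def)
next
  case (Seq c1 s t1 s1 c2 t2 s2)
  have "\<forall>q<len c1. f q < states M" "\<forall>q<len c1. \<forall>rs. delta M (f q) rs = apfst f (code c1 q rs)"
    using Seq.prems by auto
  from Seq.IH(1)[OF _ this Seq.prems(4)] Seq.prems(1) obtain ts1 where
    1: "rep K s1 ts1" "(step M ^^ t1) (f 0, ts) = (f (len c1), ts1)" by auto
  define g where "g = (\<lambda>q. f (q + len c1))"
  have "\<forall>q<len c2. g q < states M" using Seq.prems(2) by (auto simp: g_def)
  moreover have "\<forall>q<len c2. \<forall>rs. delta M (g q) rs = apfst g (code c2 q rs)"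
    using Seq.prems(3) by (auto simp: g_def apfst_def map_prod_def split: prod.splits)
  ultimately obtain ts2 where
    2: "rep K s2 ts2" "(step M ^^ t2) (g 0, ts1) = (g (len c2), ts2)"
    using Seq.IH(2)[of g ts1] 1 Seq.prems(1) by auto
  have "(step M ^^ (t1 + t2)) (f 0, ts) = (step M ^^ t2) ((step M ^^ t1) (f 0, ts))"
    by (metis add.commute comp_apply funpow_add)
  also have "\<dots> = (f (len (c1 ;; c2)), ts2)" using 1 2 by (simp add: g_def add.commute)
  finally show ?case using 2 by auto
next
  case (TestNil s r c0 t s' c1 c2)
  define e where "e = Suc (len c0 + len c1 + len c2)"
  define g where "g = (\<lambda>q. f (if q = len c0 then e else Suc q))"
  have rd: "reads ts ! (r - 1) = 0" using reads_rep[OF TestNil.prems(4)] TestNil by auto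
  have "delta M (f 0) (reads ts) = (g 0, keep (reads ts))"
    using TestNil.prems(3) rd by (simp add: Let_def g_def e_def)
  then have s1: "step M (f 0, ts) = (g 0, ts)"
    using TestNil.prems(2) by (subst step_run) (auto simp: act_keep)
  have "\<forall>q<len c0. g q < states M" using TestNil.prems(2) by (auto simp: g_def)
  moreover have "\<forall>q<len c0. \<forall>rs. delta M (g q) rs = apfst g (code c0 q rs)"
    using TestNil.prems(3)
    by (auto simp: Let_def g_def e_def apfst_def map_prod_def split: prod.splits)
  ultimately obtain ts2 where
    2: "rep K s' ts2" "(step M ^^ t) (g 0, ts) = (g (len c0), ts2)"
    using TestNil.IH[of g ts] TestNil.prems by auto
  then show ?case using s1 by (auto simp: funpow_swap1 g_def e_def)
next
  case (TestTrue s r xs c1 t s' c0 c2)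
  define e where "e = Suc (len c0 + len c1 + len c2)"
  define g where "g = (\<lambda>q. f (if q = len c1 then e else Suc (len c0 + q)))"
  have rd: "reads ts ! (r - 1) = 2" using reads_rep[OF TestTrue.prems(4), of r] TestTrue by (auto simp: letter_def)
  have "delta M (f 0) (reads ts) = (g 0, keep (reads ts))"
    using TestTrue.prems(3) rd by (simp add: Let_def g_def e_def)
  then have s1: "step M (f 0, ts) = (g 0, ts)"
    using TestTrue.prems(2) by (subst step_run) (auto simp: act_keep)
  have "\<forall>q<len c1. g q < states M" using TestTrue.prems(2) by (auto simp: g_def)
  moreover have "\<forall>q<len c1. \<forall>rs. delta M (g q) rs = apfst g (code c1 q rs)"
    using TestTrue.prems(3)
    by (auto simp: Let_def g_def e_def apfst_def map_prod_def split: prod.splits)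
  ultimately obtain ts2 where
    2: "rep K s' ts2" "(step M ^^ t) (g 0, ts) = (g (len c1), ts2)"
    using TestTrue.IH[of g ts] TestTrue.prems by auto
  then show ?case using s1 by (auto simp: funpow_swap1 g_def e_def)
next
  case (TestFalse s r xs c2 t s' c0 c1)
  define g where "g = (\<lambda>q. f (Suc (len c0 + len c1 + q)))"
  have rd: "reads ts ! (r - 1) = 1" using reads_rep[OF TestFalse.prems(4), of r] TestFalse by (auto simp: letter_def)
  have "delta M (f 0) (reads ts) = (g 0, keep (reads ts))"
    using TestFalse.prems(3) rd by (simp add: Let_def g_def)
  then have s1: "step M (f 0, ts) = (g 0, ts)"
    using TestFalse.prems(2) by (subst step_run) (auto simp: act_keep)
  have "\<forall>q<len c2. g q < states M" using TestFalse.prems(2) by (auto simp: g_def)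
  moreover have "\<forall>q<len c2. \<forall>rs. delta M (g q) rs = apfst g (code c2 q rs)"
    using TestFalse.prems(3)
    by (auto simp: Let_def g_def apfst_def map_prod_def split: prod.splits)
  ultimately obtain ts2 where
    2: "rep K s' ts2" "(step M ^^ t) (g 0, ts) = (g (len c2), ts2)"
    using TestFalse.IH[of g ts] TestFalse.prems by auto
  then show ?case using s1 by (auto simp: funpow_swap1 g_def)
next
  case (WhileNil s r c)
  have rd: "reads ts ! (r - 1) = 0" using reads_rep[OF WhileNil.prems(4)] WhileNil by auto
  have "delta M (f 0) (reads ts) = (f (Suc (len c)), keep (reads ts))"
    using WhileNil.prems(3) rd by (simp add: Let_def)
  then have s1: "step M (f 0, ts) = (f (Suc (len c)), ts)"
    using WhileNil.prems(2) by (subst step_run) (auto simp: act_keep)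
  then show ?case using WhileNil.prems(4) by auto
next
  case (WhileCons s r c t1 s1 t2 s2)
  define g where "g = (\<lambda>q. f (if q = len c then 0 else Suc q))"
  have rd: "reads ts ! (r - 1) \<noteq> 0" using reads_rep[OF WhileCons.prems(4), of r] WhileCons
    by (auto simp: letter_def split: list.splits)
  have "delta M (f 0) (reads ts) = (g 0, keep (reads ts))"
    using WhileCons.prems(3) rd by (simp add: Let_def g_def)
  then have s0: "step M (f 0, ts) = (g 0, ts)"
    using WhileCons.prems(2) by (subst step_run) (auto simp: act_keep)
  have "\<forall>q<len c. g q < states M" using WhileCons.prems(2) by (auto simp: g_def)
  moreover have "\<forall>q<len c. \<forall>rs. delta M (g q) rs = apfst g (code c q rs)"
    using WhileCons.prems(3)
    by (auto simp: Let_def g_def apfst_def map_prod_def split: prod.splits)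
  ultimately obtain ts1 where
    1: "rep K s1 ts1" "(step M ^^ t1) (g 0, ts) = (g (len c), ts1)"
    using WhileCons.IH(1)[of g ts] WhileCons.prems by auto
  obtain ts2 where
    2: "rep K s2 ts2" "(step M ^^ t2) (f 0, ts1) = (f (len (While r c)), ts2)"
    using WhileCons.IH(2)[OF WhileCons.prems(1-3) 1(1)] by auto
  have "(step M ^^ Suc (t1 + t2)) (f 0, ts) = (step M ^^ t2) ((step M ^^ t1) (step M (f 0, ts)))"
    by (metis add.commute comp_apply funpow_add funpow_Suc_right)
  also have "\<dots> = (f (len (While r c)), ts2)" using s0 1 2 by (simp add: g_def)
  finally show ?case using 2 by auto
qed

section \<open>Execution within a time bound\<close>

definition input :: "bool list list \<Rightarrow> regs" where
  "input ws r = (if 0 < r \<and> r \<le> length ws then ws ! (r - 1) else [])"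

text \<open>Exact running times depend on the data, whereas upper bounds compose by addition and may
  be rounded up.\<close>

definition ex :: "com \<Rightarrow> regs \<Rightarrow> nat \<Rightarrow> regs \<Rightarrow> bool" where
  "ex c s T s' \<longleftrightarrow> (\<exists>t\<le>T. exec c s t s')"

lemma ex_weaken: "ex c s T s' \<Longrightarrow> T \<le> T' \<Longrightarrow> ex c s T' s'"
  unfolding ex_def by (meson order_trans)

lemma ex_Seq: "ex c1 s T1 s1 \<Longrightarrow> ex c2 s1 T2 s2 \<Longrightarrow> ex (c1 ;; c2) s (T1 + T2) s2"
  unfolding ex_def by (meson add_mono exec.Seq)

lemma ex_Test:
  assumes "ex (case s r of [] \<Rightarrow> c0 | b # _ \<Rightarrow> if b then c1 else c2) s T s'"
  shows "ex (Test r c0 c1 c2) s (Suc T) s'"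
proof -
  obtain t where t: "t \<le> T" "exec (case s r of [] \<Rightarrow> c0 | b # _ \<Rightarrow> if b then c1 else c2) s t s'"
    using assms by (auto simp: ex_def)
  have "exec (Test r c0 c1 c2) s (Suc t) s'"
  proof (cases "s r")
    case (Cons b xs)
    then show ?thesis using t by (cases b) (auto intro: exec.intros)
  qed (use t in \<open>auto intro: exec.intros\<close>)
  with t show ?thesis by (auto simp: ex_def)
qed

lemma ex_While_Nil: "s r = [] \<Longrightarrow> ex (While r c) s (Suc T) s"
  unfolding ex_def by (metis exec.WhileNil One_nat_def le_add1 plus_1_eq_Suc)

lemma ex_While_Cons:
  assumes "s r \<noteq> []" "ex c s T1 s1" "ex (While r c) s1 T2 s2"
  shows "ex (While r c) s (Suc (T1 + T2)) s2"
proof -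
  obtain t1 t2 where "t1 \<le> T1" "exec c s t1 s1" "t2 \<le> T2" "exec (While r c) s1 t2 s2"
    using assms by (auto simp: ex_def)
  then have "exec (While r c) s (Suc (t1 + t2)) s2" "Suc (t1 + t2) \<le> Suc (T1 + T2)"
    using assms(1) by (auto intro: exec.intros)
  then show ?thesis unfolding ex_def by blast
qed

text \<open>Commands without loops get a functional semantics and a cost independent of the data.
  Loop bodies can then be evaluated by simplification, and inductions are left for the loops
  alone.\<close>

fun straight :: "com \<Rightarrow> bool" where
  "straight (c1 ;; c2) \<longleftrightarrow> straight c1 \<and> straight c2"
| "straight (Test r c0 c1 c2) \<longleftrightarrow> straight c0 \<and> straight c1 \<and> straight c2"
| "straight (While r c) \<longleftrightarrow> False"
| "straight _ \<longleftrightarrow> True"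

fun run :: "com \<Rightarrow> regs \<Rightarrow> regs" where
  "run (Push r b) s = s(r := b # s r)"
| "run (Pop r) s = s(r := tl (s r))"
| "run (Out b) s = s(0 := s 0 @ [b])"
| "run (c1 ;; c2) s = run c2 (run c1 s)"
| "run (Test r c0 c1 c2) s = (case s r of [] \<Rightarrow> run c0 s | b # _ \<Rightarrow> if b then run c1 s else run c2 s)"
| "run _ s = s"

fun cost :: "com \<Rightarrow> nat" where
  "cost (c1 ;; c2) = cost c1 + cost c2"
| "cost (Test r c0 c1 c2) = 1 + max (cost c0) (max (cost c1) (cost c2))"
| "cost Skip = 0"
| "cost _ = 2"

lemma ex_run: "straight c \<Longrightarrow> cost c \<le> T \<Longrightarrow> ex c s T (run c s)"
proof (induction c arbitrary: s T)
  case (Seq c1 c2)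
  then have "ex c1 s (cost c1) (run c1 s)" "ex c2 (run c1 s) (cost c2) (run c2 (run c1 s))" by auto
  from ex_Seq[OF this] Seq.prems show ?case by (auto intro: ex_weaken)
next
  case (Test r c0 c1 c2)
  from Test.prems obtain T' where T': "T = Suc T'" by (cases T) auto
  have "ex (case s r of [] \<Rightarrow> c0 | b # _ \<Rightarrow> if b then c1 else c2) s T' (run (Test r c0 c1 c2) s)"
    using Test.prems by (cases "s r") (auto simp: T' intro!: Test.IH)
  then show ?case unfolding T' by (rule ex_Test)
next
  case (Push r b)
  then show ?case using exec.Push[of r b s] by (auto simp: ex_def fun_upd_def intro!: exI[of _ 2])
next
  case (Pop r)
  then show ?case using exec.Pop[of r s] by (auto simp: ex_def fun_upd_def intro!: exI[of _ 1])
next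
  case (Out b)
  then show ?case using exec.Out[of b s] by (auto simp: ex_def fun_upd_def intro!: exI[of _ 1])
qed (auto simp: ex_def intro: exec.intros)

lemma ex_While_run:
  assumes "s r \<noteq> []" "straight c" "ex (While r c) (run c s) T s'" "Suc (cost c + T) \<le> T'"
  shows "ex (While r c) s T' s'"
  using ex_While_Cons[OF assms(1) ex_run[OF assms(2) order_refl] assms(3)] assms(4) ex_weaken by blast

lemma polytime_com:
  assumes "wf_com K c" "n < K"
    and "\<And>ws. length ws = n \<Longrightarrow>
      \<exists>s'. ex c (input ws) (poly p (sum_list (map length ws))) s' \<and> s' 0 = f ws"
  shows "polytime n f"
  unfolding polytime_def
proof (intro exI[of _ "machine K c"] exI[of _ p] conjI allI impI)
  show "is_tm (machine K c)" using assms by (simp add: is_tm_machine)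
  show "n \<le> tapes (machine K c)" using assms by (simp add: machine_def)
  fix ws :: "bool list list" assume ws: "length ws = n"
  from assms(3)[OF this] obtain s' t where t: "t \<le> poly p (sum_list (map length ws))"
    "exec c (input ws) t s'" "s' 0 = f ws" by (auto simp: ex_def)
  define ts where "ts = map (\<lambda>i. (0::int, cells (if i < length ws then ws ! i else []))) [0..<K]"
  \<comment> \<open>Because of \<open>n < K\<close> no input word lies on the output tape, so
    register 0 starts empty.\<close>
  have "rep K (input ws) ts" using assms(2) ws
    by (auto simp: rep_def ts_def input_def stack_tape_def)
  then obtain ts' where ts': "rep K s' ts'"
    "(step (machine K c) ^^ t) (0, ts) = (len c, ts')"
    using exec_sim[OF t(2) assms(1), of "\<lambda>q. q" "machine K c" ts] by (auto simp: machine_def apfst_def map_prod_def split: prod.splits)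
  have "init (machine K c) ws = (0, ts)" by (simp add: init_def ts_def machine_def)
  moreover have "snd (last ts') = cells (f ws)" using ts'(1) t(3)
    by (auto simp: rep_def last_conv_nth)
  ultimately have "yields_in (machine K c) ws t (f ws)" using ts' by (simp add: yields_in_def machine_def)
  then show "\<exists>t\<le>poly p (sum_list (map length ws)). yields_in (machine K c) ws t (f ws)" using t by auto
qed

section \<open>Verifying derivations in polynomial time\<close>

text \<open>A list of parts is a word with variables. Every \<open>Var i\<close> stands for a doubled word, \<open>dbl\<close>, which together with
  a final \<open>False\<close> is prefix-free.\<close>

datatype part = Const "bool list" | Var nat

definition dbl :: "bool list \<Rightarrow> bool list" where
  "dbl w = concat (map (\<lambda>b. [True, b]) w)"

lemma dbl_simps [simp]: "dbl [] = []" "dbl (b # w) = True # b # dbl w" "dbl (u @ v) = dbl u @ dbl v"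
  by (auto simp: dbl_def)

lemma length_dbl [simp]: "length (dbl w) = 2 * length w"
  by (induction w) auto

lemma enc_name_dbl: "enc_name w = dbl w @ [False]"
  by (simp add: enc_name_def enc_list_def dbl_def)

fun part_inst :: "(nat \<Rightarrow> bool list) \<Rightarrow> part \<Rightarrow> bool list" where
  "part_inst \<sigma> (Const w) = w"
| "part_inst \<sigma> (Var i) = dbl (\<sigma> i)"

definition inst :: "(nat \<Rightarrow> bool list) \<Rightarrow> part list \<Rightarrow> bool list" where
  "inst \<sigma> ps = concat (map (part_inst \<sigma>) ps)"

type_synonym rule = "part list list \<times> part list"

text \<open>An inapplicable rule is skipped rather than rejected. Soundness is thereby an invariant
  of the list \<open>D\<close>, and no failure has to be remembered.\<close>

fun apply_rule :: "(nat \<Rightarrow> bool list) \<Rightarrow> rule \<Rightarrow> bool list list \<Rightarrow> bool list list" where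
  "apply_rule \<sigma> (ps, c) D = (if \<forall>p\<in>set ps. inst \<sigma> p \<in> set D then inst \<sigma> c # D else D)"

fun read_word :: "bool list \<Rightarrow> bool list \<Rightarrow> bool list \<times> bool list" where
  "read_word acc [] = (acc, [])"
| "read_word acc (False # y) = (acc, y)"
| "read_word acc [True] = (acc, [])"
| "read_word acc (True # b # y) = read_word (b # acc) y"

fun read_words :: "nat \<Rightarrow> (nat \<Rightarrow> bool list) \<Rightarrow> bool list \<Rightarrow> (nat \<Rightarrow> bool list) \<times> bool list" where
  "read_words 0 \<sigma> y = (\<sigma>, y)"
| "read_words (Suc m) \<sigma> y =
     (let (\<sigma>', y') = read_words m \<sigma> y; (w, y'') = read_word [] y' in (\<sigma>'(m := rev w), y''))"

text \<open>A line of a certificate selects a rule in unary and lists the values of the \<open>m\<close> variables. Every word is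
  read as some certificate, so that no syntax check is needed.\<close>

fun line :: "nat \<Rightarrow> rule list \<Rightarrow> (nat \<Rightarrow> bool list) \<Rightarrow> bool list \<Rightarrow> bool list list \<Rightarrow>
    (nat \<Rightarrow> bool list) \<times> bool list \<times> bool list list" where
  "line m [] \<sigma> y D = (\<sigma>, tl y, D)"
| "line m (r # rs) \<sigma> [] D = (\<sigma>, [], D)"
| "line m (r # rs) \<sigma> (False # y) D = line m rs \<sigma> y D"
| "line m (r # rs) \<sigma> (True # y) D = (let (\<sigma>', y') = read_words m \<sigma> y in (\<sigma>', y', apply_rule \<sigma>' r D))"

lemma length_read_word: "length (snd (read_word acc y)) \<le> length y"
  by (induction acc y rule: read_word.induct) auto

lemma length_read_words: "length (snd (read_words m \<sigma> y)) \<le> length y"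
proof (induction m)
  case (Suc m)
  have "length (snd (read_word [] (snd (read_words m \<sigma> y)))) \<le> length y"
    using Suc length_read_word[of "[]" "snd (read_words m \<sigma> y)"] by linarith
  then show ?case by (simp add: Let_def case_prod_beta)
qed simp

text \<open>Every line consumes a letter, even when its selector runs past the last rule, where
  \<open>tl\<close> drops one. This makes \<open>lines\<close> terminate and bounds the number of
  lines by the length of the certificate.\<close>

lemma length_line: "length (fst (snd (line m rs \<sigma> y D))) \<le> length y - 1"
proof (induction m rs \<sigma> y D rule: line.induct)
  case (4 m r rs \<sigma> y D)
  then show ?case using length_read_words[of m \<sigma> y] by (auto split: prod.splits)
qed auto

function lines :: "nat \<Rightarrow> rule list \<Rightarrow> (nat \<Rightarrow> bool list) \<Rightarrow> bool list \<Rightarrow> bool list list \<Rightarrow>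
    (nat \<Rightarrow> bool list) \<times> bool list list" where
  "lines m rs \<sigma> y D = (if y = [] then (\<sigma>, D)
     else lines m rs (fst (line m rs \<sigma> y D)) (fst (snd (line m rs \<sigma> y D))) (snd (snd (line m rs \<sigma> y D))))"
  by auto
termination
proof (relation "measure (\<lambda>(m, rs, \<sigma>, y, D). length y)", goal_cases)
  case (2 m rs \<sigma> y D)
  then have "length y - 1 < length y" by simp
  then have "length (fst (snd (line m rs \<sigma> y D))) < length y"
    using length_line[of m rs \<sigma> y D] by linarith
  then show ?case by (simp add: case_prod_beta)
qed simp

declare lines.simps [simp del]

text \<open>Variable 0 carries the input into the axiom and is afterwards free for the lines to
  overwrite.\<close>

definition accepts :: "nat \<Rightarrow> rule list \<Rightarrow> part list \<Rightarrow> part list \<Rightarrow> bool list \<Rightarrow> bool list \<Rightarrow> bool" where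
  "accepts m rs ax goal x y \<longleftrightarrow>
     (let \<sigma> = (\<lambda>_. [])(0 := x); (\<sigma>', D) = lines m rs \<sigma> y [inst \<sigma> ax] in inst \<sigma>' goal \<in> set D)"

text \<open>Input, certificate, word under construction, its consumed part, mismatch, found word, failed premise,
  derived words, scanned derived words, scratch register, and the variables (stored reversed).\<close>

abbreviation (input) "rX \<equiv> (1::nat)"
abbreviation (input) "rY \<equiv> (2::nat)"
abbreviation (input) "rT \<equiv> (3::nat)"
abbreviation (input) "rU \<equiv> (4::nat)"
abbreviation (input) "rN \<equiv> (5::nat)"
abbreviation (input) "rF \<equiv> (6::nat)"
abbreviation (input) "rB \<equiv> (7::nat)"
abbreviation (input) "rD \<equiv> (8::nat)"
abbreviation (input) "rE \<equiv> (9::nat)"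
abbreviation (input) "rW \<equiv> (10::nat)"
abbreviation (input) "rV i \<equiv> (11::nat) + i"

section \<open>Programs that read values and assemble words\<close>

lemma ex_While_Nil': "s r = [] \<Longrightarrow> s' = s \<Longrightarrow> 0 < T \<Longrightarrow> ex (While r c) s T s'"
  using ex_While_Nil[of s r c "T - 1"] by simp

lemma ex_cong: "ex c s T s' \<Longrightarrow> T \<le> T' \<Longrightarrow> s' = s'' \<Longrightarrow> ex c s T' s''"
  using ex_weaken by blast

definition flag :: "nat \<Rightarrow> com" where
  "flag r = Test r (Push r True) Skip Skip"

lemma straight_flag [simp]: "straight (flag r)" "cost (flag r) = 3"
  by (auto simp: flag_def)

lemma run_flag [simp]: "run (flag r) s = s(r := if s r = [] then [True] else s r)"
  by (auto simp: flag_def split: list.split)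

lemma run_Test_same [simp]: "run (Test r c0 c c) s = (if s r = [] then run c0 s else run c s)"
  by (auto split: list.split)

definition clear :: "nat \<Rightarrow> com" where
  "clear r = While r (Pop r)"

lemma ex_clear: "3 * length (s r) + 1 \<le> T \<Longrightarrow> ex (clear r) s T (s(r := []))"
  unfolding clear_def
proof (induction "s r" arbitrary: s T)
  case Nil
  then have "s(r := []) = s" by auto
  then show ?case using Nil by (cases T) (auto intro: ex_While_Nil)
next
  case (Cons b xs)
  show ?case
    by (rule ex_While_run[where T = "T - 3"])
      (use Cons.prems Cons.hyps(2)[symmetric] Cons.hyps(1)[of "run (Pop r) s" "T - 3"] in auto)
qed

definition pour :: "nat \<Rightarrow> nat \<Rightarrow> com" where
  "pour a b = While a (Test a Skip (Pop a ;; Push b True) (Pop a ;; Push b False))"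

lemma ex_pour: "a \<noteq> b \<Longrightarrow> 6 * length (s a) + 1 \<le> T \<Longrightarrow> ex (pour a b) s T (s(b := rev (s a) @ s b, a := []))"
  unfolding pour_def
proof (induction "s a" arbitrary: s T)
  case Nil
  then have "s(b := rev (s a) @ s b, a := []) = s" by auto
  then show ?case using Nil by (cases T) (auto intro: ex_While_Nil)
next
  case (Cons x xs)
  let ?c = "Test a Skip (Pop a ;; Push b True) (Pop a ;; Push b False)"
  have r: "run ?c s = s(a := xs, b := x # s b)"
    using Cons.hyps(2)[symmetric] Cons.prems by (cases x) auto
  have e: "s(b := rev (s a) @ s b, a := []) = (run ?c s)(b := rev (run ?c s a) @ run ?c s b, a := [])"
    using Cons.hyps(2)[symmetric] Cons.prems by (auto simp: r)
  show ?case
    unfolding e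
    by (rule ex_While_run[where T = "T - 6"]) (use Cons.prems Cons.hyps(2)[symmetric] Cons.hyps(1)[of "run ?c s" "T - 6"] in \<open>auto simp: r\<close>)
qed

text \<open>A loop can only test a register for being empty, so a mark in \<open>rN\<close> says
  that reading is not finished. Pushing the letters as they are read leaves the word reversed, which
  is the form in which variables are kept.\<close>

definition read_com :: "nat \<Rightarrow> com" where
  "read_com v = clear v ;; Push rN True ;;
     While rN (Test rY (Pop rN) (Pop rY ;; Test rY (Pop rN) (Pop rY ;; Push v True) (Pop rY ;; Push v False))
                    (Pop rY ;; Pop rN))"

lemma ex_read_com:
  assumes "v \<notin> {rY, rN}" "s rN = []" "3 * length (s v) + 12 * length (s rY) + 20 \<le> T"
  shows "ex (read_com v) s T (s(v := fst (read_word [] (s rY)), rY := snd (read_word [] (s rY))))"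
proof -
  let ?c = "Test rY (Pop rN) (Pop rY ;; Test rY (Pop rN) (Pop rY ;; Push v True) (Pop rY ;; Push v False))
                    (Pop rY ;; Pop rN)"
  have loop: "ex (While rN ?c) s T (s(v := fst (read_word acc y), rY := snd (read_word acc y), rN := []))"
    if "s v = acc" "s rY = y" "s rN = [True]" "12 * length y + 12 \<le> T" for s acc y T
    using that
  proof (induction acc y arbitrary: s T rule: read_word.induct)
    case (1 acc)
    then have "run ?c s = s(rN := [])" by auto
    with 1 assms(1) show ?case
      by - (rule ex_While_run[where T = 1], simp, simp, rule ex_While_Nil', auto simp: fun_eq_iff)
  next
    case (2 acc y)
    then have "run ?c s = s(rY := y, rN := [])" by auto
    with 2 assms(1) show ?case
      by - (rule ex_While_run[where T = 1], simp, simp, rule ex_While_Nil', auto simp: fun_eq_iff)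
  next
    case (3 acc)
    then have "run ?c s = s(rY := [], rN := [])" by auto
    with 3 assms(1) show ?case
      by - (rule ex_While_run[where T = 1], simp, simp, rule ex_While_Nil', auto simp: fun_eq_iff)
  next
    case (4 acc b y)
    let ?s = "s(rY := y, v := b # acc)"
    have r: "run ?c s = ?s" using 4 assms(1) by (cases b) auto
    have "ex (While rN ?c) ?s (T - 12) (?s(v := fst (read_word (b # acc) y), rY := snd (read_word (b # acc) y), rN := []))"
      by (rule 4) (use 4 assms(1) in auto)
    moreover have "?s(v := fst (read_word (b # acc) y), rY := snd (read_word (b # acc) y), rN := [])
       = s(v := fst (read_word acc (True # b # y)), rY := snd (read_word acc (True # b # y)), rN := [])"
      using assms(1) by auto
    ultimately have "ex (While rN ?c) (run ?c s) (T - 12)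
        (s(v := fst (read_word acc (True # b # y)), rY := snd (read_word acc (True # b # y)), rN := []))"
      by (simp only: r)
    then show ?case by (rule ex_While_run[rotated 2]) (use 4 in simp_all)
  qed
  let ?s = "s(v := [], rN := [True])"
  have 0: "ex (clear v) s (3 * length (s v) + 1) (s(v := []))" by (rule ex_clear) simp
  have 1: "ex (Push rN True) (s(v := [])) 2 ?s"
    by (rule ex_cong[OF ex_run[OF _ order_refl]]) (use assms in \<open>auto simp: fun_eq_iff\<close>)
  have 2: "ex (While rN ?c) ?s (12 * length (s rY) + 12)
     (?s(v := fst (read_word [] (s rY)), rY := snd (read_word [] (s rY)), rN := []))"
    by (rule loop) (use assms in auto)
  have 3: "?s(v := fst (read_word [] (s rY)), rY := snd (read_word [] (s rY)), rN := [])
     = s(v := fst (read_word [] (s rY)), rY := snd (read_word [] (s rY)))" using assms by auto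
  show ?thesis
    unfolding read_com_def
    by (rule ex_weaken[OF ex_Seq[OF 0 ex_Seq[OF 1 2, unfolded 3]]]) (use assms in auto)
qed

definition upd_vars :: "regs \<Rightarrow> (nat \<Rightarrow> bool list) \<Rightarrow> bool list \<Rightarrow> regs" where
  "upd_vars s \<sigma> y = (\<lambda>r. if 11 \<le> r then rev (\<sigma> (r - 11)) else if r = rY then y else s r)"

primrec read_coms :: "nat \<Rightarrow> com" where
  "read_coms 0 = Skip"
| "read_coms (Suc m) = read_coms m ;; read_com (rV m)"

lemma length_read_word_fst: "length (fst (read_word acc y)) \<le> length acc + length y"
  by (induction acc y rule: read_word.induct) auto

lemma length_read_words_fst:
  assumes "\<And>i. length (\<sigma> i) \<le> N" "length y \<le> N"
  shows "length (fst (read_words m \<sigma> y) i) \<le> N"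
proof (induction m arbitrary: i)
  case (Suc m)
  have "length (fst (read_word [] (snd (read_words m \<sigma> y)))) \<le> N"
    using length_read_word_fst[of "[]" "snd (read_words m \<sigma> y)"] length_read_words[of m \<sigma> y] assms(2) by simp
  then show ?case using Suc by (auto simp: Let_def case_prod_beta)
qed (use assms in auto)

lemma ex_read_coms:
  assumes "s rN = []" "\<And>i. length (\<sigma> i) \<le> N" "length y \<le> N"
  shows "ex (read_coms m) (upd_vars s \<sigma> y) (m * (15 * N + 20))
    (upd_vars s (fst (read_words m \<sigma> y)) (snd (read_words m \<sigma> y)))"
proof (induction m)
  case 0
  show ?case using ex_run[of Skip 0] by simp
next
  case (Suc m)
  let ?\<sigma> = "fst (read_words m \<sigma> y)" and ?y = "snd (read_words m \<sigma> y)"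
  let ?s = "upd_vars s ?\<sigma> ?y"
  have "length (?s (rV m)) \<le> N" using length_read_words_fst[OF assms(2,3), where m = m and i = m] by (simp add: upd_vars_def)
  moreover have "length (?s rY) \<le> N" using length_read_words[of m \<sigma> y] assms(3) by (simp add: upd_vars_def)
  moreover have "?s rN = []" using assms(1) by (simp add: upd_vars_def)
  ultimately have "ex (read_com (rV m)) ?s (15 * N + 20)
     (?s(rV m := fst (read_word [] (?s rY)), rY := snd (read_word [] (?s rY))))"
    by (intro ex_read_com) auto
  moreover have "?s(rV m := fst (read_word [] (?s rY)), rY := snd (read_word [] (?s rY)))
     = upd_vars s (fst (read_words (Suc m) \<sigma> y)) (snd (read_words (Suc m) \<sigma> y))"
    by (auto simp: upd_vars_def Let_def case_prod_beta fun_eq_iff)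
  ultimately have "ex (read_coms (Suc m)) (upd_vars s \<sigma> y) (m * (15 * N + 20) + (15 * N + 20))
     (upd_vars s (fst (read_words (Suc m) \<sigma> y)) (snd (read_words (Suc m) \<sigma> y)))"
    using ex_Seq[OF Suc] by (simp only: read_coms.simps)
  then show ?case by (rule ex_weaken) simp
qed

text \<open>On the stack \<open>rT\<close> a word is assembled from its last letter to its first,
  and this is the order in which a reversed variable yields its letters. The copy in
  \<open>rW\<close> restores the variable.\<close>

definition insert_com :: "nat \<Rightarrow> com" where
  "insert_com v =
     While v (Test v Skip (Pop v ;; Push rW True ;; Push rT True ;; Push rT True)
                          (Pop v ;; Push rW False ;; Push rT False ;; Push rT True)) ;; pour rW v"

lemma ex_insert_com:
  assumes "v \<notin> {rT, rW}" "s rW = []" "18 * length (s v) + 2 \<le> T"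
  shows "ex (insert_com v) s T (s(rT := dbl (rev (s v)) @ s rT))"
proof -
  let ?c = "Test v Skip (Pop v ;; Push rW True ;; Push rT True ;; Push rT True)
                          (Pop v ;; Push rW False ;; Push rT False ;; Push rT True)"
  have loop: "ex (While v ?c) s (10 * length xs + 1)
      (s(v := [], rW := rev xs @ s rW, rT := dbl (rev xs) @ s rT))" if "s v = xs" for xs s
    using that
  proof (induction xs arbitrary: s)
    case Nil
    then show ?case by (intro ex_While_Nil') (auto simp: fun_eq_iff)
  next
    case (Cons x xs)
    let ?s = "s(v := xs, rW := x # s rW, rT := True # x # s rT)"
    have r: "run ?c s = ?s" using Cons.prems assms(1) by (cases x) (auto simp: fun_eq_iff)
    have "ex (While v ?c) ?s (10 * length xs + 1)
        (?s(v := [], rW := rev xs @ ?s rW, rT := dbl (rev xs) @ ?s rT))"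
      by (rule Cons.IH) (use assms in auto)
    moreover have "?s(v := [], rW := rev xs @ ?s rW, rT := dbl (rev xs) @ ?s rT)
      = s(v := [], rW := rev (x # xs) @ s rW, rT := dbl (rev (x # xs)) @ s rT)"
      using assms by (auto simp: fun_eq_iff)
    ultimately have "ex (While v ?c) (run ?c s) (10 * length xs + 1)
       (s(v := [], rW := rev (x # xs) @ s rW, rT := dbl (rev (x # xs)) @ s rT))" by (simp only: r)
    then show ?case by (rule ex_While_run[rotated 2]) (use Cons in simp_all)
  qed
  let ?s = "s(v := [], rW := rev (s v) @ s rW, rT := dbl (rev (s v)) @ s rT)"
  have "ex (pour rW v) ?s (6 * length (?s rW) + 1) (?s(v := rev (?s rW) @ ?s v, rW := []))"
    by (rule ex_pour) (use assms in auto)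
  from ex_Seq[OF loop[OF refl] this] show ?thesis
    unfolding insert_com_def by (rule ex_cong) (use assms in \<open>auto simp: fun_eq_iff\<close>)
qed

primrec push_word :: "bool list \<Rightarrow> com" where
  "push_word [] = Skip"
| "push_word (b # w) = push_word w ;; Push rT b"

lemma push_word [simp]: "straight (push_word w)" "cost (push_word w) = 2 * length w"
  "run (push_word w) s = s(rT := w @ s rT)"
  by (induction w) auto

fun build_part :: "part \<Rightarrow> com" where
  "build_part (Const w) = push_word w"
| "build_part (Var i) = insert_com (rV i)"

primrec build :: "part list \<Rightarrow> com" where
  "build [] = Skip"
| "build (p # ps) = build ps ;; build_part p"

text \<open>One number bounds, up to the factor \<open>N + 1\<close>, both the time for building a
  part and the length of the result: a letter of a variable costs at most 18 steps and contributes
  two letters.\<close>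

fun part_size :: "part \<Rightarrow> nat" where
  "part_size (Const w) = 2 * length w"
| "part_size (Var i) = 18"

definition tsize :: "part list \<Rightarrow> nat" where
  "tsize ps = sum_list (map part_size ps)"

definition vars_of :: "regs \<Rightarrow> nat \<Rightarrow> bool list" where
  "vars_of s i = rev (s (rV i))"

lemma length_inst:
  assumes "\<And>i. length (\<sigma> i) \<le> N" shows "length (inst \<sigma> ps) \<le> tsize ps * (N + 1)"
proof (induction ps)
  case (Cons p ps)
  have "length (part_inst \<sigma> p) \<le> part_size p * (N + 1)"
  proof (cases p)
    case (Var i)
    then show ?thesis using assms[of i] by simp
  qed simp
  with Cons show ?case by (simp add: inst_def tsize_def algebra_simps)
qed (simp add: inst_def)

lemma ex_build:
  assumes "\<And>i. length (vars_of s i) \<le> N" "s rW = []" "tsize ps * (N + 1) \<le> T"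
  shows "ex (build ps) s T (s(rT := inst (vars_of s) ps @ s rT))"
  using assms(3)
proof (induction ps arbitrary: T)
  case Nil
  show ?case unfolding build.simps by (rule ex_cong[OF ex_run[of Skip 0]]) (auto simp: inst_def)
next
  case (Cons p ps)
  let ?s = "s(rT := inst (vars_of s) ps @ s rT)"
  have "ex (build_part p) ?s (part_size p * (N + 1)) (s(rT := inst (vars_of s) (p # ps) @ s rT))"
  proof (cases p)
    case (Const w)
    then show ?thesis by (simp only: build_part.simps) (rule ex_cong[OF ex_run[OF _ order_refl]], auto simp: inst_def)
  next
    case (Var i)
    have "ex (insert_com (rV i)) ?s (18 * (N + 1)) (?s(rT := dbl (rev (?s (rV i))) @ ?s rT))"
      by (rule ex_insert_com) (use assms(1)[of i] assms(2) in \<open>auto simp: vars_of_def\<close>)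
    then show ?thesis unfolding Var build_part.simps
      by (rule ex_cong) (auto simp: inst_def vars_of_def fun_eq_iff)
  qed
  from ex_Seq[OF Cons.IH[OF order_refl] this] show ?case
    unfolding build.simps by (rule ex_weaken) (use Cons.prems in \<open>simp add: tsize_def algebra_simps\<close>)
qed

section \<open>Searching the list of derived words\<close>

definition enc_words :: "bool list list \<Rightarrow> bool list" where
  "enc_words ws = concat (map enc_name ws)"

text \<open>The word sought is compared with each stored word letter by letter. Consumed letters
  move to \<open>rU\<close> and return at the end of the stored word, so that the next comparison
  starts afresh. A mismatch only sets \<open>rN\<close>: the stored word is still passed over
  completely, which keeps \<open>rD\<close> and \<open>rE\<close> in step.\<close>

definition cmp :: "bool \<Rightarrow> com" where
  "cmp b = Test rT (flag rN) (Pop rT ;; Push rU True ;; (if b then Skip else flag rN))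
     (Pop rT ;; Push rU False ;; (if b then flag rN else Skip))"

definition next_bit :: com where
  "next_bit = Pop rD ;; Push rE True ;;
     Test rD Skip (Pop rD ;; Push rE True ;; cmp True) (Pop rD ;; Push rE False ;; cmp False)"

definition end_word :: com where
  "end_word = (Pop rD ;; Push rE False ;; Test rT Skip (flag rN) (flag rN) ;;
     Test rN (flag rF) Skip Skip ;; Pop rN) ;; pour rU rT"

definition scan :: com where
  "scan = While rD (Test rD Skip next_bit end_word)"

text \<open>Stated from the rest of the run to the whole run: \<open>scan\<close> is a single loop
  over letters, so the treatment of one word is not a command of its own to which a lemma could
  refer.\<close>

lemma ex_scan_dbl:
  assumes "s rD = dbl w @ z" "s rN \<in> {[], [True]}"
    and "ex scan (s(rD := z, rE := rev (dbl w) @ s rE, rT := drop (length w) (s rT),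
      rU := rev (take (length w) (s rT)) @ s rU,
      rN := if s rN = [] \<and> take (length w) (s rT) = w then [] else [True])) T s'"
  shows "ex scan s (T + 20 * length w) s'"
  using assms
proof (induction w arbitrary: s)
  case Nil
  have "s(rD := z, rE := rev (dbl []) @ s rE, rT := drop (length ([] :: bool list)) (s rT),
      rU := rev (take (length ([] :: bool list)) (s rT)) @ s rU,
      rN := if s rN = [] \<and> take (length ([] :: bool list)) (s rT) = [] then [] else [True]) = s"
    using Nil(1,2) by (auto simp: fun_eq_iff)
  with Nil(3) have "ex scan s T s'" by (simp only:)
  then show ?case by simp
next
  case (Cons b w)
  let ?s = "run next_bit s"
  have r: "?s = s(rD := dbl w @ z, rE := b # True # s rE, rT := tl (s rT),
     rU := take 1 (s rT) @ s rU, rN := if s rN = [] \<and> take 1 (s rT) = [b] then [] else [True])"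
    using Cons.prems(1,2)
    by (cases b; cases "s rT"; cases "s rN")
      (auto simp: next_bit_def cmp_def fun_eq_iff)
  have "ex scan ?s (T + 20 * length w) s'"
  proof (rule Cons.IH)
    show "?s rD = dbl w @ z" by (simp add: r)
    show "?s rN \<in> {[], [True]}" by (simp add: r)
    have "?s(rD := z, rE := rev (dbl w) @ ?s rE, rT := drop (length w) (?s rT),
      rU := rev (take (length w) (?s rT)) @ ?s rU,
      rN := if ?s rN = [] \<and> take (length w) (?s rT) = w then [] else [True])
     = s(rD := z, rE := rev (dbl (b # w)) @ s rE, rT := drop (length (b # w)) (s rT),
      rU := rev (take (length (b # w)) (s rT)) @ s rU,
      rN := if s rN = [] \<and> take (length (b # w)) (s rT) = b # w then [] else [True])"
      by (cases "s rT") (auto simp: r fun_eq_iff)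
    then show "ex scan (?s(rD := z, rE := rev (dbl w) @ ?s rE, rT := drop (length w) (?s rT),
      rU := rev (take (length w) (?s rT)) @ ?s rU,
      rN := if ?s rN = [] \<and> take (length w) (?s rT) = w then [] else [True])) T s'"
      using Cons.prems(3) by (simp only:)
  qed
  moreover have "ex next_bit s 18 ?s" by (rule ex_run) (auto simp: next_bit_def cmp_def)
  then have "ex (Test rD Skip next_bit end_word) s (Suc 18) ?s"
    using Cons.prems(1) by (intro ex_Test) simp
  ultimately have "ex scan s (Suc (Suc 18 + (T + 20 * length w))) s'"
    unfolding scan_def using Cons.prems(1) by (intro ex_While_Cons) auto
  then show ?case by (rule ex_weaken) simp
qed

lemma ex_scan_word:
  assumes "s rD = enc_name w @ z" "s rN = []" "s rU = []"
    and "ex scan (s(rD := z, rE := rev (enc_name w) @ s rE,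
      rF := if s rT = w \<and> s rF = [] then [True] else s rF)) T s'"
  shows "ex scan s (T + 20 * length w + 20 + 6 * length (s rT)) s'"
proof -
  let ?t = "s rT"
  let ?s = "s(rD := False # z, rE := rev (dbl w) @ s rE, rT := drop (length w) ?t,
      rU := rev (take (length w) ?t) @ s rU,
      rN := if s rN = [] \<and> take (length w) ?t = w then [] else [True])"
  let ?c = "Pop rD ;; Push rE False ;; Test rT Skip (flag rN) (flag rN) ;;
     Test rN (flag rF) Skip Skip ;; Pop rN"
  define s1 where "s1 = run ?c ?s"
  let ?s2 = "s(rD := z, rE := rev (enc_name w) @ s rE, rF := if ?t = w \<and> s rF = [] then [True] else s rF)"
  \<comment> \<open>The word on \<open>rT\<close> may be longer than \<open>w\<close>; equality also
    requires an empty rest, which \<open>end_word\<close> tests before it records success.\<close>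
  have t: "?t = w \<longleftrightarrow> take (length w) ?t = w \<and> drop (length w) ?t = []"
    by (metis append_Nil2 append_take_drop_id drop_all order_refl take_all)
  have s1: "s1 = s(rD := z, rE := rev (enc_name w) @ s rE, rT := drop (length w) ?t,
      rU := rev (take (length w) ?t), rF := if ?t = w \<and> s rF = [] then [True] else s rF)"
    unfolding t s1_def using assms(2,3)
    by (cases "drop (length w) ?t"; cases "take (length w) ?t = w") (auto simp: fun_eq_iff enc_name_dbl simp del: run.simps(5))
  have "ex (pour rU rT) s1 (6 * length (s1 rU) + 1) (s1(rT := rev (s1 rU) @ s1 rT, rU := []))"
    by (rule ex_pour) auto
  moreover have "s1(rT := rev (s1 rU) @ s1 rT, rU := []) = ?s2"
    using assms(3) by (auto simp: s1 fun_eq_iff)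
  moreover have "length (s1 rU) \<le> length ?t" by (simp add: s1)
  ultimately have "ex (pour rU rT) s1 (6 * length ?t + 1) ?s2" by (auto intro: ex_weaken)
  from ex_Seq[OF ex_run[OF _ order_refl] this[unfolded s1_def]]
  have "ex end_word ?s (14 + (6 * length ?t + 1)) ?s2" unfolding end_word_def by simp
  then have "ex (Test rD Skip next_bit end_word) ?s (Suc (14 + (6 * length ?t + 1))) ?s2"
    by (intro ex_Test) simp
  with assms(4) have "ex scan ?s (Suc (Suc (14 + (6 * length ?t + 1)) + T)) s'"
    unfolding scan_def by (intro ex_While_Cons) auto
  then have "ex scan s (Suc (Suc (14 + (6 * length ?t + 1)) + T) + 20 * length w) s'"
    by (intro ex_scan_dbl[where z = "False # z"]) (use assms in \<open>auto simp: enc_name_dbl\<close>)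
  then show ?thesis by (rule ex_weaken) simp
qed

lemma ex_scan:
  assumes "s rD = enc_words ws" "s rN = []" "s rU = []"
  shows "ex scan s (30 * (length (enc_words ws) + 1) * (length (s rT) + 1))
    (s(rD := [], rE := rev (enc_words ws) @ s rE,
      rF := if s rT \<in> set ws \<and> s rF = [] then [True] else s rF))"
  using assms
proof (induction ws arbitrary: s)
  case Nil
  then show ?case unfolding scan_def by (intro ex_While_Nil') (auto simp: fun_eq_iff enc_words_def)
next
  case (Cons w ws)
  let ?s = "s(rD := enc_words ws, rE := rev (enc_name w) @ s rE,
      rF := if s rT = w \<and> s rF = [] then [True] else s rF)"
  let ?s' = "s(rD := [], rE := rev (enc_words (w # ws)) @ s rE,
      rF := if s rT \<in> set (w # ws) \<and> s rF = [] then [True] else s rF)"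
  have "ex scan ?s (30 * (length (enc_words ws) + 1) * (length (?s rT) + 1)) (?s(rD := [], rE := rev (enc_words ws) @ ?s rE,
      rF := if ?s rT \<in> set ws \<and> ?s rF = [] then [True] else ?s rF))"
    by (rule Cons.IH) (use Cons.prems in auto)
  moreover have "?s(rD := [], rE := rev (enc_words ws) @ ?s rE,
      rF := if ?s rT \<in> set ws \<and> ?s rF = [] then [True] else ?s rF) = ?s'"
    by (auto simp: fun_eq_iff enc_words_def)
  ultimately have "ex scan ?s (30 * (length (enc_words ws) + 1) * (length (s rT) + 1)) ?s'" by simp
  then have "ex scan s (30 * (length (enc_words ws) + 1) * (length (s rT) + 1) + 20 * length w + 20 + 6 * length (s rT)) ?s'"
    by (intro ex_scan_word) (use Cons.prems in \<open>auto simp: enc_words_def\<close>)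
  then show ?case
    by (rule ex_weaken) (simp add: enc_words_def enc_name_dbl algebra_simps)
qed

definition clean :: "regs \<Rightarrow> bool" where
  "clean s \<longleftrightarrow> (\<forall>r\<in>{rT, rU, rN, rF, rE, rW}. s r = [])"

definition chk :: "part list \<Rightarrow> com" where
  "chk p = build p ;; scan ;; pour rE rD ;; (Test rF (flag rB) Skip Skip ;; Pop rF) ;; clear rT"

lemma ex_chk:
  assumes "clean s" "s rD = enc_words D" "\<And>i. length (vars_of s i) \<le> N" "length (enc_words D) \<le> M"
    "50 * (tsize p * (N + 1) + 1) * (M + 1) \<le> T"
  shows "ex (chk p) s T (s(rB := if inst (vars_of s) p \<in> set D \<or> s rB \<noteq> [] then s rB else [True]))"
proof -
  let ?t = "inst (vars_of s) p"
  define A where "A = tsize p * (N + 1)"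
  have A: "length ?t \<le> A" unfolding A_def by (rule length_inst) (rule assms)
  have e: "s rT = []" "s rU = []" "s rN = []" "s rF = []" "s rE = []" "s rW = []"
    using assms(1) by (auto simp: clean_def)
  let ?s1 = "s(rT := ?t)"
  let ?f = "if ?t \<in> set D then [True] else []"
  let ?s2 = "s(rT := ?t, rD := [], rE := rev (enc_words D), rF := ?f)"
  let ?s3 = "s(rT := ?t, rF := ?f)"
  let ?s4 = "s(rT := ?t, rB := if ?t \<in> set D \<or> s rB \<noteq> [] then s rB else [True])"
  let ?s5 = "s(rB := if ?t \<in> set D \<or> s rB \<noteq> [] then s rB else [True])"
  have 1: "ex (build p) s A ?s1"
    by (rule ex_cong[OF ex_build[where N = N]]) (use assms e A_def in auto)
  have "30 * (length (enc_words D) + 1) * (length ?t + 1) \<le> 30 * (M + 1) * (A + 1)"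
    using assms(4) A by (intro mult_le_mono add_le_mono) auto
  then have 2: "ex scan ?s1 (30 * (M + 1) * (A + 1)) ?s2"
    by (intro ex_cong[OF ex_scan[where ws = D]]) (use assms(2) e in \<open>auto simp: fun_eq_iff\<close>)
  have 3: "ex (pour rE rD) ?s2 (6 * M + 1) ?s3"
    by (rule ex_cong[OF ex_pour[OF _ order_refl]]) (use assms e A in \<open>auto simp: fun_eq_iff\<close>)
  have 4: "ex (Test rF (flag rB) Skip Skip ;; Pop rF) ?s3 6 ?s4"
    by (rule ex_cong[OF ex_run[OF _ order_refl]]) (use assms e A in \<open>auto simp: fun_eq_iff\<close>)
  have 5: "ex (clear rT) ?s4 (3 * A + 1) ?s5"
    by (rule ex_cong[OF ex_clear[OF order_refl]]) (use assms e A in \<open>auto simp: fun_eq_iff\<close>)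
  have "A + (30 * (M + 1) * (A + 1) + (6 * M + 1 + (6 + (3 * A + 1)))) \<le> 50 * (A + 1) * (M + 1)"
    by (simp add: algebra_simps)
  then show ?thesis
    unfolding chk_def
    by (rule ex_weaken[OF ex_Seq[OF 1 ex_Seq[OF 2 ex_Seq[OF 3 ex_Seq[OF 4 5]]]], OF order_trans])
      (use assms(5) in \<open>simp add: A_def\<close>)
qed

definition store :: com where
  "store = pour rT rU ;; Push rD False ;;
     While rU (Test rU Skip (Pop rU ;; Push rD True ;; Push rD True) (Pop rU ;; Push rD False ;; Push rD True))"

lemma ex_store:
  assumes "s rU = []" "20 * length (s rT) + 10 \<le> T"
  shows "ex store s T (s(rT := [], rD := enc_name (s rT) @ s rD))"
proof -
  let ?c = "Test rU Skip (Pop rU ;; Push rD True ;; Push rD True) (Pop rU ;; Push rD False ;; Push rD True)"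
  have loop: "ex (While rU ?c) s (8 * length xs + 1) (s(rU := [], rD := dbl (rev xs) @ s rD))"
    if "s rU = xs" for xs s
    using that
  proof (induction xs arbitrary: s)
    case Nil
    then show ?case by (intro ex_While_Nil') (auto simp: fun_eq_iff)
  next
    case (Cons x xs)
    let ?s = "s(rU := xs, rD := True # x # s rD)"
    have r: "run ?c s = ?s" using Cons.prems by (cases x) (auto simp: fun_eq_iff)
    have "ex (While rU ?c) ?s (8 * length xs + 1) (?s(rU := [], rD := dbl (rev xs) @ ?s rD))"
      by (rule Cons.IH) auto
    moreover have "?s(rU := [], rD := dbl (rev xs) @ ?s rD) = s(rU := [], rD := dbl (rev (x # xs)) @ s rD)"
      by (auto simp: fun_eq_iff)
    ultimately have "ex (While rU ?c) (run ?c s) (8 * length xs + 1)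
       (s(rU := [], rD := dbl (rev (x # xs)) @ s rD))" by (simp only: r)
    then show ?case by (rule ex_While_run[rotated 2]) (use Cons in simp_all)
  qed
  let ?s1 = "s(rT := [], rU := rev (s rT))"
  let ?s2 = "s(rT := [], rU := rev (s rT), rD := False # s rD)"
  have 1: "ex (pour rT rU) s (6 * length (s rT) + 1) ?s1"
    by (rule ex_cong[OF ex_pour[OF _ order_refl]]) (use assms in \<open>auto simp: fun_eq_iff\<close>)
  have 2: "ex (Push rD False) ?s1 2 ?s2"
    by (rule ex_cong[OF ex_run[OF _ order_refl]]) (auto simp: fun_eq_iff)
  have 3: "ex (While rU ?c) ?s2 (8 * length (s rT) + 1) (s(rT := [], rD := enc_name (s rT) @ s rD))"
    by (rule ex_cong[OF loop[where xs = "rev (s rT)"]])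
      (use assms in \<open>auto simp: fun_eq_iff enc_name_dbl\<close>)
  show ?thesis unfolding store_def
    by (rule ex_weaken[OF ex_Seq[OF 1 ex_Seq[OF 2 3]]]) (use assms in simp)
qed

section \<open>Executing the lines of a certificate\<close>

definition conf :: "(nat \<Rightarrow> bool list) \<Rightarrow> bool list \<Rightarrow> bool list list \<Rightarrow> regs" where
  "conf \<sigma> y D = upd_vars ((\<lambda>_. [])(rD := enc_words D)) \<sigma> y"

lemma conf_simps [simp]:
  "clean (conf \<sigma> y D)" "vars_of (conf \<sigma> y D) = \<sigma>"
  "conf \<sigma> y D rY = y" "conf \<sigma> y D rD = enc_words D" "conf \<sigma> y D rB = []" "conf \<sigma> y D 0 = []"
  by (auto simp: conf_def clean_def upd_vars_def vars_of_def)

lemma vars_of_upd [simp]: "r < 11 \<Longrightarrow> vars_of (s(r := a)) = vars_of s"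
  by (auto simp: vars_of_def)

definition rule_com :: "rule \<Rightarrow> com" where
  "rule_com r = foldr (\<lambda>p k. chk p ;; k) (fst r) Skip ;; Test rB (build (snd r) ;; store) Skip Skip ;; Pop rB"

definition rule_size :: "rule \<Rightarrow> nat" where
  "rule_size r = (\<Sum>p\<leftarrow>fst r. tsize p + 1) + tsize (snd r) + 1"

lemma ex_chks:
  assumes "\<And>i. length (\<sigma> i) \<le> N" "length (enc_words D) \<le> M" "b \<in> {[], [True]}"
  shows "ex (foldr (\<lambda>p k. chk p ;; k) ps Skip) ((conf \<sigma> y D)(rB := b))
    (50 * (\<Sum>p\<leftarrow>ps. tsize p + 1) * ((N + 1) * (M + 1)))
    ((conf \<sigma> y D)(rB := if b = [] \<and> (\<forall>p\<in>set ps. inst \<sigma> p \<in> set D) then [] else [True]))"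
  using assms(3)
proof (induction ps arbitrary: b)
  case Nil
  then show ?case by (auto intro!: ex_cong[OF ex_run[of Skip 0]])
next
  case (Cons p ps)
  let ?s = "(conf \<sigma> y D)(rB := b)"
  let ?b = "if inst \<sigma> p \<in> set D \<or> b \<noteq> [] then b else [True]"
  have c: "clean ?s" using conf_simps(1)[of \<sigma> y D] by (simp add: clean_def)
  have "50 * (tsize p * (N + 1) + 1) * (M + 1) \<le> 50 * (tsize p + 1) * ((N + 1) * (M + 1))"
    by (simp add: algebra_simps)
  then have 1: "ex (chk p) ?s (50 * (tsize p + 1) * ((N + 1) * (M + 1))) ((conf \<sigma> y D)(rB := ?b))"
    by (intro ex_cong[OF ex_chk[where D = D and N = N and M = M, OF c]]) (use assms in auto)
  have 2: "?b \<in> {[], [True]}" using Cons.prems by auto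
  show ?case
    by (simp only: foldr.simps o_apply, rule ex_cong[OF ex_Seq[OF 1 Cons.IH[OF 2]]])
      (use Cons.prems in \<open>auto simp: algebra_simps\<close>)
qed

lemma enc_words_Cons: "enc_words (w # ws) = enc_name w @ enc_words ws"
  by (simp add: enc_words_def)

lemma ex_rule_com:
  assumes "\<And>i. length (\<sigma> i) \<le> N" "length (enc_words D) \<le> M"
  shows "ex (rule_com r) (conf \<sigma> y D) (100 * rule_size r * ((N + 1) * (M + 1)))
     (conf \<sigma> y (apply_rule \<sigma> r D))"
proof -
  obtain ps c where r: "r = (ps, c)" by fastforce
  define X where "X = (N + 1) * (M + 1)"
  define A where "A = tsize c * (N + 1)"
  let ?ok = "\<forall>p\<in>set ps. inst \<sigma> p \<in> set D"
  let ?s1 = "(conf \<sigma> y D)(rB := if ?ok then [] else [True])"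
  have b: "(conf \<sigma> y D)(rB := []) = conf \<sigma> y D" by (simp add: fun_upd_idem)
  have 1: "ex (foldr (\<lambda>p k. chk p ;; k) ps Skip) (conf \<sigma> y D) (50 * (\<Sum>p\<leftarrow>ps. tsize p + 1) * X) ?s1"
    using ex_chks[where b = "[]" and y = y and ps = ps and \<sigma> = \<sigma> and D = D, OF assms] b
    by (auto simp: X_def)
  have len: "length (inst \<sigma> c) \<le> A" unfolding A_def by (rule length_inst) (rule assms)
  have c: "clean ?s1" using conf_simps(1)[of \<sigma> y D] by (simp add: clean_def)
  have 2: "ex (Test rB (build c ;; store) Skip Skip ;; Pop rB) ?s1 (21 * A + 20) (conf \<sigma> y (apply_rule \<sigma> r D))"
  proof (cases ?ok)
    case True
    let ?s2 = "(conf \<sigma> y D)(rT := inst \<sigma> c)"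
    have "ex (build c) ?s1 A ?s2"
      by (rule ex_cong[OF ex_build[where N = N]]) (use True assms c A_def in \<open>auto simp: clean_def fun_eq_iff\<close>)
    moreover have "ex store ?s2 (20 * A + 10) (conf \<sigma> y (apply_rule \<sigma> r D))"
      by (rule ex_cong[OF ex_store[OF _ order_refl]])
        (use True len conf_simps(1)[of \<sigma> y D] in \<open>auto simp: fun_eq_iff r clean_def conf_def enc_words_Cons upd_vars_def\<close>)
    ultimately have "ex (build c ;; store) ?s1 (A + (20 * A + 10)) (conf \<sigma> y (apply_rule \<sigma> r D))"
      by (rule ex_Seq)
    then have "ex (Test rB (build c ;; store) Skip Skip) ?s1 (Suc (A + (20 * A + 10))) (conf \<sigma> y (apply_rule \<sigma> r D))"
      using True by (intro ex_Test) simp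
    from ex_Seq[OF this ex_run[of "Pop rB", OF _ order_refl]] show ?thesis
      by (rule ex_cong) (auto simp: fun_eq_iff)
  next
    case False
    then have "ex (Test rB (build c ;; store) Skip Skip) ?s1 (Suc 0) ?s1"
      by (intro ex_Test) (auto intro!: ex_cong[OF ex_run[of Skip 0]])
    from ex_Seq[OF this ex_run[of "Pop rB", OF _ order_refl]] show ?thesis
      by (rule ex_cong) (use False in \<open>auto simp: r fun_eq_iff\<close>)
  qed
  have "21 * A + 20 \<le> 50 * (tsize c + 1) * X" unfolding A_def X_def by (simp add: algebra_simps)
  then have "50 * (\<Sum>p\<leftarrow>ps. tsize p + 1) * X + (21 * A + 20) \<le> 100 * rule_size r * X"
    unfolding rule_size_def r by (simp add: algebra_simps)
  then show ?thesis using ex_Seq[OF 1 2] unfolding rule_com_def X_def r fst_conv snd_conv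
    by (blast intro: ex_weaken)
qed

primrec line_com :: "nat \<Rightarrow> rule list \<Rightarrow> com" where
  "line_com m [] = Pop rY"
| "line_com m (r # rs) = Test rY Skip (Pop rY ;; read_coms m ;; rule_com r) (Pop rY ;; line_com m rs)"

definition line_time :: "nat \<Rightarrow> rule list \<Rightarrow> nat \<Rightarrow> nat \<Rightarrow> nat" where
  "line_time m rs N M = 3 * length rs + 2 + m * (15 * N + 20) + 100 * (\<Sum>r\<leftarrow>rs. rule_size r) * ((N + 1) * (M + 1))"

lemma conf_upd_Y: "(conf \<sigma> y D)(rY := y') = conf \<sigma> y' D"
  by (auto simp: conf_def upd_vars_def fun_eq_iff)

lemma ex_line_com:
  assumes "\<And>i. length (\<sigma> i) \<le> N" "length y \<le> N" "length (enc_words D) \<le> M"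
  shows "ex (line_com m rs) (conf \<sigma> y D) (line_time m rs N M)
    (case line m rs \<sigma> y D of (\<sigma>', y', D') \<Rightarrow> conf \<sigma>' y' D')"
  using assms
proof (induction m rs \<sigma> y D rule: line.induct)
  case (1 m \<sigma> y D)
  show ?case unfolding line_com.simps
    by (rule ex_cong[OF ex_run]) (auto simp: line_time_def conf_upd_Y)
next
  case (2 m r rs \<sigma> D)
  show ?case unfolding line_com.simps
    by (rule ex_cong[OF ex_Test[where T = 0]]) (auto simp: line_time_def intro!: ex_cong[OF ex_run[of Skip 0]])
next
  case (3 m r rs \<sigma> y D)
  have "ex (Pop rY) (conf \<sigma> (False # y) D) 2 (conf \<sigma> y D)"
    by (rule ex_cong[OF ex_run]) (auto simp: conf_upd_Y)
  moreover have "ex (line_com m rs) (conf \<sigma> y D) (line_time m rs N M)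
    (case line m rs \<sigma> y D of (\<sigma>', y', D') \<Rightarrow> conf \<sigma>' y' D')"
    by (rule 3) (use 3 in auto)
  ultimately have "ex (Pop rY ;; line_com m rs) (conf \<sigma> (False # y) D) (2 + line_time m rs N M)
     (case line m rs \<sigma> y D of (\<sigma>', y', D') \<Rightarrow> conf \<sigma>' y' D')" by (rule ex_Seq)
  then show ?case unfolding line_com.simps
    by (intro ex_cong[OF ex_Test[where T = "2 + line_time m rs N M"]]) (auto simp: line_time_def algebra_simps)
next
  case (4 m r rs \<sigma> y D)
  define \<sigma>' y' where "\<sigma>' = fst (read_words m \<sigma> y)" and "y' = snd (read_words m \<sigma> y)"
  have 1: "ex (Pop rY) (conf \<sigma> (True # y) D) 2 (conf \<sigma> y D)"
    by (rule ex_cong[OF ex_run]) (auto simp: conf_upd_Y)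
  have y: "length y \<le> N" using 4 by simp
  have 2: "ex (read_coms m) (conf \<sigma> y D) (m * (15 * N + 20)) (conf \<sigma>' y' D)"
    unfolding conf_def \<sigma>'_def y'_def by (rule ex_read_coms) (use 4 in auto)
  have "\<And>i. length (\<sigma>' i) \<le> N" unfolding \<sigma>'_def by (rule length_read_words_fst) (use 4 in auto)
  then have 3: "ex (rule_com r) (conf \<sigma>' y' D) (100 * rule_size r * ((N + 1) * (M + 1)))
     (conf \<sigma>' y' (apply_rule \<sigma>' r D))" by (rule ex_rule_com) (use 4 in auto)
  have "ex (Test rY Skip (Pop rY ;; read_coms m ;; rule_com r) (Pop rY ;; line_com m rs)) (conf \<sigma> (True # y) D)
      (Suc (2 + (m * (15 * N + 20) + 100 * rule_size r * ((N + 1) * (M + 1)))))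
     (conf \<sigma>' y' (apply_rule \<sigma>' r D))"
    by (rule ex_Test) (use ex_Seq[OF 1 ex_Seq[OF 2 3]] in simp)
  then show ?case unfolding line_com.simps
    by (rule ex_cong) (auto simp: \<sigma>'_def y'_def case_prod_beta line_time_def algebra_simps)
qed

text \<open>Values of variables are read from the certificate and never computed from derived words,
  so \<open>N\<close> bounds them throughout. Derived words therefore do not grow with the number of
  lines, and each line adds at most one word of length \<open>S * (N + 1)\<close>, doubled and
  terminated.\<close>

lemma line_growth:
  assumes "\<And>i. length (\<sigma> i) \<le> N" "length y \<le> N" "\<And>r. r \<in> set rs \<Longrightarrow> tsize (snd r) \<le> S"
    and "line m rs \<sigma> y D = (\<sigma>', y', D')"
  shows "length (\<sigma>' i) \<le> N" "length (enc_words D') \<le> length (enc_words D) + (2 * (S * (N + 1)) + 1)"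
proof -
  have "(\<forall>i. length (\<sigma>' i) \<le> N) \<and> length (enc_words D') \<le> length (enc_words D) + (2 * (S * (N + 1)) + 1)"
    using assms
  proof (induction m rs \<sigma> y D rule: line.induct)
    case (3 m r rs \<sigma> y D)
    then show ?case by simp
  next
    case (4 m r rs \<sigma> y D)
    define \<sigma>1 y1 where "\<sigma>1 = fst (read_words m \<sigma> y)" and "y1 = snd (read_words m \<sigma> y)"
    obtain ps c where r: "r = (ps, c)" by fastforce
    have s: "\<And>i. length (\<sigma>1 i) \<le> N" unfolding \<sigma>1_def by (rule length_read_words_fst) (use 4 in auto)
    have "length (inst \<sigma>1 c) \<le> tsize c * (N + 1)" by (rule length_inst) (rule s)
    also have "\<dots> \<le> S * (N + 1)" using 4(3)[of r] r by (intro mult_le_mono1) auto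
    finally have "length (enc_words (apply_rule \<sigma>1 r D)) \<le> length (enc_words D) + (2 * (S * (N + 1)) + 1)"
      by (auto simp: r enc_words_Cons enc_name_dbl)
    moreover have "\<sigma>' = \<sigma>1" "D' = apply_rule \<sigma>1 r D" using 4(4) by (auto simp: \<sigma>1_def case_prod_beta)
    ultimately show ?case using s by auto
  qed auto
  then show "length (\<sigma>' i) \<le> N" "length (enc_words D') \<le> length (enc_words D) + (2 * (S * (N + 1)) + 1)" by auto
qed

lemma ex_lines:
  assumes "\<And>i. length (\<sigma> i) \<le> N" "length y \<le> N" "\<And>r. r \<in> set rs \<Longrightarrow> tsize (snd r) \<le> S"
    and "length (enc_words D) + (2 * (S * (N + 1)) + 1) * length y \<le> M"
  shows "ex (While rY (line_com m rs)) (conf \<sigma> y D) (length y * (line_time m rs N M + 1) + 1)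
      (case lines m rs \<sigma> y D of (\<sigma>', D') \<Rightarrow> conf \<sigma>' [] D') \<and>
    (\<forall>\<sigma>' D'. lines m rs \<sigma> y D = (\<sigma>', D') \<longrightarrow> (\<forall>i. length (\<sigma>' i) \<le> N) \<and> length (enc_words D') \<le> M)"
  using assms
proof (induction m rs \<sigma> y D rule: lines.induct)
  case (1 m rs \<sigma> y D)
  show ?case
  proof (cases "y = []")
    case True
    then show ?thesis using 1 by (auto simp: lines.simps[of m rs \<sigma> "[]" D] intro!: ex_While_Nil')
  next
    case False
    obtain \<sigma>1 y1 D1 where l: "line m rs \<sigma> y D = (\<sigma>1, y1, D1)" by (metis prod_cases3)
    define K where "K = 2 * (S * (N + 1)) + 1"
    have y1: "length y1 + 1 \<le> length y" using length_line[of m rs \<sigma> y D] l False by (cases y) auto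
    have g: "\<And>i. length (\<sigma>1 i) \<le> N" "length (enc_words D1) \<le> length (enc_words D) + K"
      unfolding K_def using line_growth[OF 1(2-4) l] by auto
    \<comment> \<open>The line has used up at least one letter, and this letter pays for the growth
      of the list.\<close>
    have "K * length y1 + K \<le> K * length y" using mult_le_mono2[OF y1, of K] by simp
    then have M: "length (enc_words D1) + K * length y1 \<le> M"
      using g(2) 1(5)[folded K_def] by linarith
    have ls: "lines m rs \<sigma> y D = lines m rs \<sigma>1 y1 D1" using False l by (subst lines.simps) simp
    have IH: "ex (While rY (line_com m rs)) (conf \<sigma>1 y1 D1) (length y1 * (line_time m rs N M + 1) + 1)
      (case lines m rs \<sigma>1 y1 D1 of (\<sigma>', D') \<Rightarrow> conf \<sigma>' [] D') \<and>
    (\<forall>\<sigma>' D'. lines m rs \<sigma>1 y1 D1 = (\<sigma>', D') \<longrightarrow> (\<forall>i. length (\<sigma>' i) \<le> N) \<and> length (enc_words D') \<le> M)"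
      using 1(1)[OF False] 1(3,4) g(1) y1 M[unfolded K_def] by (simp add: l)
    have "ex (line_com m rs) (conf \<sigma> y D) (line_time m rs N M) (conf \<sigma>1 y1 D1)"
      using ex_line_com[of \<sigma> N y D M m rs] 1 l by simp
    from ex_While_Cons[OF _ this conjunct1[OF IH]] False
    have "ex (While rY (line_com m rs)) (conf \<sigma> y D)
        (Suc (line_time m rs N M + (length y1 * (line_time m rs N M + 1) + 1)))
        (case lines m rs \<sigma> y D of (\<sigma>', D') \<Rightarrow> conf \<sigma>' [] D')" by (simp add: ls)
    moreover have "Suc (line_time m rs N M + (length y1 * (line_time m rs N M + 1) + 1))
      = (length y1 + 1) * (line_time m rs N M + 1) + 1" by simp
    moreover have "\<dots> \<le> length y * (line_time m rs N M + 1) + 1"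
      using mult_le_mono1[OF y1, of "line_time m rs N M + 1"] by simp
    ultimately show ?thesis using IH unfolding ls by (metis (no_types, lifting) ex_weaken)
  qed
qed

text \<open>The registers in use depend on the rules, so the number of tapes is chosen last and
  large enough. Register 0 is excluded because it is the output and not a stack.\<close>

fun pos_regs :: "com \<Rightarrow> bool" where
  "pos_regs (Push r b) \<longleftrightarrow> 0 < r"
| "pos_regs (Pop r) \<longleftrightarrow> 0 < r"
| "pos_regs (c1 ;; c2) \<longleftrightarrow> pos_regs c1 \<and> pos_regs c2"
| "pos_regs (Test r c0 c1 c2) \<longleftrightarrow> 0 < r \<and> pos_regs c0 \<and> pos_regs c1 \<and> pos_regs c2"
| "pos_regs (While r c) \<longleftrightarrow> 0 < r \<and> pos_regs c"
| "pos_regs _ \<longleftrightarrow> True"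

lemma pos_regs_wf: "pos_regs c \<Longrightarrow> \<exists>K0. \<forall>K\<ge>K0. wf_com K c"
proof (induction c)
  case (Seq c1 c2)
  then obtain K1 K2 where "\<forall>K\<ge>K1. wf_com K c1" "\<forall>K\<ge>K2. wf_com K c2" by auto
  then show ?case by (intro exI[of _ "max K1 K2"]) auto
next
  case (Test r c0 c1 c2)
  then obtain K0 K1 K2 where "\<forall>K\<ge>K0. wf_com K c0" "\<forall>K\<ge>K1. wf_com K c1" "\<forall>K\<ge>K2. wf_com K c2" by auto
  with Test.prems show ?case by (intro exI[of _ "Suc (max r (max K0 (max K1 K2)))"]) auto
next
  case (While r c)
  then obtain K1 where "\<forall>K\<ge>K1. wf_com K c" by auto
  with While.prems show ?case by (intro exI[of _ "Suc (max r K1)"]) auto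
next
  case (Push r b)
  then show ?case by (intro exI[of _ "Suc r"]) auto
next
  case (Pop r)
  then show ?case by (intro exI[of _ "Suc r"]) auto
qed auto

text \<open>Allows time bounds to stay in the form in which they arise; the closure properties
  supply a polynomial above them.\<close>

definition poly_bounded :: "(nat \<Rightarrow> nat) \<Rightarrow> bool" where
  "poly_bounded f \<longleftrightarrow> (\<exists>p :: nat poly. \<forall>n. f n \<le> poly p n)"

lemma poly_bounded_intros [intro!]:
  "poly_bounded (\<lambda>n. k)" "poly_bounded (\<lambda>n. n)" "poly_bounded (\<lambda>n. poly p n)"
  "\<lbrakk>poly_bounded f; poly_bounded g\<rbrakk> \<Longrightarrow> poly_bounded (\<lambda>n. f n + g n)"
  "\<lbrakk>poly_bounded f; poly_bounded g\<rbrakk> \<Longrightarrow> poly_bounded (\<lambda>n. f n * g n)"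
  "poly_bounded f \<Longrightarrow> poly_bounded (\<lambda>n. Suc (f n))"
proof -
  show const: "poly_bounded (\<lambda>n. k)" for k unfolding poly_bounded_def by (intro exI[of _ "[:k:]"]) auto
  show "poly_bounded (\<lambda>n. n)" unfolding poly_bounded_def by (intro exI[of _ "[:0, 1:]"]) auto
  show "poly_bounded (\<lambda>n. poly p n)" unfolding poly_bounded_def by auto
  show add: "poly_bounded (\<lambda>n. f n + g n)" if fg: "poly_bounded f" "poly_bounded g" for f g
  proof -
    from fg obtain p q where "\<forall>n. f n \<le> poly p n" "\<forall>n. g n \<le> poly q n" unfolding poly_bounded_def by auto
    then show ?thesis unfolding poly_bounded_def by (intro exI[of _ "p + q"]) (auto simp: add_mono)
  qed
  show "poly_bounded (\<lambda>n. f n * g n)" if fg: "poly_bounded f" "poly_bounded g"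
  proof -
    from fg obtain p q where "\<forall>n. f n \<le> poly p n" "\<forall>n. g n \<le> poly q n" unfolding poly_bounded_def by auto
    then show ?thesis unfolding poly_bounded_def by (intro exI[of _ "p * q"]) (auto simp: mult_le_mono)
  qed
  show "poly_bounded (\<lambda>n. Suc (f n))" if "poly_bounded f"
    using add[OF that const[of 1]] by simp
qed

lemma polytime_bounded:
  assumes "pos_regs c" "poly_bounded T"
    and "\<And>ws. length ws = n \<Longrightarrow> \<exists>s'. ex c (input ws) (T (sum_list (map length ws))) s' \<and> s' 0 = f ws"
  shows "polytime n f"
proof -
  obtain K0 where K: "\<forall>K\<ge>K0. wf_com K c" using pos_regs_wf[OF assms(1)] by auto
  obtain p where p: "\<And>n. T n \<le> poly p n" using assms(2) by (auto simp: poly_bounded_def)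
  show ?thesis
  proof (rule polytime_com[of "max K0 (Suc n)" c n p])
    fix ws :: "bool list list" assume "length ws = n"
    then show "\<exists>s'. ex c (input ws) (poly p (sum_list (map length ws))) s' \<and> s' 0 = f ws"
      using assms(3) ex_weaken[OF _ p] by metis
  qed (use K in auto)
qed

definition verifier :: "nat \<Rightarrow> rule list \<Rightarrow> part list \<Rightarrow> part list \<Rightarrow> com" where
  "verifier m rs ax goal = pour rX (rV 0) ;; build ax ;; store ;; While rY (line_com m rs) ;;
     chk goal ;; Test rB (Out True) (Out False) (Out False)"

lemma pos_regs_build: "pos_regs (build ps)"
proof (induction ps)
  case (Cons p ps)
  have "pos_regs (push_word w)" for w by (induction w) auto
  then have "pos_regs (build_part p)" by (cases p) (auto simp: insert_com_def pour_def)
  with Cons show ?case by simp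
qed simp

lemma pos_regs_chk: "pos_regs (chk p)"
  by (simp add: chk_def pos_regs_build scan_def next_bit_def end_word_def cmp_def flag_def pour_def clear_def)

lemma pos_regs_verifier: "pos_regs (verifier m rs ax goal)"
proof -
  have st: "pos_regs store" by (simp add: store_def pour_def)
  have "pos_regs (foldr (\<lambda>p k. chk p ;; k) ps Skip)" for ps
    by (induction ps) (auto simp: pos_regs_chk)
  then have "pos_regs (rule_com r)" for r by (simp add: rule_com_def pos_regs_build st)
  moreover have "pos_regs (read_coms m)" by (induction m) (auto simp: read_com_def clear_def)
  ultimately have "pos_regs (line_com m rs)" by (induction rs) auto
  then show ?thesis by (simp add: verifier_def pos_regs_build st pos_regs_chk pour_def)
qed

text \<open>\<open>N\<close> bounds input and certificate together and hence every variable.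
  \<open>M\<close> bounds the code of all derived words: the axiom and one conclusion for each of at
  most \<open>N\<close> lines. The time adds up the six parts of \<open>verifier\<close>.\<close>

lemma ex_verifier:
  assumes "length x + length y \<le> N" "\<And>r. r \<in> set rs \<Longrightarrow> tsize (snd r) \<le> S"
    and M: "M = 2 * (tsize ax * (N + 1)) + 1 + (2 * (S * (N + 1)) + 1) * N"
  shows "\<exists>s'. ex (verifier m rs ax goal) (input [x, y])
     (6 * N + 1 + (tsize ax * (N + 1) + (20 * (tsize ax * (N + 1)) + 10 + (N * (line_time m rs N M + 1) + 1 +
       (50 * (tsize goal * (N + 1) + 1) * (M + 1) + 3))))) s' \<and> s' 0 = [accepts m rs ax goal x y]"
proof -
  let ?\<sigma> = "(\<lambda>_. [])(0 := x)"
  let ?t = "inst ?\<sigma> ax"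
  obtain \<sigma>' D' where l: "lines m rs ?\<sigma> y [?t] = (\<sigma>', D')" by fastforce
  have x: "length x \<le> N" "length y \<le> N" using assms(1) by auto
  have \<sigma>: "length (?\<sigma> i) \<le> N" for i using x by simp
  have t: "length ?t \<le> tsize ax * (N + 1)" by (rule length_inst) (rule \<sigma>)
  \<comment> \<open>Pouring reverses the input, and variables are kept reversed.\<close>
  have 1: "ex (pour rX (rV 0)) (input [x, y]) (6 * N + 1) (conf ?\<sigma> y [])"
    by (rule ex_cong[OF ex_pour[OF _ order_refl]])
      (use x in \<open>auto simp: input_def conf_def upd_vars_def enc_words_def fun_eq_iff nth_Cons'\<close>)
  have 2: "ex (build ax) (conf ?\<sigma> y []) (tsize ax * (N + 1)) ((conf ?\<sigma> y [])(rT := ?t))"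
    by (rule ex_cong[OF ex_build[where N = N]]) (use x conf_simps(1)[of ?\<sigma> y "[]"] in \<open>auto simp: clean_def\<close>)
  have 3: "ex store ((conf ?\<sigma> y [])(rT := ?t)) (20 * (tsize ax * (N + 1)) + 10) (conf ?\<sigma> y [?t])"
    by (rule ex_cong[OF ex_store[OF _ order_refl]])
      (use t conf_simps(1)[of ?\<sigma> y "[]"] in \<open>auto simp: clean_def fun_eq_iff conf_def upd_vars_def enc_words_def\<close>)
  have "(2 * (S * (N + 1)) + 1) * length y \<le> (2 * (S * (N + 1)) + 1) * N" using x(2) by (rule mult_le_mono2)
  then have "length (enc_words [?t]) + (2 * (S * (N + 1)) + 1) * length y \<le> M"
    using t unfolding M enc_words_def by (simp add: enc_name_dbl)
  from ex_lines[where \<sigma> = ?\<sigma> and rs = rs and m = m, OF \<sigma> x(2) assms(2) this] l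
  have 4: "ex (While rY (line_com m rs)) (conf ?\<sigma> y [?t]) (length y * (line_time m rs N M + 1) + 1) (conf \<sigma>' [] D')"
    and \<sigma>': "\<And>i. length (\<sigma>' i) \<le> N" and D': "length (enc_words D') \<le> M" by auto
  have "length y * (line_time m rs N M + 1) + 1 \<le> N * (line_time m rs N M + 1) + 1"
    using x(2) by (intro add_le_mono mult_le_mono) auto
  from ex_weaken[OF 4 this]
  have 4: "ex (While rY (line_com m rs)) (conf ?\<sigma> y [?t]) (N * (line_time m rs N M + 1) + 1) (conf \<sigma>' [] D')" .
  let ?b = "inst \<sigma>' goal \<in> set D'"
  let ?s5 = "(conf \<sigma>' [] D')(rB := if ?b then [] else [True])"
  have 5: "ex (chk goal) (conf \<sigma>' [] D') (50 * (tsize goal * (N + 1) + 1) * (M + 1)) ?s5"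
    by (rule ex_cong[OF ex_chk[where N = N and M = M and D = D', OF _ _ _ _ order_refl]]) (use \<sigma>' D' in \<open>auto\<close>)
  have 6: "ex (Test rB (Out True) (Out False) (Out False)) ?s5 3 (?s5(0 := [?b]))"
    by (rule ex_cong[OF ex_run[OF _ order_refl]]) auto
  have "accepts m rs ax goal x y = ?b" by (simp add: accepts_def l)
  then show ?thesis unfolding verifier_def
    using ex_Seq[OF 1 ex_Seq[OF 2 ex_Seq[OF 3 ex_Seq[OF 4 ex_Seq[OF 5 6]]]]] by auto
qed

theorem polytime_accepts: "polytime 2 (\<lambda>ws. [accepts m rs ax goal (ws ! 0) (ws ! 1)])"
proof -
  define S where "S = (\<Sum>r\<leftarrow>rs. tsize (snd r))"
  have S: "tsize (snd r) \<le> S" if "r \<in> set rs" for r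
    using that unfolding S_def by (intro member_le_sum_list) auto
  define M where "M N = 2 * (tsize ax * (N + 1)) + 1 + (2 * (S * (N + 1)) + 1) * N" for N
  define T where "T N = 6 * N + 1 + (tsize ax * (N + 1) + (20 * (tsize ax * (N + 1)) + 10 +
    (N * (line_time m rs N (M N) + 1) + 1 + (50 * (tsize goal * (N + 1) + 1) * (M N + 1) + 3))))" for N
  show ?thesis
  proof (rule polytime_bounded[OF pos_regs_verifier[of m rs ax goal]])
    show "poly_bounded T"
      unfolding T_def line_time_def M_def by (intro poly_bounded_intros)
    fix ws :: "bool list list" assume "length ws = 2"
    then obtain x y where ws: "ws = [x, y]" by (auto simp: numeral_2_eq_2 length_Suc_conv)
    have "\<exists>s'. ex (verifier m rs ax goal) (input [x, y]) (T (length x + length y)) s' \<and>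
        s' 0 = [accepts m rs ax goal x y]"
      unfolding T_def by (rule ex_verifier[OF order_refl S M_def])
    then show "\<exists>s'. ex (verifier m rs ax goal) (input ws) (T (sum_list (map length ws))) s' \<and>
       s' 0 = [accepts m rs ax goal (ws ! 0) (ws ! 1)]"
      by (simp add: ws)
  qed
qed

section \<open>Proof systems and NP\<close>

text \<open>The parameters serve two purposes. Soundness takes all substitutions and all words;
  completeness restricts the substitutions by \<open>P\<close> and the conclusions to a finite
  \<open>U\<close>, so that derivable words can be counted.\<close>

inductive_set derivable ::
    "rule list \<Rightarrow> ((nat \<Rightarrow> bool list) \<Rightarrow> bool) \<Rightarrow> bool list set \<Rightarrow> bool list \<Rightarrow> bool list set"
  for rs P U w where
  axiom: "w \<in> derivable rs P U w"
| step: "\<lbrakk>(ps, c) \<in> set rs; P \<sigma>; inst \<sigma> c \<in> U; \<And>p. p \<in> set ps \<Longrightarrow> inst \<sigma> p \<in> derivable rs P U w\<rbrakk>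
    \<Longrightarrow> inst \<sigma> c \<in> derivable rs P U w"

lemma line_sound:
  assumes "line m rs \<sigma> y D = (\<sigma>', y', D')" "set D \<subseteq> derivable rs0 (\<lambda>_. True) UNIV w" "set rs \<subseteq> set rs0"
  shows "set D' \<subseteq> derivable rs0 (\<lambda>_. True) UNIV w"
  using assms
proof (induction m rs \<sigma> y D rule: line.induct)
  case (4 m r rs \<sigma> y D)
  obtain ps c where r: "r = (ps, c)" by fastforce
  have "inst \<sigma>' c \<in> derivable rs0 (\<lambda>_. True) UNIV w" if "\<forall>p\<in>set ps. inst \<sigma>' p \<in> set D"
    by (rule derivable.step[of ps]) (use that r 4 in auto)
  moreover have "D' = apply_rule \<sigma>' r D" using 4 by (auto simp: case_prod_beta)
  ultimately show ?case using 4 r by auto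
qed auto

lemma lines_sound:
  assumes "lines m rs \<sigma> y D = (\<sigma>', D')" "set D \<subseteq> derivable rs (\<lambda>_. True) UNIV w"
  shows "set D' \<subseteq> derivable rs (\<lambda>_. True) UNIV w"
  using assms
proof (induction m rs \<sigma> y D rule: lines.induct)
  case (1 m rs \<sigma> y D)
  show ?case
  proof (cases "y = []")
    case True
    then show ?thesis using 1 by (simp add: lines.simps)
  next
    case False
    obtain \<sigma>1 y1 D1 where l: "line m rs \<sigma> y D = (\<sigma>1, y1, D1)" by (metis prod_cases3)
    have "lines m rs \<sigma>1 y1 D1 = (\<sigma>', D')" using False l 1(2) by (subst (asm) lines.simps) simp
    moreover have "set D1 \<subseteq> derivable rs (\<lambda>_. True) UNIV w" by (rule line_sound[OF l 1(3)]) simp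
    ultimately show ?thesis using 1(1)[OF False] l by simp
  qed
qed

lemma lines_Nil: "lines m rs \<sigma> [] D = (\<sigma>, D)"
  by (subst lines.simps) simp

definition enc_line :: "nat \<Rightarrow> nat \<Rightarrow> (nat \<Rightarrow> bool list) \<Rightarrow> bool list" where
  "enc_line m j \<sigma> = replicate j False @ [True] @ concat (map (\<lambda>i. enc_name (\<sigma> i)) [0..<m])"

lemma read_word_enc: "read_word acc (enc_name w @ y) = (rev w @ acc, y)"
  unfolding enc_name_dbl by (induction w arbitrary: acc) auto

lemma read_words_enc:
  "read_words m \<tau> (concat (map (\<lambda>i. enc_name (\<sigma> i)) [0..<m]) @ y) = ((\<lambda>i. if i < m then \<sigma> i else \<tau> i), y)"
proof (induction m arbitrary: y)
  case (Suc m)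
  show ?case using Suc[of "enc_name (\<sigma> m) @ y"] by (auto simp: read_word_enc fun_eq_iff less_Suc_eq)
qed simp

text \<open>Reading a line changes the first \<open>m\<close> variables only. As both substitutions
  are empty from \<open>m\<close> on, the new one is exactly \<open>\<sigma>\<close>.\<close>

lemma line_enc:
  assumes "j < length rs" "\<And>i. i \<ge> m \<Longrightarrow> \<sigma> i = []" "\<And>i. i \<ge> m \<Longrightarrow> \<tau> i = []"
  shows "line m rs \<tau> (enc_line m j \<sigma> @ y) D = (\<sigma>, y, apply_rule \<sigma> (rs ! j) D)"
  using assms(1)
proof (induction rs arbitrary: j)
  case (Cons r rs)
  have "(\<lambda>i. if i < m then \<sigma> i else \<tau> i) = \<sigma>" using assms by fastforce
  with Cons show ?case by (cases j) (auto simp: enc_line_def read_words_enc)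
qed simp

lemma lines_enc:
  assumes "j < length rs" "\<And>i. i \<ge> m \<Longrightarrow> \<sigma> i = []" "\<And>i. i \<ge> m \<Longrightarrow> \<tau> i = []"
  shows "lines m rs \<tau> (enc_line m j \<sigma> @ y) D = lines m rs \<sigma> y (apply_rule \<sigma> (rs ! j) D)"
proof -
  have ne: "(enc_line m j \<sigma> @ y = []) = False" by (simp add: enc_line_def)
  have l: "line m rs \<tau> (enc_line m j \<sigma> @ y) D = (\<sigma>, y, apply_rule \<sigma> (rs ! j) D)"
    by (rule line_enc) (use assms in auto)
  show ?thesis
    unfolding lines.simps[of m rs \<tau> "enc_line m j \<sigma> @ y" D] by (simp only: ne if_False l fst_conv snd_conv)
qed

lemma length_enc_line:
  assumes "\<And>i. length (\<sigma> i) \<le> L"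
  shows "length (enc_line m j \<sigma>) \<le> j + 1 + m * (2 * L + 1)"
proof -
  have "(\<Sum>i\<leftarrow>[0..<m]. length (enc_name (\<sigma> i))) \<le> (\<Sum>i\<leftarrow>[0..<m]. 2 * L + 1)"
    by (rule sum_list_mono) (use assms in \<open>simp add: enc_name_dbl\<close>)
  also have "\<dots> = m * (2 * L + 1)" by (simp add: sum_list_triv)
  finally show ?thesis by (simp add: enc_line_def length_concat o_def)
qed

text \<open>As long as a derivable word is missing, some line derives a new one, so the number of
  derivable words bounds the number of lines.\<close>

lemma lines_complete:
  fixes rs m P U w L
  assumes "finite U" "w \<in> set D" "\<And>\<sigma> i. P \<sigma> \<Longrightarrow> length (\<sigma> i) \<le> L" "\<And>\<sigma> i. P \<sigma> \<Longrightarrow> i \<ge> m \<Longrightarrow> \<sigma> i = []"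
    and "\<And>i. i \<ge> m \<Longrightarrow> \<tau> i = []"
  shows "\<exists>y. length y \<le> card (derivable rs P U w - set D) * (length rs + m * (2 * L + 1)) \<and>
    derivable rs P U w \<subseteq> set (snd (lines m rs \<tau> y D))"
  using assms(2,5)
proof (induction "card (derivable rs P U w - set D)" arbitrary: D \<tau>)
  case 0
  have "derivable rs P U w \<subseteq> insert w U" by (auto elim: derivable.cases)
  then have "finite (derivable rs P U w)" using assms(1) finite_subset by blast
  then have "derivable rs P U w \<subseteq> set D" using 0(1) by simp
  then show ?case by (intro exI[of _ "[]"]) (simp add: lines_Nil)
next
  case (Suc n)
  have "\<exists>ps c \<sigma>. (ps, c) \<in> set rs \<and> P \<sigma> \<and> inst \<sigma> c \<in> U \<and> (\<forall>p\<in>set ps. inst \<sigma> p \<in> set D \<inter> derivable rs P U w) \<and> inst \<sigma> c \<notin> set D"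
  proof (rule ccontr)
    assume "\<not> ?thesis"
    then have *: "(ps, c) \<in> set rs \<Longrightarrow> P \<sigma> \<Longrightarrow> inst \<sigma> c \<in> U \<Longrightarrow>
      \<forall>p\<in>set ps. inst \<sigma> p \<in> set D \<inter> derivable rs P U w \<Longrightarrow> inst \<sigma> c \<in> set D" for ps c \<sigma>
      by metis
    have "v \<in> set D" if "v \<in> derivable rs P U w" for v
      using that
    proof induction
      case (step ps c \<sigma>)
      show ?case by (rule *[of ps]) (use step in auto)
    qed (use Suc.prems in simp)
    then have "derivable rs P U w - set D = {}" by auto
    with Suc.hyps(2) show False by (metis card.empty nat.distinct(1))
  qed
  then obtain ps c \<sigma> where r: "(ps, c) \<in> set rs" "P \<sigma>" "inst \<sigma> c \<in> U"
    "\<forall>p\<in>set ps. inst \<sigma> p \<in> set D \<inter> derivable rs P U w" "inst \<sigma> c \<notin> set D" by metis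
  have d: "inst \<sigma> c \<in> derivable rs P U w"
    by (rule derivable.step[where ps = ps]) (use r in auto)
  obtain j where j: "j < length rs" "rs ! j = (ps, c)" using r(1) by (metis in_set_conv_nth)
  have D: "apply_rule \<sigma> (rs ! j) D = inst \<sigma> c # D" using r(4) j by simp
  have "derivable rs P U w - set (inst \<sigma> c # D) = (derivable rs P U w - set D) - {inst \<sigma> c}" by auto
  then have n: "n = card (derivable rs P U w - set (inst \<sigma> c # D))"
    using Suc.hyps(2) r(5) d by (metis Diff_iff card_Diff_singleton diff_Suc_1)
  obtain y where y: "length y \<le> n * (length rs + m * (2 * L + 1))"
      "derivable rs P U w \<subseteq> set (snd (lines m rs \<sigma> y (inst \<sigma> c # D)))"
    using Suc.hyps(1)[OF n, where \<tau> = \<sigma>] assms(4)[OF r(2)] Suc.prems(1) unfolding n[symmetric] by fastforce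
  have "lines m rs \<tau> (enc_line m j \<sigma> @ y) D = lines m rs \<sigma> y (inst \<sigma> c # D)"
    using lines_enc[where \<sigma> = \<sigma> and \<tau> = \<tau> and m = m and y = y and D = D, OF j(1) assms(4)[OF r(2)] Suc.prems(2)] D by simp
  moreover have "length (enc_line m j \<sigma>) \<le> length rs + m * (2 * L + 1)"
    using length_enc_line[where \<sigma> = \<sigma> and m = m and j = j, OF assms(3)[OF r(2)]] j(1) by linarith
  ultimately show ?case using y Suc.hyps(2)[symmetric]
    by (intro exI[of _ "enc_line m j \<sigma> @ y"]) simp
qed

section \<open>Facts with words as arguments\<close>

type_synonym atom = "nat \<times> part list list"
type_synonym fact = "nat \<times> bool list list"

definition arg_inst :: "(nat \<Rightarrow> bool list) \<Rightarrow> part list \<Rightarrow> bool list" where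
  "arg_inst \<sigma> ps = concat (map (\<lambda>p. case p of Const w \<Rightarrow> w | Var i \<Rightarrow> \<sigma> i) ps)"

definition atom_inst :: "(nat \<Rightarrow> bool list) \<Rightarrow> atom \<Rightarrow> fact" where
  "atom_inst \<sigma> a = (fst a, map (arg_inst \<sigma>) (snd a))"

text \<open>\<open>inst\<close> doubles the values of variables; with the constants doubled here and
  a final \<open>False\<close>, an instance is the code of the plain concatenation. Rules can thus
  be written over undoubled words.\<close>

definition enc_arg :: "part list \<Rightarrow> part list" where
  "enc_arg ps = map (\<lambda>p. case p of Const w \<Rightarrow> Const (dbl w) | Var i \<Rightarrow> Var i) ps @ [Const [False]]"

definition enc_atom :: "atom \<Rightarrow> part list" where
  "enc_atom a = Const (enc_tag (fst a)) # concat (map enc_arg (snd a))"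

definition enc_fact :: "fact \<Rightarrow> bool list" where
  "enc_fact f = enc_tag (fst f) @ concat (map enc_name (snd f))"

lemma inst_append: "inst \<sigma> (ps @ qs) = inst \<sigma> ps @ inst \<sigma> qs"
  by (simp add: inst_def)

lemma inst_enc_arg: "inst \<sigma> (enc_arg ps) = enc_name (arg_inst \<sigma> ps)"
proof (induction ps)
  case (Cons p ps)
  then show ?case by (cases p) (auto simp: enc_arg_def inst_def arg_inst_def enc_name_dbl)
qed (simp add: enc_arg_def inst_def arg_inst_def enc_name_dbl)

lemma inst_enc_atom: "inst \<sigma> (enc_atom a) = enc_fact (atom_inst \<sigma> a)"
proof -
  have "inst \<sigma> (concat (map enc_arg as)) = concat (map enc_name (map (arg_inst \<sigma>) as))" for as
    by (induction as) (auto simp: inst_append inst_enc_arg, simp add: inst_def)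
  moreover have "inst \<sigma> (Const w # ps) = w @ inst \<sigma> ps" for w ps by (simp add: inst_def)
  ultimately show ?thesis by (simp add: enc_atom_def enc_fact_def atom_inst_def)
qed

lemma enc_tag_prefix: "enc_tag i @ u = enc_tag j @ v \<longleftrightarrow> i = j \<and> u = v"
proof (induction i arbitrary: j)
  case 0
  show ?case by (cases j) (auto simp: enc_tag_def)
next
  case (Suc i)
  show ?case using Suc by (cases j) (auto simp: enc_tag_def)
qed

lemma enc_name_prefix: "enc_name w @ u = enc_name w' @ v \<longleftrightarrow> w = w' \<and> u = v"
  unfolding enc_name_dbl
proof (induction w arbitrary: w')
  case Nil
  show ?case by (cases w') auto
next
  case (Cons b w)
  show ?case using Cons by (cases w') auto
qed

lemma enc_names_inj: "concat (map enc_name as) = concat (map enc_name bs) \<Longrightarrow> as = bs"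
proof (induction as arbitrary: bs)
  case Nil
  then show ?case by (cases bs) (auto simp: enc_name_dbl)
next
  case (Cons a as)
  then show ?case by (cases bs) (auto simp: enc_name_prefix, simp add: enc_name_dbl)
qed

lemma inj_enc_fact: "enc_fact f = enc_fact g \<Longrightarrow> f = g"
  using enc_names_inj by (auto simp: enc_fact_def enc_tag_prefix prod_eq_iff)

text \<open>Makes a substitution a finite object: \<open>set ws\<close> tells where its values come
  from and \<open>length ws\<close> bounds the variables in use.\<close>

definition subst :: "bool list list \<Rightarrow> nat \<Rightarrow> bool list" where
  "subst ws i = (if i < length ws then ws ! i else [])"

text \<open>\<open>W\<close> is the pool of words of a derivation. Restricting the arguments of
  conclusions, and not only the values of variables, leaves polynomially many facts in the size of
  \<open>W\<close>.\<close>

inductive proves :: "(atom list \<times> atom) list \<Rightarrow> nat \<Rightarrow> bool list set \<Rightarrow> fact \<Rightarrow> fact \<Rightarrow> bool"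
  for rs m W ax where
  axiom: "proves rs m W ax ax"
| step: "\<lbrakk>(ps, c) \<in> set rs; set ws \<subseteq> W; length ws \<le> m; set (snd (atom_inst (subst ws) c)) \<subseteq> W;
     \<And>p. p \<in> set ps \<Longrightarrow> proves rs m W ax (atom_inst (subst ws) p)\<rbrakk>
   \<Longrightarrow> proves rs m W ax (atom_inst (subst ws) c)"

definition enc_rule :: "atom list \<times> atom \<Rightarrow> rule" where
  "enc_rule r = (map enc_atom (fst r), enc_atom (snd r))"

lemma proves_derivable:
  assumes "proves rs m W ax f"
  shows "enc_fact f \<in> derivable (map enc_rule rs) (\<lambda>\<sigma>. \<exists>ws. \<sigma> = subst ws \<and> set ws \<subseteq> W \<and> length ws \<le> m)
     (enc_fact ` {f. fst f \<in> (fst \<circ> snd) ` set rs \<and> length (snd f) \<in> (length \<circ> snd \<circ> snd) ` set rs \<and> set (snd f) \<subseteq> W})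
     (enc_fact ax)"
  using assms
proof induction
  case (step ps c ws)
  have "inst (subst ws) (enc_atom c) \<in> derivable (map enc_rule rs) (\<lambda>\<sigma>. \<exists>ws. \<sigma> = subst ws \<and> set ws \<subseteq> W \<and> length ws \<le> m)
     (enc_fact ` {f. fst f \<in> (fst \<circ> snd) ` set rs \<and> length (snd f) \<in> (length \<circ> snd \<circ> snd) ` set rs \<and> set (snd f) \<subseteq> W})
     (enc_fact ax)"
  proof (rule derivable.step)
    show "(map enc_atom ps, enc_atom c) \<in> set (map enc_rule rs)" using step(1) by (force simp: enc_rule_def)
    show "inst (subst ws) (enc_atom c) \<in> enc_fact ` {f. fst f \<in> (fst \<circ> snd) ` set rs \<and>
      length (snd f) \<in> (length \<circ> snd \<circ> snd) ` set rs \<and> set (snd f) \<subseteq> W}"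
      using step(1,4) by (force simp: inst_enc_atom atom_inst_def)
  qed (use step in \<open>auto simp: inst_enc_atom\<close>)
  then show ?case by (simp add: inst_enc_atom)
qed (rule derivable.axiom)

text \<open>Every instance of a coded atom is the code of a fact, and codes are injective. A
  property of facts that the rules preserve is therefore an invariant of the derivable
  words.\<close>

lemma derivable_sound:
  assumes "w \<in> derivable (map enc_rule rs) (\<lambda>_. True) UNIV (enc_fact ax)" "mean ax"
    and "\<And>ps c \<sigma>. (ps, c) \<in> set rs \<Longrightarrow> (\<And>p. p \<in> set ps \<Longrightarrow> mean (atom_inst \<sigma> p)) \<Longrightarrow> mean (atom_inst \<sigma> c)"
  shows "\<exists>f. w = enc_fact f \<and> mean f"
  using assms(1)
proof induction
  case (step ps' c' \<sigma>)
  then obtain ps c where r: "(ps, c) \<in> set rs" "ps' = map enc_atom ps" "c' = enc_atom c"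
    by (auto simp: enc_rule_def)
  have "mean (atom_inst \<sigma> c)"
  proof (rule assms(3)[OF r(1)])
    fix p assume "p \<in> set ps"
    then obtain f where "enc_fact (atom_inst \<sigma> p) = enc_fact f" "mean f"
      using step.IH[of "enc_atom p"] r by (auto simp: inst_enc_atom)
    then show "mean (atom_inst \<sigma> p)" using inj_enc_fact by metis
  qed
  then show ?case using r(3) by (metis inst_enc_atom)
next
  case axiom
  show ?case using assms(2) by blast
qed

text \<open>The rules are fixed and \<open>x\<close> enters through the axiom, so the meaning of the
  facts may depend on \<open>x\<close>. Predicates and arities are those of the rules; hence the
  facts over \<open>W\<close> are polynomially many, and a certificate needs at most one line for
  each.\<close>

theorem NP_proof_system:
  fixes rs :: "(atom list \<times> atom) list" and A :: "bool list set" and p :: "nat poly"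
  assumes m: "0 < m"
    and sound: "\<And>x. \<exists>mean. mean (0, [x]) \<and>
      (\<forall>(ps, c)\<in>set rs. \<forall>\<sigma>. (\<forall>p\<in>set ps. mean (atom_inst \<sigma> p)) \<longrightarrow> mean (atom_inst \<sigma> c)) \<and>
      (mean (g, []) \<longrightarrow> x \<in> A)"
    and complete: "\<And>x. x \<in> A \<Longrightarrow> \<exists>W. finite W \<and> card W \<le> poly p (length x) \<and>
      (\<forall>w\<in>W. length w \<le> poly p (length x)) \<and> proves rs m W (0, [x]) (g, [])"
  shows "A \<in> NP"
proof -
  define axiom goal where "axiom = enc_atom (0, [[Var 0]])" and "goal = enc_atom (g, [])"
  define R where "R = accepts m (map enc_rule rs) axiom goal"
  have ax: "inst ((\<lambda>_. [])(0 := x)) axiom = enc_fact (0, [x])" for x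
    unfolding axiom_def inst_enc_atom by (simp add: atom_inst_def arg_inst_def)
  have goal: "inst \<sigma> goal = enc_fact (g, [])" for \<sigma>
    unfolding goal_def inst_enc_atom by (simp add: atom_inst_def)
  have R: "R x y \<longleftrightarrow> enc_fact (g, []) \<in> set (snd (lines m (map enc_rule rs) ((\<lambda>_. [])(0 := x)) y [enc_fact (0, [x])]))" for x y
    by (simp add: R_def accepts_def ax goal case_prod_beta)
  define K where "K = Max (insert 0 ((fst \<circ> snd) ` set rs))"
  define a where "a = Max (insert 0 ((length \<circ> snd \<circ> snd) ` set rs))"
  \<comment> \<open>Predicate numbers up to \<open>K\<close> with argument lists up to length
    \<open>a\<close>, one more for the axiom, times the length of a line.\<close>
  define B where "B n = ((K + 1) * (\<Sum>i\<le>a. poly p n ^ i) + 1) * (length rs + m * (2 * poly p n + 1))" for n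
  have snd: "x \<in> A" if "R x y" for x y
  proof -
    obtain mean where mean: "mean (0, [x])" "\<forall>(ps, c)\<in>set rs. \<forall>\<sigma>. (\<forall>p\<in>set ps. mean (atom_inst \<sigma> p)) \<longrightarrow> mean (atom_inst \<sigma> c)"
      "mean (g, []) \<longrightarrow> x \<in> A" using sound[of x] by (elim exE conjE) (rule that)
    have rules: "mean (atom_inst \<sigma> c)" if "(ps, c) \<in> set rs" "\<And>p. p \<in> set ps \<Longrightarrow> mean (atom_inst \<sigma> p)" for ps c \<sigma>
      using bspec[OF mean(2) that(1)] that(2) by simp
    obtain \<sigma>' D' where l: "lines m (map enc_rule rs) ((\<lambda>_. [])(0 := x)) y [enc_fact (0, [x])] = (\<sigma>', D')" by fastforce
    have "set D' \<subseteq> derivable (map enc_rule rs) (\<lambda>_. True) UNIV (enc_fact (0, [x]))"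
      by (rule lines_sound[OF l]) (simp add: derivable.axiom)
    then have "enc_fact (g, []) \<in> derivable (map enc_rule rs) (\<lambda>_. True) UNIV (enc_fact (0, [x]))"
      using that l by (auto simp: R)
    then obtain f where "enc_fact (g, []) = enc_fact f" "mean f"
      using derivable_sound[where mean = mean and ax = "(0, [x])" and rs = rs] mean(1) rules by metis
    then show ?thesis using mean(3) inj_enc_fact by blast
  qed
  have cmp: "\<exists>y. length y \<le> B (length x) \<and> R x y" if "x \<in> A" for x
  proof -
    obtain W where W: "finite W" "card W \<le> poly p (length x)" "\<forall>w\<in>W. length w \<le> poly p (length x)"
      "proves rs m W (0, [x]) (g, [])" using complete[OF \<open>x \<in> A\<close>] by metis
    define F where "F = {f :: fact. fst f \<in> (fst \<circ> snd) ` set rs \<and> length (snd f) \<in> (length \<circ> snd \<circ> snd) ` set rs \<and> set (snd f) \<subseteq> W}"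
    define P where "P = (\<lambda>\<sigma>. \<exists>ws. \<sigma> = subst ws \<and> set ws \<subseteq> W \<and> length ws \<le> m)"
    define X where "X = derivable (map enc_rule rs) P (enc_fact ` F) (enc_fact (0, [x]))"
    have K: "k \<le> K" if "k \<in> (fst \<circ> snd) ` set rs" for k
      unfolding K_def by (rule Max_ge) (use that in auto)
    have a: "k \<le> a" if "k \<in> (length \<circ> snd \<circ> snd) ` set rs" for k
      unfolding a_def by (rule Max_ge) (use that in auto)
    have F: "F \<subseteq> {..K} \<times> {ws. set ws \<subseteq> W \<and> length ws \<le> a}"
    proof
      fix f assume "f \<in> F"
      then show "f \<in> {..K} \<times> {ws. set ws \<subseteq> W \<and> length ws \<le> a}"
        using K[of "fst f"] a[of "length (snd f)"] unfolding F_def by (cases f) simp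
    qed
    have fin: "finite ({..K} \<times> {ws. set ws \<subseteq> W \<and> length ws \<le> a})"
      using finite_lists_length_le[OF W(1)] by simp
    have "card F \<le> (K + 1) * (\<Sum>i\<le>a. card W ^ i)"
      using card_mono[OF fin F] card_lists_length_le[OF W(1), of a] by (simp add: card_cartesian_product)
    also have "\<dots> \<le> (K + 1) * (\<Sum>i\<le>a. poly p (length x) ^ i)"
      using W(2) by (intro mult_le_mono2 sum_mono power_mono) auto
    finally have cF: "card F \<le> (K + 1) * (\<Sum>i\<le>a. poly p (length x) ^ i)" .
    have finF: "finite F" using F fin finite_subset by blast
    have "X \<subseteq> insert (enc_fact (0, [x])) (enc_fact ` F)" unfolding X_def by (auto elim: derivable.cases)
    then have "card X \<le> card (insert (enc_fact (0, [x])) (enc_fact ` F))" using finF by (intro card_mono) auto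
    also have "\<dots> \<le> card F + 1" using card_image_le[OF finF, of enc_fact] by (simp add: card_insert_if finF le_SucI)
    finally have cX: "card X \<le> (K + 1) * (\<Sum>i\<le>a. poly p (length x) ^ i) + 1" using cF by linarith
    have finX: "finite X" using \<open>X \<subseteq> _\<close> finF finite_subset by blast
    have "\<exists>y. length y \<le> card (X - set [enc_fact (0, [x])]) * (length (map enc_rule rs) + m * (2 * poly p (length x) + 1)) \<and>
      X \<subseteq> set (snd (lines m (map enc_rule rs) ((\<lambda>_. [])(0 := x)) y [enc_fact (0, [x])]))"
      unfolding X_def
    proof (rule lines_complete)
      show "length (\<sigma> i) \<le> poly p (length x)" if "P \<sigma>" for \<sigma> i
        using that W(3) by (auto simp: P_def subst_def dest!: nth_mem)
      show "\<sigma> i = []" if "P \<sigma>" "i \<ge> m" for \<sigma> i using that by (auto simp: P_def subst_def)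
    qed (use finF m in auto)
    then obtain y where y: "length y \<le> card (X - {enc_fact (0, [x])}) * (length rs + m * (2 * poly p (length x) + 1))"
      "X \<subseteq> set (snd (lines m (map enc_rule rs) ((\<lambda>_. [])(0 := x)) y [enc_fact (0, [x])]))" by auto
    have "card (X - {enc_fact (0, [x])}) \<le> card X" using finX by (simp add: card_Diff1_le)
    then have "length y \<le> B (length x)" unfolding B_def using y(1) cX
      by (meson le_trans mult_le_mono1)
    moreover have "enc_fact (g, []) \<in> X" using proves_derivable[OF W(4)] unfolding X_def P_def F_def .
    ultimately show ?thesis using y(2) R by blast
  qed
  have sum: "poly_bounded (\<lambda>n. \<Sum>i\<le>a. poly p n ^ i)" for a :: nat
  proof -
    have pw: "poly_bounded (\<lambda>n. poly p n ^ i)" for i by (induction i) auto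
    show ?thesis by (induction a) (auto intro: pw simp: )
  qed
  have "poly_bounded B" unfolding B_def by (intro poly_bounded_intros sum)
  then obtain q where q: "\<And>n. B n \<le> poly q n" by (auto simp: poly_bounded_def)
  have "x \<in> A \<longleftrightarrow> (\<exists>y. length y \<le> poly q (length x) \<and> R x y)" for x
    using snd cmp q le_trans by blast
  then show ?thesis unfolding NP_def R_def using polytime_accepts by blast
qed

section \<open>Entailment and homomorphisms\<close>

fun map_blank :: "('b \<Rightarrow> ('u, 'b, 'l) rdf_term) \<Rightarrow> ('u, 'b, 'l) rdf_term \<Rightarrow> ('u, 'b, 'l) rdf_term" where
  "map_blank \<mu> (BNode b) = \<mu> b"
| "map_blank \<mu> t = t"

fun map_triple :: "('b \<Rightarrow> ('u, 'b, 'l) rdf_term) \<Rightarrow> ('u, 'b, 'l) triple \<Rightarrow> ('u, 'b, 'l) triple" where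
  "map_triple \<mu> (s, p, o') = (map_blank \<mu> s, p, map_blank \<mu> o')"

abbreviation (input) res_terms :: "('u, 'b, 'l) rdf_term set" where
  "res_terms \<equiv> URI ` reserved"

lemma terms_ofI:
  "(s, p, o') \<in> G \<Longrightarrow> s \<in> terms_of G" "(s, p, o') \<in> G \<Longrightarrow> o' \<in> terms_of G"
  "(s, p, o') \<in> G \<Longrightarrow> URI p \<in> terms_of G"
  by (force simp: terms_of_def)+

lemma class_terms_sub: "class_terms G \<subseteq> terms_of G"
  by (auto simp: class_terms_def intro: terms_ofI)

lemma prop_terms_sub: "prop_terms G \<subseteq> terms_of G"
  by (auto simp: prop_terms_def intro: terms_ofI)

text \<open>Reserved names occur in a graph only as predicates, so a rule never derives a triple whose
  predicate is \<open>Sp\<close>, \<open>Dom\<close>, \<open>Range\<close> or \<open>Sc\<close> from a user-defined subproperty.\<close>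

lemma Cl_B_invariant:
  assumes "is_graph G" "t \<in> Cl_B G"
  shows "case t of (s, p, o') \<Rightarrow>
    s \<in> terms_of G - res_terms \<and> o' \<in> terms_of G - res_terms \<and>
    (p \<notin> reserved \<longrightarrow> URI p \<in> prop_terms G) \<and>
    (p = Sp \<or> p = BotP \<longrightarrow> s \<in> prop_terms G \<and> o' \<in> prop_terms G) \<and>
    (p = Dom \<or> p = Range \<longrightarrow> s \<in> prop_terms G \<and> o' \<in> class_terms G) \<and>
    (p = Sc \<or> p = BotC \<longrightarrow> s \<in> class_terms G \<and> o' \<in> class_terms G) \<and>
    (p = Type \<longrightarrow> o' \<in> class_terms G)"
  using assms(2)
proof induction
  case (base t)
  obtain s p o' where t: "t = (s, p, o')" by (metis prod_cases3)
  then have "s \<notin> res_terms" "o' \<notin> res_terms" using base assms(1) by (auto simp: is_graph_def)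
  then show ?case using base t by (auto simp: prop_terms_def class_terms_def intro: terms_ofI)
next
  case (r2b D E X Y)
  then have "E \<notin> reserved" by auto
  then show ?case using r2b by (auto simp: reserved_def)
next
  case (r5c A B)
  then show ?case using class_terms_sub by (auto simp: reserved_def)
next
  case (r6c A B)
  then show ?case using prop_terms_sub by (auto simp: reserved_def)
qed (auto simp: reserved_def)

lemma uni_Cl_B:
  assumes "is_graph G" "(s, p, o') \<in> Cl_B G"
  shows "s \<in> terms_of G" "o' \<in> terms_of G" "URI p \<in> terms_of G \<union> res_terms"
proof -
  note inv = Cl_B_invariant[OF assms, unfolded prod.case]
  show "s \<in> terms_of G" by (rule DiffD1[OF conjunct1[OF inv]])
  show "o' \<in> terms_of G" by (rule DiffD1[OF conjunct1[OF conjunct2[OF inv]]])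
  show "URI p \<in> terms_of G \<union> res_terms"
  proof (cases "p \<in> reserved")
    case False
    then have "URI p \<in> prop_terms G" by (rule mp[OF conjunct1[OF conjunct2[OF conjunct2[OF inv]]]])
    then show ?thesis using prop_terms_sub by (rule UnI1[OF subsetD, rotated])
  qed (rule UnI2, rule imageI)
qed

section \<open>Soundness of the closure rules\<close>

lemma typing_cond_dom:
  assumes ty: "typing_cond I" and h: "(p, c) \<in> pext_of I Dom"
  shows "p \<in> Prop I" "c \<in> Cls I" "(x, y) \<in> PExt I p \<Longrightarrow> (x, c) \<in> pext_of I Type"
proof -
  have *: "\<forall>(p, c)\<in>pext_of I Dom. p \<in> Prop I \<and> c \<in> Cls I \<and> (\<forall>(x, y)\<in>PExt I p. x \<in> CExt I c)"
    using ty[unfolded typing_cond_def] by (rule conjunct1[OF conjunct2[OF conjunct2]])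
  have i: "p \<in> Prop I \<and> c \<in> Cls I \<and> (\<forall>(x, y)\<in>PExt I p. x \<in> CExt I c)"
    using bspec[OF * h] by (rule case_prodD)
  then show "p \<in> Prop I" "c \<in> Cls I" by blast+
  have "\<forall>c\<in>Cls I. \<forall>x. x \<in> CExt I c \<longleftrightarrow> (x, c) \<in> pext_of I Type"
    using ty[unfolded typing_cond_def] by (rule conjunct1)
  with i show "(x, y) \<in> PExt I p \<Longrightarrow> (x, c) \<in> pext_of I Type" by blast
qed

lemma typing_cond_range:
  assumes ty: "typing_cond I" and h: "(p, c) \<in> pext_of I Range"
  shows "p \<in> Prop I" "c \<in> Cls I" "(x, y) \<in> PExt I p \<Longrightarrow> (y, c) \<in> pext_of I Type"
proof -
  have *: "\<forall>(p, c)\<in>pext_of I Range. p \<in> Prop I \<and> c \<in> Cls I \<and> (\<forall>(x, y)\<in>PExt I p. y \<in> CExt I c)"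
    using ty[unfolded typing_cond_def] by (rule conjunct2[OF conjunct2[OF conjunct2]])
  have i: "p \<in> Prop I \<and> c \<in> Cls I \<and> (\<forall>(x, y)\<in>PExt I p. y \<in> CExt I c)"
    using bspec[OF * h] by (rule case_prodD)
  then show "p \<in> Prop I" "c \<in> Cls I" by blast+
  have "\<forall>c\<in>Cls I. \<forall>x. x \<in> CExt I c \<longleftrightarrow> (x, c) \<in> pext_of I Type"
    using ty[unfolded typing_cond_def] by (rule conjunct1)
  with i show "(x, y) \<in> PExt I p \<Longrightarrow> (y, c) \<in> pext_of I Type" by blast
qed

fun holds :: "('u, 'b, 'l) interp \<Rightarrow> ('b \<Rightarrow> 'l elem) \<Rightarrow> ('u, 'b, 'l) triple \<Rightarrow> bool" where
  "holds I \<alpha> (s, p, o') \<longleftrightarrow>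
     den I (URI p) \<in> Prop I \<and> (eval_term I \<alpha> s, eval_term I \<alpha> o') \<in> pext_of I p"

text \<open>The assignment of the blank nodes stays fixed, and each rule mirrors a condition on
  interpretations under the denotations of its terms. \<open>r8a\<close> and \<open>r8b\<close>
  combine the inclusion of a subproperty with the condition on domain or range.\<close>

lemma Cl_B_sound:
  assumes "is_model V I G" "simple_cond I \<alpha> G" "t \<in> Cl_B G"
  shows "holds I \<alpha> t"
proof -
  have sp: "subproperty_cond I" and sc: "subclass_cond I" and ty: "typing_cond I"
    and bc: "class_disj_cond I" and bp: "prop_disj_cond I"
    using assms(1) by (simp_all add: is_model_def)
  have res: "den I (URI e) \<in> Prop I" if "e \<in> {Sp, Sc, Type, Dom, Range, BotC, BotP}" for e
    using assms(2) that unfolding simple_cond_def reserved_def by blast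
  have G: "holds I \<alpha> t" if "t \<in> G" for t
    using that assms(2) by (cases t) (auto simp: simple_cond_def)
  have spD: "p \<in> Prop I" "q \<in> Prop I" "PExt I p \<subseteq> PExt I q" if "(p, q) \<in> pext_of I Sp" for p q
    using sp that by (auto simp: subproperty_cond_def)
  have spT: "(p, r) \<in> pext_of I Sp" if "(p, q) \<in> pext_of I Sp" "(q, r) \<in> pext_of I Sp" for p q r
    using sp that spD unfolding subproperty_cond_def by (meson trans_onD)
  have scD: "c \<in> Cls I" "d \<in> Cls I" "CExt I c \<subseteq> CExt I d" if "(c, d) \<in> pext_of I Sc" for c d
    using sc that by (auto simp: subclass_cond_def)
  have scT: "(c, e) \<in> pext_of I Sc" if "(c, d) \<in> pext_of I Sc" "(d, e) \<in> pext_of I Sc" for c d e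
    using sc that scD unfolding subclass_cond_def by (meson trans_onD)
  have tyD: "c \<in> Cls I" if "(x, c) \<in> pext_of I Type" for x c
    using ty that by (auto simp: typing_cond_def)
  have ty_iff: "x \<in> CExt I c \<longleftrightarrow> (x, c) \<in> pext_of I Type" if "c \<in> Cls I" for x c
    using ty that by (auto simp: typing_cond_def)
  have scTy: "(x, d) \<in> pext_of I Type" if "(c, d) \<in> pext_of I Sc" "(x, c) \<in> pext_of I Type" for x c d
    using scD[OF that(1)] that(2) ty_iff by blast
  note domD = typing_cond_dom[OF ty] and rangeD = typing_cond_range[OF ty]
  note bc' = bc[unfolded class_disj_cond_def] and bp' = bp[unfolded prop_disj_cond_def]
  have bcD: "p \<in> Cls I" "q \<in> Cls I" "(q, p) \<in> pext_of I BotC" if "(p, q) \<in> pext_of I BotC" for p q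
    using subsetD[OF conjunct1[OF bc'] that] symD[OF conjunct1[OF conjunct2[OF bc']] that] by simp_all
  have bpD: "p \<in> Prop I" "q \<in> Prop I" "(q, p) \<in> pext_of I BotP" if "(p, q) \<in> pext_of I BotP" for p q
    using subsetD[OF conjunct1[OF bp'] that] symD[OF conjunct1[OF conjunct2[OF bp']] that] by simp_all
  have cls: "eval_term I \<alpha> c \<in> Cls I" if "c \<in> class_terms G" for c
    using that unfolding class_terms_def
    by (auto dest!: G dest: scD(1,2) tyD domD(2) rangeD(2) bcD(1,2))
  have props: "eval_term I \<alpha> p \<in> Prop I" if "p \<in> prop_terms G" for p
    using that unfolding prop_terms_def
  proof (elim UnE CollectE exE conjE)
    fix q s o' assume "p = URI q" "(s, q, o') \<in> G"
    then show ?thesis using G[of "(s, q, o')"] by simp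
  next
    fix x
    assume "(p, Sp, x) \<in> G \<or> (x, Sp, p) \<in> G \<or> (p, Dom, x) \<in> G \<or> (p, Range, x) \<in> G \<or>
             (p, BotP, x) \<in> G \<or> (x, BotP, p) \<in> G"
    then show ?thesis
      by (auto dest!: G dest: spD(1,2) domD(1) rangeD(1) bpD(1,2))
  qed
  have up: "(x, y) \<in> PExt I b" if "(a, b) \<in> pext_of I Sp" "(x, y) \<in> PExt I a" for x y a b
    using spD(3)[OF that(1)] that(2) by blast
  from assms(3) show ?thesis
  proof induction
    case (base t)
    then show ?case by (rule G)
  next
    case (r2a A B C)
    then show ?case unfolding holds.simps by (meson spT)
  next
    case (r2b D E X Y)
    then have "(den I (URI D), den I (URI E)) \<in> pext_of I Sp" "(eval_term I \<alpha> X, eval_term I \<alpha> Y) \<in> PExt I (den I (URI D))"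
      by (simp_all add: pext_of_def)
    from up[OF this] spD(2)[OF this(1)] show ?case by (simp add: pext_of_def)
  next
    case (r3a A B C)
    then show ?case unfolding holds.simps by (meson scT)
  next
    case (r3b A B X)
    then show ?case unfolding holds.simps by (meson scTy)
  next
    case (r4a D B X Y)
    then have "(den I (URI D), eval_term I \<alpha> B) \<in> pext_of I Dom" "(eval_term I \<alpha> X, eval_term I \<alpha> Y) \<in> PExt I (den I (URI D))"
      by (simp_all add: pext_of_def)
    from domD(3)[OF this] show ?case by (simp add: res)
  next
    case (r4b D B X Y)
    then have "(den I (URI D), eval_term I \<alpha> B) \<in> pext_of I Range" "(eval_term I \<alpha> X, eval_term I \<alpha> Y) \<in> PExt I (den I (URI D))"
      by (simp_all add: pext_of_def)
    from rangeD(3)[OF this] show ?case by (simp add: res)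
  next
    case (r5a A B)
    then show ?case unfolding holds.simps by (meson bcD(3))
  next
    case (r5b A B C)
    then show ?case unfolding holds.simps using bc' by meson
  next
    case (r5c A B)
    then show ?case unfolding holds.simps using bc' cls by meson
  next
    case (r6a A B)
    then show ?case unfolding holds.simps by (meson bpD(3))
  next
    case (r6b A B C)
    then show ?case unfolding holds.simps using bp' by meson
  next
    case (r6c A B)
    then show ?case unfolding holds.simps using bp' props by meson
  next
    case (r7a A C B D)
    then show ?case unfolding holds.simps using bp' res by (meson insertCI)
  next
    case (r7b A C B D)
    then show ?case unfolding holds.simps using bp' res by (meson insertCI)
  next
    case (r8a A B D X Y)
    then have "(den I (URI D), eval_term I \<alpha> A) \<in> pext_of I Sp" "(eval_term I \<alpha> X, eval_term I \<alpha> Y) \<in> PExt I (den I (URI D))"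
      by (simp_all add: pext_of_def)
    from domD(3)[OF _ up[OF this]] r8a show ?case by (simp add: res)
  next
    case (r8b A B D X Y)
    then have "(den I (URI D), eval_term I \<alpha> A) \<in> pext_of I Sp" "(eval_term I \<alpha> X, eval_term I \<alpha> Y) \<in> PExt I (den I (URI D))"
      by (simp_all add: pext_of_def)
    from rangeD(3)[OF _ up[OF this]] r8b show ?case by (simp add: res)
  qed
qed

lemma eval_map_blank:
  "(\<And>b. t = BNode b \<Longrightarrow> \<beta> b = eval_term I \<alpha> (\<mu> b)) \<Longrightarrow> eval_term I \<beta> t = eval_term I \<alpha> (map_blank \<mu> t)"
  by (cases t) auto

lemma hom_entails:
  assumes "is_graph G" "map_triple \<mu> ` H \<subseteq> Cl_B G"
  shows "entails G H"
  unfolding entails_def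
proof (intro allI impI)
  fix V I assume m: "is_model V I G"
  then obtain \<alpha> where \<alpha>: "range \<alpha> \<subseteq> Res I" "simple_cond I \<alpha> G" by (auto simp: is_model_def)
  \<comment> \<open>A blank node of \<open>H\<close> gets a resource, as it occurs in a pair of some
    property extension. For other blank nodes the value may lie outside \<open>Res\<close>, and
    \<open>\<alpha>\<close> steps in.\<close>
  define \<beta> where "\<beta> b = (if eval_term I \<alpha> (\<mu> b) \<in> Res I then eval_term I \<alpha> (\<mu> b) else \<alpha> b)" for b
  have V: "URI ` reserved \<union> uni G \<subseteq> V" and I: "is_interp V I" using m by (auto simp: is_model_def)
  have sound: "den I (URI p) \<in> Prop I" "(eval_term I \<beta> s, eval_term I \<beta> o') \<in> pext_of I p"
    if "(s, p, o') \<in> H" for s p o'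
  proof -
    have "(map_blank \<mu> s, p, map_blank \<mu> o') \<in> Cl_B G" using that assms(2) by force
    from Cl_B_sound[OF m \<alpha>(2) this]
    have p: "den I (URI p) \<in> Prop I" "(eval_term I \<alpha> (map_blank \<mu> s), eval_term I \<alpha> (map_blank \<mu> o')) \<in> pext_of I p" by auto
    then have "eval_term I \<alpha> (map_blank \<mu> s) \<in> Res I" "eval_term I \<alpha> (map_blank \<mu> o') \<in> Res I"
      using I by (auto simp: is_interp_def pext_of_def)
    then have "eval_term I \<beta> s = eval_term I \<alpha> (map_blank \<mu> s)" "eval_term I \<beta> o' = eval_term I \<alpha> (map_blank \<mu> o')"
      by (auto intro!: eval_map_blank simp: \<beta>_def)
    with p show "den I (URI p) \<in> Prop I" "(eval_term I \<beta> s, eval_term I \<beta> o') \<in> pext_of I p" by auto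
  qed
  have "uni H \<subseteq> V"
  proof
    fix t assume "t \<in> uni H"
    then obtain s p o' where h: "(s, p, o') \<in> H" "t \<in> {s, URI p, o'}" "t \<in> UL"
      by (auto simp: uni_def terms_of_def)
    have "(map_blank \<mu> s, p, map_blank \<mu> o') \<in> Cl_B G" using h assms(2) by force
    note uni_Cl_B[OF assms(1) this]
    moreover have "map_blank \<mu> t = t" using h(3) by (auto simp: UL_def)
    ultimately have "t \<in> terms_of G \<union> res_terms" using h(2) by auto
    then show "t \<in> V" using V h(3) by (auto simp: uni_def)
  qed
  moreover have "simple_cond I \<beta> H" using sound \<alpha>(2) by (auto simp: simple_cond_def)
  moreover have "range \<beta> \<subseteq> Res I" using \<alpha>(1) by (auto simp: \<beta>_def)
  ultimately show "is_model V I H" using m by (auto simp: is_model_def)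
qed

lemma Cl_B_graph:
  assumes "is_graph G" "(s, p, o') \<in> Cl_B G"
  shows "s \<in> terms_of G" "o' \<in> terms_of G" "s \<notin> res_terms" "o' \<notin> res_terms"
    "p \<notin> reserved \<Longrightarrow> URI p \<in> prop_terms G"
    "p = Sp \<or> p = BotP \<Longrightarrow> s \<in> prop_terms G \<and> o' \<in> prop_terms G"
    "p = Dom \<or> p = Range \<Longrightarrow> s \<in> prop_terms G \<and> o' \<in> class_terms G"
    "p = Sc \<or> p = BotC \<Longrightarrow> s \<in> class_terms G \<and> o' \<in> class_terms G"
    "p = Type \<Longrightarrow> o' \<in> class_terms G"
proof -
  note i1 = Cl_B_invariant[OF assms, unfolded prod.case]
  note i2 = conjunct2[OF i1] note i3 = conjunct2[OF i2] note i4 = conjunct2[OF i3]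
  note i5 = conjunct2[OF i4] note i6 = conjunct2[OF i5]
  show "s \<in> terms_of G" by (rule DiffD1[OF conjunct1[OF i1]])
  show "s \<notin> res_terms" by (rule notI, rule DiffD2[OF conjunct1[OF i1]])
  show "o' \<in> terms_of G" by (rule DiffD1[OF conjunct1[OF i2]])
  show "o' \<notin> res_terms" by (rule notI, rule DiffD2[OF conjunct1[OF i2]])
  show "p \<notin> reserved \<Longrightarrow> URI p \<in> prop_terms G" by (rule mp[OF conjunct1[OF i3]])
  show "p = Sp \<or> p = BotP \<Longrightarrow> s \<in> prop_terms G \<and> o' \<in> prop_terms G" by (rule mp[OF conjunct1[OF i4]])
  show "p = Dom \<or> p = Range \<Longrightarrow> s \<in> prop_terms G \<and> o' \<in> class_terms G" by (rule mp[OF conjunct1[OF i5]])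
  show "p = Sc \<or> p = BotC \<Longrightarrow> s \<in> class_terms G \<and> o' \<in> class_terms G" by (rule mp[OF conjunct1[OF i6]])
  show "p = Type \<Longrightarrow> o' \<in> class_terms G" by (rule mp[OF conjunct2[OF i6]])
qed

section \<open>The canonical model of a graph\<close>

lemma finite_terms_of: "finite G \<Longrightarrow> finite (terms_of G)"
  by (auto simp: terms_of_def)

text \<open>The domain consists of (names of) the terms of the graph. A blank node or literal \<open>a\<close> that is
  used as a property relates whatever its derived subproperties relate. In addition, a self-disjoint
  property has to be disjoint from the reserved names as well, which is never expressed by a triple.\<close>

locale canonical_model =
  fixes G :: "('u, 'b, 'l) triples" and f :: "('u, 'b, 'l) rdf_term \<Rightarrow> 'l elem"
  assumes G: "is_graph G"
    and inj: "inj_on f (terms_of G \<union> res_terms)"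
    and lit: "\<And>l. f (Lit l) = ELit l"
begin

definition T :: "('u, 'b, 'l) rdf_term set" where "T = terms_of G \<union> res_terms"

definition PT :: "('u, 'b, 'l) rdf_term set" where "PT = prop_terms G \<union> res_terms"

text \<open>\<open>Cls\<close> has to be non-empty. If no term is used as a class, a reserved name
  stands in; its class extension is empty, since it is the object of no closure triple.\<close>

definition CT :: "('u, 'b, 'l) rdf_term set" where
  "CT = (if class_terms G = {} then {URI Sp} else class_terms G)"

definition Q :: "('u, 'b, 'l) rdf_term \<Rightarrow> (('u, 'b, 'l) rdf_term \<times> ('u, 'b, 'l) rdf_term) set" where
  "Q t = {(a, b). \<exists>q. (t = URI q \<or> (URI q, Sp, t) \<in> Cl_B G) \<and> (a, q, b) \<in> Cl_B G} \<union>
     {(a, b). t = URI BotP \<and> a \<in> PT \<and> b \<in> PT \<and> ((a, BotP, a) \<in> Cl_B G \<or> (b, BotP, b) \<in> Cl_B G)}"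

definition M :: "('u, 'b, 'l) interp" where
  "M = \<lparr>Res = f ` T, Prop = f ` PT, Cls = f ` CT, Lits = f ` T,
     PExt = (\<lambda>e. {(f a, f b) | a b t. t \<in> T \<and> f t = e \<and> (a, b) \<in> Q t}),
     CExt = (\<lambda>e. {f a | a c. c \<in> CT \<and> f c = e \<and> (a, Type, c) \<in> Cl_B G}), den = f\<rparr>"

lemmas Cl = Cl_B_graph[OF G]

lemma sub: "PT \<subseteq> T" "CT \<subseteq> T" "res_terms \<subseteq> PT" "URI ` reserved \<subseteq> T"
  using prop_terms_sub[of G] class_terms_sub[of G] by (auto simp: PT_def CT_def T_def reserved_def)

lemma f_eq: "a \<in> T \<Longrightarrow> b \<in> T \<Longrightarrow> f a = f b \<longleftrightarrow> a = b"
  using inj unfolding T_def by (meson inj_onD)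

lemma finite_T: "finite T"
  using G finite_terms_of[of G] by (auto simp: T_def is_graph_def reserved_def)

lemma Cl_T: "(a, q, b) \<in> Cl_B G \<Longrightarrow> a \<in> T \<and> b \<in> T"
  using Cl(1,2) by (auto simp: T_def)

lemma Q_T: "(a, b) \<in> Q t \<Longrightarrow> a \<in> T \<and> b \<in> T"
  using Cl_T sub unfolding Q_def by blast

lemma PExt_M: "t \<in> T \<Longrightarrow> (x, y) \<in> PExt M (f t) \<longleftrightarrow> (\<exists>a b. x = f a \<and> y = f b \<and> (a, b) \<in> Q t)"
proof -
  assume t: "t \<in> T"
  have "(x, y) \<in> PExt M (f t) \<longleftrightarrow> (\<exists>a b t'. x = f a \<and> y = f b \<and> t' \<in> T \<and> f t' = f t \<and> (a, b) \<in> Q t')"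
    by (simp add: M_def)
  then show ?thesis using f_eq[OF _ t] t by (metis (no_types))
qed

lemma den_M: "den M = f"
  by (simp add: M_def)

lemma pext_M: "e \<in> reserved \<Longrightarrow> (x, y) \<in> pext_of M e \<longleftrightarrow> (\<exists>a b. x = f a \<and> y = f b \<and> (a, b) \<in> Q (URI e))"
proof -
  assume "e \<in> reserved"
  then have "URI e \<in> T" using sub(4) by blast
  then show ?thesis unfolding pext_of_def den_M by (rule PExt_M)
qed

text \<open>\<open>r2b\<close> already lifts triples from a subproperty to a reference, so reading
  off the derived subproperties adds pairs only for blank nodes and literals.\<close>

lemma Q_URI: "q \<noteq> BotP \<Longrightarrow> (a, b) \<in> Q (URI q) \<longleftrightarrow> (a, q, b) \<in> Cl_B G"
  unfolding Q_def by (auto intro: Cl_B.r2b)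

lemma Q_BotP: "(a, b) \<in> Q (URI BotP) \<longleftrightarrow> (a, BotP, b) \<in> Cl_B G \<or>
    a \<in> PT \<and> b \<in> PT \<and> ((a, BotP, a) \<in> Cl_B G \<or> (b, BotP, b) \<in> Cl_B G)"
  unfolding Q_def by (auto intro: Cl_B.r2b)

lemma pext:
  "(x, y) \<in> pext_of M Sp \<longleftrightarrow> (\<exists>a b. x = f a \<and> y = f b \<and> (a, Sp, b) \<in> Cl_B G)"
  "(x, y) \<in> pext_of M Sc \<longleftrightarrow> (\<exists>a b. x = f a \<and> y = f b \<and> (a, Sc, b) \<in> Cl_B G)"
  "(x, y) \<in> pext_of M Type \<longleftrightarrow> (\<exists>a b. x = f a \<and> y = f b \<and> (a, Type, b) \<in> Cl_B G)"
  "(x, y) \<in> pext_of M Dom \<longleftrightarrow> (\<exists>a b. x = f a \<and> y = f b \<and> (a, Dom, b) \<in> Cl_B G)"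
  "(x, y) \<in> pext_of M Range \<longleftrightarrow> (\<exists>a b. x = f a \<and> y = f b \<and> (a, Range, b) \<in> Cl_B G)"
  "(x, y) \<in> pext_of M BotC \<longleftrightarrow> (\<exists>a b. x = f a \<and> y = f b \<and> (a, BotC, b) \<in> Cl_B G)"
  "(x, y) \<in> pext_of M BotP \<longleftrightarrow> (\<exists>a b. x = f a \<and> y = f b \<and> (a, b) \<in> Q (URI BotP))"
  by (simp_all add: pext_M reserved_def Q_URI)

text \<open>Reserved names are never subjects in the closure, so the additional pairs of
  \<open>BotP\<close> need not be inherited by anything; for the other pairs \<open>r2a\<close>
  suffices.\<close>

lemma Q_mono: "(a, Sp, b) \<in> Cl_B G \<Longrightarrow> Q a \<subseteq> Q b"
proof -
  assume ab: "(a, Sp, b) \<in> Cl_B G"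
  then have "a \<noteq> URI BotP" using Cl(3)[OF ab] by (auto simp: reserved_def)
  show ?thesis
  proof
    fix z assume "z \<in> Q a"
    then obtain x y q where z: "z = (x, y)" "a = URI q \<or> (URI q, Sp, a) \<in> Cl_B G" "(x, q, y) \<in> Cl_B G"
      using \<open>a \<noteq> URI BotP\<close> unfolding Q_def by blast
    then have "(URI q, Sp, b) \<in> Cl_B G" using ab Cl_B.r2a by blast
    then show "z \<in> Q b" using z unfolding Q_def by blast
  qed
qed

text \<open>A blank node or literal \<open>t\<close> cannot be the predicate in (4a) or (4b). Its
  pairs come from a reference below it, and \<open>r8a\<close> and \<open>r8b\<close> type exactly
  those.\<close>

lemma Q_typing:
  assumes "(a, b) \<in> Q t"
  shows "(t, Dom, c) \<in> Cl_B G \<Longrightarrow> (a, Type, c) \<in> Cl_B G" "(t, Range, c) \<in> Cl_B G \<Longrightarrow> (b, Type, c) \<in> Cl_B G"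
proof -
  have *: "\<exists>q. (t = URI q \<or> (URI q, Sp, t) \<in> Cl_B G) \<and> (a, q, b) \<in> Cl_B G" if "t \<noteq> URI BotP"
    using assms that unfolding Q_def by blast
  show "(a, Type, c) \<in> Cl_B G" if "(t, Dom, c) \<in> Cl_B G"
  proof -
    have "t \<noteq> URI BotP" using Cl(3)[OF that] by (auto simp: reserved_def)
    then obtain q where "t = URI q \<or> (URI q, Sp, t) \<in> Cl_B G" "(a, q, b) \<in> Cl_B G" using * by blast
    then show ?thesis using that Cl_B.r4a Cl_B.r8a by metis
  qed
  show "(b, Type, c) \<in> Cl_B G" if "(t, Range, c) \<in> Cl_B G"
  proof -
    have "t \<noteq> URI BotP" using Cl(3)[OF that] by (auto simp: reserved_def)
    then obtain q where "t = URI q \<or> (URI q, Sp, t) \<in> Cl_B G" "(a, q, b) \<in> Cl_B G" using * by blast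
    then show ?thesis using that Cl_B.r4b Cl_B.r8b by metis
  qed
qed

lemma CExt_M: "c \<in> CT \<Longrightarrow> x \<in> CExt M (f c) \<longleftrightarrow> (\<exists>a. x = f a \<and> (a, Type, c) \<in> Cl_B G)"
proof -
  assume c: "c \<in> CT"
  have "x \<in> CExt M (f c) \<longleftrightarrow> (\<exists>a c'. x = f a \<and> c' \<in> CT \<and> f c' = f c \<and> (a, Type, c') \<in> Cl_B G)"
    by (simp add: M_def)
  moreover have "f c' = f c \<longleftrightarrow> c' = c" if "c' \<in> CT" for c' using f_eq sub(2) c that by blast
  ultimately show ?thesis using c by metis
qed

lemma class_CT: "c \<in> class_terms G \<Longrightarrow> c \<in> CT"
  by (auto simp: CT_def)

lemma CT_class: "(a, BotC, b) \<in> Cl_B G \<Longrightarrow> c \<in> CT \<Longrightarrow> c \<in> class_terms G"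
  using Cl(8)[of a BotC b] by (auto simp: CT_def split: if_splits)

lemma class_terms_triple: "c \<in> class_terms G \<Longrightarrow> c \<notin> res_terms"
  using G unfolding is_graph_def class_terms_def by fastforce

lemma BotP_Q:
  assumes "(a, b) \<in> Q (URI BotP)"
  shows "a \<in> PT" "b \<in> PT" "(b, a) \<in> Q (URI BotP)" "(c, Sp, a) \<in> Cl_B G \<Longrightarrow> (c, b) \<in> Q (URI BotP)"
    "a = b \<Longrightarrow> c \<in> PT \<Longrightarrow> (a, c) \<in> Q (URI BotP)"
proof -
  show P: "a \<in> PT" "b \<in> PT" using assms Cl(6)[of a BotP b] by (auto simp: Q_BotP PT_def)
  show "(b, a) \<in> Q (URI BotP)" using assms Cl_B.r6a unfolding Q_BotP by blast
  show "(a, c) \<in> Q (URI BotP)" if "a = b" "c \<in> PT"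
    using assms that P unfolding Q_BotP by blast
  show "(c, b) \<in> Q (URI BotP)" if c: "(c, Sp, a) \<in> Cl_B G"
  proof (cases "(a, BotP, a) \<in> Cl_B G")
    case True
    \<comment> \<open>A subproperty of a self-disjoint property is itself self-disjoint and thus
      acquires all additional pairs.\<close>
    then have "(c, BotP, a) \<in> Cl_B G" using c by (rule Cl_B.r6b)
    then have "(a, BotP, c) \<in> Cl_B G" by (rule Cl_B.r6a)
    then have "(c, BotP, c) \<in> Cl_B G" using c by (rule Cl_B.r6b)
    moreover have "c \<in> PT" using Cl(6)[OF c] by (simp add: PT_def)
    ultimately show ?thesis using P by (simp add: Q_BotP)
  next
    case False
    moreover have "c \<in> PT" using Cl(6)[OF c] by (simp add: PT_def)
    ultimately show ?thesis using assms P c Cl_B.r6b unfolding Q_BotP by blast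
  qed
qed

declare den_M [simp]

lemma M_sel [simp]: "Res M = f ` T" "Prop M = f ` PT" "Cls M = f ` CT" "Lits M = f ` T"
  by (simp_all add: M_def)

lemma is_interp_M: "is_interp (res_terms \<union> uni G) M"
  unfolding is_interp_def M_sel den_M
proof (intro conjI)
  show "res_terms \<union> uni G \<subseteq> UL" by (auto simp: UL_def uni_def)
  show "finite (f ` T)" "finite (f ` PT)" "finite (f ` CT)" "finite (f ` T)"
    using finite_T sub finite_subset by blast+
  show "f ` T \<noteq> {}" "f ` PT \<noteq> {}" "f ` CT \<noteq> {}" "f ` T \<noteq> {}"
    using sub by (auto simp: CT_def PT_def T_def reserved_def)
  show "f ` CT \<subseteq> f ` T" using sub by blast
  have T: "res_terms \<union> uni G \<subseteq> T" by (auto simp: T_def uni_def)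
  then show "\<forall>l. Lit l \<in> res_terms \<union> uni G \<longrightarrow> ELit l \<in> f ` T" by (metis imageI lit subsetD)
  show "\<forall>t\<in>res_terms \<union> uni G. f t \<in> f ` T \<union> f ` PT" using T by blast
  show "\<forall>l. Lit (Plain l) \<in> res_terms \<union> uni G \<longrightarrow> f (Lit (Plain l)) = ELit (Plain l)" by (simp add: lit)
  show "\<forall>l. Lit l \<in> res_terms \<union> uni G \<longrightarrow> f (Lit l) \<in> f ` T" using T by blast
  show "\<forall>p\<in>f ` PT. PExt M p \<subseteq> f ` T \<times> f ` T" using Q_T by (auto simp: M_def)
  show "\<forall>c\<in>f ` CT. CExt M c \<subseteq> f ` T" using Cl_T by (auto simp: M_def)
qed simp

lemma f_Cl_eq:
  assumes "(a, p, b) \<in> Cl_B G" "(c, q, d) \<in> Cl_B G"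
  shows "f a = f c \<longleftrightarrow> a = c" "f a = f d \<longleftrightarrow> a = d" "f b = f c \<longleftrightarrow> b = c" "f b = f d \<longleftrightarrow> b = d"
  using Cl_T[OF assms(1)] Cl_T[OF assms(2)] f_eq by auto

lemma subproperty_M: "subproperty_cond M"
proof -
  have "(x, z) \<in> pext_of M Sp" if "(x, y) \<in> pext_of M Sp" "(y, z) \<in> pext_of M Sp" for x y z
    using that f_Cl_eq(3) unfolding pext by (metis Cl_B.r2a)
  moreover have "p \<in> Prop M \<and> q \<in> Prop M \<and> PExt M p \<subseteq> PExt M q" if pq: "(p, q) \<in> pext_of M Sp" for p q
  proof -
    obtain a b where ab: "p = f a" "q = f b" "(a, Sp, b) \<in> Cl_B G" using pq unfolding pext by blast
    have "PExt M p \<subseteq> PExt M q"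
      using Q_mono[OF ab(3)] Cl_T[OF ab(3)] unfolding ab(1,2) by (force simp: PExt_M)
    then show ?thesis using ab Cl(6)[OF ab(3)] by (auto simp: PT_def)
  qed
  ultimately show ?thesis unfolding subproperty_cond_def trans_on_def by blast
qed

lemma subclass_M: "subclass_cond M"
proof -
  have "(x, z) \<in> pext_of M Sc" if "(x, y) \<in> pext_of M Sc" "(y, z) \<in> pext_of M Sc" for x y z
    using that f_Cl_eq(3) unfolding pext by (metis Cl_B.r3a)
  moreover have "p \<in> Cls M \<and> q \<in> Cls M \<and> CExt M p \<subseteq> CExt M q" if pq: "(p, q) \<in> pext_of M Sc" for p q
  proof -
    obtain a b where ab: "p = f a" "q = f b" "(a, Sc, b) \<in> Cl_B G" using pq unfolding pext by blast
    then have c: "a \<in> CT" "b \<in> CT" using Cl(8)[OF ab(3)] class_CT by auto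
    have "CExt M p \<subseteq> CExt M q"
      using Cl_B.r3b[OF ab(3)] CExt_M[OF c(1)] CExt_M[OF c(2)] unfolding ab(1,2) by blast
    then show ?thesis using ab c by auto
  qed
  ultimately show ?thesis unfolding subclass_cond_def trans_on_def by blast
qed

lemma typing_M: "typing_cond M"
  unfolding typing_cond_def
proof (intro conjI ballI allI, goal_cases)
  case (1 c x)
  then obtain c' where c: "c = f c'" "c' \<in> CT" by auto
  have "c'' = c'" if "f c' = f c''" "(a, Type, c'') \<in> Cl_B G" for a c''
    using that f_eq sub(2) c(2) Cl_T[OF that(2)] by blast
  then show ?case using c unfolding pext c(1) CExt_M[OF c(2)] by blast
next
  case (2 z)
  obtain x c where "z = (x, c)" by fastforce
  then show ?case using 2 Cl(9) class_CT by (fastforce simp: pext)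
next
  case (3 z)
  obtain p c where z: "z = (p, c)" by fastforce
  then obtain a b where ab: "p = f a" "c = f b" "(a, Dom, b) \<in> Cl_B G" using 3[unfolded z] unfolding pext by blast
  have b: "b \<in> CT" "a \<in> PT" using Cl(7)[OF ab(3)] class_CT by (auto simp: PT_def)
  have "x \<in> CExt M (f b)" if "(x, y) \<in> PExt M (f a)" for x y
    using that Q_typing(1)[OF _ ab(3)] Cl_T[OF ab(3)] by (auto simp: PExt_M CExt_M[OF b(1)])
  then show ?case using z ab b by auto
next
  case (4 z)
  obtain p c where z: "z = (p, c)" by fastforce
  then obtain a b where ab: "p = f a" "c = f b" "(a, Range, b) \<in> Cl_B G" using 4[unfolded z] unfolding pext by blast
  have b: "b \<in> CT" "a \<in> PT" using Cl(7)[OF ab(3)] class_CT by (auto simp: PT_def)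
  have "y \<in> CExt M (f b)" if "(x, y) \<in> PExt M (f a)" for x y
    using that Q_typing(2)[OF _ ab(3)] Cl_T[OF ab(3)] by (auto simp: PExt_M CExt_M[OF b(1)])
  then show ?case using z ab b by auto
qed

lemma class_disj_M: "class_disj_cond M"
proof -
  have 1: "x \<in> Cls M \<and> y \<in> Cls M \<and> (y, x) \<in> pext_of M BotC" if "(x, y) \<in> pext_of M BotC" for x y
    using that Cl(8) class_CT Cl_B.r5a unfolding pext by fastforce
  have 2: "(e, d) \<in> pext_of M BotC" if "(c, d) \<in> pext_of M BotC" "(e, c) \<in> pext_of M Sc" for c d e
    using that f_Cl_eq(2) unfolding pext by (metis Cl_B.r5b)
  have 3: "(c, d) \<in> pext_of M BotC" if cc: "(c, c) \<in> pext_of M BotC" and d: "d \<in> Cls M" for c d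
  proof -
    obtain a b where ab: "c = f a" "c = f b" "(a, BotC, b) \<in> Cl_B G" using cc unfolding pext by blast
    then have "a = b" using f_Cl_eq(2)[OF ab(3) ab(3)] by simp
    obtain d' where d': "d = f d'" "d' \<in> class_terms G" using d CT_class[OF ab(3)] by auto
    have "(a, BotC, d') \<in> Cl_B G"
      using Cl_B.r5c[OF ab(3)[folded \<open>a = b\<close>] d'(2)] Cl(3)[OF ab(3)] class_terms_triple[OF d'(2)] by simp
    then show ?thesis using ab d' unfolding pext by blast
  qed
  show ?thesis unfolding class_disj_cond_def sym_def
    by (intro conjI allI impI subrelI; (elim conjE)?) (use 1 in blast, use 1 in blast, use 2 in blast, use 3 in blast)
qed

lemma prop_disj_M: "prop_disj_cond M"
proof -
  have 1: "x \<in> Prop M \<and> y \<in> Prop M \<and> (y, x) \<in> pext_of M BotP" if "(x, y) \<in> pext_of M BotP" for x y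
    using that BotP_Q(1-3) unfolding pext by fastforce
  have 2: "(e, d) \<in> pext_of M BotP" if cd: "(c, d) \<in> pext_of M BotP" and ec: "(e, c) \<in> pext_of M Sp" for c d e
  proof -
    obtain a b where ab: "c = f a" "d = f b" "(a, b) \<in> Q (URI BotP)" using cd unfolding pext by blast
    obtain e' a' where e: "e = f e'" "c = f a'" "(e', Sp, a') \<in> Cl_B G" using ec unfolding pext by blast
    have "a = a'" using ab e Q_T[OF ab(3)] Cl_T[OF e(3)] f_eq by metis
    then show ?thesis using BotP_Q(4)[OF ab(3)] e ab unfolding pext by blast
  qed
  have 3: "(c, d) \<in> pext_of M BotP" if cc: "(c, c) \<in> pext_of M BotP" and d: "d \<in> Prop M" for c d
  proof -
    obtain a b where ab: "c = f a" "c = f b" "(a, b) \<in> Q (URI BotP)" using cc unfolding pext by blast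
    then have "a = b" using f_eq Q_T[OF ab(3)] by metis
    then show ?thesis using BotP_Q(5)[OF ab(3)] d ab pext by auto
  qed
  have 4: "(p, q) \<in> pext_of M BotP"
    if pc: "(p, c) \<in> pext_of M Dom" and qd: "(q, d) \<in> pext_of M Dom" and cd: "(c, d) \<in> pext_of M BotC" for p q c d
  proof -
    obtain a1 c1 where A: "p = f a1" "c = f c1" "(a1, Dom, c1) \<in> Cl_B G" using pc unfolding pext by blast
    obtain a2 d1 where B: "q = f a2" "d = f d1" "(a2, Dom, d1) \<in> Cl_B G" using qd unfolding pext by blast
    obtain c2 d2 where C: "c = f c2" "d = f d2" "(c2, BotC, d2) \<in> Cl_B G" using cd unfolding pext by blast
    have "c2 = c1" "d2 = d1" using A B C f_Cl_eq(3)[OF A(3) C(3)] f_Cl_eq(4)[OF B(3) C(3)] by auto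
    then have "(a1, BotP, a2) \<in> Cl_B G" using A B C Cl_B.r7a by blast
    then show ?thesis using A B by (auto simp: pext Q_BotP)
  qed
  have 5: "(p, q) \<in> pext_of M BotP"
    if pc: "(p, c) \<in> pext_of M Range" and qd: "(q, d) \<in> pext_of M Range" and cd: "(c, d) \<in> pext_of M BotC" for p q c d
  proof -
    obtain a1 c1 where A: "p = f a1" "c = f c1" "(a1, Range, c1) \<in> Cl_B G" using pc unfolding pext by blast
    obtain a2 d1 where B: "q = f a2" "d = f d1" "(a2, Range, d1) \<in> Cl_B G" using qd unfolding pext by blast
    obtain c2 d2 where C: "c = f c2" "d = f d2" "(c2, BotC, d2) \<in> Cl_B G" using cd unfolding pext by blast
    have "c2 = c1" "d2 = d1" using A B C f_Cl_eq(3)[OF A(3) C(3)] f_Cl_eq(4)[OF B(3) C(3)] by auto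
    then have "(a1, BotP, a2) \<in> Cl_B G" using A B C Cl_B.r7b by blast
    then show ?thesis using A B by (auto simp: pext Q_BotP)
  qed
  show ?thesis unfolding prop_disj_cond_def sym_def
    by (intro conjI allI impI subrelI; (elim conjE)?)
      (use 1 in blast, use 1 in blast, use 2 in blast, use 3 in blast, use 4 in blast, use 5 in blast)
qed

lemma is_model_M: "is_model (res_terms \<union> uni G) M G"
proof -
  \<comment> \<open>Blank nodes of the graph denote their own names; the others get some element of
    the domain.\<close>
  define \<alpha> where "\<alpha> b = (if BNode b \<in> T then f (BNode b) else f (URI Sp))" for b
  have "range \<alpha> \<subseteq> Res M" using sub(4) by (auto simp: \<alpha>_def reserved_def)
  moreover have ev: "eval_term M \<alpha> t = f t" if "t \<in> T" for t
    using that by (cases t) (auto simp: \<alpha>_def)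
  have "simple_cond M \<alpha> G"
    unfolding simple_cond_def
  proof (intro conjI ballI)
    fix t assume t: "t \<in> G"
    obtain s p o' where spo: "t = (s, p, o')" by (metis prod_cases3)
    have cl: "(s, p, o') \<in> Cl_B G" using t spo by (auto intro: Cl_B.base)
    have p: "URI p \<in> PT" using t spo by (auto simp: PT_def prop_terms_def)
    then have "(f s, f o') \<in> PExt M (f (URI p))" 
      using PExt_M[of "URI p" "f s" "f o'"] sub(1) cl unfolding Q_def by blast
    then show "case t of (s, p, o') \<Rightarrow> den M (URI p) \<in> Prop M \<and> (eval_term M \<alpha> s, eval_term M \<alpha> o') \<in> pext_of M p"
      using p spo Cl_T[OF cl] by (auto simp: ev pext_of_def)
  qed (use sub(3) in auto)
  ultimately show ?thesis
    unfolding is_model_def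
    using is_interp_M subproperty_M subclass_M typing_M class_disj_M prop_disj_M by blast
qed

text \<open>Pulling the values of the blank nodes back along \<open>f\<close> maps \<open>H\<close>
  into the relations \<open>Q\<close>, which exceed the closure only at \<open>BotP\<close>. An
  additional pair stems from a self-disjoint term. If a component of it is a reserved name, it is
  replaced by \<open>z\<close>, which \<open>r6c\<close> makes disjoint from that term.\<close>

lemma hom_M:
  assumes H: "is_graph H" and m: "is_model (res_terms \<union> uni G) M H"
  shows "\<exists>\<mu>. map_triple \<mu> ` H \<subseteq> Cl_B G"
proof -
  obtain \<beta> where \<beta>: "range \<beta> \<subseteq> f ` T" "simple_cond M \<beta> H" using m by (auto simp: is_model_def)
  have V: "uni H \<subseteq> T" using m by (auto simp: is_model_def T_def uni_def)
  define \<nu> where "\<nu> b = inv_into T f (\<beta> b)" for b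
  have \<nu>: "f (\<nu> b) = \<beta> b" "\<nu> b \<in> T" for b
    using \<beta>(1) unfolding \<nu>_def by (meson f_inv_into_f inv_into_into rangeI subsetD)+
  have ev: "eval_term M \<beta> t = f (map_blank \<nu> t)" for t using \<nu> by (cases t) auto
  have inT: "map_blank \<nu> t \<in> T" if "t \<in> terms_of H" for t
    using that V \<nu> by (cases t) (auto simp: uni_def UL_def)
  have hQ: "(map_blank \<nu> s, map_blank \<nu> o') \<in> Q (URI p)" if "(s, p, o') \<in> H" for s p o'
  proof -
    have p: "URI p \<in> T" using inT[OF terms_ofI(3)[OF that]] by simp
    have "(f (map_blank \<nu> s), f (map_blank \<nu> o')) \<in> PExt M (f (URI p))"
      using that \<beta>(2) ev by (auto simp: simple_cond_def pext_of_def)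
    then obtain a b where "f (map_blank \<nu> s) = f a" "f (map_blank \<nu> o') = f b" "(a, b) \<in> Q (URI p)"
      unfolding PExt_M[OF p] by blast
    then show ?thesis using inT[OF terms_ofI(1)[OF that]] inT[OF terms_ofI(2)[OF that]] Q_T f_eq by metis
  qed
  \<comment> \<open>One choice for all blank nodes keeps the result a single map. A blank node with
    a reserved value occurs in \<open>H\<close> only in triples matched by additional pairs, as
    closure triples have no reserved subject or object.\<close>
  define z where "z = (SOME z. (z, BotP, z) \<in> Cl_B G)"
  define \<mu> where "\<mu> b = (if \<nu> b \<in> res_terms then z else \<nu> b)" for b
  have nres: "map_blank \<mu> t = (if map_blank \<nu> t \<in> res_terms then z else map_blank \<nu> t)" if "t \<notin> res_terms" for t
    using that by (cases t) (auto simp: \<mu>_def)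
  have "map_triple \<mu> t \<in> Cl_B G" if t: "t \<in> H" for t
  proof -
    obtain s p o' where spo: "t = (s, p, o')" by (metis prod_cases3)
    then have n: "s \<notin> res_terms" "o' \<notin> res_terms" using H t by (auto simp: is_graph_def)
    have h: "(map_blank \<nu> s, map_blank \<nu> o') \<in> Q (URI p)" using hQ t spo by simp
    let ?a = "map_blank \<nu> s" and ?b = "map_blank \<nu> o'"
    show ?thesis
    proof (cases "(?a, p, ?b) \<in> Cl_B G")
      case True
      then show ?thesis using Cl(3,4)[OF True] unfolding spo map_triple.simps nres[OF n(1)] nres[OF n(2)]
        by (simp only: if_False)
    next
      case False
      then have p: "p = BotP" using h Q_URI by blast
      from h False have ab: "?a \<in> PT" "?b \<in> PT" "(?a, BotP, ?a) \<in> Cl_B G \<or> (?b, BotP, ?b) \<in> Cl_B G"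
        by (auto simp: p Q_BotP)
      obtain w where "(w, BotP, w) \<in> Cl_B G" using ab(3) by blast
      then have z: "(z, BotP, z) \<in> Cl_B G" unfolding z_def by (rule someI)
      have disj: "(a, BotP, if b \<in> res_terms then z else b) \<in> Cl_B G"
        if a: "(a, BotP, a) \<in> Cl_B G" and b: "b \<in> PT" for a b
      proof (rule Cl_B.r6c[OF a])
        show "(if b \<in> res_terms then z else b) \<in> prop_terms G" using b Cl(6)[OF z] by (auto simp: PT_def)
        show "is_triple (a, BotP, if b \<in> res_terms then z else b)" using Cl(3)[OF a] Cl(3)[OF z] by simp
      qed
      show ?thesis
        using ab(3)
      proof
        assume a: "(?a, BotP, ?a) \<in> Cl_B G"
        show ?thesis using disj[OF a ab(2)] Cl(3)[OF a]
          unfolding spo map_triple.simps nres[OF n(1)] nres[OF n(2)] p by (simp only: if_False)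
      next
        assume b: "(?b, BotP, ?b) \<in> Cl_B G"
        show ?thesis using Cl_B.r6a[OF disj[OF b ab(1)]] Cl(3)[OF b]
          unfolding spo map_triple.simps nres[OF n(1)] nres[OF n(2)] p by (simp only: if_False)
      qed
    qed
  qed
  then show ?thesis by blast
qed

end

theorem entails_iff_hom:
  assumes "is_graph G" "is_graph H"
  shows "entails G H \<longleftrightarrow> (\<exists>\<mu>. map_triple \<mu> ` H \<subseteq> Cl_B G)"
proof
  assume e: "entails G H"
  have "finite (terms_of G \<union> URI ` reserved)"
    using assms(1) finite_terms_of[of G] by (auto simp: is_graph_def reserved_def)
  then obtain g :: "_ \<Rightarrow> nat" where g: "inj_on g (terms_of G \<union> URI ` reserved)"
    using finite_imp_inj_to_nat_seg by metis
  \<comment> \<open>Literals have to be available as elements and plain ones denote themselves; the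
    remaining terms get distinct numbers.\<close>
  define f where "f t = (case t of Lit l \<Rightarrow> ELit l | _ \<Rightarrow> Obj (g t))" for t
  interpret canonical_model G f
    by unfold_locales (use assms(1) g in \<open>auto simp: f_def inj_on_def split: rdf_term.splits\<close>)
  show "\<exists>\<mu>. map_triple \<mu> ` H \<subseteq> Cl_B G"
    using hom_M[OF assms(2)] e is_model_M unfolding entails_def by blast
qed (use assms(1) hom_entails in blast)

corollary entails_ground_iff:
  assumes "is_graph G" "is_graph H" "ground H"
  shows "entails G H \<longleftrightarrow> H \<subseteq> Cl_B G"
proof -
  have "map_triple \<mu> t = t" if "t \<in> H" for t \<mu>
  proof -
    obtain s p o' where t: "t = (s, p, o')" by (metis prod_cases3)
    have "s \<notin> range BNode" "o' \<notin> range BNode"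
      using assms(3) that t terms_ofI[of s p o' H] by (auto simp: ground_def)
    then show ?thesis unfolding t by (cases s; cases o') auto
  qed
  then have "map_triple \<mu> ` H = H" for \<mu> by simp
  then show ?thesis using entails_iff_hom[OF assms(1,2)] by simp
qed

section \<open>The size of the closure\<close>

lemma Cl_B_user_triple:
  fixes G :: "('u, 'b, 'l) triples"
  assumes "is_graph G" "t \<in> Cl_B G"
  shows "case t of (s, p, o') \<Rightarrow> p \<notin> reserved \<longrightarrow> (\<exists>q. (s, q, o') \<in> G)"
  using assms(2)
proof induction
  case (base t)
  then show ?case by (cases t) auto
next
  case (r2b D E X Y)
  have "(URI D :: ('u, 'b, 'l) rdf_term) \<notin> res_terms"
    using Cl_B_invariant[OF assms(1) r2b(1), unfolded prod.case] by (elim conjE DiffE) assumption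
  then have "D \<notin> reserved" by blast
  then show ?case using r2b.IH(2) by simp
qed (simp_all add: reserved_def)

lemma card_terms_of:
  assumes "finite G" shows "card (terms_of G) \<le> 3 * card G"
proof -
  have "card (\<Union>t\<in>G. case t of (s, p, o') \<Rightarrow> {s, URI p, o'}) \<le> (\<Sum>t\<in>G. card (case t of (s, p, o') \<Rightarrow> {s, URI p, o'}))"
    using assms by (rule card_UN_le)
  also have "\<dots> \<le> (\<Sum>t\<in>G. 3)"
  proof (rule sum_mono)
    fix t :: "('a, 'b, 'c) triple"
    obtain s p o' where t: "t = (s, p, o')" by (metis prod_cases3)
    have "card (set [s, URI p, o']) \<le> 3" using card_length[of "[s, URI p, o']"] by simp
    then show "card (case t of (s, p, o') \<Rightarrow> {s, URI p, o'}) \<le> 3" by (simp add: t)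
  qed
  finally show ?thesis by (simp add: terms_of_def mult.commute)
qed

text \<open>With at most \<open>3 * card G\<close> terms there are at most
  \<open>3 * (card G)\<^sup>2\<close> triples with a non-reserved predicate and at most 7 times 9
  times \<open>(card G)\<^sup>2\<close> with one of the seven reserved ones; 66 is 3 + 63.\<close>

lemma card_Cl_B:
  fixes G :: "('u, 'b, 'l) triples"
  assumes "is_graph G"
  shows "finite (Cl_B G)" "card (Cl_B G) \<le> 66 * (card G)\<^sup>2"
proof -
  let ?N = "terms_of G"
  let ?R = "reserved :: 'u uri set"
  \<comment> \<open>Only references among the terms matter as predicates; on the other terms the
    value is unspecified, which an upper bound tolerates.\<close>
  let ?g = "\<lambda>((s, p, o'), t). (s, (case t of URI u \<Rightarrow> u), o')"
  have finG: "finite G" using assms by (simp add: is_graph_def)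
  then have finN: "finite ?N" by (auto simp: terms_of_def)
  have "t \<in> ?g ` (G \<times> ?N) \<union> ?N \<times> ?R \<times> ?N" if tG: "t \<in> Cl_B G" for t
  proof -
    obtain s p o' where t: "t = (s, p, o')" by (metis prod_cases3)
    note T = uni_Cl_B[OF assms tG[unfolded t]]
    show ?thesis
    proof (cases "p \<in> reserved")
      case True
      then show ?thesis using T t by simp
    next
      case False
      then obtain q where q: "(s, q, o') \<in> G" using Cl_B_user_triple[OF assms tG] t by auto
      have "URI p \<in> ?N" using T(3) False by blast
      then show ?thesis using q t by (intro UnI1 image_eqI[of _ _ "((s, q, o'), URI p)"]) auto
    qed
  qed
  then have sub: "Cl_B G \<subseteq> ?g ` (G \<times> ?N) \<union> ?N \<times> ?R \<times> ?N" by blast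
  have finr: "finite (reserved :: 'u uri set)" "card (reserved :: 'u uri set) \<le> 7"
    using card_length[of "[Sp, Sc, Type, Dom, Range, BotC, BotP :: 'u uri]"] by (simp_all add: reserved_def)
  have fin: "finite (?g ` (G \<times> ?N) \<union> ?N \<times> ?R \<times> ?N)" using finG finN finr by simp
  then show "finite (Cl_B G)" using sub finite_subset by blast
  have "card (Cl_B G) \<le> card (?g ` (G \<times> ?N) \<union> ?N \<times> ?R \<times> ?N)" using fin sub by (rule card_mono)
  also have "\<dots> \<le> card (?g ` (G \<times> ?N)) + card (?N \<times> ?R \<times> ?N)" by (rule card_Un_le)
  also have "\<dots> \<le> card G * card ?N + card ?N * (7 * card ?N)"
    using card_image_le[of "G \<times> ?N" ?g] finG finN finr(2)
    by (intro add_mono) (auto simp: card_cartesian_product intro!: mult_le_mono)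
  also have "\<dots> \<le> card G * (3 * card G) + (3 * card G) * (7 * (3 * card G))"
    using card_terms_of[OF finG] by (intro add_mono mult_le_mono) auto
  also have "\<dots> = 66 * (card G)\<^sup>2" by (simp add: power2_eq_square)
  finally show "card (Cl_B G) \<le> 66 * (card G)\<^sup>2" .
qed

section \<open>Entailment is in NP\<close>

lemma enc_tag_inj [simp]: "enc_tag i = enc_tag j \<longleftrightarrow> i = j"
  using enc_tag_prefix[of i "[]" j "[]"] by simp

lemma enc_uri_prefix: "enc_uri u @ v = enc_uri u' @ v' \<longleftrightarrow> u = u' \<and> v = v'"
proof -
  have [simp]: "enc_tag i @ w = enc_tag j \<longleftrightarrow> i = j \<and> w = []" for i j w
    using enc_tag_prefix[of i w j "[]"] by simp
  have [simp]: "enc_tag i = enc_tag j @ w \<longleftrightarrow> i = j \<and> w = []" for i j w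
    using enc_tag_prefix[of i "[]" j w] by simp auto
  show ?thesis
    by (cases u; cases u') (auto simp: enc_tag_prefix enc_name_prefix)
qed

lemma enc_term_prefix: "enc_term t @ v = enc_term t' @ v' \<longleftrightarrow> t = t' \<and> v = v'"
proof -
  have "enc_term t @ v = enc_term t' @ v' \<Longrightarrow> t = t' \<and> v = v'"
    by (cases t rule: enc_term.cases; cases t' rule: enc_term.cases)
      (simp_all add: enc_tag_prefix enc_name_prefix enc_uri_prefix)
  then show ?thesis by auto
qed

lemma enc_triple_prefix: "enc_triple t @ v = enc_triple t' @ v' \<longleftrightarrow> t = t' \<and> v = v'"
  by (cases t; cases t') (auto simp: enc_term_prefix enc_uri_prefix)

lemma enc_uri_inj [simp]: "enc_uri u = enc_uri u' \<longleftrightarrow> u = u'"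
  using enc_uri_prefix[of u "[]" u' "[]"] by simp

lemma enc_term_inj [simp]: "enc_term t = enc_term t' \<longleftrightarrow> t = t'"
  using enc_term_prefix[of t "[]" t' "[]"] by simp

lemma enc_term_URI: "False # w = enc_term t \<longleftrightarrow> (\<exists>u. t = URI u \<and> w = enc_uri u)"
  by (cases t rule: enc_term.cases) (auto simp: enc_tag_def numeral_eq_Suc)

definition enc_triples :: "name_triple list \<Rightarrow> bool list" where
  "enc_triples ts = concat (map (\<lambda>t. True # enc_triple t) ts)"

lemma enc_triples_simps [simp]:
  "enc_triples [] = []" "enc_triples (t # ts) = True # enc_triple t @ enc_triples ts"
  "enc_triples (ts @ us) = enc_triples ts @ enc_triples us"
  by (simp_all add: enc_triples_def)

lemma enc_instance_eq: "enc_instance gs hs = enc_triples gs @ False # enc_triples hs @ [False]"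
  by (simp add: enc_instance_def enc_list_def enc_triples_def)

text \<open>A triple is announced by \<open>True\<close> and the list is closed by
  \<open>False\<close>, so a parse of some beginning of the word yields a beginning of the
  list.\<close>

lemma enc_triples_prefix:
  "enc_triples ts @ u = enc_triples gs @ False # v \<Longrightarrow> \<exists>us. gs = ts @ us"
proof (induction ts arbitrary: gs)
  case (Cons t ts)
  then show ?case by (cases gs) (auto simp: enc_triple_prefix)
qed simp

lemma enc_instance_inj: "enc_instance gs hs = enc_instance gs' hs' \<Longrightarrow> gs = gs' \<and> hs = hs'"
proof -
  assume eq: "enc_instance gs hs = enc_instance gs' hs'"
  then obtain us us' where "gs' = gs @ us" "gs = gs' @ us'"
    unfolding enc_instance_eq using enc_triples_prefix[of gs _ gs'] enc_triples_prefix[of gs' _ gs] by metis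
  then have g: "gs = gs'" by simp
  with eq have "enc_triples hs @ [False] = enc_triples hs' @ [False]" by (simp add: enc_instance_eq)
  then obtain us us' where "hs' = hs @ us" "hs = hs' @ us'"
    using enc_triples_prefix[of hs _ hs' "[]"] enc_triples_prefix[of hs' _ hs "[]"] by metis
  with g show ?thesis by simp
qed

section \<open>Assignments of blank nodes coded as words\<close>

definition enc_env :: "(bool list \<times> name_term) list \<Rightarrow> bool list" where
  "enc_env ps = concat (map (\<lambda>(b, t). enc_term (BNode b) @ enc_term t) ps)"

text \<open>The first entry for a blank node counts. Nothing is demanded of the word behind the
  entries read, because the certificate supplies it unchecked.\<close>

definition lookup :: "bool list \<Rightarrow> bool list \<Rightarrow> name_term \<Rightarrow> bool" where
  "lookup e b t \<longleftrightarrow> (\<exists>ps r. e = enc_env ps @ r \<and> map_of ps b = Some t)"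

lemma enc_env_Cons: "enc_env ((b, t) # ps) = enc_term (BNode b) @ enc_term t @ enc_env ps"
  by (simp add: enc_env_def)

text \<open>Codes of terms are prefix-free, so two readings of a word agree entry by entry until
  \<open>b\<close> is found. This prevents a certificate from giving one blank node two
  values.\<close>

lemma lookup_unique:
  assumes "lookup e b t" "lookup e b t'" shows "t = t'"
proof -
  have "t = t'" if "enc_env ps @ r = enc_env ps' @ r'" "map_of ps b = Some t" "map_of ps' b = Some t'" for ps ps' r r'
    using that
  proof (induction ps arbitrary: ps')
    case (Cons p ps)
    obtain c u where p: "p = (c, u)" by fastforce
    show ?case
    proof (cases ps')
      case (Cons p' qs)
      obtain c' u' where p': "p' = (c', u')" by fastforce
      have "c = c' \<and> u = u' \<and> enc_env ps @ r = enc_env qs @ r'"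
        using Cons.prems(1) unfolding Cons p p' enc_env_Cons append.assoc enc_term_prefix by auto
      then show ?thesis using Cons.IH[of qs] Cons.prems Cons p p' by (auto split: if_splits)
    qed (use Cons in simp)
  qed simp
  then show ?thesis using assms unfolding lookup_def by metis
qed

definition env :: "bool list \<Rightarrow> bool list \<Rightarrow> name_term" where
  "env e b = (SOME t. lookup e b t)"

lemma env_eq: "lookup e b t \<Longrightarrow> env e b = t"
  unfolding env_def using lookup_unique by blast

section \<open>The intended meaning of the facts\<close>

context
  fixes x :: "bool list"
begin

text \<open>Rules apply before \<open>x\<close> is known to be an instance. The meaning therefore
  refers to all triples in well-formed beginnings of an arbitrary word.\<close>

definition parsed :: "(bool list, bool list, bool list) triples" where
  "parsed = {t. \<exists>ts r. (\<forall>t\<in>set ts. is_triple t) \<and> x = enc_triples ts @ r \<and> t \<in> set ts}"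

definition m_name :: "bool list \<Rightarrow> bool" where "m_name w \<longleftrightarrow> w \<in> range enc_name"
definition m_blank :: "bool list \<Rightarrow> bool" where "m_blank w \<longleftrightarrow> w \<in> range (enc_term \<circ> BNode)"
definition m_const :: "bool list \<Rightarrow> bool" where "m_const w \<longleftrightarrow> w \<in> enc_term ` (UL - URI ` reserved)"
definition m_term :: "bool list \<Rightarrow> bool" where "m_term w \<longleftrightarrow> w \<in> enc_term ` (- URI ` reserved)"
definition m_uri :: "bool list \<Rightarrow> bool" where "m_uri w \<longleftrightarrow> w \<in> range enc_uri"
definition m_graph :: "bool list \<Rightarrow> bool" where
  "m_graph r \<longleftrightarrow> (\<exists>ts. (\<forall>t\<in>set ts. is_triple t) \<and> x = enc_triples ts @ r)"
text \<open>The conjunct \<open>is_triple\<close>, together with the exclusion of reserved names in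
  \<open>m_class\<close> and \<open>m_prop\<close>, yields the side conditions of \<open>r5c\<close>
  and \<open>r6c\<close>.\<close>

definition m_in :: "(bool list, bool list, bool list) triples \<Rightarrow> bool list \<Rightarrow> bool list \<Rightarrow> bool list \<Rightarrow> bool" where
  "m_in G s p o' \<longleftrightarrow> (\<exists>S P T. s = enc_term S \<and> p = enc_uri P \<and> o' = enc_term T \<and> (S, P, T) \<in> G \<and> is_triple (S, P, T))"
definition m_class :: "bool list \<Rightarrow> bool" where
  "m_class w \<longleftrightarrow> w \<in> enc_term ` (class_terms parsed - URI ` reserved)"
definition m_prop :: "bool list \<Rightarrow> bool" where
  "m_prop w \<longleftrightarrow> w \<in> enc_term ` (prop_terms parsed - URI ` reserved)"
definition m_neq :: "bool list \<Rightarrow> bool list \<Rightarrow> bool" where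
  "m_neq u v \<longleftrightarrow> u \<noteq> v"
definition m_lookup :: "bool list \<Rightarrow> bool list \<Rightarrow> bool list \<Rightarrow> bool" where
  "m_lookup e b t \<longleftrightarrow> (\<exists>B T. b = enc_term (BNode B) \<and> t = enc_term T \<and> lookup e B T)"
definition m_map :: "bool list \<Rightarrow> bool list \<Rightarrow> bool list \<Rightarrow> bool" where
  "m_map e s t \<longleftrightarrow> (\<exists>S. s = enc_term S \<and> t = enc_term (map_blank (env e) S))"
definition m_query :: "bool list \<Rightarrow> bool list \<Rightarrow> bool" where
  "m_query e r \<longleftrightarrow> (\<exists>gs hs. (\<forall>t\<in>set gs \<union> set hs. is_triple t) \<and>
     x = enc_triples gs @ False # enc_triples hs @ r \<and> map_triple (env e) ` set hs \<subseteq> Cl_B parsed)"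
definition m_accept :: bool where
  "m_accept \<longleftrightarrow> x \<in> entailment_problem"

definition meaning :: "fact \<Rightarrow> bool" where
  "meaning f = ([\<lambda>as. as ! 0 = x, \<lambda>as. m_name (as ! 0), \<lambda>as. m_blank (as ! 0), \<lambda>as. m_const (as ! 0),
     \<lambda>as. m_term (as ! 0), \<lambda>as. m_uri (as ! 0), \<lambda>as. m_graph (as ! 0),
     \<lambda>as. m_in parsed (as ! 0) (as ! 1) (as ! 2), \<lambda>as. m_query (as ! 0) (as ! 1),
     \<lambda>as. m_in (Cl_B parsed) (as ! 0) (as ! 1) (as ! 2), \<lambda>as. m_class (as ! 0), \<lambda>as. m_prop (as ! 0),
     \<lambda>as. m_neq (as ! 0) (as ! 1), \<lambda>as. m_lookup (as ! 0) (as ! 1) (as ! 2),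
     \<lambda>as. m_map (as ! 0) (as ! 1) (as ! 2), \<lambda>as. m_accept] ! fst f) (snd f)"

end

section \<open>The rule system for entailment\<close>

abbreviation (input) "fINPUT w \<equiv> (0 :: nat, [w])"
abbreviation (input) "fNAME w \<equiv> (1 :: nat, [w])"
abbreviation (input) "fBLANK w \<equiv> (2 :: nat, [w])"
abbreviation (input) "fCONST w \<equiv> (3 :: nat, [w])"
abbreviation (input) "fTERM w \<equiv> (4 :: nat, [w])"
abbreviation (input) "fURI w \<equiv> (5 :: nat, [w])"
abbreviation (input) "fGRAPH w \<equiv> (6 :: nat, [w])"
abbreviation (input) "fTRIPLE s p t \<equiv> (7 :: nat, [s, p, t])"
abbreviation (input) "fQUERY e w \<equiv> (8 :: nat, [e, w])"
abbreviation (input) "fCL s p t \<equiv> (9 :: nat, [s, p, t])"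
abbreviation (input) "fCLASS w \<equiv> (10 :: nat, [w])"
abbreviation (input) "fPROP w \<equiv> (11 :: nat, [w])"
abbreviation (input) "fNEQ u v \<equiv> (12 :: nat, [u, v])"
abbreviation (input) "fLOOKUP e b t \<equiv> (13 :: nat, [e, b, t])"
abbreviation (input) "fMAP e s t \<equiv> (14 :: nat, [e, s, t])"
abbreviation (input) "fACCEPT \<equiv> (15 :: nat, [])"

abbreviation (input) "v0 \<equiv> [Var 0]"
abbreviation (input) "v1 \<equiv> [Var 1]"
abbreviation (input) "v2 \<equiv> [Var 2]"
abbreviation (input) "v3 \<equiv> [Var 3]"
abbreviation (input) "v4 \<equiv> [Var 4]"
abbreviation (input) "v5 \<equiv> [Var 5]"
abbreviation (input) "v6 \<equiv> [Var 6]"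
abbreviation (input) "pc u \<equiv> [Const (enc_uri u)]"
abbreviation (input) "ut v \<equiv> [Const [False], Var v]"

definition syntax_rules :: "(atom list \<times> atom) list" where
  "syntax_rules =
    [([], fNAME [Const [False]]),
     ([fNAME v0], fNAME [Const [True, True], Var 0]),
     ([fNAME v0], fNAME [Const [True, False], Var 0]),
     ([fNAME v0], fBLANK [Const (enc_tag 1), Var 0]),
     ([fNAME v0], fCONST [Const (enc_tag 0 @ enc_tag 7), Var 0]),
     ([fNAME v0], fCONST [Const (enc_tag 2), Var 0]),
     ([fNAME v0], fCONST [Const (enc_tag 3), Var 0]),
     ([fBLANK v0], fTERM v0),
     ([fCONST v0], fTERM v0),
     ([], fURI (pc Sp)), ([], fURI (pc Sc)), ([], fURI (pc Type)), ([], fURI (pc Dom)),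
     ([], fURI (pc Range)), ([], fURI (pc BotC)), ([], fURI (pc BotP)),
     ([fNAME v0], fURI [Const (enc_tag 7), Var 0])]"

text \<open>The instance is read from the left; where one code ends and the next begins is guessed
  and then certified by facts about the pieces. At the \<open>False\<close> between the graphs a
  word for the assignment is guessed, and from there on a triple is passed only if its image is in
  the closure.\<close>

definition parse_rules :: "(atom list \<times> atom) list" where
  "parse_rules =
    [([fINPUT v0], fGRAPH v0),
     ([fGRAPH [Const [True], Var 0, Var 1, Var 2, Var 3], fTERM v0, fURI v1, fTERM v2], fGRAPH v3),
     ([fGRAPH [Const [True], Var 0, Var 1, Var 2, Var 3], fTERM v0, fURI v1, fTERM v2], fTRIPLE v0 v1 v2),
     ([fGRAPH [Const [False], Var 0]], fQUERY v1 v0),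
     ([fQUERY v0 [Const [True], Var 1, Var 2, Var 3, Var 4], fTERM v1, fURI v2, fTERM v3,
       fMAP v0 v1 v5, fMAP v0 v3 v6, fCL v5 v2 v6], fQUERY v0 v4),
     ([fQUERY v0 [Const [False]]], fACCEPT)]"

text \<open>Rules have no negation, so the inequality needed for skipping an entry is witnessed by a
  common prefix followed by different letters.\<close>

definition env_rules :: "(atom list \<times> atom) list" where
  "env_rules =
    [([], fNEQ [Var 0, Const [False], Var 1] [Var 0, Const [True], Var 2]),
     ([], fNEQ [Var 0, Const [True], Var 1] [Var 0, Const [False], Var 2]),
     ([fBLANK v0, fTERM v1], fLOOKUP [Var 0, Var 1, Var 2] v0 v1),
     ([fLOOKUP v0 v1 v2, fNEQ v3 v1, fBLANK v3, fTERM v4], fLOOKUP [Var 3, Var 4, Var 0] v1 v2),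
     ([fCONST v0], fMAP v1 v0 v0),
     ([fLOOKUP v0 v1 v2], fMAP v0 v1 v2)]"

text \<open>A variable holds the code of a reference as a predicate, and \<open>ut\<close> prepends
  the \<open>False\<close> that turns it into the code of the same reference as a term. This ties
  the two occurrences in rules such as (2b) together.\<close>

definition closure_rules :: "(atom list \<times> atom) list" where
  "closure_rules =
    [([fTRIPLE v0 v1 v2], fCL v0 v1 v2),
     ([fCL v0 (pc Sp) v1, fCL v1 (pc Sp) v2], fCL v0 (pc Sp) v2),
     ([fCL (ut 0) (pc Sp) (ut 1), fCL v2 v0 v3], fCL v2 v1 v3),
     ([fCL v0 (pc Sc) v1, fCL v1 (pc Sc) v2], fCL v0 (pc Sc) v2),
     ([fCL v0 (pc Sc) v1, fCL v2 (pc Type) v0], fCL v2 (pc Type) v1),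
     ([fCL (ut 0) (pc Dom) v1, fCL v2 v0 v3], fCL v2 (pc Type) v1),
     ([fCL (ut 0) (pc Range) v1, fCL v2 v0 v3], fCL v3 (pc Type) v1),
     ([fCL v0 (pc BotC) v1], fCL v1 (pc BotC) v0),
     ([fCL v0 (pc BotC) v1, fCL v2 (pc Sc) v0], fCL v2 (pc BotC) v1),
     ([fCL v0 (pc BotC) v0, fCLASS v1], fCL v0 (pc BotC) v1),
     ([fCL v0 (pc BotP) v1], fCL v1 (pc BotP) v0),
     ([fCL v0 (pc BotP) v1, fCL v2 (pc Sp) v0], fCL v2 (pc BotP) v1),
     ([fCL v0 (pc BotP) v0, fPROP v1], fCL v0 (pc BotP) v1),
     ([fCL v0 (pc Dom) v2, fCL v1 (pc Dom) v3, fCL v2 (pc BotC) v3], fCL v0 (pc BotP) v1),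
     ([fCL v0 (pc Range) v2, fCL v1 (pc Range) v3, fCL v2 (pc BotC) v3], fCL v0 (pc BotP) v1),
     ([fCL v0 (pc Dom) v1, fCL (ut 2) (pc Sp) v0, fCL v3 v2 v4], fCL v3 (pc Type) v1),
     ([fCL v0 (pc Range) v1, fCL (ut 2) (pc Sp) v0, fCL v3 v2 v4], fCL v4 (pc Type) v1)]"

text \<open>In the last rule tag 7 restricts to non-reserved predicates. The reserved ones in use
  also belong to \<open>prop_terms\<close>, but the conclusion of \<open>r6c\<close> has to be a
  triple.\<close>

definition usage_rules :: "(atom list \<times> atom) list" where
  "usage_rules =
    [([fTRIPLE v0 (pc Sc) v1], fCLASS v0), ([fTRIPLE v0 (pc Sc) v1], fCLASS v1),
     ([fTRIPLE v0 (pc Type) v1], fCLASS v1), ([fTRIPLE v0 (pc Dom) v1], fCLASS v1),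
     ([fTRIPLE v0 (pc Range) v1], fCLASS v1),
     ([fTRIPLE v0 (pc BotC) v1], fCLASS v0), ([fTRIPLE v0 (pc BotC) v1], fCLASS v1),
     ([fTRIPLE v0 (pc Sp) v1], fPROP v0), ([fTRIPLE v0 (pc Sp) v1], fPROP v1),
     ([fTRIPLE v0 (pc Dom) v1], fPROP v0), ([fTRIPLE v0 (pc Range) v1], fPROP v0),
     ([fTRIPLE v0 (pc BotP) v1], fPROP v0), ([fTRIPLE v0 (pc BotP) v1], fPROP v1),
     ([fTRIPLE v0 [Const (enc_tag 7), Var 1] v2], fPROP [Const (enc_tag 0 @ enc_tag 7), Var 1])]"

definition sound_rule :: "bool list \<Rightarrow> atom list \<times> atom \<Rightarrow> bool" where
  "sound_rule x r \<longleftrightarrow> (\<forall>\<sigma>. (\<forall>p\<in>set (fst r). meaning x (atom_inst \<sigma> p)) \<longrightarrow> meaning x (atom_inst \<sigma> (snd r)))"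

lemmas sound_simps = sound_rule_def meaning_def atom_inst_def arg_inst_def

section \<open>Soundness of the rule system\<close>

declare enc_uri.simps [simp del] enc_term.simps [simp del]

lemma m_name_intros:
  "m_name [False]" "m_name w \<Longrightarrow> m_name (True # b # w)"
proof -
  show "m_name [False]" unfolding m_name_def by (rule image_eqI[of _ _ "[]"]) (auto simp: enc_name_dbl)
  assume "m_name w"
  then obtain v where "w = enc_name v" by (auto simp: m_name_def)
  then show "m_name (True # b # w)" unfolding m_name_def
    by (intro image_eqI[of _ _ "b # v"]) (auto simp: enc_name_dbl)
qed

lemma m_name_codes:
  assumes "m_name w"
  shows "m_blank (enc_tag 1 @ w)" "m_const (enc_tag 0 @ enc_tag 7 @ w)" "m_const (enc_tag 2 @ w)"
    "m_const (enc_tag 3 @ w)" "m_uri (enc_tag 7 @ w)"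
proof -
  obtain v where v: "w = enc_name v" using assms by (auto simp: m_name_def)
  show "m_blank (enc_tag 1 @ w)" by (auto simp: m_blank_def v enc_term.simps)
  show "m_const (enc_tag 0 @ enc_tag 7 @ w)" unfolding m_const_def
    by (rule image_eqI[of _ _ "URI (Uri v)"]) (auto simp: v enc_term.simps enc_uri.simps UL_def reserved_def)
  show "m_const (enc_tag 2 @ w)" unfolding m_const_def
    by (rule image_eqI[of _ _ "Lit (Plain v)"]) (auto simp: v enc_term.simps UL_def)
  show "m_const (enc_tag 3 @ w)" unfolding m_const_def
    by (rule image_eqI[of _ _ "Lit (Typed v)"]) (auto simp: v enc_term.simps UL_def)
  show "m_uri (enc_tag 7 @ w)" unfolding m_uri_def
    by (rule image_eqI[of _ _ "Uri v"]) (auto simp: v enc_uri.simps)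
qed

lemma m_term_intros: "m_blank w \<Longrightarrow> m_term w" "m_const w \<Longrightarrow> m_term w"
  by (auto simp: m_blank_def m_const_def m_term_def)

lemma m_uri_enc: "m_uri (enc_uri u)"
  by (simp add: m_uri_def)

lemma sound_syntax_rules: "r \<in> set syntax_rules \<Longrightarrow> sound_rule x r"
  unfolding syntax_rules_def
  by (auto simp: sound_simps m_name_intros m_term_intros m_uri_enc simp del: One_nat_def dest: m_name_codes)

lemma m_triple:
  assumes "m_graph x (True # s @ p @ t @ r)" "m_term s" "m_uri p" "m_term t"
  shows "m_graph x r" "m_in (parsed x) s p t"
proof -
  obtain ts where ts: "\<forall>t\<in>set ts. is_triple t" "x = enc_triples ts @ True # s @ p @ t @ r"
    using assms(1) by (auto simp: m_graph_def)
  obtain S where S: "s = enc_term S" "S \<notin> URI ` reserved" using assms(2) unfolding m_term_def by blast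
  obtain P where P: "p = enc_uri P" using assms(3) unfolding m_uri_def by blast
  obtain T where T: "t = enc_term T" "T \<notin> URI ` reserved" using assms(4) unfolding m_term_def by blast
  have spt: "s = enc_term S" "p = enc_uri P" "t = enc_term T" "is_triple (S, P, T)"
    unfolding is_triple.simps using S P T by blast+
  have x: "x = enc_triples (ts @ [(S, P, T)]) @ r" using ts(2) spt by simp
  have ok: "\<forall>t\<in>set (ts @ [(S, P, T)]). is_triple t" using ts(1) spt(4) by auto
  show "m_graph x r" unfolding m_graph_def using x ok by blast
  have "(S, P, T) \<in> parsed x" unfolding parsed_def
    by (intro CollectI exI[of _ "ts @ [(S, P, T)]"] exI[of _ r] conjI ok x) simp
  then show "m_in (parsed x) s p t" unfolding m_in_def using spt by blast
qed

lemma m_query_start: "m_graph x (False # r) \<Longrightarrow> m_query x e r"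
  unfolding m_graph_def m_query_def by (elim exE conjE, rule exI, rule exI[of _ "[]"]) auto

lemma m_query_step:
  assumes "m_query x e (True # s @ p @ t @ r)" "m_term s" "m_uri p" "m_term t"
    "m_map e s s'" "m_map e t t'" "m_in (Cl_B (parsed x)) s' p t'"
  shows "m_query x e r"
proof -
  obtain gs hs where gh: "\<forall>t\<in>set gs \<union> set hs. is_triple t"
     "x = enc_triples gs @ False # enc_triples hs @ True # s @ p @ t @ r"
     "map_triple (env e) ` set hs \<subseteq> Cl_B (parsed x)"
    using assms(1) by (auto simp: m_query_def)
  obtain S where S: "s = enc_term S" "S \<notin> URI ` reserved" using assms(2) unfolding m_term_def by blast
  obtain P where P: "p = enc_uri P" using assms(3) unfolding m_uri_def by blast
  obtain T where T: "t = enc_term T" "T \<notin> URI ` reserved" using assms(4) unfolding m_term_def by blast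
  have spt: "s = enc_term S" "p = enc_uri P" "t = enc_term T" "is_triple (S, P, T)"
    unfolding is_triple.simps using S P T by blast+
  have "map_triple (env e) (S, P, T) \<in> Cl_B (parsed x)"
    using assms(5-7) spt by (auto simp: m_map_def m_in_def)
  then show ?thesis unfolding m_query_def
    using gh spt by (intro exI[of _ gs] exI[of _ "hs @ [(S, P, T)]"]) auto
qed

text \<open>Only now is the word known to end properly. Prefix-freeness makes its parse unique, so
  \<open>parsed x\<close> is exactly the first graph and \<open>env e\<close> is a homomorphism from
  the second.\<close>

lemma m_query_end:
  assumes "m_query x e [False]" shows "m_accept x"
proof -
  obtain gs hs where gh: "\<forall>t\<in>set gs \<union> set hs. is_triple t"
     "x = enc_triples gs @ False # enc_triples hs @ [False]"
     "map_triple (env e) ` set hs \<subseteq> Cl_B (parsed x)"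
    using assms by (auto simp: m_query_def)
  have x: "x = enc_instance gs hs" using gh(2) by (simp add: enc_instance_eq)
  have "parsed x = set gs"
  proof
    show "set gs \<subseteq> parsed x" unfolding parsed_def using gh(1,2) by blast
    show "parsed x \<subseteq> set gs"
    proof
      fix t assume "t \<in> parsed x"
      then obtain ts r where ts: "x = enc_triples ts @ r" "t \<in> set ts" by (auto simp: parsed_def)
      then obtain us where "gs = ts @ us" using enc_triples_prefix gh(2) by metis
      then show "t \<in> set gs" using ts(2) by simp
    qed
  qed
  moreover have "is_graph (set gs)" "is_graph (set hs)" using gh(1) by (auto simp: is_graph_def)
  ultimately have "entails (set gs) (set hs)" using entails_iff_hom gh(3) by auto
  then show ?thesis unfolding m_accept_def entailment_problem_def
    using x \<open>is_graph (set gs)\<close> \<open>is_graph (set hs)\<close> by blast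
qed

lemma sound_parse_rules: "r \<in> set parse_rules \<Longrightarrow> sound_rule x r"
proof -
  have "m_graph x x" unfolding m_graph_def by (intro exI[of _ "[]"]) simp
  then show "r \<in> set parse_rules \<Longrightarrow> sound_rule x r"
    unfolding parse_rules_def
    by (auto simp: sound_simps m_query_end m_query_start intro: m_triple m_query_step)
qed

lemma m_lookup_intros:
  "m_blank b \<Longrightarrow> m_term t \<Longrightarrow> m_lookup (b @ t @ e) b t"
  "m_lookup e b t \<Longrightarrow> m_neq c b \<Longrightarrow> m_blank c \<Longrightarrow> m_term u \<Longrightarrow> m_lookup (c @ u @ e) b t"
proof -
  assume "m_blank b" "m_term t"
  then obtain B T where *: "b = enc_term (BNode B)" "t = enc_term T" by (auto simp: m_blank_def m_term_def)
  then have "lookup (b @ t @ e) B T" unfolding lookup_def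
    by (intro exI[of _ "[(B, T)]"] exI[of _ e]) (simp add: enc_env_def)
  then show "m_lookup (b @ t @ e) b t" unfolding m_lookup_def using * by blast
next
  assume "m_lookup e b t" "m_neq c b" "m_blank c" "m_term u"
  then obtain B T C U where *: "b = enc_term (BNode B)" "t = enc_term T" "lookup e B T" "c = enc_term (BNode C)"
    "u = enc_term U" "C \<noteq> B"
    by (auto simp: m_blank_def m_term_def m_lookup_def m_neq_def)
  then obtain ps r where "e = enc_env ps @ r" "map_of ps B = Some T" by (auto simp: lookup_def)
  then have "lookup (c @ u @ e) B T" unfolding lookup_def
    using * by (intro exI[of _ "(C, U) # ps"] exI[of _ r]) (simp add: enc_env_Cons)
  then show "m_lookup (c @ u @ e) b t" unfolding m_lookup_def using * by blast
qed

lemma m_map_intros: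
  "m_const s \<Longrightarrow> m_map e s s" "m_lookup e s t \<Longrightarrow> m_map e s t"
proof -
  assume "m_const s"
  then obtain S where "s = enc_term S" "S \<in> UL" by (auto simp: m_const_def)
  then show "m_map e s s" unfolding m_map_def by (intro exI[of _ S]) (auto simp: UL_def)
next
  assume "m_lookup e s t"
  then obtain B T where "s = enc_term (BNode B)" "t = enc_term T" "lookup e B T" by (auto simp: m_lookup_def)
  then show "m_map e s t" unfolding m_map_def by (intro exI[of _ "BNode B"]) (auto simp: env_eq)
qed

lemma sound_env_rules: "r \<in> set env_rules \<Longrightarrow> sound_rule x r"
  unfolding env_rules_def
  by (auto simp: sound_simps m_map_intros m_lookup_intros) (auto simp: m_neq_def)

lemma sound_usage_rules: "r \<in> set usage_rules \<Longrightarrow> sound_rule x r"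
proof -
  have c: "m_class x w" if "w = enc_term C" "C \<in> class_terms (parsed x)" "C \<notin> URI ` reserved" for w C
    using that by (auto simp: m_class_def)
  have p: "m_prop x w" if "w = enc_term C" "C \<in> prop_terms (parsed x)" "C \<notin> URI ` reserved" for w C
    using that by (auto simp: m_prop_def)
  have u: "m_prop x (enc_tag 0 @ enc_tag 7 @ w)" if in_w: "m_in (parsed x) s (enc_tag 7 @ w) t" for s w t
  proof -
    obtain S P T where spt: "enc_tag 7 @ w = enc_uri P" "(S, P, T) \<in> parsed x" using in_w unfolding m_in_def by metis
    then obtain v where "P = Uri v" by (cases P) (auto simp: enc_uri.simps enc_tag_prefix enc_tag_prefix[of _ _ _ "[]", simplified])
    then show ?thesis using spt unfolding m_prop_def
      by (intro image_eqI[of _ _ "URI P"]) (auto simp: enc_term.simps reserved_def prop_terms_def)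
  qed
  show "r \<in> set usage_rules \<Longrightarrow> sound_rule x r"
    unfolding usage_rules_def
    by (auto simp: sound_simps u) (auto simp: m_in_def intro!: c p; auto simp: class_terms_def prop_terms_def)+
qed

lemma sound_closure_rules: "r \<in> set closure_rules \<Longrightarrow> sound_rule x r"
  unfolding closure_rules_def
  by (auto simp: sound_simps m_in_def enc_term_URI m_class_def m_prop_def)
    (erule Cl_B.base, erule (1) Cl_B.r2a, erule (1) Cl_B.r2b, erule (1) Cl_B.r3a, erule (1) Cl_B.r3b,
      erule (1) Cl_B.r4a, erule (1) Cl_B.r4b, erule Cl_B.r5a, erule (1) Cl_B.r5b,
      (erule (1) Cl_B.r5c, simp), erule Cl_B.r6a, erule (1) Cl_B.r6b, (erule (1) Cl_B.r6c, simp),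
      erule (2) Cl_B.r7a, erule (2) Cl_B.r7b, erule (2) Cl_B.r8a, erule (2) Cl_B.r8b)

definition all_rules :: "(atom list \<times> atom) list" where
  "all_rules = syntax_rules @ parse_rules @ env_rules @ closure_rules @ usage_rules"

section \<open>Derivations over polynomially many words\<close>

definition subwords :: "'a list \<Rightarrow> 'a list set" where
  "subwords x = {w. \<exists>u v. x = u @ w @ v}"

lemma subwords_finite: "finite (subwords x)" "card (subwords x) \<le> (length x + 1) * (length x + 1)"
proof -
  have s: "subwords x \<subseteq> (\<lambda>(i, j). take j (drop i x)) ` ({..length x} \<times> {..length x})"
  proof
    fix w assume "w \<in> subwords x"
    then obtain u v where "x = u @ w @ v" by (auto simp: subwords_def)
    then show "w \<in> (\<lambda>(i, j). take j (drop i x)) ` ({..length x} \<times> {..length x})"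
      by (intro image_eqI[of _ _ "(length u, length w)"]) auto
  qed
  have fin: "finite ((\<lambda>(i, j). take j (drop i x)) ` ({..length x} \<times> {..length x}))" by simp
  show "finite (subwords x)" by (rule finite_subset[OF s fin])
  have "card (subwords x) \<le> card ((\<lambda>(i, j). take j (drop i x)) ` ({..length x} \<times> {..length x}))"
    by (rule card_mono[OF fin s])
  also have "\<dots> \<le> card ({..length x} \<times> {..length x})" by (rule card_image_le) simp
  finally show "card (subwords x) \<le> (length x + 1) * (length x + 1)" by (simp add: card_cartesian_product)
qed

lemma subwords_trans: "w \<in> subwords x \<Longrightarrow> w = u @ v @ z \<Longrightarrow> v \<in> subwords x"
proof -
  assume "w \<in> subwords x" "w = u @ v @ z"
  then obtain a b where "x = (a @ u) @ v @ (z @ b)" by (auto simp: subwords_def)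
  then show ?thesis unfolding subwords_def by blast
qed

lemma subwords_mono: "w \<in> subwords y \<Longrightarrow> y \<in> subwords x \<Longrightarrow> w \<in> subwords x"
  unfolding subwords_def[of y] using subwords_trans by blast

lemma subwords_length: "w \<in> subwords x \<Longrightarrow> length w \<le> length x"
  by (auto simp: subwords_def)

locale completeness =
  fixes gs hs :: "name_triple list" and \<mu> :: "bool list \<Rightarrow> name_term"
  assumes graphs: "is_graph (set gs)" "is_graph (set hs)"
    and hom: "map_triple \<mu> ` set hs \<subseteq> Cl_B (set gs)"
begin

definition x :: "bool list" where "x = enc_instance gs hs"

text \<open>A blank node may be listed repeatedly; all its entries in \<open>e\<close> carry the
  same value.\<close>

definition blanks :: "bool list list" where
  "blanks = concat (map (\<lambda>(s, p, t). (case s of BNode b \<Rightarrow> [b] | _ \<Rightarrow> []) @ (case t of BNode b \<Rightarrow> [b] | _ \<Rightarrow> [])) hs)"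

definition e :: "bool list" where "e = enc_env (map (\<lambda>b. (b, \<mu> b)) blanks)"

text \<open>All words of a derivation: parts of the instance, suffixes of the environment, and the codes of the
  reserved names. The codes of a reference as a predicate and as a term differ by a leading \<open>False\<close>.\<close>

definition W :: "bool list set" where
  "W = subwords x \<union> (#) False ` subwords x \<union> {w. \<exists>u. e = u @ w} \<union> enc_uri ` reserved"

text \<open>Seven is the largest number of variables in a rule, reached where a triple of the second
  graph is passed.\<close>

abbreviation "prv \<equiv> proves all_rules 7 W (0, [x])"

lemma prv_rule:
  assumes "(ps, c) \<in> set all_rules" "set ws \<subseteq> W" "length ws \<le> 7" "f = atom_inst (subst ws) c"
    "set (snd f) \<subseteq> W" "\<And>p. p \<in> set ps \<Longrightarrow> prv (atom_inst (subst ws) p)"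
  shows "prv f"
  using assms by (auto intro: proves.step)

lemmas rules_defs = all_rules_def syntax_rules_def parse_rules_def env_rules_def closure_rules_def usage_rules_def
lemmas inst_defs = atom_inst_def arg_inst_def subst_def

lemma W_sub: "w \<in> subwords x \<Longrightarrow> w \<in> W" "w \<in> subwords x \<Longrightarrow> False # w \<in> W"
  by (auto simp: W_def)

lemma prv_name: "enc_name v \<in> subwords x \<Longrightarrow> prv (fNAME (enc_name v))"
proof (induction v)
  case Nil
  show ?case
    by (rule prv_rule[of "[]" "fNAME [Const [False]]" "[]"])
      (simp add: rules_defs, use W_sub Nil in \<open>auto simp: inst_defs enc_name_dbl\<close>)
next
  case (Cons b v)
  have w: "enc_name (b # v) = [True, b] @ enc_name v" by (simp add: enc_name_dbl)
  have sub: "enc_name v \<in> subwords x" using subwords_trans[OF Cons.prems, of "[True, b]" _ "[]"] w by simp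
  show ?case
    by (rule prv_rule[of "[fNAME v0]" "fNAME [Const [True, b], Var 0]" "[enc_name v]"])
      (use W_sub(1)[OF sub] W_sub(1)[OF Cons.prems] Cons.IH[OF sub] w in \<open>cases b; auto simp: rules_defs inst_defs\<close>)+
qed

lemma prv_blank: "enc_term (BNode v) \<in> subwords x \<Longrightarrow> prv (fBLANK (enc_term (BNode v)))"
proof -
  assume *: "enc_term (BNode v) \<in> subwords x"
  have w: "enc_term (BNode v) = enc_tag 1 @ enc_name v" by (simp add: enc_term.simps)
  have sub: "enc_name v \<in> subwords x" using subwords_trans[OF *, of "enc_tag 1" _ "[]"] w by simp
  show ?thesis
    by (rule prv_rule[of "[fNAME v0]" "fBLANK [Const (enc_tag 1), Var 0]" "[enc_name v]"])
      (simp add: rules_defs, use W_sub(1)[OF sub] W_sub(1)[OF *] prv_name[OF sub] w in \<open>auto simp: inst_defs\<close>)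
qed

lemma prv_const: "enc_term t \<in> subwords x \<Longrightarrow> t \<in> UL - URI ` reserved \<Longrightarrow> prv (fCONST (enc_term t))"
proof -
  assume *: "enc_term t \<in> subwords x" "t \<in> UL - URI ` reserved"
  then obtain i v where "(i, t) \<in> {(enc_tag 0 @ enc_tag 7, URI (Uri v)), (enc_tag 2, Lit (Plain v)), (enc_tag 3, Lit (Typed v))}"
    by (cases t rule: enc_term.cases; (cases "case t of URI u \<Rightarrow> u")?) (auto simp: UL_def reserved_def)
  then have i: "i \<in> {enc_tag 0 @ enc_tag 7, enc_tag 2, enc_tag 3}" and w: "enc_term t = i @ enc_name v"
    by (auto simp: enc_term.simps enc_uri.simps)
  have sub: "enc_name v \<in> subwords x" using subwords_trans[OF *(1), of i _ "[]"] w by simp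
  show ?thesis
    by (rule prv_rule[of "[fNAME v0]" "fCONST [Const i, Var 0]" "[enc_name v]"])
      (simp add: rules_defs, use i W_sub(1)[OF sub] W_sub(1)[OF *(1)] prv_name[OF sub] w in \<open>auto simp: inst_defs\<close>)
qed

lemma prv_term: "enc_term t \<in> subwords x \<Longrightarrow> t \<notin> URI ` reserved \<Longrightarrow> prv (fTERM (enc_term t))"
proof (cases "t \<in> UL")
  case True
  assume *: "enc_term t \<in> subwords x" "t \<notin> URI ` reserved"
  then have p: "prv (fCONST (enc_term t))" using prv_const True by simp
  show ?thesis
    by (rule prv_rule[of "[fCONST v0]" "fTERM v0" "[enc_term t]"])
      (simp add: rules_defs, use p W_sub(1)[OF *(1)] in \<open>auto simp: inst_defs\<close>)
next
  case False
  assume *: "enc_term t \<in> subwords x" "t \<notin> URI ` reserved"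
  from False obtain v where "t = BNode v" by (cases t) (auto simp: UL_def)
  then have p: "prv (fBLANK (enc_term t))" using prv_blank * by simp
  show ?thesis
    by (rule prv_rule[of "[fBLANK v0]" "fTERM v0" "[enc_term t]"])
      (simp add: rules_defs, use p W_sub(1)[OF *(1)] in \<open>auto simp: inst_defs\<close>)
qed

lemma prv_uri: "enc_uri u \<in> subwords x \<Longrightarrow> prv (fURI (enc_uri u))"
proof (cases "u \<in> reserved")
  case True
  then have W: "enc_uri u \<in> W" by (auto simp: W_def)
  show ?thesis
    by (rule prv_rule[of "[]" "fURI (pc u)" "[]"])
      (simp add: rules_defs, use True W in \<open>auto simp: inst_defs reserved_def\<close>)
next
  case False
  assume *: "enc_uri u \<in> subwords x"
  from False obtain v where "u = Uri v" by (cases u) (auto simp: reserved_def)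
  then have w: "enc_uri u = enc_tag 7 @ enc_name v" by (simp add: enc_uri.simps)
  have sub: "enc_name v \<in> subwords x" using subwords_trans[OF *, of "enc_tag 7" _ "[]"] w by simp
  show ?thesis
    by (rule prv_rule[of "[fNAME v0]" "fURI [Const (enc_tag 7), Var 0]" "[enc_name v]"])
      (simp add: rules_defs, use W_sub(1)[OF sub] W_sub(1)[OF *] prv_name[OF sub] w in \<open>auto simp: inst_defs\<close>)
qed

lemma x_eq: "x = enc_triples gs @ False # enc_triples hs @ [False]"
  by (simp add: x_def enc_instance_eq)

lemma subword_triple: "t \<in> set gs \<union> set hs \<Longrightarrow> enc_triple t \<in> subwords x"
proof -
  have *: "enc_triple t \<in> subwords (enc_triples ts)" if t: "t \<in> set ts" for t ts
  proof -
    obtain us vs where "ts = us @ t # vs" using t by (metis split_list)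
    then show ?thesis unfolding subwords_def
      by (intro CollectI exI[of _ "enc_triples us @ [True]"] exI[of _ "enc_triples vs"]) simp
  qed
  have "enc_triples gs \<in> subwords x" "enc_triples hs \<in> subwords x"
    unfolding subwords_def x_eq
    by (intro CollectI exI[of _ "[]"] exI[of _ "False # enc_triples hs @ [False]"]; simp)
      (intro CollectI exI[of _ "enc_triples gs @ [False]"] exI[of _ "[False]"]; simp)
  then show "t \<in> set gs \<union> set hs \<Longrightarrow> enc_triple t \<in> subwords x"
    using *[of t gs] *[of t hs] subwords_mono by blast
qed

lemma subword_codes:
  assumes "(s, p, t) \<in> set gs \<union> set hs"
  shows "enc_term s \<in> subwords x" "enc_uri p \<in> subwords x" "enc_term t \<in> subwords x"
  using subwords_trans[OF subword_triple[OF assms], of "[]" "enc_term s" "enc_uri p @ enc_term t"]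
    subwords_trans[OF subword_triple[OF assms], of "enc_term s" "enc_uri p" "enc_term t"]
    subwords_trans[OF subword_triple[OF assms], of "enc_term s @ enc_uri p" "enc_term t" "[]"]
  by simp_all

lemma not_reserved:
  assumes "(s, p, t) \<in> set gs \<union> set hs"
  shows "s \<notin> URI ` reserved" "t \<notin> URI ` reserved"
  using assms graphs by (auto simp: is_graph_def)

lemma prv_graph: "gs = us @ vs \<Longrightarrow> prv (fGRAPH (enc_triples vs @ False # enc_triples hs @ [False]))"
proof (induction us arbitrary: vs rule: rev_induct)
  case Nil
  have x: "enc_triples vs @ False # enc_triples hs @ [False] = x" using Nil x_eq by simp
  have "x \<in> subwords x" unfolding subwords_def by (intro CollectI exI[of _ "[]"]) simp
  note W = W_sub(1)[OF this]
  show ?case unfolding x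
    by (rule prv_rule[of "[fINPUT v0]" "fGRAPH v0" "[x]"])
      (simp add: rules_defs, use W in \<open>auto simp: inst_defs intro: proves.axiom\<close>)
next
  case (snoc t us)
  obtain s p u where t: "t = (s, p, u)" by (metis prod_cases3)
  let ?r = "enc_triples vs @ False # enc_triples hs @ [False]"
  have in_gs: "(s, p, u) \<in> set gs \<union> set hs" using snoc.prems t by simp
  note sub = subword_codes[OF in_gs] and nr = not_reserved[OF in_gs]
  have IH: "prv (fGRAPH (True # enc_term s @ enc_uri p @ enc_term u @ ?r))"
    using snoc.IH[of "t # vs"] snoc.prems t by simp
  have r: "?r \<in> subwords x" 
    unfolding subwords_def x_eq
    by (rule CollectI, rule exI[of _ "enc_triples (us @ [t])"], rule exI[of _ "[]"]) (use snoc.prems in simp)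
  show ?case
    by (rule prv_rule[of "[fGRAPH [Const [True], Var 0, Var 1, Var 2, Var 3], fTERM v0, fURI v1, fTERM v2]"
          "fGRAPH v3" "[enc_term s, enc_uri p, enc_term u, ?r]"])
      (simp add: rules_defs, use IH W_sub(1)[OF r] W_sub(1)[OF sub(1)] W_sub(1)[OF sub(2)] W_sub(1)[OF sub(3)] prv_term[OF sub(1) nr(1)] prv_uri[OF sub(2)] prv_term[OF sub(3) nr(2)] in \<open>auto simp: inst_defs\<close>)
qed

lemma prv_triple:
  assumes "(s, p, u) \<in> set gs" shows "prv (fTRIPLE (enc_term s) (enc_uri p) (enc_term u))"
proof -
  obtain us vs where gs: "gs = us @ (s, p, u) # vs" using assms by (metis split_list)
  let ?r = "enc_triples vs @ False # enc_triples hs @ [False]"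
  have in_gs: "(s, p, u) \<in> set gs \<union> set hs" using assms by simp
  note sub = subword_codes[OF in_gs] and nr = not_reserved[OF in_gs]
  have g: "prv (fGRAPH (True # enc_term s @ enc_uri p @ enc_term u @ ?r))"
    using prv_graph[OF gs] by simp
  have r: "?r \<in> subwords x" 
    unfolding subwords_def x_eq
    by (rule CollectI, rule exI[of _ "enc_triples (us @ [(s, p, u)])"], rule exI[of _ "[]"]) (use gs in simp)
  show ?thesis
    by (rule prv_rule[of "[fGRAPH [Const [True], Var 0, Var 1, Var 2, Var 3], fTERM v0, fURI v1, fTERM v2]"
          "fTRIPLE v0 v1 v2" "[enc_term s, enc_uri p, enc_term u, ?r]"])
      (simp add: rules_defs, use g W_sub(1)[OF r] W_sub(1)[OF sub(1)] W_sub(1)[OF sub(2)] W_sub(1)[OF sub(3)] prv_term[OF sub(1) nr(1)] prv_uri[OF sub(2)] prv_term[OF sub(3) nr(2)] in \<open>auto simp: inst_defs\<close>)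
qed

lemma W_term: "t \<in> terms_of (set gs) \<Longrightarrow> enc_term t \<in> W"
proof -
  assume "t \<in> terms_of (set gs)"
  then obtain s p u where h: "(s, p, u) \<in> set gs" "t \<in> {s, URI p, u}" by (auto simp: terms_of_def)
  then have "(s, p, u) \<in> set gs \<union> set hs" by simp
  note sub = subword_codes[OF this]
  have "enc_term (URI p) = False # enc_uri p" by (simp add: enc_term.simps enc_tag_def)
  then show ?thesis using h(2) sub W_sub by auto
qed

lemma W_uri:
  assumes "URI u \<in> terms_of (set gs)" shows "enc_uri u \<in> W"
proof -
  obtain s p t where h: "(s, p, t) \<in> set gs" "URI u \<in> {s, URI p, t}" using assms by (auto simp: terms_of_def)
  then have "(s, p, t) \<in> set gs \<union> set hs" by simp
  note sub = subword_codes[OF this]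
  have "enc_term (URI u) = [False] @ enc_uri u" by (simp add: enc_term.simps enc_tag_def)
  then have "enc_uri u \<in> subwords x" if "enc_term (URI u) \<in> subwords x"
    using subwords_trans[OF that, of "[False]" _ "[]"] by simp
  then show ?thesis using h(2) sub W_sub(1) by auto
qed

lemma W_reserved: "u \<in> reserved \<Longrightarrow> enc_uri u \<in> W"
  by (simp add: W_def)

lemma prv_class:
  assumes "c \<in> class_terms (set gs)" shows "prv (fCLASS (enc_term c))"
proof -
  have A: "prv (fCLASS (enc_term c))" if t: "(c, p, y) \<in> set gs" and p: "p \<in> {Sc, BotC}" for p y
  proof -
    have W: "enc_term c \<in> W" "enc_term y \<in> W" using W_term terms_ofI[OF t] by auto
    show ?thesis
      by (rule prv_rule[of "[fTRIPLE v0 (pc p) v1]" "fCLASS v0" "[enc_term c, enc_term y]"])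
        (use p in \<open>force simp: rules_defs\<close>, use W prv_triple[OF t] in \<open>auto simp: inst_defs\<close>)
  qed
  have B: "prv (fCLASS (enc_term c))" if t: "(y, p, c) \<in> set gs" and p: "p \<in> {Sc, Type, Dom, Range, BotC}" for p y
  proof -
    have W: "enc_term c \<in> W" "enc_term y \<in> W" using W_term terms_ofI[OF t] by auto
    show ?thesis
      by (rule prv_rule[of "[fTRIPLE v0 (pc p) v1]" "fCLASS v1" "[enc_term y, enc_term c]"])
        (use p in \<open>force simp: rules_defs\<close>, use W prv_triple[OF t] in \<open>auto simp: inst_defs\<close>)
  qed
  show ?thesis using assms A B unfolding class_terms_def by blast
qed

lemma prv_prop:
  assumes "c \<in> prop_terms (set gs)" "c \<notin> URI ` reserved" shows "prv (fPROP (enc_term c))"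
proof -
  have A: "prv (fPROP (enc_term c))" if t: "(c, p, y) \<in> set gs" and p: "p \<in> {Sp, Dom, Range, BotP}" for p y
  proof -
    have W: "enc_term c \<in> W" "enc_term y \<in> W" using W_term terms_ofI[OF t] by auto
    show ?thesis
      by (rule prv_rule[of "[fTRIPLE v0 (pc p) v1]" "fPROP v0" "[enc_term c, enc_term y]"])
        (use p in \<open>force simp: rules_defs\<close>, use W prv_triple[OF t] in \<open>auto simp: inst_defs\<close>)
  qed
  have B: "prv (fPROP (enc_term c))" if t: "(y, p, c) \<in> set gs" and p: "p \<in> {Sp, BotP}" for p y
  proof -
    have W: "enc_term c \<in> W" "enc_term y \<in> W" using W_term terms_ofI[OF t] by auto
    show ?thesis
      by (rule prv_rule[of "[fTRIPLE v0 (pc p) v1]" "fPROP v1" "[enc_term y, enc_term c]"])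
        (use p in \<open>force simp: rules_defs\<close>, use W prv_triple[OF t] in \<open>auto simp: inst_defs\<close>)
  qed
  have C: "prv (fPROP (enc_term c))" if c: "c = URI p" and t: "(y, p, z) \<in> set gs" for p y z
  proof -
    obtain v where v: "p = Uri v" using assms(2) c by (cases p) (auto simp: reserved_def)
    have W: "enc_term c \<in> W" "enc_term y \<in> W" "enc_term z \<in> W" using W_term terms_ofI[OF t] c by auto
    have "(y, p, z) \<in> set gs \<union> set hs" using t by simp
    from subword_codes(2)[OF this] have "enc_name v \<in> subwords x"
      using subwords_trans[of "enc_uri p" x "enc_tag 7" "enc_name v" "[]"] v by (simp add: enc_uri.simps)
    then have n: "enc_name v \<in> W" by (rule W_sub(1))
    have e: "enc_uri p = enc_tag 7 @ enc_name v" "enc_term c = enc_tag 0 @ enc_tag 7 @ enc_name v"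
      by (simp_all add: v c enc_uri.simps enc_term.simps)
    show ?thesis
      by (rule prv_rule[of "[fTRIPLE v0 [Const (enc_tag 7), Var 1] v2]"
            "fPROP [Const (enc_tag 0 @ enc_tag 7), Var 1]" "[enc_term y, enc_name v, enc_term z]"])
        (simp add: rules_defs, use W n e prv_triple[OF t] in \<open>auto simp: inst_defs\<close>)
  qed
  show ?thesis using assms A B C unfolding prop_terms_def by blast
qed

lemma Cl_W:
  assumes "(s, p, t) \<in> Cl_B (set gs)"
  shows "enc_term s \<in> W" "enc_term t \<in> W" "enc_uri p \<in> W"
proof -
  note T = uni_Cl_B[OF graphs(1) assms]
  show "enc_term s \<in> W" "enc_term t \<in> W" using T W_term by auto
  show "enc_uri p \<in> W" using T(3) W_uri W_reserved by blast
qed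

lemma Cl_W_URI:
  assumes "(URI u, p, t) \<in> Cl_B (set gs)" shows "enc_uri u \<in> W"
  using uni_Cl_B(1)[OF graphs(1) assms] W_uri by blast

lemma Cl_W_URI':
  assumes "(s, p, URI u) \<in> Cl_B (set gs)" shows "enc_uri u \<in> W"
  using uni_Cl_B(2)[OF graphs(1) assms] W_uri by blast

lemma enc_URI: "enc_term (URI u) = False # enc_uri u"
  by (simp add: enc_term.simps enc_tag_def)

lemma W_res: "enc_uri Sp \<in> W" "enc_uri Sc \<in> W" "enc_uri Type \<in> W" "enc_uri Dom \<in> W"
  "enc_uri Range \<in> W" "enc_uri BotC \<in> W" "enc_uri BotP \<in> W"
  by (auto simp: W_def reserved_def)

abbreviation (input) "cl t \<equiv> (case t of (s, p, u) \<Rightarrow> prv (fCL (enc_term s) (enc_uri p) (enc_term u)))"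

lemma prv_Cl: "t \<in> Cl_B (set gs) \<Longrightarrow> cl t"
proof (induction rule: Cl_B.induct)
  case (base t)
  obtain s p u where t: "t = (s, p, u)" by (metis prod_cases3)
  note W = Cl_W[OF Cl_B.base[OF base, unfolded t]]
  show ?case unfolding t prod.case
    by (rule prv_rule[of "[fTRIPLE v0 v1 v2]" "fCL v0 v1 v2" "[enc_term s, enc_uri p, enc_term u]"])
      (simp add: rules_defs, use W prv_triple base t in \<open>auto simp: inst_defs\<close>)
next
  case (r2a A B C)
  show ?case unfolding prod.case
    by (rule prv_rule[of "[fCL v0 (pc Sp) v1, fCL v1 (pc Sp) v2]" "fCL v0 (pc Sp) v2" "[enc_term A, enc_term B, enc_term C]"])
      (simp add: rules_defs, use Cl_W[OF r2a(1)] Cl_W[OF r2a(2)] r2a.IH in \<open>auto simp: inst_defs W_res\<close>)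
next
  case (r2b D E X Y)
  show ?case unfolding prod.case
    by (rule prv_rule[of "[fCL (ut 0) (pc Sp) (ut 1), fCL v2 v0 v3]" "fCL v2 v1 v3" "[enc_uri D, enc_uri E, enc_term X, enc_term Y]"])
      (simp add: rules_defs, use Cl_W_URI[OF r2b(1)] Cl_W_URI'[OF r2b(1)] Cl_W[OF r2b(2)] r2b.IH in \<open>auto simp: inst_defs W_res enc_URI\<close>)
next
  case (r3a A B C)
  show ?case unfolding prod.case
    by (rule prv_rule[of "[fCL v0 (pc Sc) v1, fCL v1 (pc Sc) v2]" "fCL v0 (pc Sc) v2" "[enc_term A, enc_term B, enc_term C]"])
      (simp add: rules_defs, use Cl_W[OF r3a(1)] Cl_W[OF r3a(2)] r3a.IH in \<open>auto simp: inst_defs W_res\<close>)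
next
  case (r3b A B X)
  show ?case unfolding prod.case
    by (rule prv_rule[of "[fCL v0 (pc Sc) v1, fCL v2 (pc Type) v0]" "fCL v2 (pc Type) v1" "[enc_term A, enc_term B, enc_term X]"])
      (simp add: rules_defs, use Cl_W[OF r3b(1)] Cl_W[OF r3b(2)] r3b.IH in \<open>auto simp: inst_defs W_res\<close>)
next
  case (r4a D B X Y)
  show ?case unfolding prod.case
    by (rule prv_rule[of "[fCL (ut 0) (pc Dom) v1, fCL v2 v0 v3]" "fCL v2 (pc Type) v1" "[enc_uri D, enc_term B, enc_term X, enc_term Y]"])
      (simp add: rules_defs, use Cl_W_URI[OF r4a(1)] Cl_W[OF r4a(1)] Cl_W[OF r4a(2)] r4a.IH in \<open>auto simp: inst_defs W_res enc_URI\<close>)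
next
  case (r4b D B X Y)
  show ?case unfolding prod.case
    by (rule prv_rule[of "[fCL (ut 0) (pc Range) v1, fCL v2 v0 v3]" "fCL v3 (pc Type) v1" "[enc_uri D, enc_term B, enc_term X, enc_term Y]"])
      (simp add: rules_defs, use Cl_W_URI[OF r4b(1)] Cl_W[OF r4b(1)] Cl_W[OF r4b(2)] r4b.IH in \<open>auto simp: inst_defs W_res enc_URI\<close>)
next
  case (r5a A B)
  show ?case unfolding prod.case
    by (rule prv_rule[of "[fCL v0 (pc BotC) v1]" "fCL v1 (pc BotC) v0" "[enc_term A, enc_term B]"])
      (simp add: rules_defs, use Cl_W[OF r5a(1)] r5a.IH in \<open>auto simp: inst_defs W_res\<close>)
next
  case (r5b A B C)
  show ?case unfolding prod.case
    by (rule prv_rule[of "[fCL v0 (pc BotC) v1, fCL v2 (pc Sc) v0]" "fCL v2 (pc BotC) v1" "[enc_term A, enc_term B, enc_term C]"])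
      (simp add: rules_defs, use Cl_W[OF r5b(1)] Cl_W[OF r5b(2)] r5b.IH in \<open>auto simp: inst_defs W_res\<close>)
next
  case (r5c A B)
  have "enc_term B \<in> W" using r5c(2) class_terms_sub W_term by blast
  then show ?case unfolding prod.case
    using Cl_W[OF r5c(1)] r5c.IH prv_class[OF r5c(2)]
    by - (rule prv_rule[of "[fCL v0 (pc BotC) v0, fCLASS v1]" "fCL v0 (pc BotC) v1" "[enc_term A, enc_term B]"],
      simp add: rules_defs, auto simp: inst_defs W_res)
next
  case (r6a A B)
  show ?case unfolding prod.case
    by (rule prv_rule[of "[fCL v0 (pc BotP) v1]" "fCL v1 (pc BotP) v0" "[enc_term A, enc_term B]"])
      (simp add: rules_defs, use Cl_W[OF r6a(1)] r6a.IH in \<open>auto simp: inst_defs W_res\<close>)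
next
  case (r6b A B C)
  show ?case unfolding prod.case
    by (rule prv_rule[of "[fCL v0 (pc BotP) v1, fCL v2 (pc Sp) v0]" "fCL v2 (pc BotP) v1" "[enc_term A, enc_term B, enc_term C]"])
      (simp add: rules_defs, use Cl_W[OF r6b(1)] Cl_W[OF r6b(2)] r6b.IH in \<open>auto simp: inst_defs W_res\<close>)
next
  case (r6c A B)
  have "enc_term B \<in> W" using r6c(2) prop_terms_sub W_term by blast
  moreover have "B \<notin> URI ` reserved" using r6c(3) by simp
  ultimately show ?case unfolding prod.case
    using Cl_W[OF r6c(1)] r6c.IH prv_prop[OF r6c(2)]
    by - (rule prv_rule[of "[fCL v0 (pc BotP) v0, fPROP v1]" "fCL v0 (pc BotP) v1" "[enc_term A, enc_term B]"],
      simp add: rules_defs, auto simp: inst_defs W_res)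
next
  case (r7a A C B D)
  show ?case unfolding prod.case
    by (rule prv_rule[of "[fCL v0 (pc Dom) v2, fCL v1 (pc Dom) v3, fCL v2 (pc BotC) v3]" "fCL v0 (pc BotP) v1" "[enc_term A, enc_term B, enc_term C, enc_term D]"])
      (simp add: rules_defs, use Cl_W[OF r7a(1)] Cl_W[OF r7a(2)] r7a.IH in \<open>auto simp: inst_defs W_res\<close>)
next
  case (r7b A C B D)
  show ?case unfolding prod.case
    by (rule prv_rule[of "[fCL v0 (pc Range) v2, fCL v1 (pc Range) v3, fCL v2 (pc BotC) v3]" "fCL v0 (pc BotP) v1" "[enc_term A, enc_term B, enc_term C, enc_term D]"])
      (simp add: rules_defs, use Cl_W[OF r7b(1)] Cl_W[OF r7b(2)] r7b.IH in \<open>auto simp: inst_defs W_res\<close>)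
next
  case (r8a A B D X Y)
  show ?case unfolding prod.case
    by (rule prv_rule[of "[fCL v0 (pc Dom) v1, fCL (ut 2) (pc Sp) v0, fCL v3 v2 v4]" "fCL v3 (pc Type) v1" "[enc_term A, enc_term B, enc_uri D, enc_term X, enc_term Y]"])
      (simp add: rules_defs, use Cl_W_URI[OF r8a(2)] Cl_W[OF r8a(1)] Cl_W[OF r8a(3)] r8a.IH in \<open>auto simp: inst_defs W_res enc_URI\<close>)
next
  case (r8b A B D X Y)
  show ?case unfolding prod.case
    by (rule prv_rule[of "[fCL v0 (pc Range) v1, fCL (ut 2) (pc Sp) v0, fCL v3 v2 v4]" "fCL v4 (pc Type) v1" "[enc_term A, enc_term B, enc_uri D, enc_term X, enc_term Y]"])
      (simp add: rules_defs, use Cl_W_URI[OF r8b(2)] Cl_W[OF r8b(1)] Cl_W[OF r8b(3)] r8b.IH in \<open>auto simp: inst_defs W_res enc_URI\<close>)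
qed

end

text \<open>Two words of which neither begins the other part at their first different letter; this
  is the witness that a \<open>NEQ\<close> fact asks for.\<close>

lemma prefix_incomparable:
  fixes u v :: "bool list"
  assumes "\<And>a b. u @ a \<noteq> v @ b"
  shows "\<exists>p c u' v'. u = p @ c # u' \<and> v = p @ (\<not> c) # v'"
  using assms
proof (induction u arbitrary: v)
  case Nil
  then show ?case by (metis append_Nil append_Nil2)
next
  case (Cons c u)
  show ?case
  proof (cases v)
    case Nil
    then show ?thesis using Cons.prems by (metis append_Nil append_Nil2)
  next
    case (Cons d w)
    show ?thesis
    proof (cases "c = d")
      case True
      then have "u @ a \<noteq> w @ b" for a b using Cons.prems[of a b] Cons by simp
      from Cons.IH[OF this] obtain p c' u' v' where "u = p @ c' # u'" "w = p @ (\<not> c') # v'" by blast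
      then show ?thesis using Cons True by (intro exI[of _ "c # p"]) auto
    next
      case False
      then have "c # u = [] @ c # u \<and> v = [] @ (\<not> c) # w" using Cons by simp
      then show ?thesis by blast
    qed
  qed
qed

context completeness
begin

text \<open>By \<open>r6c\<close> a mere predicate of the first graph can become an object in the
  closure, and a blank node may be mapped to it. Its code as a term need not be a part of the
  instance; only the code without the leading \<open>False\<close> is.\<close>

lemma prv_term_gs:
  assumes "t \<in> terms_of (set gs)" "t \<notin> URI ` reserved"
  shows "prv (fTERM (enc_term t))"
proof (cases "enc_term t \<in> subwords x")
  case True
  then show ?thesis using prv_term assms(2) by blast
next
  case False
  obtain s p u where h: "(s, p, u) \<in> set gs" "t \<in> {s, URI p, u}" using assms(1) by (auto simp: terms_of_def)
  then have hg: "(s, p, u) \<in> set gs \<union> set hs" by simp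
  note sub = subword_codes[OF hg]
  have t: "t = URI p" using h(2) sub False by auto
  then obtain v where v: "p = Uri v" using assms(2) by (cases p) (auto simp: reserved_def)
  have n: "enc_name v \<in> subwords x"
    using subwords_trans[OF sub(2), of "enc_tag 7" "enc_name v" "[]"] v by (simp add: enc_uri.simps)
  have e: "enc_term t = (enc_tag 0 @ enc_tag 7) @ enc_name v" by (simp add: t v enc_term.simps enc_uri.simps)
  have W: "enc_term t \<in> W" using W_term assms(1) by blast
  have c: "prv (fCONST (enc_term t))"
    by (rule prv_rule[of "[fNAME v0]" "fCONST [Const (enc_tag 0 @ enc_tag 7), Var 0]" "[enc_name v]"])
      (simp add: rules_defs, use W_sub(1)[OF n] W prv_name[OF n] e in \<open>auto simp: inst_defs\<close>)
  show ?thesis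
    by (rule prv_rule[of "[fCONST v0]" "fTERM v0" "[enc_term t]"])
      (simp add: rules_defs, use c W in \<open>auto simp: inst_defs\<close>)
qed

lemma blanks_iff: "b \<in> set blanks \<longleftrightarrow> (\<exists>s p t. (s, p, t) \<in> set hs \<and> (s = BNode b \<or> t = BNode b))"
  by (force simp: blanks_def split: rdf_term.splits)

lemma blank_codes:
  assumes "b \<in> set blanks"
  shows "enc_term (BNode b) \<in> subwords x" "\<mu> b \<in> terms_of (set gs)" "\<mu> b \<notin> URI ` reserved"
proof -
  obtain s p t where h: "(s, p, t) \<in> set hs" "s = BNode b \<or> t = BNode b" using assms blanks_iff by blast
  then have "(s, p, t) \<in> set gs \<union> set hs" by simp
  from subword_codes[OF this] h(2) show "enc_term (BNode b) \<in> subwords x" by auto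
  have "(map_blank \<mu> s, p, map_blank \<mu> t) \<in> Cl_B (set gs)" using hom h(1) by force
  from Cl_B_graph(1-4)[OF graphs(1) this] h(2)
  show "\<mu> b \<in> terms_of (set gs)" "\<mu> b \<notin> URI ` reserved" by auto
qed

text \<open>Entries are added in front of a shorter environment, so every environment in the
  derivation is a suffix of \<open>e\<close>. For this reason \<open>W\<close> contains these
  suffixes.\<close>

lemma prv_lookup:
  assumes "\<forall>c\<in>set cs. c \<in> set blanks" "enc_env (map (\<lambda>b. (b, \<mu> b)) blanks) = u @ enc_env (map (\<lambda>b. (b, \<mu> b)) cs)"
    "b \<in> set cs"
  shows "prv (fLOOKUP (enc_env (map (\<lambda>b. (b, \<mu> b)) cs)) (enc_term (BNode b)) (enc_term (\<mu> b)))"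
  using assms
proof (induction cs arbitrary: u)
  case (Cons c cs)
  let ?e = "enc_env (map (\<lambda>b. (b, \<mu> b)) cs)"
  let ?f = "enc_env (map (\<lambda>b. (b, \<mu> b)) (c # cs))"
  let ?c = "enc_term (BNode c)" and ?b = "enc_term (BNode b)"
  have f: "?f = ?c @ enc_term (\<mu> c) @ ?e" by (simp add: enc_env_Cons)
  have "e = (u @ ?c @ enc_term (\<mu> c)) @ ?e" using Cons.prems(2) f by (simp add: e_def)
  then have eW: "?e \<in> W" unfolding W_def by blast
  have "e = u @ ?f" using Cons.prems(2) by (simp add: e_def)
  then have fW: "?f \<in> W" unfolding W_def by blast
  have c: "c \<in> set blanks" and b: "b \<in> set blanks" using Cons.prems by auto
  note cc = blank_codes[OF c] and bb = blank_codes[OF b]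
  have W: "?c \<in> W" "?b \<in> W" "enc_term (\<mu> c) \<in> W" "enc_term (\<mu> b) \<in> W"
    using W_sub(1)[OF cc(1)] W_sub(1)[OF bb(1)] W_term[OF cc(2)] W_term[OF bb(2)] by auto
  note pc = prv_blank[OF cc(1)] and pt = prv_term_gs[OF cc(2,3)]
  show ?case
  proof (cases "c = b")
    case True
    show ?thesis
      by (rule prv_rule[of "[fBLANK v0, fTERM v1]" "fLOOKUP [Var 0, Var 1, Var 2] v0 v1" "[?c, enc_term (\<mu> c), ?e]"])
        (simp add: rules_defs, use True W eW fW pc pt f in \<open>auto simp: inst_defs\<close>)
  next
    case False
    have IH: "prv (fLOOKUP ?e ?b (enc_term (\<mu> b)))"
      using Cons.IH[of "u @ ?c @ enc_term (\<mu> c)"] Cons.prems False f by simp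
    have "?c @ a \<noteq> ?b @ a'" for a a' using False enc_term_prefix by simp
    then obtain p d v w where d: "?c = p @ d # v" "?b = p @ (\<not> d) # w" using prefix_incomparable by metis
    have "p \<in> subwords x" "v \<in> subwords x" "w \<in> subwords x"
      using subwords_trans[OF cc(1), of "[]" p "d # v"] subwords_trans[OF cc(1), of "p @ [d]" v "[]"]
        subwords_trans[OF bb(1), of "p @ [\<not> d]" w "[]"] d by simp_all
    then have W': "p \<in> W" "v \<in> W" "w \<in> W" using W_sub(1) by auto
    have neq: "prv (fNEQ ?c ?b)"
      by (rule prv_rule[of "[]" "fNEQ [Var 0, Const [d], Var 1] [Var 0, Const [\<not> d], Var 2]" "[p, v, w]"])
        ((cases d; simp add: rules_defs), use W W' d in \<open>auto simp: inst_defs\<close>)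
    show ?thesis
      by (rule prv_rule[of "[fLOOKUP v0 v1 v2, fNEQ v3 v1, fBLANK v3, fTERM v4]" "fLOOKUP [Var 3, Var 4, Var 0] v1 v2"
            "[?e, ?b, enc_term (\<mu> b), ?c, enc_term (\<mu> c)]"])
        (simp add: rules_defs, use W eW fW pc pt f neq IH in \<open>auto simp: inst_defs\<close>)
  qed
qed simp

lemma e_W: "e \<in> W"
proof -
  have "e = [] @ e" by simp
  then show ?thesis unfolding W_def by blast
qed

lemma prv_map:
  assumes "(s, p, t) \<in> set hs" "r = s \<or> r = t"
  shows "prv (fMAP e (enc_term r) (enc_term (map_blank \<mu> r)))"
proof -
  have "(s, p, t) \<in> set gs \<union> set hs" using assms(1) by simp
  note sub = subword_codes[OF this] and nr = not_reserved[OF this]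
  have r: "enc_term r \<in> subwords x" "r \<notin> URI ` reserved" using sub nr assms(2) by auto
  show ?thesis
  proof (cases "r \<in> UL")
    case True
    then have m: "map_blank \<mu> r = r" by (auto simp: UL_def)
    have c: "prv (fCONST (enc_term r))" using prv_const[OF r(1)] True r(2) by simp
    show ?thesis
      by (rule prv_rule[of "[fCONST v0]" "fMAP v1 v0 v0" "[enc_term r, e]"])
        (simp add: rules_defs, use m c e_W W_sub(1)[OF r(1)] in \<open>auto simp: inst_defs\<close>)
  next
    case False
    then obtain b where b: "r = BNode b" by (cases r) (auto simp: UL_def)
    then have bl: "b \<in> set blanks" using assms blanks_iff by blast
    have l: "prv (fLOOKUP e (enc_term r) (enc_term (\<mu> b)))"
      unfolding e_def b by (rule prv_lookup[of _ "[]"]) (use bl in auto)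
    have "enc_term (\<mu> b) \<in> W" using W_term blank_codes[OF bl] by blast
    then show ?thesis
      using l e_W W_sub(1)[OF r(1)] b
      by - (rule prv_rule[of "[fLOOKUP v0 v1 v2]" "fMAP v0 v1 v2" "[e, enc_term r, enc_term (\<mu> b)]"],
        simp add: rules_defs, auto simp: inst_defs)
  qed
qed

lemma prv_query: "hs = us @ vs \<Longrightarrow> prv (fQUERY e (enc_triples vs @ [False]))"
proof (induction us arbitrary: vs rule: rev_induct)
  case Nil
  have g: "prv (fGRAPH (False # enc_triples hs @ [False]))" using prv_graph[of gs "[]"] by simp
  have "enc_triples hs @ [False] \<in> subwords x" unfolding subwords_def x_eq
    by (rule CollectI, rule exI[of _ "enc_triples gs @ [False]"], rule exI[of _ "[]"]) simp
  then have w: "enc_triples hs @ [False] \<in> W" by (rule W_sub(1))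
  have hs: "hs = vs" using Nil by simp
  show ?case unfolding hs[symmetric]
    by (rule prv_rule[of "[fGRAPH [Const [False], Var 0]]" "fQUERY v1 v0" "[enc_triples hs @ [False], e]"])
      (simp add: rules_defs, use g w e_W in \<open>auto simp: inst_defs\<close>)
next
  case (snoc h us)
  obtain s p t where h: "h = (s, p, t)" by (metis prod_cases3)
  let ?r = "enc_triples vs @ [False]"
  have hs: "(s, p, t) \<in> set hs" using snoc.prems h by simp
  then have hg: "(s, p, t) \<in> set gs \<union> set hs" by simp
  note sub = subword_codes[OF hg] and nr = not_reserved[OF hg]
  have IH: "prv (fQUERY e (True # enc_term s @ enc_uri p @ enc_term t @ ?r))"
    using snoc.IH[of "h # vs"] snoc.prems h by simp
  have "?r \<in> subwords x" unfolding subwords_def x_eq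
    by (rule CollectI, rule exI[of _ "enc_triples gs @ False # enc_triples (us @ [h])"], rule exI[of _ "[]"])
      (use snoc.prems in simp)
  then have r: "?r \<in> W" by (rule W_sub(1))
  have cl: "(map_blank \<mu> s, p, map_blank \<mu> t) \<in> Cl_B (set gs)" using hom hs by force
  show ?case
    by (rule prv_rule[of "[fQUERY v0 [Const [True], Var 1, Var 2, Var 3, Var 4], fTERM v1, fURI v2, fTERM v3,
       fMAP v0 v1 v5, fMAP v0 v3 v6, fCL v5 v2 v6]" "fQUERY v0 v4"
       "[e, enc_term s, enc_uri p, enc_term t, ?r, enc_term (map_blank \<mu> s), enc_term (map_blank \<mu> t)]"])
      (simp add: rules_defs, use IH r W_sub(1)[OF sub(1)] W_sub(1)[OF sub(2)] W_sub(1)[OF sub(3)] e_W Cl_W[OF cl]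
        prv_term[OF sub(1) nr(1)] prv_uri[OF sub(2)] prv_term[OF sub(3) nr(2)] prv_Cl[OF cl]
        prv_map[OF hs, of s] prv_map[OF hs, of t] in \<open>auto simp: inst_defs\<close>)
qed

lemma prv_accept: "prv fACCEPT"
  by (rule prv_rule[of "[fQUERY v0 [Const [False]]]" "fACCEPT" "[e]"])
    (simp add: rules_defs, use prv_query[of hs "[]"] e_W in \<open>auto simp: inst_defs\<close>)

lemma length_x: "length hs \<le> length x"
proof -
  have "length ts \<le> length (enc_triples ts)" for ts by (induction ts) auto
  from this[of hs] show ?thesis by (simp add: x_eq)
qed

lemma length_code:
  assumes "t \<in> terms_of (set gs)" shows "length (enc_term t) \<le> length x + 1"
proof -
  obtain s p u where h: "(s, p, u) \<in> set gs" "t \<in> {s, URI p, u}" using assms by (auto simp: terms_of_def)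
  then have "(s, p, u) \<in> set gs \<union> set hs" by simp
  note sub = subword_codes[OF this]
  show ?thesis using h(2) subwords_length[OF sub(1)] subwords_length[OF sub(2)] subwords_length[OF sub(3)]
    by (auto simp: enc_URI)
qed

lemma length_e: "length e \<le> (2 * length x) * (2 * length x + 1)"
proof -
  have "length bs \<le> 2 * length ts"
    if "bs = concat (map (\<lambda>(s, p, t). (case s of BNode b \<Rightarrow> [b] | _ \<Rightarrow> []) @ (case t of BNode b \<Rightarrow> [b] | _ \<Rightarrow> [])) ts)"
    for bs :: "bool list list" and ts :: "name_triple list"
    using that by (induction ts arbitrary: bs) (auto split: rdf_term.splits)
  from this[OF blanks_def] have b: "length blanks \<le> 2 * length x" using length_x by linarith
  have "length (enc_env (map (\<lambda>b. (b, \<mu> b)) bs)) \<le> length bs * (2 * length x + 1)" if "set bs \<subseteq> set blanks" for bs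
    using that
  proof (induction bs)
    case (Cons b bs)
    then have "length (enc_term (BNode b)) \<le> length x" "length (enc_term (\<mu> b)) \<le> length x + 1"
      using blank_codes[of b] subwords_length length_code by auto
    with Cons show ?case by (simp add: enc_env_Cons)
  qed (simp add: enc_env_def)
  from this[of blanks] have "length e \<le> length blanks * (2 * length x + 1)" by (simp add: e_def)
  also have "\<dots> \<le> (2 * length x) * (2 * length x + 1)" using b by (rule mult_le_mono1)
  finally show ?thesis .
qed

text \<open>The bound on the cardinality counts the parts of the instance twice, without and with a
  leading \<open>False\<close>, then the suffixes of \<open>e\<close> including the empty one, and
  the seven reserved names. The length of \<open>e\<close> is quadratic: at most two blank nodes per
  triple of \<open>hs\<close>, each with two codes.\<close>

lemma W_bounds:
  assumes "n = length x"
  shows "finite W" "card W \<le> 2 * ((n + 1) * (n + 1)) + ((2 * n) * (2 * n + 1) + 1) + 7"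
    "w \<in> W \<Longrightarrow> length w \<le> n + 1 + (2 * n) * (2 * n + 1) + 7"
proof -
  have suf: "{w. \<exists>u. e = u @ w} \<subseteq> (\<lambda>i. drop i e) ` {..length e}"
  proof
    fix w assume "w \<in> {w. \<exists>u. e = u @ w}"
    then obtain u where u: "e = u @ w" by blast
    show "w \<in> (\<lambda>i. drop i e) ` {..length e}" by (rule image_eqI[of _ _ "length u"]) (simp_all add: u)
  qed
  have fin: "finite ((\<lambda>i. drop i e) ` {..length e})" by simp
  have suf_card: "card {w. \<exists>u. e = u @ w} \<le> length e + 1" "finite {w. \<exists>u. e = u @ w}"
    using card_mono[OF fin suf] card_image_le[of "{..length e}" "\<lambda>i. drop i e"] finite_subset[OF suf fin]
    by simp_all
  have res: "finite (enc_uri ` reserved)" "card (enc_uri ` reserved) \<le> 7"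
    using card_length[of "map enc_uri [Sp, Sc, Type, Dom, Range, BotC, BotP]"] by (simp_all add: reserved_def)
  show "finite W" unfolding W_def using subwords_finite(1)[of x] suf_card(2) res(1) by simp
  have "card ((#) False ` subwords x) \<le> card (subwords x)" by (rule card_image_le) (rule subwords_finite)
  then show "card W \<le> 2 * ((n + 1) * (n + 1)) + ((2 * n) * (2 * n + 1) + 1) + 7"
    using card_Un_le[of "subwords x \<union> (#) False ` subwords x \<union> {w. \<exists>u. e = u @ w}" "enc_uri ` reserved"]
      card_Un_le[of "subwords x \<union> (#) False ` subwords x" "{w. \<exists>u. e = u @ w}"]
      card_Un_le[of "subwords x" "(#) False ` subwords x"]
      subwords_finite(2)[of x] suf_card(1) res(2) length_e
    unfolding W_def assms by linarith
  \<comment> \<open>The longest of these codes is \<open>enc_tag 6\<close>: six times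
    \<open>True\<close> and the final \<open>False\<close>.\<close>
  have "length (enc_uri u) \<le> 7" if "u \<in> reserved" for u
    using that by (auto simp: reserved_def enc_uri.simps enc_tag_def)
  moreover have "length w \<le> length e" if "e = u @ w" for u w using that by simp
  ultimately show "w \<in> W \<Longrightarrow> length w \<le> n + 1 + (2 * n) * (2 * n + 1) + 7"
    unfolding W_def assms
    by (elim UnE CollectE imageE exE) (use subwords_length length_e in \<open>force+\<close>)
qed

end

theorem entailment_problem_NP: "entailment_problem \<in> NP"
proof -
  define f where "f n = 2 * ((n + 1) * (n + 1)) + ((2 * n) * (2 * n + 1) + 1) + 7 + (n + 1 + (2 * n) * (2 * n + 1) + 7)" for n :: nat
  have "poly_bounded f" unfolding f_def by (intro poly_bounded_intros)
  then obtain p where p: "\<And>n. f n \<le> poly p n" by (auto simp: poly_bounded_def)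
  show ?thesis
  proof (rule NP_proof_system[where m = 7 and rs = all_rules and g = 15 and p = p])
    fix x :: "bool list"
    have snd: "sound_rule x r" if "r \<in> set all_rules" for r
      using that unfolding all_rules_def set_append
      by (elim UnE) (rule sound_syntax_rules sound_parse_rules sound_env_rules sound_closure_rules
        sound_usage_rules, assumption)+
    show "\<exists>mean. mean (0, [x]) \<and>
      (\<forall>(ps, c)\<in>set all_rules. \<forall>\<sigma>. (\<forall>p\<in>set ps. mean (atom_inst \<sigma> p)) \<longrightarrow> mean (atom_inst \<sigma> c)) \<and>
      (mean (15, []) \<longrightarrow> x \<in> entailment_problem)"
    proof (intro exI[of _ "meaning x"] conjI)
      show "meaning x (0, [x])" by (simp add: meaning_def)
      show "\<forall>(ps, c)\<in>set all_rules. \<forall>\<sigma>. (\<forall>p\<in>set ps. meaning x (atom_inst \<sigma> p)) \<longrightarrow> meaning x (atom_inst \<sigma> c)"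
        using snd unfolding sound_rule_def by fastforce
      show "meaning x (15, []) \<longrightarrow> x \<in> entailment_problem" by (simp add: meaning_def m_accept_def)
    qed
  next
    fix x assume "x \<in> entailment_problem"
    then obtain gs hs where gh: "x = enc_instance gs hs" "is_graph (set gs)" "is_graph (set hs)" "entails (set gs) (set hs)"
      by (auto simp: entailment_problem_def)
    then obtain \<mu> where "map_triple \<mu> ` set hs \<subseteq> Cl_B (set gs)" using entails_iff_hom by blast
    then interpret C: completeness gs hs \<mu> using gh by unfold_locales
    have x: "C.x = x" by (simp add: C.x_def gh)
    have "card C.W \<le> poly p (length x)" using C.W_bounds(2)[of "length x"] p[of "length x"] x unfolding f_def by simp
    moreover have "length w \<le> poly p (length x)" if "w \<in> C.W" for w
      using C.W_bounds(3)[OF _ that, of "length x"] p[of "length x"] x unfolding f_def by simp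
    ultimately show "\<exists>W. finite W \<and> card W \<le> poly p (length x) \<and> (\<forall>w\<in>W. length w \<le> poly p (length x)) \<and>
       proves all_rules 7 W (0, [x]) (15, [])"
      using C.W_bounds(1) C.prv_accept x by blast
  qed simp
qed

section \<open>Computations as tilings\<close>

text \<open>The tile of a tape position at some time records the state, the scanned symbols, and for every tape the
  contents of the cell and the direction in which the head is to be found: 0 for here, 1 for the right,
  2 for the left. Equal state and scanned symbols along a row make the step computable from every single
  tile. \<open>None\<close> separates the rows.\<close>

type_synonym tile = "(nat \<times> nat list \<times> nat list \<times> nat list) option"

datatype label = Hor | Ver | Border | LeftPad | Sym nat | Guess | GuessEnd | Accept

text \<open>A row should read 1...1 0 2...2. Rows of 1 alone or of 2 alone pass this local test as
  well; they are ruled out by the conditions on the first row and by \<open>Ver\<close>.\<close>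

fun dir_hor :: "nat \<Rightarrow> nat \<Rightarrow> bool" where
  "dir_hor d d' \<longleftrightarrow> (if d = 1 then d' \<in> {0, 1} else d' = 2)"

text \<open>A tile knows the side on which the head is but not the distance. After a move towards
  the tile two directions are therefore possible, and \<open>dir_hor\<close> decides between
  them.\<close>

fun dir_ver :: "move \<Rightarrow> nat \<Rightarrow> nat \<Rightarrow> bool" where
  "dir_ver Stay d d' \<longleftrightarrow> d' = d"
| "dir_ver MoveRight d d' \<longleftrightarrow> (if d = 2 then d' \<in> {0, 2} else d' = 1)"
| "dir_ver MoveLeft d d' \<longleftrightarrow> (if d = 1 then d' \<in> {0, 1} else d' = 2)"

definition dir :: "int \<Rightarrow> int \<Rightarrow> nat" where
  "dir h j = (if h = j then 0 else if h > j then 1 else 2)"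

locale tiling =
  fixes M :: tm
  assumes tm: "is_tm M" and two_tapes: "2 \<le> tapes M"
begin

text \<open>A halted machine rewrites what it scans and stays, so that a run can be prolonged to any
  number of rows.\<close>

definition action :: "nat \<Rightarrow> nat list \<Rightarrow> nat \<times> (nat \<times> move) list" where
  "action q rs = (if q < states M then delta M q rs else (q, keep rs))"

definition tiles :: "tile set" where
  "tiles = insert None (Some ` ({..states M} \<times> {rs. set rs \<subseteq> {..<symbols M} \<and> length rs = tapes M} \<times>
     {cs. set cs \<subseteq> {..<symbols M} \<and> length cs = tapes M} \<times> {ds. set ds \<subseteq> {..<3} \<and> length ds = tapes M}))"

text \<open>A separator satisfies every horizontal constraint, so the end of a row and the start of
  the next are unrelated, while \<open>Ver\<close> keeps separators in their column. The scanned
  symbol \<open>rs ! u\<close> is checked only in the tile holding head \<open>u\<close>;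
  \<open>Hor\<close> spreads it over the row. \<open>Guess\<close> admits any letters followed by
  blanks on the second tape.\<close>

fun rel0 :: "label \<Rightarrow> tile \<Rightarrow> tile \<Rightarrow> bool" where
  "rel0 Hor (Some (q, rs, cs, ds)) (Some (q', rs', cs', ds')) \<longleftrightarrow>
     q' = q \<and> rs' = rs \<and> (\<forall>u<tapes M. dir_hor (ds ! u) (ds' ! u))"
| "rel0 Hor _ _ \<longleftrightarrow> True"
| "rel0 Ver None None \<longleftrightarrow> True"
| "rel0 Ver (Some (q, rs, cs, ds)) (Some (q', rs', cs', ds')) \<longleftrightarrow>
     q' = fst (action q rs) \<and>
     (\<forall>u<tapes M. dir_ver (snd (snd (action q rs) ! u)) (ds ! u) (ds' ! u) \<and>
       (if ds ! u = 0 then rs ! u = cs ! u \<and> cs' ! u = fst (snd (action q rs) ! u) else cs' ! u = cs ! u))"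
| "rel0 Ver _ _ \<longleftrightarrow> False"
| "rel0 Border a _ \<longleftrightarrow> a = None"
| "rel0 LeftPad (Some (q, rs, cs, ds)) _ \<longleftrightarrow> q = 0 \<and> (\<forall>u<tapes M. ds ! u = 1 \<and> (u \<noteq> 1 \<longrightarrow> cs ! u = 0))"
| "rel0 (Sym c) (Some (q, rs, cs, ds)) _ \<longleftrightarrow>
     q = 0 \<and> cs ! 0 = c \<and> (\<forall>u<tapes M. ds ! u \<noteq> 1 \<and> (2 \<le> u \<longrightarrow> cs ! u = 0))"
| "rel0 Guess (Some (q, rs, cs, ds)) (Some (q', rs', cs', ds')) \<longleftrightarrow>
     cs ! 1 < 3 \<and> (cs ! 1 = 0 \<longrightarrow> cs' ! 1 = 0)"
| "rel0 GuessEnd (Some (q, rs, cs, ds)) _ \<longleftrightarrow> cs ! 1 = 0"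
| "rel0 Accept (Some (q, rs, cs, ds)) _ \<longleftrightarrow> q = states M \<and> cs ! (tapes M - 1) = 2"
| "rel0 _ _ _ \<longleftrightarrow> False"

definition rel :: "label \<Rightarrow> tile \<Rightarrow> tile \<Rightarrow> bool" where
  "rel l a b \<longleftrightarrow> a \<in> tiles \<and> b \<in> tiles \<and> rel0 l a b"

lemma finite_tiles: "finite tiles"
  unfolding tiles_def by (simp add: finite_lists_length_eq)

section \<open>Runs of the machine as tilings\<close>

definition run_conf :: "bool list \<Rightarrow> bool list \<Rightarrow> nat \<Rightarrow> config" where
  "run_conf x y t = (step M ^^ t) (init M [x, y])"

definition valid :: "nat \<Rightarrow> config \<Rightarrow> bool" where
  "valid t c \<longleftrightarrow> fst c \<le> states M \<and> length (snd c) = tapes M \<and>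
     (\<forall>u<tapes M. \<bar>fst (snd c ! u)\<bar> \<le> int t \<and> (\<forall>i. snd (snd c ! u) i < symbols M))"

lemma step_action: "length ts = tapes M \<Longrightarrow> step M (q, ts) = (fst (action q (reads ts)), map2 act (snd (action q (reads ts))) ts)"
  by (simp add: step_def action_def act_keep reads_def[symmetric] case_prod_beta)

lemma reads_ok:
  assumes "valid t (q, ts)" shows "length (reads ts) = tapes M" "set (reads ts) \<subseteq> {..<symbols M}"
proof -
  show "length (reads ts) = tapes M" using assms by (simp add: valid_def)
  show "set (reads ts) \<subseteq> {..<symbols M}"
  proof
    fix s assume "s \<in> set (reads ts)"
    then obtain u where u: "u < length ts" "s = reads ts ! u" by (auto simp: in_set_conv_nth)
    then have "s = snd (ts ! u) (fst (ts ! u))" by (simp add: reads_def case_prod_beta)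
    then show "s \<in> {..<symbols M}" using assms u by (auto simp: valid_def)
  qed
qed

lemma action_ok:
  assumes "q \<le> states M" "length rs = tapes M" "set rs \<subseteq> {..<symbols M}"
  shows "fst (action q rs) \<le> states M" "length (snd (action q rs)) = tapes M"
    "u < tapes M \<Longrightarrow> fst (snd (action q rs) ! u) < symbols M"
proof -
  have *: "fst (action q rs) \<le> states M \<and> length (snd (action q rs)) = tapes M \<and>
    (\<forall>(w, m)\<in>set (snd (action q rs)). w < symbols M)"
    using tm assms by (auto simp: action_def is_tm_def dest: keep_ok[OF _ assms(3)])
  then show "fst (action q rs) \<le> states M" "length (snd (action q rs)) = tapes M" by auto
  show "fst (snd (action q rs) ! u) < symbols M" if "u < tapes M"
    using * that nth_mem[of u "snd (action q rs)"] by (auto simp: case_prod_beta)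
qed

lemma act_simps:
  "fst (act a (h, c)) = (case snd a of MoveLeft \<Rightarrow> h - 1 | Stay \<Rightarrow> h | MoveRight \<Rightarrow> h + 1)"
  "snd (act a (h, c)) = c(h := fst a)"
  by (cases a; simp)+

lemma step_nth:
  assumes "valid t (q, ts)" "u < tapes M" "step M (q, ts) = (q', ts')"
  shows "ts' ! u = act (snd (action q (reads ts)) ! u) (ts ! u)"
proof -
  have l: "length ts = tapes M" using assms(1) by (simp add: valid_def)
  have "q \<le> states M" using assms(1) by (simp add: valid_def)
  from action_ok(2)[OF this reads_ok[OF assms(1)]] l assms(2,3) step_action[OF l, of q]
  show ?thesis by auto
qed

lemma valid_step: "valid t c \<Longrightarrow> valid (Suc t) (step M c)"
proof -
  assume v: "valid t c"
  obtain q ts where c: "c = (q, ts)" by fastforce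
  obtain q' ts' where s: "step M (q, ts) = (q', ts')" by fastforce
  have l: "length ts = tapes M" and q: "q \<le> states M" using v by (auto simp: valid_def c)
  note ok = action_ok[OF q reads_ok[OF v[unfolded c]]]
  have q': "q' = fst (action q (reads ts))" "ts' = map2 act (snd (action q (reads ts))) ts"
    using s step_action[OF l, of q] by auto
  have "\<bar>fst (ts' ! u)\<bar> \<le> int (Suc t) \<and> (\<forall>i. snd (ts' ! u) i < symbols M)" if u: "u < tapes M" for u
  proof -
    obtain h cc where hc: "ts ! u = (h, cc)" by fastforce
    have "\<bar>h\<bar> \<le> int t" "\<forall>i. cc i < symbols M" using v u hc by (auto simp: valid_def c)
    then show ?thesis unfolding step_nth[OF v[unfolded c] u s] hc act_simps
      using ok(3)[OF u] by (auto split: move.split)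
  qed
  then show ?thesis unfolding c s using q' ok l by (simp add: valid_def)
qed

lemma valid_run: "valid t (run_conf x y t)"
proof (induction t)
  case 0
  have "cells w i < symbols M" for w i using tm by (auto simp: cells_def is_tm_def)
  then show ?case by (simp add: run_conf_def valid_def init_def)
next
  case (Suc t)
  then show ?case using valid_step by (simp add: run_conf_def)
qed

lemma run_halted: "fst (run_conf x y t) = states M \<Longrightarrow> t \<le> t' \<Longrightarrow> run_conf x y t' = run_conf x y t"
proof (induction t')
  case (Suc t')
  show ?case
  proof (cases "t \<le> t'")
    case True
    then have e: "run_conf x y t' = run_conf x y t" using Suc by simp
    obtain q ts where c: "run_conf x y t = (q, ts)" by fastforce
    have "run_conf x y (Suc t') = step M (run_conf x y t')" by (simp add: run_conf_def)
    then show ?thesis using e c Suc.prems by (simp add: step_def)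
  next
    case False
    then have "t = Suc t'" using Suc.prems by simp
    then show ?thesis by simp
  qed
qed simp

definition conf_tile :: "config \<Rightarrow> int \<Rightarrow> tile" where
  "conf_tile c j = Some (fst c, reads (snd c), map (\<lambda>(h, cc). cc j) (snd c), map (\<lambda>(h, cc). dir h j) (snd c))"

lemma conf_tile_in: "valid t c \<Longrightarrow> conf_tile c j \<in> tiles"
proof -
  assume v: "valid t c"
  obtain q ts where c: "c = (q, ts)" by fastforce
  note r = reads_ok[OF v[unfolded c]]
  have "set (map (\<lambda>(h, cc). cc j) ts) \<subseteq> {..<symbols M}"
    using v unfolding c valid_def by (force simp: in_set_conv_nth case_prod_beta)
  moreover have "set (map (\<lambda>(h, cc). dir h j) ts) \<subseteq> {..<3}" by (auto simp: dir_def)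
  ultimately show ?thesis using v r unfolding conf_tile_def tiles_def c by (simp add: valid_def)
qed

lemma conf_tile_Hor: "valid t c \<Longrightarrow> rel0 Hor (conf_tile c j) (conf_tile c (j + 1))"
  by (auto simp: conf_tile_def valid_def case_prod_beta dir_def)

lemma conf_tile_Ver: "valid t c \<Longrightarrow> rel0 Ver (conf_tile c j) (conf_tile (step M c) j)"
proof -
  assume v: "valid t c"
  obtain q ts where c: "c = (q, ts)" by fastforce
  obtain q' ts' where s: "step M (q, ts) = (q', ts')" by fastforce
  have l: "length ts = tapes M" "length ts' = tapes M"
    using v valid_step[OF v] s by (auto simp: valid_def c)
  have q': "q' = fst (action q (reads ts))" using s step_action[OF l(1), of q] by auto
  have "dir_ver (snd (snd (action q (reads ts)) ! u)) (dir (fst (ts ! u)) j) (dir (fst (ts' ! u)) j) \<and>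
     (if dir (fst (ts ! u)) j = 0 then reads ts ! u = snd (ts ! u) j \<and> snd (ts' ! u) j = fst (snd (action q (reads ts)) ! u)
      else snd (ts' ! u) j = snd (ts ! u) j)" if u: "u < tapes M" for u
  proof -
    obtain h cc where hc: "ts ! u = (h, cc)" by fastforce
    have "reads ts ! u = cc h" using u l hc by (simp add: reads_def)
    then show ?thesis unfolding step_nth[OF v[unfolded c] u s] hc act_simps
      by (cases "snd (snd (action q (reads ts)) ! u)") (auto simp: dir_def)
  qed
  then show ?thesis unfolding c s conf_tile_def using q' l by (simp add: case_prod_beta)
qed

end

text \<open>Rows of width \<open>W\<close> consist of a separator and the tape positions from \<open>- B\<close> to \<open>B\<close>, and are numbered
  consecutively: position \<open>j\<close> at time \<open>t\<close> has the number \<open>t * W + 1 + B + j\<close>. The tile \<open>F\<close> is the middle of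
  the last row, after \<open>B\<close> steps. In the first row the second tape, which holds the certificate, is only
  constrained to be a word of length at most \<open>Q\<close>.\<close>

definition constraints :: "bool list \<Rightarrow> nat \<Rightarrow> nat \<Rightarrow> (nat \<times> label \<times> nat) list" where
  "constraints x Q T = (let n = length x; B = n + Q + T; W = 2 * B + 2; F = B * W + B + 1 in
     [(0, Border, 0)] @
     concat (map (\<lambda>i. [(1 + i, LeftPad, 1 + i), (1 + i, GuessEnd, 1 + i)]) [0..<B]) @
     concat (map (\<lambda>i. [(B + 1 + i, Sym (letter (x ! i)), B + 1 + i)]) [0..<n]) @
     concat (map (\<lambda>i. [(B + 1 + n + i, Sym 0, B + 1 + n + i)]) [0..<Q + T + 1]) @
     concat (map (\<lambda>i. [(B + 1 + i, Guess, B + 1 + i + 1)]) [0..<Q]) @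
     concat (map (\<lambda>i. [(B + 1 + Q + i, GuessEnd, B + 1 + Q + i)]) [0..<n + T + 1]) @
     concat (map (\<lambda>i. [(i, Hor, i + 1), (i, Ver, i + W)]) [0..<F]) @
     [(F, Accept, F)] @
     concat (map (\<lambda>i. [(F + i, Hor, F + i + 1), (F + i, Ver, F + i + W)]) [0..<W]))"

text \<open>Turns the list into conditions on positions. The two stretches of \<open>Hor\<close> and
  \<open>Ver\<close>, between which the generator writes \<open>Accept\<close>, are joined into one
  range.\<close>

lemma constraints_Ball:
  fixes x :: "bool list"
  assumes "n = length x" "B = n + Q + T" "W = 2 * B + 2"
  shows "(\<forall>(i, l, j)\<in>set (constraints x Q T). R l i j) \<longleftrightarrow>
    R Border 0 0 \<and>
    (\<forall>i<B. R LeftPad (1 + i) (1 + i) \<and> R GuessEnd (1 + i) (1 + i)) \<and>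
    (\<forall>i<n. R (Sym (letter (x ! i))) (B + 1 + i) (B + 1 + i)) \<and>
    (\<forall>i<Q + T + 1. R (Sym 0) (B + 1 + n + i) (B + 1 + n + i)) \<and>
    (\<forall>i<Q. R Guess (B + 1 + i) (B + 1 + i + 1)) \<and>
    (\<forall>i<n + T + 1. R GuessEnd (B + 1 + Q + i) (B + 1 + Q + i)) \<and>
    (\<forall>i<B * W + B + 1 + W. R Hor i (i + 1) \<and> R Ver i (i + W)) \<and>
    R Accept (B * W + B + 1) (B * W + B + 1)"
proof -
  define F where "F = B * W + B + 1"
  have split: "(\<forall>i<F + W. P i) \<longleftrightarrow> (\<forall>i<F. P i) \<and> (\<forall>i<W. P (F + i))" for P :: "nat \<Rightarrow> bool"
  proof (intro iffI conjI allI impI)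
    fix i assume "(\<forall>i<F. P i) \<and> (\<forall>i<W. P (F + i))" "i < F + W"
    then show "P i" by (cases "i < F") (auto dest: spec[of _ "i - F"])
  qed auto
  have "constraints x Q T =
     [(0, Border, 0)] @
     concat (map (\<lambda>i. [(1 + i, LeftPad, 1 + i), (1 + i, GuessEnd, 1 + i)]) [0..<B]) @
     concat (map (\<lambda>i. [(B + 1 + i, Sym (letter (x ! i)), B + 1 + i)]) [0..<n]) @
     concat (map (\<lambda>i. [(B + 1 + n + i, Sym 0, B + 1 + n + i)]) [0..<Q + T + 1]) @
     concat (map (\<lambda>i. [(B + 1 + i, Guess, B + 1 + i + 1)]) [0..<Q]) @
     concat (map (\<lambda>i. [(B + 1 + Q + i, GuessEnd, B + 1 + Q + i)]) [0..<n + T + 1]) @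
     concat (map (\<lambda>i. [(i, Hor, i + 1), (i, Ver, i + W)]) [0..<F]) @
     [(F, Accept, F)] @
     concat (map (\<lambda>i. [(F + i, Hor, F + i + 1), (F + i, Ver, F + i + W)]) [0..<W])"
    unfolding constraints_def F_def assms Let_def by (rule refl)
  then show ?thesis unfolding F_def[symmetric] split[of "\<lambda>i. R Hor i (i + 1) \<and> R Ver i (i + W)"]
    by (simp only: set_append set_concat set_map ball_Un ball_UN list.set ball_simps bex_simps prod.case
        set_upt atLeast0LessThan lessThan_iff Ball_def[of "{..<_}"] simp_thms conj_assoc)
      (intro iffI; elim conjE; intro conjI; assumption)
qed

context tiling
begin

lemma accepting_tiling:
  assumes "length y \<le> Q" "t \<le> T" "1 \<le> T" "yields_in M [x, y] t [True]"
  shows "\<exists>\<tau>. \<forall>(i, l, j)\<in>set (constraints x Q T). rel l (\<tau> i) (\<tau> j)"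
proof -
  define n B where "n = length x" and "B = n + Q + T"
  define W where "W = 2 * B + 2"
  define pos where "pos k = int (k mod W) - 1 - int B" for k
  \<comment> \<open>Number \<open>k\<close> lies in row \<open>k div W\<close>; column 0 is the
    separator and column \<open>B + 1\<close> is cell 0. The tiling continues beyond row
    \<open>B\<close>, because vertical constraints reach into later rows.\<close>
  define \<tau> where "\<tau> k = (if k mod W = 0 then None else conf_tile (run_conf x y (k div W)) (pos k))" for k
  have W: "W > 0" by (simp add: W_def)
  have "t \<le> B" using assms(2) by (simp add: B_def)
  have in_t: "\<tau> k \<in> tiles" for k
    using conf_tile_in[OF valid_run] by (simp add: \<tau>_def tiles_def)
  have row0: "\<tau> i = conf_tile (run_conf x y 0) (int i - 1 - int B)" if "0 < i" "i < W" for i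
    using that by (simp add: \<tau>_def pos_def)
  have init: "run_conf x y 0 = (0, map (\<lambda>u. (0, cells (if u < 2 then [x, y] ! u else []))) [0..<tapes M])"
    by (simp add: run_conf_def init_def numeral_2_eq_2)
  have tile0: "conf_tile (run_conf x y 0) j = Some (0, reads (snd (run_conf x y 0)),
      map (\<lambda>u. cells (if u < 2 then [x, y] ! u else []) j) [0..<tapes M], map (\<lambda>u. dir 0 j) [0..<tapes M])" for j
    by (simp add: conf_tile_def init)
  have hor: "rel0 Hor (\<tau> k) (\<tau> (k + 1))" for k
  proof (cases "k mod W = 0 \<or> (k + 1) mod W = 0")
    case True
    then show ?thesis by (cases "\<tau> k"; cases "\<tau> (k + 1)") (auto simp: \<tau>_def conf_tile_def)
  next
    case False
    then have m: "(k + 1) mod W = k mod W + 1" by (metis Suc_eq_plus1 mod_Suc)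
    then have "(k + 1) div W = k div W" by (metis False Suc_eq_plus1 div_Suc)
    then show ?thesis using False conf_tile_Hor[OF valid_run, of x y "k div W" "pos k"] m
      by (simp add: \<tau>_def pos_def algebra_simps)
  qed
  have ver: "rel0 Ver (\<tau> k) (\<tau> (k + W))" for k
  proof (cases "k mod W = 0")
    case False
    have "run_conf x y (Suc (k div W)) = step M (run_conf x y (k div W))" by (simp add: run_conf_def)
    then show ?thesis using False W conf_tile_Ver[OF valid_run, of x y "k div W" "pos k"]
      by (simp add: \<tau>_def pos_def)
  qed (simp add: \<tau>_def)
  obtain q ts where c: "run_conf x y t = (q, ts)" by fastforce
  then have q: "q = states M" "snd (last ts) = cells [True]"
    using assms(4) by (auto simp: yields_in_def run_conf_def)
  \<comment> \<open>After halting the configuration repeats, so row \<open>B\<close> still shows the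
    halting configuration.\<close>
  then have cB: "run_conf x y B = (q, ts)" using run_halted[of x y t B] c \<open>t \<le> B\<close> by simp
  have lts: "length ts = tapes M" using valid_run[of t x y] c by (simp add: valid_def)
  then have "ts \<noteq> []" using two_tapes by auto
  then have lst: "last ts = ts ! (tapes M - 1)" "tapes M - 1 < length ts" using lts two_tapes by (auto simp: last_conv_nth)
  let ?F = "B * W + B + 1"
  have "?F mod W = (B + 1) mod W" "?F div W = B + (B + 1) div W"
    using W div_mult_self3[of W B "B + 1"] mod_mult_self3[of B W "B + 1"] by (simp_all only: add.assoc)
  then have F: "?F mod W = B + 1" "?F div W = B" by (simp_all add: W_def)
  have acc: "rel0 Accept (\<tau> ?F) (\<tau> ?F)"
  proof -
    have "\<tau> ?F = conf_tile (q, ts) 0" unfolding \<tau>_def pos_def F using cB by simp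
    then show ?thesis using q lst by (simp add: conf_tile_def case_prod_beta cells_def)
  qed
  have guess: "rel0 Guess (\<tau> (B + 1 + i)) (\<tau> (B + 1 + i + 1))" if "i < Q" for i
  proof -
    have "rel0 Guess (conf_tile (run_conf x y 0) (int i)) (conf_tile (run_conf x y 0) (int i + 1))"
      using two_tapes by (simp add: tile0) (auto simp: cells_def)
    then show ?thesis using row0[of "B + 1 + i"] row0[of "B + 1 + i + 1"] that
      by (simp add: W_def B_def algebra_simps)
  qed
  show ?thesis
    unfolding rel_def constraints_Ball[OF n_def B_def W_def]
  proof (intro exI[of _ \<tau>] conjI allI impI in_t hor ver acc guess)
    show "rel0 Border (\<tau> 0) (\<tau> 0)" by (simp add: \<tau>_def)
    fix i
    show "rel0 LeftPad (\<tau> (1 + i)) (\<tau> (1 + i))" if "i < B"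
      using row0[of "1 + i"] that by (simp add: tile0 W_def dir_def) (auto simp: cells_def nth_Cons')
    show "rel0 GuessEnd (\<tau> (1 + i)) (\<tau> (1 + i))" if "i < B"
      using row0[of "1 + i"] that two_tapes by (simp add: tile0 W_def cells_def)
    show "rel0 (Sym (letter (x ! i))) (\<tau> (B + 1 + i)) (\<tau> (B + 1 + i))" if "i < n"
      using row0[of "B + 1 + i"] that two_tapes
      by (simp add: tile0 W_def dir_def B_def) (auto simp: cells_def letter_def n_def)
    show "rel0 (Sym 0) (\<tau> (B + 1 + n + i)) (\<tau> (B + 1 + n + i))" if "i < Q + T + 1"
      using row0[of "B + 1 + n + i"] that two_tapes
      by (simp add: tile0 W_def dir_def B_def) (auto simp: cells_def n_def simp flip: length_greater_0_conv)
    show "rel0 GuessEnd (\<tau> (B + 1 + Q + i)) (\<tau> (B + 1 + Q + i))" if "i < n + T + 1"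
      using row0[of "B + 1 + Q + i"] that two_tapes assms(1)
      by (simp add: tile0 W_def B_def) (auto simp: cells_def)
  qed
qed

text \<open>The move leaves the direction open only on the side to which the head moves. There
  \<open>dir_hor\<close> decides: the cell next to the old head has a neighbour with forced
  direction, and so the head is placed on it and not further out. The strict bound on
  \<open>h\<close> keeps the new position inside the row.\<close>

lemma dir_update:
  fixes h b :: int
  assumes ver: "\<And>j. - b \<le> j \<Longrightarrow> j \<le> b \<Longrightarrow> dir_ver m (dir h j) (D j)"
    and hor: "\<And>j. - b \<le> j \<Longrightarrow> j < b \<Longrightarrow> dir_hor (D j) (D (j + 1))"
    and h: "\<bar>h\<bar> < b" and j: "- b \<le> j" "j \<le> b"
  shows "D j = dir (case m of MoveLeft \<Rightarrow> h - 1 | Stay \<Rightarrow> h | MoveRight \<Rightarrow> h + 1) j"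
proof -
  have hb: "- b \<le> h" "h < b" "- b < h" "h \<le> b" using h by linarith+
  show ?thesis
  proof (cases m)
    case Stay
    then show ?thesis using ver[OF j] by simp
  next
    case MoveRight
    have le: "D i = 1" if "- b \<le> i" "i \<le> h" for i
      using ver[of i] that h MoveRight by (auto simp: dir_def split: if_splits)
    have gt: "D i \<in> {0, 2}" if "h < i" "i \<le> b" for i
      using ver[of i] that h MoveRight by (auto simp: dir_def split: if_splits)
    consider "j \<le> h" | "j = h + 1" | "h + 1 < j" by linarith
    then show ?thesis
    proof cases
      case 1
      then show ?thesis using le[of j] j MoveRight by (simp add: dir_def)
    next
      case 2
      then show ?thesis using le[of h] hor[of h] gt[of j] j hb MoveRight by (auto simp: dir_def)
    next
      case 3
      then show ?thesis using gt[of "j - 1"] hor[of "j - 1"] j h MoveRight by (auto simp: dir_def)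
    qed
  next
    case MoveLeft
    have ge: "D i = 2" if "h \<le> i" "i \<le> b" for i
      using ver[of i] that h MoveLeft by (auto simp: dir_def split: if_splits)
    have lt: "D i \<in> {0, 1}" if "- b \<le> i" "i < h" for i
      using ver[of i] that h MoveLeft by (auto simp: dir_def split: if_splits)
    consider "h \<le> j" | "j = h - 1" | "j < h - 1" by linarith
    then show ?thesis
    proof cases
      case 1
      then show ?thesis using ge[of j] j MoveLeft by (simp add: dir_def)
    next
      case 2
      then have "j < b" using hb by linarith
      then show ?thesis using 2 ge[of h] hor[of j] lt[of j] j hb MoveLeft by (auto simp: dir_def)
    next
      case 3
      then have "j < b" using hb by linarith
      then show ?thesis using 3 lt[of j] lt[of "j + 1"] hor[of j] j hb MoveLeft by (auto simp: dir_def split: if_splits)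
    qed
  qed
qed

text \<open>At cell -1 the direction is 1, so cell 0, where 1 is forbidden, holds the head; behind
  it only 2 is possible.\<close>

lemma dir_init:
  fixes b :: int
  assumes neg: "\<And>j. - b \<le> j \<Longrightarrow> j < 0 \<Longrightarrow> D j = 1"
    and nonneg: "\<And>j. 0 \<le> j \<Longrightarrow> j \<le> b \<Longrightarrow> D j \<noteq> 1 \<and> D j < 3"
    and hor: "\<And>j. - b \<le> j \<Longrightarrow> j < b \<Longrightarrow> dir_hor (D j) (D (j + 1))"
    and b: "0 < b" and j: "- b \<le> j" "j \<le> b"
  shows "D j = dir 0 j"
proof -
  consider "j < 0" | "j = 0" | "0 < j" by linarith
  then show ?thesis
  proof cases
    case 1
    then show ?thesis using neg j by (simp add: dir_def)
  next
    case 2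
    then show ?thesis using neg[of "-1"] hor[of "-1"] nonneg[of 0] b by (auto simp: dir_def)
  next
    case 3
    then show ?thesis using nonneg[of "j - 1"] hor[of "j - 1"] j b by (auto simp: dir_def)
  qed
qed

lemma tiles_Some:
  "Some (q, rs, cs, ds) \<in> tiles \<Longrightarrow> length rs = tapes M \<and> length cs = tapes M \<and> length ds = tapes M \<and> set ds \<subseteq> {..<3}"
  by (auto simp: tiles_def)

text \<open>Row \<open>t\<close> is the configuration after \<open>t\<close> steps on
  \<open>x\<close> and on the word that the second tape holds in row 0. Heads move by at most one
  cell per step, so a row from \<open>- B\<close> to \<open>B\<close> is wide enough for
  \<open>B\<close> steps.\<close>

lemma tiling_accepting:
  assumes cons: "\<forall>(i, l, j)\<in>set (constraints x Q T). rel l (\<tau> i) (\<tau> j)" and T: "1 \<le> T"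
  shows "\<exists>y. length y \<le> Q \<and> fst (run_conf x y (length x + Q + T)) = states M \<and>
    snd (last (snd (run_conf x y (length x + Q + T)))) 0 = 2"
proof -
  define n B where "n = length x" and "B = n + Q + T"
  define W where "W = 2 * B + 2"
  define b where "b = int B"
  define idx where "idx t j = nat (int (t * W + 1 + B) + j)" for t j
  define S where "S t j = \<tau> (idx t j)" for t j
  note C = cons[unfolded constraints_Ball[OF n_def B_def W_def] rel_def]
  have hor_k: "rel0 Hor (\<tau> k) (\<tau> (k + 1))" "rel0 Ver (\<tau> k) (\<tau> (k + W))" "\<tau> k \<in> tiles"
    if "k < B * W + B + 1 + W" for k
    using C that by blast+
  \<comment> \<open>The constraints extend a full row width past the middle of row \<open>B\<close>,
    so they cover the rest of that row.\<close>
  have idx_le: "idx t j < B * W + B + 1 + W" if "t \<le> B" "- b \<le> j" "j \<le> b" for t j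
  proof -
    have "t * W \<le> B * W" using that(1) by (rule mult_le_mono1)
    then have "int (t * W) \<le> int (B * W)" by (simp only: of_nat_le_iff)
    moreover have "int B < int W" by (simp add: W_def)
    ultimately have "int (t * W + 1 + B) + j < int (B * W + B + 1 + W)"
      using that(3) unfolding b_def of_nat_add by linarith
    then show ?thesis unfolding idx_def by linarith
  qed
  have pos: "0 \<le> int (t * W + 1 + B) + j" if "- b \<le> j" for t j
    using that unfolding b_def of_nat_add by linarith
  have idx_Suc: "idx t (j + 1) = idx t j + 1" if "- b \<le> j" for t j
    using pos[OF that, of t] unfolding idx_def by linarith
  have idx_W: "idx (Suc t) j = idx t j + W" if "- b \<le> j" for t j
  proof -
    have "int (Suc t * W + 1 + B) + j = int (t * W + 1 + B) + j + int W" by (simp add: algebra_simps)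
    then show ?thesis using pos[OF that, of t] unfolding idx_def by linarith
  qed
  have H: "rel0 Hor (S t j) (S t (j + 1))" if "t \<le> B" "- b \<le> j" "j < b" for t j
    using hor_k(1)[OF idx_le[of t j]] that idx_Suc[of j t] by (simp add: S_def)
  have V: "rel0 Ver (S t j) (S (Suc t) j)" if "t < B" "- b \<le> j" "j \<le> b" for t j
    using hor_k(2)[OF idx_le[of t j]] that idx_W[of j t] by (simp add: S_def)
  have in_t: "S t j \<in> tiles" if "t \<le> B" "- b \<le> j" "j \<le> b" for t j
    using hor_k(3)[OF idx_le[of t j]] that by (simp add: S_def)
  have idx0: "idx 0 (int i) = B + 1 + i" for i by (simp add: idx_def)
  have idxl: "idx 0 (int i - b) = 1 + i" for i by (simp add: idx_def b_def)
  have left: "rel0 LeftPad (S 0 j) (S 0 j) \<and> rel0 GuessEnd (S 0 j) (S 0 j)" if "- b \<le> j" "j < 0" for j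
  proof -
    have "nat (j + b) < B" using that by (simp add: b_def)
    moreover have "S 0 j = \<tau> (1 + nat (j + b))" using idxl[of "nat (j + b)"] that by (simp add: S_def)
    ultimately show ?thesis using C by simp
  qed
  have right: "\<exists>c. rel0 (Sym c) (S 0 (int i)) (S 0 (int i)) \<and> c = cells x (int i)" if "i \<le> B" for i
  proof (cases "i < n")
    case True
    then have "rel0 (Sym (letter (x ! i))) (S 0 (int i)) (S 0 (int i))" using C by (simp add: S_def idx0)
    then show ?thesis using True by (auto simp: cells_def n_def letter_def)
  next
    case False
    then have "i - n < Q + T + 1" "B + 1 + n + (i - n) = B + 1 + i" using that by (simp_all add: B_def)
    then have "rel0 (Sym 0) (S 0 (int i)) (S 0 (int i))" using C by (metis S_def idx0)
    then show ?thesis using False by (auto simp: cells_def n_def)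
  qed
  define cell where "cell a = (case a of Some (q, rs, cs, ds) \<Rightarrow> (cs :: nat list) ! 1)" for a :: tile
  define c where "c i = cell (S 0 (int i))" for i
  have someR: "\<exists>q rs cs ds. S 0 (int i) = Some (q, rs, cs, ds)" if "i \<le> B" for i
    using right[OF that] by (cases "S 0 (int i)") auto
  have cQ: "c i < 3 \<and> (c i = 0 \<longrightarrow> c (i + 1) = 0)" if iQ: "i < Q" for i
  proof -
    have "rel0 Guess (S 0 (int i)) (S 0 (int (i + 1)))" using C iQ by (simp add: S_def idx0 del: of_nat_Suc of_nat_add)
    moreover obtain q rs cs ds where "S 0 (int i) = Some (q, rs, cs, ds)" using someR[of i] iQ by (auto simp: B_def)
    moreover obtain q' rs' cs' ds' where "S 0 (int (i + 1)) = Some (q', rs', cs', ds')"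
      using someR[of "i + 1"] iQ T by (auto simp: B_def)
    ultimately show ?thesis by (simp add: c_def cell_def)
  qed
  have cE: "c i = 0" if iQ: "Q \<le> i" "i \<le> B" for i
  proof -
    have "i - Q < n + T + 1" "B + 1 + Q + (i - Q) = B + 1 + i" using iQ by (simp_all add: B_def)
    then have "rel0 GuessEnd (S 0 (int i)) (S 0 (int i))" using C by (metis S_def idx0)
    moreover obtain q rs cs ds where "S 0 (int i) = Some (q, rs, cs, ds)" using someR[of i] iQ by auto
    ultimately show ?thesis by (simp add: c_def cell_def)
  qed
  \<comment> \<open>The certificate ends at the first blank of the second tape; \<open>Guess\<close>
    and \<open>GuessEnd\<close> make all later cells blank.\<close>
  define m where "m = (LEAST i. c i = 0)"
  have "c Q = 0" using cE[of Q] by (simp add: B_def)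
  then have m: "c m = 0" "m \<le> Q" "\<And>i. i < m \<Longrightarrow> c i \<noteq> 0"
    unfolding m_def by (auto intro: LeastI Least_le dest: not_less_Least)
  have c0: "c i = 0" if "m \<le> i" "i \<le> B" for i
    using that
  proof (induction i rule: dec_induct)
    case (step i)
    then show ?case using cQ[of i] cE[of "Suc i"] by (cases "i < Q") auto
  qed (use m in simp)
  define y where "y = map (\<lambda>i. c i = 2) [0..<m]"
  have ly: "length y \<le> Q" using m by (simp add: y_def)
  have cy: "cells y (int i) = c i" if "i \<le> B" for i
  proof (cases "i < m")
    case True
    then have "c i < 3" "c i \<noteq> 0" using m cQ[of i] by auto
    then show ?thesis using True by (auto simp: cells_def y_def)
  next
    case False
    then show ?thesis using c0[of i] that by (simp add: cells_def y_def)
  qed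
  define Q' where "Q' t = fst (run_conf x y t)" for t
  define ts where "ts t = snd (run_conf x y t)" for t
  have val: "valid t (Q' t, ts t)" for t using valid_run by (simp add: Q'_def ts_def)
  have lts: "length (ts t) = tapes M" for t using val by (simp add: valid_def)
  have init: "Q' 0 = 0" "ts 0 = map (\<lambda>u. (0, cells (if u < 2 then [x, y] ! u else []))) [0..<tapes M]"
    by (simp_all add: Q'_def ts_def run_conf_def init_def numeral_2_eq_2)
  define dd where "dd a u = (case a of Some (q, rs, cs, ds) \<Rightarrow> (ds :: nat list) ! u)" for a :: tile and u
  \<comment> \<open>The scanned symbols of a row stay open; they are pinned down by vertical
    constraints when the next row is considered.\<close>
  have inv: "\<forall>j. - b \<le> j \<and> j \<le> b \<longrightarrow>
     (\<exists>rs. S t j = Some (Q' t, rs, map (\<lambda>(h, cc). cc j) (ts t), map (\<lambda>(h, cc). dir h j) (ts t)))" if "t \<le> B" for t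
    using that
  proof (induction t)
    case 0
    have ex: "\<exists>rs cs ds. S 0 j = Some (0, rs, cs, ds) \<and> length cs = tapes M \<and> length ds = tapes M \<and>
        (\<forall>u<tapes M. cs ! u = snd (ts 0 ! u) j) \<and> (\<forall>u<tapes M. ds ! u < 3 \<and> (j < 0 \<longrightarrow> ds ! u = 1) \<and> (0 \<le> j \<longrightarrow> ds ! u \<noteq> 1))"
      if j: "- b \<le> j" "j \<le> b" for j
    proof (cases "j < 0")
      case True
      note l = left[OF j(1) True]
      then obtain q rs cs ds where S: "S 0 j = Some (q, rs, cs, ds)" by (cases "S 0 j") auto
      have len: "length cs = tapes M" "length ds = tapes M" using tiles_Some in_t[OF _ j, of 0] S by auto
      have "cs ! u = snd (ts 0 ! u) j" if "u < tapes M" for u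
        using l S that True by (cases "u = 1") (auto simp: init cells_def)
      then show ?thesis using l S len True by auto
    next
      case False
      then obtain i where i: "j = int i" "i \<le> B" using j(2) by (metis b_def nat_le_iff nat_0_le not_less)
      obtain q rs cs ds where S: "S 0 j = Some (q, rs, cs, ds)" using someR[OF i(2)] i(1) by auto
      have l: "rel0 (Sym (cells x j)) (S 0 j) (S 0 j)" using right[OF i(2)] i(1) by auto
      have len: "length cs = tapes M" "length ds = tapes M" "set ds \<subseteq> {..<3}" using tiles_Some in_t[OF _ j, of 0] S by auto
      have c1: "cs ! 1 = cells y j" using cy[OF i(2)] S i(1) by (simp add: c_def cell_def)
      have "cs ! u = snd (ts 0 ! u) j" if "u < tapes M" for u
      proof -
        consider "u = 0" | "u = 1" | "2 \<le> u" by linarith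
        then show ?thesis using l S that c1 by cases (auto simp: init cells_Nil)
      qed
      moreover have "ds ! u < 3" if "u < tapes M" for u using len that by (metis lessThan_iff nth_mem subsetD)
      ultimately show ?thesis using l S len False by auto
    qed
    show ?case
    proof (intro allI impI)
      fix j assume j: "- b \<le> j \<and> j \<le> b"
      obtain rs cs ds where S: "S 0 j = Some (0, rs, cs, ds)" "length cs = tapes M" "length ds = tapes M"
        "\<forall>u<tapes M. cs ! u = snd (ts 0 ! u) j" using ex j by blast
      have "ds ! u = dir 0 j" if u: "u < tapes M" for u
      proof -
        have "dd (S 0 j) u = dir 0 j"
        proof (rule dir_init[where b = b and D = "\<lambda>j. dd (S 0 j) u"])
          fix j assume j: "- b \<le> j" "j < b"
          obtain rs cs ds where 1: "S 0 j = Some (0, rs, cs, ds)" using ex[of j] j by auto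
          obtain rs' cs' ds' where 2: "S 0 (j + 1) = Some (0, rs', cs', ds')" using ex[of "j + 1"] j by auto
          have "\<forall>u<tapes M. dir_hor (ds ! u) (ds' ! u)" using H[of 0 j] j 1 2 by (simp del: dir_hor.simps)
          then show "dir_hor (dd (S 0 j) u) (dd (S 0 (j + 1)) u)" using 1 2 u by (simp add: dd_def del: dir_hor.simps)
        next
          fix j assume "- b \<le> j" "j < 0"
          then show "dd (S 0 j) u = 1" using ex[of j] u by (auto simp: dd_def b_def)
        next
          fix j assume "0 \<le> j" "j \<le> b"
          then show "dd (S 0 j) u \<noteq> 1 \<and> dd (S 0 j) u < 3" using ex[of j] u by (auto simp: dd_def b_def)
        qed (use j T in \<open>auto simp: b_def B_def\<close>)
        then show ?thesis by (simp add: S dd_def)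
      qed
      then have "ds = map (\<lambda>(h, cc). dir h j) (ts 0)" "cs = map (\<lambda>(h, cc). cc j) (ts 0)"
        using S by (auto intro!: nth_equalityI simp: init)
      then show "\<exists>rs. S 0 j = Some (Q' 0, rs, map (\<lambda>(h, cc). cc j) (ts 0), map (\<lambda>(h, cc). dir h j) (ts 0))"
        using S(1) init(1) by auto
    qed
  next
    case (Suc t)
    then have IH: "\<exists>rs. S t j = Some (Q' t, rs, map (\<lambda>(h, cc). cc j) (ts t), map (\<lambda>(h, cc). dir h j) (ts t))"
      if "- b \<le> j" "j \<le> b" for j using that by simp
    have tB: "t < B" using Suc.prems by simp
    let ?h = "\<lambda>u. fst (ts t ! u)" and ?c = "\<lambda>u. snd (ts t ! u)"
    \<comment> \<open>Strict because of \<open>t < B\<close>, so the move of this step stays in the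
      row.\<close>
    have h: "\<bar>?h u\<bar> < b" if "u < tapes M" for u
      using val[of t] that tB by (auto simp: valid_def b_def)
    obtain rs where rs0: "S t (- b) = Some (Q' t, rs, map (\<lambda>(h, cc). cc (- b)) (ts t), map (\<lambda>(h, cc). dir h (- b)) (ts t))"
      using IH[of "- b"] by (auto simp: b_def)
    have rs: "S t j = Some (Q' t, rs, map (\<lambda>(h, cc). cc j) (ts t), map (\<lambda>(h, cc). dir h j) (ts t))"
      if "- b \<le> j" "j \<le> b" for j
      using that
    proof (induction j rule: int_ge_induct)
      case (step j)
      obtain rs' where "S t (j + 1) = Some (Q' t, rs', map (\<lambda>(h, cc). cc (j + 1)) (ts t), map (\<lambda>(h, cc). dir h (j + 1)) (ts t))"
        using IH[of "j + 1"] step by auto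
      then show ?case using H[of t j] step tB by simp
    qed (rule rs0)
    \<comment> \<open>\<open>Hor\<close> makes \<open>rs\<close> the same along the row, and
      \<open>Ver\<close> compares \<open>rs ! u\<close> with the cell under head
      \<open>u\<close>.\<close>
    have "rs = reads (ts t)"
    proof (rule nth_equalityI)
      show len: "length rs = length (reads (ts t))"
        using tiles_Some in_t[of t "- b"] rs0 tB lts by (auto simp: b_def)
      fix u assume "u < length rs"
      then have u: "u < tapes M" using len lts by simp
      have j: "- b \<le> ?h u" "?h u \<le> b" using h[OF u] by auto
      obtain q' rs' cs' ds' where S': "S (Suc t) (?h u) = Some (q', rs', cs', ds')"
        using V[OF tB j] rs[OF j] by (cases "S (Suc t) (?h u)") auto
      have "rs ! u = ?c u (?h u)"
        using V[OF tB j] rs[OF j] S' u lts by (simp add: case_prod_beta dir_def)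
      then show "rs ! u = reads (ts t) ! u" using u lts by (simp add: reads_def case_prod_beta)
    qed
    note rs = rs[unfolded this]
    have st: "step M (Q' t, ts t) = (Q' (Suc t), ts (Suc t))"
      by (simp add: Q'_def ts_def run_conf_def)
    have q': "Q' (Suc t) = fst (action (Q' t) (reads (ts t)))"
      using step_action[OF lts, of "Q' t" t] st by simp
    let ?a = "\<lambda>u. snd (action (Q' t) (reads (ts t))) ! u"
    have nth: "fst (ts (Suc t) ! u) = (case snd (?a u) of MoveLeft \<Rightarrow> ?h u - 1 | Stay \<Rightarrow> ?h u | MoveRight \<Rightarrow> ?h u + 1)"
      "snd (ts (Suc t) ! u) = (?c u)(?h u := fst (?a u))" if "u < tapes M" for u
      using step_nth[OF val that st] act_simps[of "?a u" "?h u" "?c u"] by simp_all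
    have ex: "\<exists>rs' cs' ds'. S (Suc t) j = Some (Q' (Suc t), rs', cs', ds') \<and> length cs' = tapes M \<and> length ds' = tapes M \<and>
        (\<forall>u<tapes M. cs' ! u = snd (ts (Suc t) ! u) j \<and> dir_ver (snd (?a u)) (dir (?h u) j) (ds' ! u))"
      if j: "- b \<le> j" "j \<le> b" for j
    proof -
      obtain q1 rs' cs' ds' where S': "S (Suc t) j = Some (q1, rs', cs', ds')"
        using V[OF tB j] rs[OF j] by (cases "S (Suc t) j") auto
      have len: "length cs' = tapes M" "length ds' = tapes M" using tiles_Some in_t[OF Suc.prems j] S' by auto
      note v = V[OF tB j, unfolded rs[OF j] S']
      have "q1 = Q' (Suc t)" using v q' by simp
      moreover have "cs' ! u = snd (ts (Suc t) ! u) j \<and> dir_ver (snd (?a u)) (dir (?h u) j) (ds' ! u)" if u: "u < tapes M" for u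
        using v u lts unfolding nth(2)[OF u] by (auto simp: case_prod_beta dir_def split: if_splits)
      ultimately show ?thesis using S' len by blast
    qed
    show ?case
    proof (intro allI impI)
      fix j assume j: "- b \<le> j \<and> j \<le> b"
      obtain rs' cs ds where S: "S (Suc t) j = Some (Q' (Suc t), rs', cs, ds)" "length cs = tapes M" "length ds = tapes M"
        "\<forall>u<tapes M. cs ! u = snd (ts (Suc t) ! u) j" using ex j by blast
      have "ds ! u = dir (fst (ts (Suc t) ! u)) j" if u: "u < tapes M" for u
      proof -
        have "dd (S (Suc t) j) u = dir (fst (ts (Suc t) ! u)) j"
          unfolding nth(1)[OF u]
        proof (rule dir_update[where b = b and D = "\<lambda>j. dd (S (Suc t) j) u"])
          fix j assume j: "- b \<le> j" "j < b"
          obtain rs cs ds where 1: "S (Suc t) j = Some (Q' (Suc t), rs, cs, ds)" using ex[of j] j by auto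
          obtain rs' cs' ds' where 2: "S (Suc t) (j + 1) = Some (Q' (Suc t), rs', cs', ds')" using ex[of "j + 1"] j by auto
          have "\<forall>u<tapes M. dir_hor (ds ! u) (ds' ! u)" using H[OF Suc.prems j] 1 2 by (simp del: dir_hor.simps)
          then show "dir_hor (dd (S (Suc t) j) u) (dd (S (Suc t) (j + 1)) u)"
            using 1 2 u by (simp add: dd_def del: dir_hor.simps)
        next
          fix j assume "- b \<le> j" "j \<le> b"
          then show "dir_ver (snd (?a u)) (dir (?h u) j) (dd (S (Suc t) j) u)" using ex[of j] u by (auto simp: dd_def)
        qed (use j h[OF u] in auto)
        then show ?thesis by (simp add: S dd_def)
      qed
      then have "ds = map (\<lambda>(h, cc). dir h j) (ts (Suc t))" "cs = map (\<lambda>(h, cc). cc j) (ts (Suc t))"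
        using S lts by (auto intro!: nth_equalityI simp: case_prod_beta)
      then show "\<exists>rs. S (Suc t) j = Some (Q' (Suc t), rs, map (\<lambda>(h, cc). cc j) (ts (Suc t)), map (\<lambda>(h, cc). dir h j) (ts (Suc t)))"
        using S(1) by auto
    qed
  qed
  have "idx B 0 = B * W + B + 1" unfolding idx_def add_0_right nat_int by simp
  then have "rel0 Accept (S B 0) (S B 0)" using C by (simp add: S_def)
  moreover obtain rs where "S B 0 = Some (Q' B, rs, map (\<lambda>(h, cc). cc 0) (ts B), map (\<lambda>(h, cc). dir h 0) (ts B))"
    using inv[of B] by (auto simp: b_def)
  moreover have "ts B \<noteq> []" "last (ts B) = ts B ! (tapes M - 1)" "tapes M - 1 < tapes M"
    using lts[of B] two_tapes by (auto simp: last_conv_nth simp flip: length_greater_0_conv)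
  ultimately have "Q' B = states M \<and> snd (last (ts B)) 0 = 2" using lts[of B] by (simp add: case_prod_beta)
  then show ?thesis using ly by (auto simp: Q'_def ts_def B_def n_def)
qed

end

section \<open>Tilings as homomorphisms\<close>

lemma Cl_B_plain:
  assumes "\<And>s p t. (s, p, t) \<in> G \<Longrightarrow> p \<notin> reserved"
  shows "Cl_B G = G"
proof -
  have "t \<in> G" if "t \<in> Cl_B G" for t
    using that
  proof induction
    case (r2b D E X Y)
    then show ?case using assms by (force simp: reserved_def)
  qed (use assms in \<open>force simp: reserved_def\<close>)+
  then show ?thesis by (auto intro: Cl_B.base)
qed

fun label_num :: "label \<Rightarrow> nat" where
  "label_num Hor = 0"
| "label_num Ver = 1"
| "label_num Border = 2"
| "label_num LeftPad = 3"
| "label_num Guess = 4"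
| "label_num GuessEnd = 5"
| "label_num Accept = 6"
| "label_num (Sym c) = 7 + c"

lemma label_num_inj [simp]: "label_num l = label_num l' \<longleftrightarrow> l = l'"
  by (cases l; cases l') auto

definition labels :: "label set" where
  "labels = {Hor, Ver, Border, LeftPad, Guess, GuessEnd, Accept, Sym 0, Sym 1, Sym 2}"

text \<open>A program writes a unary name by copying a counter, and the names stay short because the
  positions are polynomially many.\<close>

definition unary :: "nat \<Rightarrow> bool list" where "unary n = replicate n True"

lemma unary_inj [simp]: "unary m = unary n \<longleftrightarrow> m = n"
  unfolding unary_def by (metis length_replicate)

lemma length_unary [simp]: "length (unary n) = n"
  by (simp add: unary_def)

fun con_triple :: "nat \<times> label \<times> nat \<Rightarrow> name_triple" where
  "con_triple (i, l, j) = (BNode (unary i), Uri (unary (label_num l)), BNode (unary j))"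

lemma constraints_labels: "(i, l, j) \<in> set (constraints x Q T) \<Longrightarrow> l \<in> labels"
proof -
  have "\<forall>(i, l, j)\<in>set (constraints x Q T). l \<in> labels"
    unfolding constraints_Ball[OF refl refl refl, where R = "\<lambda>l i j. l \<in> labels"]
    by (auto simp: labels_def letter_def)
  then show "(i, l, j) \<in> set (constraints x Q T) \<Longrightarrow> l \<in> labels" by blast
qed

lemma poly_nat_mono: "a \<le> b \<Longrightarrow> poly p a \<le> poly (p :: nat poly) b"
  by (induction p) (auto intro: mult_le_mono)

lemma entailment_problemI:
  "is_graph (set gs) \<Longrightarrow> is_graph (set hs) \<Longrightarrow> entails (set gs) (set hs) \<Longrightarrow> enc_instance gs hs \<in> entailment_problem"
  unfolding entailment_problem_def by blast

context tiling
begin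

definition tile_term :: "tile \<Rightarrow> name_term" where
  "tile_term a = URI (Uri (unary (to_nat a)))"

definition template :: "name_triple set" where
  "template = (\<lambda>(l, a, b). (tile_term a, Uri (unary (label_num l)), tile_term b)) `
     {(l, a, b). l \<in> labels \<and> rel l a b}"

lemma template_graph: "is_graph template" "Cl_B template = template"
proof -
  have "{(l, a, b). l \<in> labels \<and> rel l a b} \<subseteq> labels \<times> tiles \<times> tiles" by (auto simp: rel_def)
  moreover have "finite (labels \<times> tiles \<times> tiles)" using finite_tiles by (simp add: labels_def)
  ultimately have "finite template" unfolding template_def using finite_subset by blast
  moreover have "is_triple t" if "t \<in> template" for t
    using that by (auto simp: template_def tile_term_def reserved_def)
  ultimately show "is_graph template" by (simp add: is_graph_def)
  show "Cl_B template = template"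
    by (rule Cl_B_plain) (auto simp: template_def reserved_def)
qed

lemma entails_template:
  assumes "\<And>i l j. (i, l, j) \<in> set cs \<Longrightarrow> l \<in> labels"
  shows "entails template (con_triple ` set cs) \<longleftrightarrow> (\<exists>\<tau>. \<forall>(i, l, j)\<in>set cs. rel l (\<tau> i) (\<tau> j))"
proof -
  have H: "is_graph (con_triple ` set cs)" by (auto simp: is_graph_def reserved_def)
  have "(\<exists>\<mu>. map_triple \<mu> ` con_triple ` set cs \<subseteq> template) \<longleftrightarrow> (\<exists>\<tau>. \<forall>(i, l, j)\<in>set cs. rel l (\<tau> i) (\<tau> j))"
  proof
    assume "\<exists>\<mu>. map_triple \<mu> ` con_triple ` set cs \<subseteq> template"
    then obtain \<mu> where \<mu>: "map_triple \<mu> ` con_triple ` set cs \<subseteq> template" by blast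
    \<comment> \<open>The choice is determined wherever a constraint applies, since distinct tiles
      have distinct terms; elsewhere it is arbitrary.\<close>
    define \<tau> where "\<tau> i = (SOME a. \<mu> (unary i) = tile_term a)" for i
    have t: "tile_term a = tile_term b \<longleftrightarrow> a = b" for a b by (simp add: tile_term_def)
    have "rel l (\<tau> i) (\<tau> j)" if c: "(i, l, j) \<in> set cs" for i l j
    proof -
      have "map_triple \<mu> (con_triple (i, l, j)) \<in> template" using \<mu> c by blast
      then obtain a b where "\<mu> (unary i) = tile_term a" "\<mu> (unary j) = tile_term b" "rel l a b"
        by (auto simp: template_def)
      moreover from this have "\<tau> i = a" "\<tau> j = b" unfolding \<tau>_def by (simp_all add: t)
      ultimately show ?thesis by simp
    qed
    then show "\<exists>\<tau>. \<forall>(i, l, j)\<in>set cs. rel l (\<tau> i) (\<tau> j)" by blast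
  next
    assume "\<exists>\<tau>. \<forall>(i, l, j)\<in>set cs. rel l (\<tau> i) (\<tau> j)"
    then obtain \<tau> where \<tau>: "\<forall>(i, l, j)\<in>set cs. rel l (\<tau> i) (\<tau> j)" by blast
    have "map_triple (\<lambda>w. tile_term (\<tau> (length w))) (con_triple c) \<in> template" if c: "c \<in> set cs" for c
    proof -
      obtain i l j where ilj: "c = (i, l, j)" by (metis prod_cases3)
      then show ?thesis using c \<tau> assms[of i l j] unfolding template_def
        by (intro image_eqI[of _ _ "(l, \<tau> i, \<tau> j)"]) auto
    qed
    then show "\<exists>\<mu>. map_triple \<mu> ` con_triple ` set cs \<subseteq> template" by blast
  qed
  then show ?thesis using entails_iff_hom[OF template_graph(1) H] template_graph(2) by simp
qed

text \<open>Polynomials with natural coefficients are monotone, so \<open>T\<close> bounds the run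
  on every admissible certificate; the added 1 makes it positive. The machine has halted by the last
  row, where \<open>Accept\<close> reads its verdict. Injectivity of the encoding turns membership
  in the language into entailment between the given graphs.\<close>

theorem tiling_reduction:
  fixes p q :: "nat poly" and R :: "bool list \<Rightarrow> bool list \<Rightarrow> bool"
  assumes M: "\<And>x y. \<exists>t\<le>poly p (length x + length y). yields_in M [x, y] t [R x y]"
    and gs: "set gs = template" and T: "T = poly p (length x + poly q (length x)) + 1"
  shows "(\<exists>y. length y \<le> poly q (length x) \<and> R x y) \<longleftrightarrow>
    enc_instance gs (map con_triple (constraints x (poly q (length x)) T)) \<in> entailment_problem"
proof -
  let ?n = "length x" and ?Q = "poly q (length x)"
  let ?hs = "map con_triple (constraints x ?Q T)"
  have H: "is_graph (set ?hs)" by (auto simp: is_graph_def reserved_def)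
  have "enc_instance gs ?hs \<in> entailment_problem \<longleftrightarrow> entails (set gs) (set ?hs)"
  proof
    assume "enc_instance gs ?hs \<in> entailment_problem"
    then obtain gs' hs' where "enc_instance gs ?hs = enc_instance gs' hs'" "entails (set gs') (set hs')"
      unfolding entailment_problem_def by blast
    then show "entails (set gs) (set ?hs)" using enc_instance_inj by blast
  next
    assume e: "entails (set gs) (set ?hs)"
    have "is_graph (set gs)" using template_graph(1) gs by simp
    then show "enc_instance gs ?hs \<in> entailment_problem" using H e by (rule entailment_problemI)
  qed
  also have "\<dots> \<longleftrightarrow> (\<exists>\<tau>. \<forall>(i, l, j)\<in>set (constraints x ?Q T). rel l (\<tau> i) (\<tau> j))"
    unfolding set_map gs by (rule entails_template) (rule constraints_labels)
  also have "\<dots> \<longleftrightarrow> (\<exists>y. length y \<le> ?Q \<and> R x y)"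
  proof
    assume "\<exists>\<tau>. \<forall>(i, l, j)\<in>set (constraints x ?Q T). rel l (\<tau> i) (\<tau> j)"
    then obtain \<tau> where "\<forall>(i, l, j)\<in>set (constraints x ?Q T). rel l (\<tau> i) (\<tau> j)" by blast
    from tiling_accepting[OF this] T obtain y where y: "length y \<le> ?Q"
      "snd (last (snd (run_conf x y (?n + ?Q + T)))) 0 = 2" by auto
    obtain t where t: "t \<le> poly p (?n + length y)" "yields_in M [x, y] t [R x y]" using M by blast
    have "poly p (?n + length y) \<le> poly p (?n + ?Q)" using y(1) by (intro poly_nat_mono) simp
    then have "t \<le> ?n + ?Q + T" using t(1) T by linarith
    moreover have f: "fst (run_conf x y t) = states M" "snd (last (snd (run_conf x y t))) = cells [R x y]"
      using t(2) by (auto simp: yields_in_def run_conf_def case_prod_beta)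
    ultimately have "cells [R x y] 0 = 2" using run_halted[of x y t "?n + ?Q + T"] y(2) by simp
    then show "\<exists>y. length y \<le> ?Q \<and> R x y" using y(1) by (auto simp: cells_def split: if_splits)
  next
    assume "\<exists>y. length y \<le> ?Q \<and> R x y"
    then obtain y where y: "length y \<le> ?Q" "R x y" by blast
    obtain t where t: "t \<le> poly p (?n + length y)" "yields_in M [x, y] t [R x y]" using M by blast
    have "poly p (?n + length y) \<le> poly p (?n + ?Q)" using y(1) by (intro poly_nat_mono) simp
    then have "t \<le> T" using t(1) T by linarith
    then show "\<exists>\<tau>. \<forall>(i, l, j)\<in>set (constraints x ?Q T). rel l (\<tau> i) (\<tau> j)"
      using accepting_tiling[OF y(1), of t T x] t(2) y(2) T by simp
  qed
  finally show ?thesis by simp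
qed

end

section \<open>Generating the constraints\<close>

fun outw :: "bool list \<Rightarrow> com" where
  "outw [] = Skip"
| "outw (b # w) = Out b ;; outw w"

lemma outw [simp]: "straight (outw w)" "cost (outw w) = 2 * length w"
  "run (outw w) s = s(0 := s 0 @ w)"
  by (induction w arbitrary: s) (auto simp: fun_eq_iff)

section \<open>Writing constraints with unary counters\<close>

abbreviation (input) "rI \<equiv> (2::nat)"
abbreviation (input) "rW' \<equiv> (3::nat)"
abbreviation (input) "rTmp \<equiv> (4::nat)"

text \<open>Names are coded by doubling, and the doubled \<open>unary k\<close> is
  \<open>unary (2 * k)\<close>: hence two letters for each mark. The marks return from
  \<open>rTmp\<close> because the counter is needed again.\<close>

definition emit :: "nat \<Rightarrow> com" where
  "emit r = While r (Pop r ;; Push rTmp True ;; Out True ;; Out True) ;; pour rTmp r"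

lemma unary_0 [simp]: "unary 0 = []" by (simp add: unary_def)
lemma unary_Suc: "unary (Suc n) = True # unary n" by (simp add: unary_def)
lemma rev_unary [simp]: "rev (unary n) = unary n" by (simp add: unary_def)
lemma unary_add: "unary (m + n) = unary m @ unary n" by (simp add: unary_def replicate_add)
lemma unary_snoc: "unary n @ [True] = True # unary n" by (simp add: unary_def replicate_append_same)

lemma ex_emit:
  assumes "r \<notin> {0, rTmp}" "s r = unary k" "s rTmp = []" "20 * k + 2 \<le> T"
  shows "ex (emit r) s T (s(0 := s 0 @ unary (2 * k)))"
proof -
  let ?c = "Pop r ;; Push rTmp True ;; Out True ;; Out True"
  have loop: "ex (While r ?c) s (10 * k + 1) (s(r := [], rTmp := unary k @ s rTmp, 0 := s 0 @ unary (2 * k)))"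
    if "s r = unary k" for s k
    using that
  proof (induction k arbitrary: s)
    case 0
    then show ?case by (intro ex_While_Nil') (auto simp: fun_eq_iff)
  next
    case (Suc k)
    let ?s = "s(r := unary k, rTmp := True # s rTmp, 0 := s 0 @ [True, True])"
    have r: "run ?c s = ?s" using Suc.prems assms(1) by (auto simp: fun_eq_iff unary_Suc)
    have "ex (While r ?c) ?s (10 * k + 1) (?s(r := [], rTmp := unary k @ ?s rTmp, 0 := ?s 0 @ unary (2 * k)))"
      by (rule Suc.IH) (use assms(1) in auto)
    moreover have "?s(r := [], rTmp := unary k @ ?s rTmp, 0 := ?s 0 @ unary (2 * k))
      = s(r := [], rTmp := unary (Suc k) @ s rTmp, 0 := s 0 @ unary (2 * Suc k))"
      using assms(1) by (auto simp: fun_eq_iff unary_Suc unary_snoc[symmetric])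
    ultimately have "ex (While r ?c) (run ?c s) (10 * k + 1)
       (s(r := [], rTmp := unary (Suc k) @ s rTmp, 0 := s 0 @ unary (2 * Suc k)))" by (simp only: r)
    then show ?case by (rule ex_While_run[rotated 2]) (use Suc in \<open>simp_all add: unary_Suc\<close>)
  qed
  let ?s = "s(r := [], rTmp := unary k @ s rTmp, 0 := s 0 @ unary (2 * k))"
  have "ex (pour rTmp r) ?s (6 * length (?s rTmp) + 1) (?s(r := rev (?s rTmp) @ ?s r, rTmp := []))"
    by (rule ex_pour) (use assms in auto)
  from ex_Seq[OF loop[where s = s and k = k, OF assms(2)] this] show ?thesis
    unfolding emit_def by (rule ex_cong) (use assms in \<open>auto simp: fun_eq_iff\<close>)
qed

fun con_word :: "nat \<times> label \<times> nat \<Rightarrow> bool list" where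
  "con_word (i, l, j) = True # enc_triple (con_triple (i, l, j))"

lemma enc_triples_con: "enc_triples (map con_triple cs) = concat (map con_word cs)"
  by (induction cs) auto

lemma dbl_unary: "dbl (unary n) = unary (2 * n)"
  by (induction n) (auto simp: unary_Suc)

lemma con_word_eq: "con_word (i, l, j) = (True # enc_tag 1) @ unary (2 * i) @
    ([False] @ enc_uri (Uri (unary (label_num l))) @ enc_tag 1) @ unary (2 * j) @ [False]"
  by (simp add: enc_term.simps enc_name_dbl dbl_unary)

text \<open>A triple \<open>(l, a, b)\<close> describes the constraint between the positions \<open>i\<close> and \<open>i + a\<close>, or \<open>i + a + W\<close> if
  \<open>b\<close> holds.\<close>

fun con_com :: "label \<times> nat \<times> bool \<Rightarrow> com" where
  "con_com (l, a, b) = outw (True # enc_tag 1) ;; emit rI ;;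
     outw ([False] @ enc_uri (Uri (unary (label_num l))) @ enc_tag 1) ;; emit rI ;;
     (if b then emit rW' else Skip) ;; outw (unary (2 * a) @ [False])"

definition counters :: "regs \<Rightarrow> nat \<Rightarrow> nat \<Rightarrow> bool" where
  "counters s i w \<longleftrightarrow> s rI = unary i \<and> s rW' = unary w \<and> s rTmp = []"

fun con_of :: "nat \<Rightarrow> label \<times> nat \<times> bool \<Rightarrow> nat \<Rightarrow> nat \<times> label \<times> nat" where
  "con_of w (l, a, b) i = (i, l, i + a + (if b then w else 0))"

text \<open>The factor is chosen before registers and counters and so depends on the constraint
  only; this keeps the time of the loops polynomial.\<close>

lemma ex_con_com: "\<exists>\<kappa>. \<forall>s i w N. counters s i w \<and> i \<le> N \<and> w \<le> N \<longrightarrow>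
   ex (con_com c) s (\<kappa> * (N + 1)) (s(0 := s 0 @ con_word (con_of w c i)))"
proof -
  obtain l a b where c: "c = (l, a, b)" by (metis prod_cases3)
  define k1 k2 k3 where "k1 = 2 * length (True # enc_tag 1)"
    and "k2 = 2 * length ([False] @ enc_uri (Uri (unary (label_num l))) @ enc_tag 1)"
    and "k3 = 2 * length (unary (2 * a) @ [False])"
  show ?thesis
  \<comment> \<open>At most three numbers are written, each within \<open>20 * N + 2\<close> steps;
    66 is 60 + 6.\<close>
  proof (intro exI[of _ "k1 + k2 + k3 + 66"] allI impI)
    fix s i w N assume h: "counters s i w \<and> i \<le> N \<and> w \<le> N"
    let ?w1 = "True # enc_tag 1" and ?w2 = "[False] @ enc_uri (Uri (unary (label_num l))) @ enc_tag 1"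
    let ?w3 = "unary (2 * a) @ [False]" and ?wb = "if b then unary (2 * w) else []"
    let ?s = "\<lambda>o'. s(0 := s 0 @ o')"
    have 1: "ex (outw ?w1) s k1 (?s ?w1)" by (rule ex_cong[OF ex_run[OF _ order_refl]]) (auto simp: k1_def)
    have 2: "ex (emit rI) (?s ?w1) (20 * N + 2) (?s (?w1 @ unary (2 * i)))"
      by (rule ex_cong[OF ex_emit[of _ _ i, OF _ _ _ order_refl]]) (use h in \<open>auto simp: counters_def\<close>)
    have 3: "ex (outw ?w2) (?s (?w1 @ unary (2 * i))) k2 (?s (?w1 @ unary (2 * i) @ ?w2))"
      by (rule ex_cong[OF ex_run[OF _ order_refl]]) (auto simp: k2_def)
    have 4: "ex (emit rI) (?s (?w1 @ unary (2 * i) @ ?w2)) (20 * N + 2) (?s (?w1 @ unary (2 * i) @ ?w2 @ unary (2 * i)))"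
      by (rule ex_cong[OF ex_emit[of _ _ i, OF _ _ _ order_refl]]) (use h in \<open>auto simp: counters_def\<close>)
    have 5: "ex (if b then emit rW' else Skip) (?s (?w1 @ unary (2 * i) @ ?w2 @ unary (2 * i))) (20 * N + 2)
        (?s (?w1 @ unary (2 * i) @ ?w2 @ unary (2 * i) @ ?wb))"
    proof (cases b)
      case True
      then show ?thesis
        by (simp only: if_True)
          (rule ex_cong[OF ex_emit[of _ _ w, OF _ _ _ order_refl]], use h in \<open>auto simp: counters_def\<close>)
    next
      case False
      then show ?thesis by (simp only: if_False) (rule ex_cong[OF ex_run[OF _ order_refl]], auto)
    qed
    have 6: "ex (outw ?w3) (?s (?w1 @ unary (2 * i) @ ?w2 @ unary (2 * i) @ ?wb)) k3
        (?s (?w1 @ unary (2 * i) @ ?w2 @ unary (2 * i) @ ?wb @ ?w3))"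
      by (rule ex_cong[OF ex_run[OF _ order_refl]]) (auto simp: k3_def)
    \<comment> \<open>Addition in unary is concatenation, so the name of the second position is
      written piece by piece.\<close>
    have w: "con_word (con_of w c i) = ?w1 @ unary (2 * i) @ ?w2 @ unary (2 * i) @ ?wb @ ?w3"
      unfolding c con_of.simps con_word_eq by (simp add: unary_add[symmetric] distrib_left add.commute add.left_commute)
    have "k1 + (20 * N + 2 + (k2 + (20 * N + 2 + (20 * N + 2 + k3)))) \<le> (k1 + k2 + k3 + 66) * (N + 1)"
      by (simp add: algebra_simps)
    then show "ex (con_com c) s ((k1 + k2 + k3 + 66) * (N + 1)) (?s (con_word (con_of w c i)))"
      unfolding w unfolding c con_com.simps
      by (rule ex_weaken[OF ex_Seq[OF 1 ex_Seq[OF 2 ex_Seq[OF 3 ex_Seq[OF 4 ex_Seq[OF 5 6]]]]]])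
  qed
qed

definition body :: "(label \<times> nat \<times> bool) list \<Rightarrow> com" where
  "body cs = foldr (\<lambda>c k. con_com c ;; k) cs Skip"

lemma ex_body: "\<exists>\<kappa>. \<forall>s i w N. counters s i w \<and> i \<le> N \<and> w \<le> N \<longrightarrow>
   ex (body cs) s (\<kappa> * (N + 1)) (s(0 := s 0 @ concat (map (\<lambda>c. con_word (con_of w c i)) cs)))"
proof (induction cs)
  case Nil
  show ?case unfolding body_def by (auto intro!: ex_cong[OF ex_run[of Skip 0]])
next
  case (Cons c cs)
  obtain k1 where k1: "\<And>s i w N. counters s i w \<and> i \<le> N \<and> w \<le> N \<Longrightarrow>
     ex (con_com c) s (k1 * (N + 1)) (s(0 := s 0 @ con_word (con_of w c i)))" using ex_con_com by metis
  obtain k2 where k2: "\<And>s i w N. counters s i w \<and> i \<le> N \<and> w \<le> N \<Longrightarrow>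
     ex (body cs) s (k2 * (N + 1)) (s(0 := s 0 @ concat (map (\<lambda>c. con_word (con_of w c i)) cs)))" using Cons by metis
  show ?case
  proof (intro exI[of _ "k1 + k2"] allI impI)
    fix s i w N assume h: "counters s i w \<and> i \<le> N \<and> w \<le> N"
    let ?s = "s(0 := s 0 @ con_word (con_of w c i))"
    have "counters ?s i w" using h by (simp add: counters_def)
    then have 2: "ex (body cs) ?s (k2 * (N + 1)) (?s(0 := ?s 0 @ concat (map (\<lambda>c. con_word (con_of w c i)) cs)))"
      using k2 h by blast
    have b: "body (c # cs) = con_com c ;; body cs" by (simp add: body_def)
    show "ex (body (c # cs)) s ((k1 + k2) * (N + 1)) (s(0 := s 0 @ concat (map (\<lambda>c. con_word (con_of w c i)) (c # cs))))"
      unfolding b by (rule ex_cong[OF ex_Seq[OF k1[OF h] 2]]) (auto simp: algebra_simps)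
  qed
qed

definition phase :: "nat \<Rightarrow> (label \<times> nat \<times> bool) list \<Rightarrow> com" where
  "phase r cs = While r (Pop r ;; body cs ;; Push rI True)"

text \<open>Register \<open>r\<close> counts the rounds down while \<open>rI\<close> counts
  positions up. \<open>rI\<close> keeps its final value, so the next block can continue from
  there.\<close>

lemma ex_phase: "\<exists>\<kappa>. \<forall>s i w N k r. r > 4 \<and> counters s i w \<and> s r = unary k \<and> i + k \<le> N \<and> w \<le> N \<longrightarrow>
   ex (phase r cs) s (\<kappa> * ((N + 1) * (N + 1)))
     (s(r := [], rI := unary (i + k), 0 := s 0 @ concat (map con_word (concat (map (\<lambda>d. map (\<lambda>c. con_of w c (i + d)) cs) [0..<k])))))"
proof -
  obtain k1 where k1: "\<And>s i w N. counters s i w \<and> i \<le> N \<and> w \<le> N \<Longrightarrow>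
     ex (body cs) s (k1 * (N + 1)) (s(0 := s 0 @ concat (map (\<lambda>c. con_word (con_of w c i)) cs)))" using ex_body by metis
  have loop: "ex (phase r cs) s (k * (k1 * (N + 1) + 5) + 1)
     (s(r := [], rI := unary (i + k), 0 := s 0 @ concat (map con_word (concat (map (\<lambda>d. map (\<lambda>c. con_of w c (i + d)) cs) [0..<k])))))"
    if "r > 4" "counters s i w" "s r = unary k" "i + k \<le> N" "w \<le> N" for s i w N k r
    using that unfolding phase_def
  proof (induction k arbitrary: s i)
    case 0
    then show ?case by (intro ex_While_Nil') (auto simp: fun_eq_iff counters_def)
  next
    case (Suc k)
    let ?o = "concat (map (\<lambda>c. con_word (con_of w c i)) cs)"
    let ?s1 = "s(r := unary k)"
    let ?s2 = "s(r := unary k, 0 := s 0 @ ?o)"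
    let ?s3 = "s(r := unary k, 0 := s 0 @ ?o, rI := unary (i + 1))"
    have 1: "ex (Pop r) s 2 ?s1" by (rule ex_cong[OF ex_run]) (use Suc.prems in \<open>auto simp: unary_Suc\<close>)
    have "counters ?s1 i w" using Suc.prems by (simp add: counters_def)
    then have "ex (body cs) ?s1 (k1 * (N + 1)) (?s1(0 := ?s1 0 @ ?o))" using k1[of ?s1 i w N] Suc.prems by simp
    then have 2: "ex (body cs) ?s1 (k1 * (N + 1)) ?s2"
      by (rule ex_cong) (use Suc.prems in \<open>auto simp: fun_eq_iff\<close>)
    have 3: "ex (Push rI True) ?s2 2 ?s3"
      by (rule ex_cong[OF ex_run]) (use Suc.prems in \<open>auto simp: fun_eq_iff counters_def unary_Suc\<close>)
    have c3: "counters ?s3 (i + 1) w" using Suc.prems by (simp add: counters_def)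
    have 4: "ex (While r (Pop r ;; body cs ;; Push rI True)) ?s3 (k * (k1 * (N + 1) + 5) + 1)
      (?s3(r := [], rI := unary (i + 1 + k), 0 := ?s3 0 @ concat (map con_word (concat (map (\<lambda>d. map (\<lambda>c. con_of w c (i + 1 + d)) cs) [0..<k])))))"
      by (rule Suc.IH[OF Suc.prems(1) c3 _ _ Suc.prems(5)]) (use Suc.prems in simp_all)
    have up: "[0..<Suc k] = 0 # map Suc [0..<k]" by (simp add: map_Suc_upt upt_conv_Cons del: upt_Suc)
    have e: "?s3(r := [], rI := unary (i + 1 + k), 0 := ?s3 0 @ concat (map con_word (concat (map (\<lambda>d. map (\<lambda>c. con_of w c (i + 1 + d)) cs) [0..<k]))))
      = s(r := [], rI := unary (i + Suc k), 0 := s 0 @ concat (map con_word (concat (map (\<lambda>d. map (\<lambda>c. con_of w c (i + d)) cs) [0..<Suc k]))))"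
      unfolding up using Suc.prems(1) by (auto simp: fun_eq_iff o_def)
    have "s r \<noteq> []" using Suc.prems by (simp add: unary_Suc)
    from ex_While_Cons[OF this ex_Seq[OF 1 ex_Seq[OF 2 3]] 4[unfolded e]] show ?case
      by (rule ex_weaken) (simp add: algebra_simps)
  qed
  show ?thesis
  proof (intro exI[of _ "k1 + 6"] allI impI)
    fix s i w N k r assume h: "r > 4 \<and> counters s i w \<and> s r = unary k \<and> i + k \<le> N \<and> w \<le> N"
    have "k * (k1 * (N + 1) + 5) + 1 \<le> (N + 1) * (k1 * (N + 1) + 5) + (N + 1)"
      using h by (intro add_mono mult_le_mono1) auto
    also have "\<dots> \<le> (k1 + 6) * ((N + 1) * (N + 1))" by (simp add: algebra_simps)
    finally show "ex (phase r cs) s ((k1 + 6) * ((N + 1) * (N + 1)))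
     (s(r := [], rI := unary (i + k), 0 := s 0 @ concat (map con_word (concat (map (\<lambda>d. map (\<lambda>c. con_of w c (i + d)) cs) [0..<k])))))"
      using ex_weaken[OF loop[of r s i w k N]] h by blast
  qed
qed

definition input_phase :: com where
  "input_phase = While 1 (Test 1 Skip (Pop 1 ;; con_com (Sym 2, 0, False) ;; Push rI True)
     (Pop 1 ;; con_com (Sym 1, 0, False) ;; Push rI True))"

lemma ex_input_phase: "\<exists>\<kappa>. \<forall>s i w N xs. counters s i w \<and> s 1 = xs \<and> i + length xs \<le> N \<and> w \<le> N \<longrightarrow>
   ex input_phase s (\<kappa> * ((N + 1) * (N + 1)))
     (s(1 := [], rI := unary (i + length xs), 0 := s 0 @ concat (map con_word (map (\<lambda>d. con_of w (Sym (letter (xs ! d)), 0, False) (i + d)) [0..<length xs]))))"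
proof -
  obtain k1 where k1: "\<And>s i w N. counters s i w \<and> i \<le> N \<and> w \<le> N \<Longrightarrow>
     ex (con_com (Sym 1, 0, False)) s (k1 * (N + 1)) (s(0 := s 0 @ con_word (con_of w (Sym 1, 0, False) i)))" using ex_con_com by metis
  obtain k2 where k2: "\<And>s i w N. counters s i w \<and> i \<le> N \<and> w \<le> N \<Longrightarrow>
     ex (con_com (Sym 2, 0, False)) s (k2 * (N + 1)) (s(0 := s 0 @ con_word (con_of w (Sym 2, 0, False) i)))" using ex_con_com by metis
  define kk where "kk = k1 + k2"
  have con: "ex (con_com (Sym (letter b), 0, False)) s (kk * (N + 1)) (s(0 := s 0 @ con_word (con_of w (Sym (letter b), 0, False) i)))"
    if "counters s i w" "i \<le> N" "w \<le> N" for b s i w N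
  proof (cases b)
    case True
    have "letter b = 2" using True by (simp add: letter_def)
    moreover have "k2 * (N + 1) \<le> kk * (N + 1)" unfolding kk_def by (rule mult_le_mono1) simp
    ultimately show ?thesis using ex_weaken[OF k2[of s i w N]] that by simp
  next
    case False
    have "letter b = 1" using False by (simp add: letter_def)
    moreover have "k1 * (N + 1) \<le> kk * (N + 1)" unfolding kk_def by (rule mult_le_mono1) simp
    ultimately show ?thesis using ex_weaken[OF k1[of s i w N]] that by simp
  qed
  let ?c = "Test 1 Skip (Pop 1 ;; con_com (Sym 2, 0, False) ;; Push rI True) (Pop 1 ;; con_com (Sym 1, 0, False) ;; Push rI True)"
  have loop: "ex (While 1 ?c) s (length xs * (kk * (N + 1) + 6) + 1)
     (s(1 := [], rI := unary (i + length xs), 0 := s 0 @ concat (map con_word (map (\<lambda>d. con_of w (Sym (letter (xs ! d)), 0, False) (i + d)) [0..<length xs]))))"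
    if "counters s i w" "s 1 = xs" "i + length xs \<le> N" "w \<le> N" for s i w N xs
    using that
  proof (induction xs arbitrary: s i)
    case Nil
    then show ?case by (intro ex_While_Nil') (auto simp: fun_eq_iff counters_def)
  next
    case (Cons b xs)
    let ?con = "con_com (Sym (letter b), 0, False)"
    let ?o = "con_word (con_of w (Sym (letter b), 0, False) i)"
    let ?s1 = "s(1 := xs)"
    let ?s2 = "s(1 := xs, 0 := s 0 @ ?o)"
    let ?s3 = "s(1 := xs, 0 := s 0 @ ?o, rI := unary (i + 1))"
    have 1: "ex (Pop 1) s 2 ?s1" by (rule ex_cong[OF ex_run]) (use Cons.prems in auto)
    have "counters ?s1 i w" using Cons.prems by (simp add: counters_def)
    then have "ex ?con ?s1 (kk * (N + 1)) (?s1(0 := ?s1 0 @ ?o))" using con[of ?s1 i w N b] Cons.prems by simp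
    then have 2: "ex ?con ?s1 (kk * (N + 1)) ?s2"
      by (rule ex_cong) (auto simp: fun_eq_iff)
    have 3: "ex (Push rI True) ?s2 2 ?s3"
      by (rule ex_cong[OF ex_run]) (use Cons.prems in \<open>auto simp: fun_eq_iff counters_def unary_Suc\<close>)
    have c: "(case s 1 of [] \<Rightarrow> Skip | b # _ \<Rightarrow> if b then Pop 1 ;; con_com (Sym 2, 0, False) ;; Push rI True
        else Pop 1 ;; con_com (Sym 1, 0, False) ;; Push rI True) = Pop 1 ;; ?con ;; Push rI True"
      using Cons.prems(2) by (simp add: letter_def del: con_com.simps)
    have 5: "ex ?c s (Suc (2 + (kk * (N + 1) + 2))) ?s3"
      by (rule ex_Test) (unfold c, rule ex_Seq[OF 1 ex_Seq[OF 2 3]])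
    have c3: "counters ?s3 (i + 1) w" using Cons.prems by (simp add: counters_def)
    have 4: "ex (While 1 ?c) ?s3 (length xs * (kk * (N + 1) + 6) + 1)
      (?s3(1 := [], rI := unary (i + 1 + length xs), 0 := ?s3 0 @ concat (map con_word (map (\<lambda>d. con_of w (Sym (letter (xs ! d)), 0, False) (i + 1 + d)) [0..<length xs]))))"
      by (rule Cons.IH[OF c3 _ _ Cons.prems(4)]) (use Cons.prems in simp_all)
    have up: "[0..<length (b # xs)] = 0 # map Suc [0..<length xs]" by (simp add: map_Suc_upt upt_conv_Cons del: upt_Suc)
    have e: "?s3(1 := [], rI := unary (i + 1 + length xs), 0 := ?s3 0 @ concat (map con_word (map (\<lambda>d. con_of w (Sym (letter (xs ! d)), 0, False) (i + 1 + d)) [0..<length xs])))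
      = s(1 := [], rI := unary (i + length (b # xs)), 0 := s 0 @ concat (map con_word (map (\<lambda>d. con_of w (Sym (letter ((b # xs) ! d)), 0, False) (i + d)) [0..<length (b # xs)])))"
      unfolding up by (auto simp: fun_eq_iff o_def simp del: con_word.simps upt_Suc)
    have "s 1 \<noteq> []" using Cons.prems by simp
    from ex_While_Cons[OF this 5 4[unfolded e]] show ?case
      by (rule ex_weaken) (simp add: algebra_simps)
  qed
  show ?thesis
  proof (intro exI[of _ "kk + 7"] allI impI)
    fix s i w N xs assume h: "counters s i w \<and> s 1 = xs \<and> i + length xs \<le> N \<and> w \<le> N"
    have "length xs * (kk * (N + 1) + 6) + 1 \<le> (N + 1) * (kk * (N + 1) + 6) + (N + 1)"
      using h by (intro add_mono mult_le_mono1) auto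
    also have "\<dots> \<le> (kk + 7) * ((N + 1) * (N + 1))" by (simp add: algebra_simps)
    finally show "ex input_phase s ((kk + 7) * ((N + 1) * (N + 1)))
     (s(1 := [], rI := unary (i + length xs), 0 := s 0 @ concat (map con_word (map (\<lambda>d. con_of w (Sym (letter (xs ! d)), 0, False) (i + d)) [0..<length xs]))))"
      unfolding input_phase_def using ex_weaken[OF loop[of s i w xs N]] h by blast
  qed
qed

section \<open>Evaluating polynomials in unary\<close>

primrec push_ones :: "nat \<Rightarrow> nat \<Rightarrow> com" where
  "push_ones d 0 = Skip"
| "push_ones d (Suc k) = push_ones d k ;; Push d True"

lemma push_ones [simp]: "straight (push_ones d k)" "cost (push_ones d k) = 2 * k"
  "run (push_ones d k) s = s(d := unary k @ s d)" "0 < d \<Longrightarrow> pos_regs (push_ones d k)"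
  by (induction k) (auto simp: unary_Suc)

definition copy_com :: "nat \<Rightarrow> com" where
  "copy_com d = While 5 (Pop 5 ;; Push 6 True ;; Push d True) ;; pour 6 5"

lemma ex_copy:
  assumes "d \<notin> {0, 1, 5, 6, 7}" "s 5 = unary m" "s 6 = []"
  shows "ex (copy_com d) s (13 * m + 2) (s(d := unary m @ s d))"
proof -
  let ?c = "Pop 5 ;; Push 6 True ;; Push d True"
  have loop: "ex (While 5 ?c) s (7 * m + 1) (s(5 := [], 6 := unary m @ s 6, d := unary m @ s d))"
    if "s 5 = unary m" for s m
    using that
  proof (induction m arbitrary: s)
    case 0
    then show ?case by (intro ex_While_Nil') (auto simp: fun_eq_iff)
  next
    case (Suc m)
    let ?s = "s(5 := unary m, 6 := True # s 6, d := True # s d)"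
    have r: "run ?c s = ?s" using Suc.prems assms(1) by (auto simp: fun_eq_iff unary_Suc)
    have "ex (While 5 ?c) ?s (7 * m + 1) (?s(5 := [], 6 := unary m @ ?s 6, d := unary m @ ?s d))"
      by (rule Suc.IH) (use assms(1) in auto)
    moreover have "?s(5 := [], 6 := unary m @ ?s 6, d := unary m @ ?s d)
      = s(5 := [], 6 := unary (Suc m) @ s 6, d := unary (Suc m) @ s d)"
      using assms(1) by (auto simp: fun_eq_iff unary_Suc unary_snoc[symmetric])
    ultimately have "ex (While 5 ?c) (run ?c s) (7 * m + 1)
       (s(5 := [], 6 := unary (Suc m) @ s 6, d := unary (Suc m) @ s d))" by (simp only: r)
    then show ?case by (rule ex_While_run[rotated 2]) (use Suc in \<open>simp_all add: unary_Suc\<close>)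
  qed
  let ?s = "s(5 := [], 6 := unary m @ s 6, d := unary m @ s d)"
  have "ex (pour 6 5) ?s (6 * length (?s 6) + 1) (?s(5 := rev (?s 6) @ ?s 5, 6 := []))"
    by (rule ex_pour) (use assms in auto)
  from ex_Seq[OF loop[where s = s and m = m, OF assms(2)] this] show ?thesis
    unfolding copy_com_def by (rule ex_cong) (use assms in \<open>auto simp: fun_eq_iff\<close>)
qed

definition times_com :: "nat \<Rightarrow> com" where
  "times_com d = While 1 (Test 1 Skip (Pop 1 ;; Push 7 True) (Pop 1 ;; Push 7 False) ;; copy_com d) ;; pour 7 1"

lemma ex_times:
  assumes d: "d \<notin> {0, 1, 5, 6, 7}" and s: "s 5 = unary m" "s 6 = []" "s 7 = []" and n: "length (s 1) = n"
  shows "ex (times_com d) s (n * (13 * m + 8) + 6 * n + 2) (s(d := unary (n * m) @ s d))"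
proof -
  let ?t = "Test 1 Skip (Pop 1 ;; Push 7 True) (Pop 1 ;; Push 7 False)"
  have loop: "ex (While 1 (?t ;; copy_com d)) s (length xs * (13 * m + 8) + 1)
      (s(1 := [], 7 := rev xs @ s 7, d := unary (length xs * m) @ s d))"
    if "s 1 = xs" "s 5 = unary m" "s 6 = []" for s xs
    using that
  proof (induction xs arbitrary: s)
    case Nil
    then show ?case by (intro ex_While_Nil') (auto simp: fun_eq_iff)
  next
    case (Cons x xs)
    let ?s1 = "s(1 := xs, 7 := x # s 7)"
    let ?s2 = "s(1 := xs, 7 := x # s 7, d := unary m @ s d)"
    have 1: "ex ?t s 5 ?s1"
      by (rule ex_cong[OF ex_run[OF _ order_refl]]) (use Cons.prems in \<open>auto simp: fun_eq_iff\<close>)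
    have 2: "ex (copy_com d) ?s1 (13 * m + 2) ?s2"
      by (rule ex_cong[OF ex_copy[OF d]]) (use Cons.prems d in \<open>auto simp: fun_eq_iff\<close>)
    have "ex (While 1 (?t ;; copy_com d)) ?s2 (length xs * (13 * m + 8) + 1)
      (?s2(1 := [], 7 := rev xs @ ?s2 7, d := unary (length xs * m) @ ?s2 d))"
      by (rule Cons.IH) (use Cons.prems d in auto)
    moreover have "?s2(1 := [], 7 := rev xs @ ?s2 7, d := unary (length xs * m) @ ?s2 d)
       = s(1 := [], 7 := rev (x # xs) @ s 7, d := unary (length (x # xs) * m) @ s d)"
      using d by (auto simp: fun_eq_iff unary_add[symmetric] add.commute)
    ultimately have 3: "ex (While 1 (?t ;; copy_com d)) ?s2 (length xs * (13 * m + 8) + 1)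
       (s(1 := [], 7 := rev (x # xs) @ s 7, d := unary (length (x # xs) * m) @ s d))" by (simp only:)
    have "s 1 \<noteq> []" using Cons.prems by simp
    from ex_While_Cons[OF this ex_Seq[OF 1 2] 3] show ?case by (rule ex_weaken) simp
  qed
  let ?s = "s(1 := [], 7 := rev (s 1) @ s 7, d := unary (length (s 1) * m) @ s d)"
  have "ex (pour 7 1) ?s (6 * length (?s 7) + 1) (?s(1 := rev (?s 7) @ ?s 1, 7 := []))"
    by (rule ex_pour) auto
  from ex_Seq[OF loop[where s = s, OF refl s(1,2)] this] show ?thesis
    unfolding times_com_def by (rule ex_cong) (use assms in \<open>auto simp: fun_eq_iff\<close>)
qed

text \<open>Horner's scheme: \<open>pCons a p\<close> has the value \<open>a + n * poly p n\<close>.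
  Multiplication by \<open>n\<close> runs once through the input, which is rebuilt afterwards, so
  the length itself is never stored.\<close>

lemma ex_poly_com:
  fixes p :: "nat poly"
  assumes d: "d \<notin> {0, 1, 5, 6, 7}"
  shows "\<exists>c tp. pos_regs c \<and> (\<forall>s. s d = [] \<and> s 5 = [] \<and> s 6 = [] \<and> s 7 = [] \<longrightarrow>
     ex c s (poly tp (length (s 1))) (s(d := unary (poly p (length (s 1))))))"
proof (induction p)
  case 0
  show ?case
    by (intro exI[of _ Skip] exI[of _ 0]) (auto intro!: ex_cong[OF ex_run[of Skip 0]])
next
  case (pCons a p)
  then obtain c tp where c: "pos_regs c" "\<And>s. s d = [] \<and> s 5 = [] \<and> s 6 = [] \<and> s 7 = [] \<Longrightarrow>
     ex c s (poly tp (length (s 1))) (s(d := unary (poly p (length (s 1)))))" by metis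
  let ?c = "c ;; pour d 5 ;; times_com d ;; clear 5 ;; push_ones d a"
  define tp' where "tp' = tp + [:22:] * p + [:0, 13:] * p + [:0, 14:] + [:2 * a + 5:]"
  show ?case
  proof (intro exI[of _ ?c] exI[of _ tp'] conjI allI impI)
    show "pos_regs ?c" using c(1) d by (auto simp: times_com_def copy_com_def pour_def clear_def)
    fix s :: regs assume s: "s d = [] \<and> s 5 = [] \<and> s 6 = [] \<and> s 7 = []"
    define n m where "n = length (s 1)" and "m = poly p n"
    let ?s1 = "s(d := unary m)" and ?s2 = "s(5 := unary m)" and ?s3 = "s(5 := unary m, d := unary (n * m))"
    let ?s4 = "s(d := unary (n * m))" and ?s5 = "s(d := unary (a + n * m))"
    have 1: "ex c s (poly tp n) ?s1" using c(2)[OF s] by (simp add: m_def n_def)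
    have 2: "ex (pour d 5) ?s1 (6 * m + 1) ?s2"
      by (rule ex_cong[OF ex_pour[OF _ order_refl]]) (use d s in \<open>auto simp: fun_eq_iff\<close>)
    have 3: "ex (times_com d) ?s2 (n * (13 * m + 8) + 6 * n + 2) ?s3"
      by (rule ex_cong[OF ex_times[OF d, where m = m and n = n]]) (use d s in \<open>auto simp: fun_eq_iff n_def\<close>)
    have 4: "ex (clear 5) ?s3 (3 * m + 1) ?s4"
      by (rule ex_cong[OF ex_clear[OF order_refl]]) (use d s in \<open>auto simp: fun_eq_iff\<close>)
    have 5: "ex (push_ones d a) ?s4 (2 * a) ?s5"
      by (rule ex_cong[OF ex_run[OF _ order_refl]]) (auto simp: fun_eq_iff unary_add)
    show "ex ?c s (poly tp' (length (s 1))) (s(d := unary (poly (pCons a p) (length (s 1)))))"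
      by (rule ex_cong[OF ex_Seq[OF 1 ex_Seq[OF 2 ex_Seq[OF 3 ex_Seq[OF 4 5]]]]])
        (simp_all add: tp'_def m_def n_def algebra_simps)
  qed
qed

fun set_all :: "nat \<Rightarrow> (nat \<times> nat poly) list \<Rightarrow> regs \<Rightarrow> regs" where
  "set_all n [] s = s"
| "set_all n ((d, p) # ds) s = set_all n ds (s(d := unary (poly p n)))"

text \<open>All block lengths are computed in advance, because \<open>input_phase\<close> uses up
  register 1.\<close>

lemma ex_set_all:
  assumes "distinct (map fst ds)" "\<And>d. d \<in> set (map fst ds) \<Longrightarrow> d \<notin> {0, 1, 5, 6, 7}"
  shows "\<exists>c tp. pos_regs c \<and> (\<forall>s. (\<forall>d\<in>set (map fst ds). s d = []) \<and> s 5 = [] \<and> s 6 = [] \<and> s 7 = [] \<longrightarrow>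
     ex c s (poly tp (length (s 1))) (set_all (length (s 1)) ds s))"
  using assms
proof (induction ds)
  case Nil
  show ?case
    by (intro exI[of _ Skip] exI[of _ 0]) (auto intro!: ex_cong[OF ex_run[of Skip 0]])
next
  case (Cons dp ds)
  obtain d p where dp: "dp = (d, p)" by fastforce
  obtain c1 t1 where c1: "pos_regs c1" "\<And>s. s d = [] \<and> s 5 = [] \<and> s 6 = [] \<and> s 7 = [] \<Longrightarrow>
     ex c1 s (poly t1 (length (s 1))) (s(d := unary (poly p (length (s 1)))))"
    using ex_poly_com[of d p] Cons.prems(2)[of d] dp by auto
  obtain c2 t2 where c2: "pos_regs c2" "\<And>s. (\<forall>d\<in>set (map fst ds). s d = []) \<and> s 5 = [] \<and> s 6 = [] \<and> s 7 = [] \<Longrightarrow>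
     ex c2 s (poly t2 (length (s 1))) (set_all (length (s 1)) ds s)"
    using Cons.IH Cons.prems dp by auto
  show ?case
  proof (intro exI[of _ "c1 ;; c2"] exI[of _ "t1 + t2"] conjI allI impI)
    show "pos_regs (c1 ;; c2)" using c1 c2 by simp
    fix s :: regs assume s: "(\<forall>d\<in>set (map fst (dp # ds)). s d = []) \<and> s 5 = [] \<and> s 6 = [] \<and> s 7 = []"
    let ?s = "s(d := unary (poly p (length (s 1))))"
    have d: "d \<notin> {0, 1, 5, 6, 7}" using Cons.prems(2)[of d] dp by simp
    then have l: "?s 1 = s 1" by simp
    have 1: "ex c1 s (poly t1 (length (s 1))) ?s" using c1(2) s dp by simp
    have "(\<forall>d\<in>set (map fst ds). ?s d = []) \<and> ?s 5 = [] \<and> ?s 6 = [] \<and> ?s 7 = []"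
      using s d dp Cons.prems(1) by auto
    from c2(2)[OF this] have 2: "ex c2 ?s (poly t2 (length (s 1))) (set_all (length (s 1)) ds ?s)" by (simp only: l)
    show "ex (c1 ;; c2) s (poly (t1 + t2) (length (s 1))) (set_all (length (s 1)) (dp # ds) s)"
      using ex_Seq[OF 1 2] by (simp add: dp)
  qed
qed

section \<open>The generator of the reduction\<close>

lemma pos_regs_outw: "pos_regs (outw w)"
  by (induction w) auto

lemma pos_regs_con: "pos_regs (con_com c)"
  by (cases c) (auto simp: pos_regs_outw emit_def pour_def)

lemma pos_regs_phase: "0 < r \<Longrightarrow> pos_regs (phase r cs)"
proof -
  have "pos_regs (body cs)" unfolding body_def by (induction cs) (auto simp: pos_regs_con)
  then show "0 < r \<Longrightarrow> pos_regs (phase r cs)" by (simp add: phase_def)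
qed

lemma counters_upd: "counters s i w \<Longrightarrow> r \<notin> {2, 3, 4} \<Longrightarrow> counters (s(r := v)) i w"
  by (auto simp: counters_def)

lemma counters_rI: "counters s i w \<Longrightarrow> counters (s(2 := unary j)) j w"
  by (auto simp: counters_def)

text \<open>The blocks of \<open>constraints\<close> are ordered so that one counter runs through
  them. It is reset only before the certificate block and before the adjacency constraints, and it
  reaches the position of \<open>Accept\<close> between two loops.\<close>

lemma polytime_constraints:
  fixes Q T :: "nat poly"
  shows "polytime 1 (\<lambda>ws. w0 @ concat (map con_word
    (constraints (ws ! 0) (poly Q (length (ws ! 0))) (poly T (length (ws ! 0))))) @ [False])"
proof -
  define nP :: "nat poly" where "nP = [:0, 1:]"
  define BP WP FP where "BP = nP + Q + T" and "WP = [:2:] * BP + [:2:]" and "FP = BP * WP + BP + [:1:]"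
  \<comment> \<open>Register 3 holds the row width, register 10 the start of the certificate block,
    and the others the lengths of the loops.\<close>
  define ds :: "(nat \<times> nat poly) list" where "ds = [(3, WP), (8, BP), (9, Q + T + [:1:]), (10, BP + [:1:]), (11, Q),
    (12, nP + T + [:1:]), (13, FP), (14, WP)]"
  obtain cs ts where cs: "pos_regs cs" and cs2:
    "\<And>s :: regs. (\<forall>d\<in>set (map fst ds). s d = []) \<and> s 5 = [] \<and> s 6 = [] \<and> s 7 = [] \<Longrightarrow>
       ex cs s (poly ts (length (s 1))) (set_all (length (s 1)) ds s)"
  proof -
    have "distinct (map fst ds)" "\<And>d. d \<in> set (map fst ds) \<Longrightarrow> d \<notin> {0, 1, 5, 6, 7}"
      by (auto simp: ds_def)
    from ex_set_all[OF this] show thesis using that by blast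
  qed
  let ?L1 = "[(LeftPad, 0, False), (GuessEnd, 0, False)] :: (label \<times> nat \<times> bool) list"
  let ?L2 = "[(Sym 0, 0, False)] :: (label \<times> nat \<times> bool) list"
  let ?L3 = "[(Guess, 1, False)] :: (label \<times> nat \<times> bool) list"
  let ?L4 = "[(GuessEnd, 0, False)] :: (label \<times> nat \<times> bool) list"
  let ?L5 = "[(Hor, 1, False), (Ver, 0, True)] :: (label \<times> nat \<times> bool) list"
  define out where "out w L i k = concat (map con_word (concat (map (\<lambda>d. map (\<lambda>c. con_of w c (i + d)) L) [0..<k])))"
    for w :: nat and L i k
  \<comment> \<open>The factor is turned into a function of the block, so that the running time can
    be written with it.\<close>
  have "\<exists>\<kappa>. \<forall>L s i w N k r. r > 4 \<and> counters s i w \<and> s r = unary k \<and> i + k \<le> N \<and> w \<le> N \<longrightarrow>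
     ex (phase r L) s (\<kappa> L * ((N + 1) * (N + 1))) (s(r := [], 2 := unary (i + k), 0 := s 0 @ out w L i k))"
    unfolding out_def by (rule choice, rule allI, rule ex_phase)
  then obtain kp where "\<forall>L s i w N k r. r > 4 \<and> counters s i w \<and> s r = unary k \<and> i + k \<le> N \<and> w \<le> N \<longrightarrow>
     ex (phase r L) s (kp L * ((N + 1) * (N + 1))) (s(r := [], 2 := unary (i + k), 0 := s 0 @ out w L i k))" ..
  note kp = this[rule_format]
  have "\<exists>\<kappa>. \<forall>c s i w N. counters s i w \<and> i \<le> N \<and> w \<le> N \<longrightarrow>
     ex (con_com c) s (\<kappa> c * (N + 1)) (s(0 := s 0 @ con_word (con_of w c i)))"
    by (rule choice, rule allI, rule ex_con_com)
  then obtain kc where "\<forall>c s i w N. counters s i w \<and> i \<le> N \<and> w \<le> N \<longrightarrow>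
     ex (con_com c) s (kc c * (N + 1)) (s(0 := s 0 @ con_word (con_of w c i)))" ..
  note kc = this[rule_format]
  define inp where "inp w xs i = concat (map con_word (map (\<lambda>d. con_of w (Sym (letter (xs ! d)), 0, False) (i + d)) [0..<length xs]))"
    for w :: nat and xs i
  have "\<exists>\<kappa>. \<forall>s i w N xs. counters s i w \<and> s 1 = xs \<and> i + length xs \<le> N \<and> w \<le> N \<longrightarrow>
     ex input_phase s (\<kappa> * ((N + 1) * (N + 1))) (s(1 := [], 2 := unary (i + length xs), 0 := s 0 @ inp w xs i))"
    unfolding inp_def by (rule ex_input_phase)
  then obtain ki where "\<forall>s i w N xs. counters s i w \<and> s 1 = xs \<and> i + length xs \<le> N \<and> w \<le> N \<longrightarrow>
     ex input_phase s (ki * ((N + 1) * (N + 1))) (s(1 := [], 2 := unary (i + length xs), 0 := s 0 @ inp w xs i))" ..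
  note ki = this[rule_format]
  define prog where "prog = cs ;; outw w0 ;; con_com (Border, 0, False) ;; Push 2 True ;; phase 8 ?L1 ;; input_phase ;;
    phase 9 ?L2 ;; clear 2 ;; pour 10 2 ;; phase 11 ?L3 ;; phase 12 ?L4 ;; clear 2 ;; phase 13 ?L5 ;;
    con_com (Accept, 0, False) ;; phase 14 ?L5 ;; Out False"
  \<comment> \<open>\<open>N\<close> is the largest position that the counter reaches and bounds all
    counters.\<close>
  define time where "time n = (let N = poly FP n + poly WP n; N2 = (N + 1) * (N + 1) in
     poly ts n + (2 * length w0 + (kc (Border, 0, False) * (N + 1) + (2 + (kp ?L1 * N2 + (ki * N2 + (kp ?L2 * N2 + ((3 * N + 1) +
     ((6 * N + 1) + (kp ?L3 * N2 + (kp ?L4 * N2 + ((3 * N + 1) + (kp ?L5 * N2 + (kc (Accept, 0, False) * (N + 1) + (kp ?L5 * N2 + 2)))))))))))))))" for n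
  show ?thesis
  proof (rule polytime_bounded[where c = prog and T = time])
    show "pos_regs prog"
      unfolding prog_def using cs(1)
      by (simp add: pos_regs_outw pos_regs_con pos_regs_phase input_phase_def clear_def pour_def del: con_com.simps)
    show "poly_bounded time"
      unfolding time_def Let_def by (intro poly_bounded_intros)
    fix ws :: "bool list list" assume "length ws = 1"
    then obtain x where ws: "ws = [x]" by (auto simp: length_Suc_conv)
    define n where "n = length x"
    define B where "B = n + poly Q n + poly T n"
    define W where "W = 2 * B + 2"
    define F where "F = B * W + B + 1"
    define N where "N = F + W"
    have polys: "poly BP n = B" "poly WP n = W" "poly FP n = F"
      by (simp_all add: BP_def WP_def FP_def nP_def B_def W_def F_def)
    define s0 where "s0 = input [x]"
    have s0: "s0 1 = x" "\<And>r. r \<noteq> 1 \<Longrightarrow> s0 r = []" by (auto simp: s0_def input_def)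
    define s1 where "s1 = set_all n ds s0"
    have e1: "ex cs s0 (poly ts n) s1" using cs2[of s0] s0 by (simp add: s1_def n_def ds_def)
    have r1: "s1 0 = []" "s1 1 = x" "s1 2 = []" "s1 3 = unary W" "s1 4 = []" "s1 8 = unary B"
      "s1 9 = unary (poly Q n + poly T n + 1)" "s1 10 = unary (B + 1)" "s1 11 = unary (poly Q n)"
      "s1 12 = unary (n + poly T n + 1)" "s1 13 = unary F" "s1 14 = unary W"
      using s0 polys by (simp_all add: s1_def ds_def nP_def)
    have c1: "counters s1 0 W" using r1 by (simp add: counters_def)
    have Bs: "n \<le> B" "poly Q n \<le> B" "poly T n \<le> B" "B + 1 + n + (poly Q n + poly T n + 1) = W"
      "B + 1 + poly Q n + (n + poly T n + 1) = W" "W \<le> N" "F + W \<le> N" "F \<le> N" "B + 1 \<le> N"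
      by (simp_all add: B_def W_def N_def F_def)
    define s2 where "s2 = s1(0 := s1 0 @ w0)"
    have e2: "ex (outw w0) s1 (2 * length w0) s2"
      by (rule ex_cong[OF ex_run[OF _ order_refl]]) (auto simp: s2_def)
    have c2: "counters s2 0 W" unfolding s2_def by (rule counters_upd[OF c1]) simp
    define s3 where "s3 = s2(0 := s2 0 @ con_word (con_of W (Border, 0, False) 0))"
    have e3: "ex (con_com (Border, 0, False)) s2 (kc (Border, 0, False) * (N + 1)) s3" unfolding s3_def by (rule kc) (use c2 Bs in simp)
    have c3: "counters s3 0 W" unfolding s3_def by (rule counters_upd[OF c2]) simp
    define s4 where "s4 = s3(2 := unary 1)"
    have e4: "ex (Push 2 True) s3 2 s4"
      by (rule ex_cong[OF ex_run[OF _ order_refl]]) (use c3 in \<open>auto simp: s4_def counters_def unary_def\<close>)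
    have c4: "counters s4 1 W" unfolding s4_def by (rule counters_rI[OF c3])
    define s5 where "s5 = s4(8 := [], 2 := unary (1 + B), 0 := s4 0 @ out W ?L1 1 B)"
    have e5: "ex (phase 8 ?L1) s4 (kp ?L1 * ((N + 1) * (N + 1))) s5"
      unfolding s5_def by (rule kp) (use c4 r1 Bs in \<open>simp add: s4_def s3_def s2_def\<close>)
    have c5: "counters s5 (1 + B) W" using c4 by (simp add: s5_def counters_def)
    define s6 where "s6 = s5(1 := [], 2 := unary (1 + B + length x), 0 := s5 0 @ inp W x (1 + B))"
    have e6: "ex input_phase s5 (ki * ((N + 1) * (N + 1))) s6"
      unfolding s6_def by (rule ki) (use c5 r1 Bs in \<open>simp add: s5_def s4_def s3_def s2_def n_def[symmetric]\<close>)
    have c6: "counters s6 (1 + B + n) W" using c5 by (simp add: s6_def counters_def n_def)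
    define s7 where "s7 = s6(9 := [], 2 := unary (1 + B + n + (poly Q n + poly T n + 1)),
      0 := s6 0 @ out W ?L2 (1 + B + n) (poly Q n + poly T n + 1))"
    have e7: "ex (phase 9 ?L2) s6 (kp ?L2 * ((N + 1) * (N + 1))) s7"
      unfolding s7_def by (rule kp) (use c6 r1 Bs in \<open>simp add: s6_def s5_def s4_def s3_def s2_def\<close>)
    have l7: "length (s7 2) \<le> N" using Bs by (simp add: s7_def)
    define s8 where "s8 = s7(2 := [])"
    have e8: "ex (clear 2) s7 (3 * N + 1) s8"
      by (rule ex_cong[OF ex_clear[OF order_refl]]) (use l7 in \<open>auto simp: s8_def\<close>)
    have r8: "s8 10 = unary (B + 1)" using r1 by (simp add: s8_def s7_def s6_def s5_def s4_def s3_def s2_def)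
    define s9 where "s9 = s8(2 := unary (B + 1), 10 := [])"
    have e9: "ex (pour 10 2) s8 (6 * N + 1) s9"
      by (rule ex_cong[OF ex_pour[OF _ order_refl]]) (use r8 Bs in \<open>auto simp: s9_def s8_def fun_eq_iff\<close>)
    have c9: "counters s9 (B + 1) W" using c6 by (simp add: s9_def s8_def s7_def counters_def)
    define s10 where "s10 = s9(11 := [], 2 := unary (B + 1 + poly Q n), 0 := s9 0 @ out W ?L3 (B + 1) (poly Q n))"
    have e10: "ex (phase 11 ?L3) s9 (kp ?L3 * ((N + 1) * (N + 1))) s10"
      unfolding s10_def by (rule kp) (use c9 r1 Bs in \<open>simp add: s9_def s8_def s7_def s6_def s5_def s4_def s3_def s2_def\<close>)
    have c10: "counters s10 (B + 1 + poly Q n) W" using c9 by (simp add: s10_def counters_def)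
    define s11 where "s11 = s10(12 := [], 2 := unary (B + 1 + poly Q n + (n + poly T n + 1)),
      0 := s10 0 @ out W ?L4 (B + 1 + poly Q n) (n + poly T n + 1))"
    have e11: "ex (phase 12 ?L4) s10 (kp ?L4 * ((N + 1) * (N + 1))) s11"
      unfolding s11_def by (rule kp) (use c10 r1 Bs in \<open>simp add: s10_def s9_def s8_def s7_def s6_def s5_def s4_def s3_def s2_def\<close>)
    have l11: "length (s11 2) \<le> N" using Bs by (simp add: s11_def)
    define s12 where "s12 = s11(2 := unary 0)"
    have e12: "ex (clear 2) s11 (3 * N + 1) s12"
      by (rule ex_cong[OF ex_clear[OF order_refl]]) (use l11 in \<open>auto simp: s12_def\<close>)
    have c12: "counters s12 0 W" using c10 by (simp add: s12_def s11_def counters_def)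
    define s13 where "s13 = s12(13 := [], 2 := unary (0 + F), 0 := s12 0 @ out W ?L5 0 F)"
    have e13: "ex (phase 13 ?L5) s12 (kp ?L5 * ((N + 1) * (N + 1))) s13"
      unfolding s13_def by (rule kp) (use c12 r1 Bs in \<open>simp add: s12_def s11_def s10_def s9_def s8_def s7_def s6_def s5_def s4_def s3_def s2_def\<close>)
    have c13: "counters s13 F W" using c12 by (simp add: s13_def counters_def)
    define s14 where "s14 = s13(0 := s13 0 @ con_word (con_of W (Accept, 0, False) F))"
    have e14: "ex (con_com (Accept, 0, False)) s13 (kc (Accept, 0, False) * (N + 1)) s14" unfolding s14_def by (rule kc) (use c13 Bs in simp)
    have c14: "counters s14 F W" unfolding s14_def by (rule counters_upd[OF c13]) simp
    define s15 where "s15 = s14(14 := [], 2 := unary (F + W), 0 := s14 0 @ out W ?L5 F W)"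
    have e15: "ex (phase 14 ?L5) s14 (kp ?L5 * ((N + 1) * (N + 1))) s15"
      unfolding s15_def by (rule kp) (use c14 r1 Bs in \<open>simp add: s14_def s13_def s12_def s11_def s10_def s9_def s8_def s7_def s6_def s5_def s4_def s3_def s2_def\<close>)
    define s16 where "s16 = s15(0 := s15 0 @ [False])"
    have e16: "ex (Out False) s15 2 s16"
      by (rule ex_cong[OF ex_run[OF _ order_refl]]) (auto simp: s16_def)
    have T: "time n = poly ts n + (2 * length w0 + (kc (Border, 0, False) * (N + 1) + (2 + (kp ?L1 * ((N + 1) * (N + 1)) + (ki * ((N + 1) * (N + 1)) +
      (kp ?L2 * ((N + 1) * (N + 1)) + ((3 * N + 1) + ((6 * N + 1) + (kp ?L3 * ((N + 1) * (N + 1)) + (kp ?L4 * ((N + 1) * (N + 1)) +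
      ((3 * N + 1) + (kp ?L5 * ((N + 1) * (N + 1)) + (kc (Accept, 0, False) * (N + 1) + (kp ?L5 * ((N + 1) * (N + 1)) + 2))))))))))))))"
      unfolding time_def Let_def polys N_def ..
    have run: "ex prog s0 (time n) s16"
      unfolding prog_def T
      by (rule ex_Seq[OF e1 ex_Seq[OF e2 ex_Seq[OF e3 ex_Seq[OF e4 ex_Seq[OF e5 ex_Seq[OF e6 ex_Seq[OF e7 ex_Seq[OF e8
        ex_Seq[OF e9 ex_Seq[OF e10 ex_Seq[OF e11 ex_Seq[OF e12 ex_Seq[OF e13 ex_Seq[OF e14 ex_Seq[OF e15 e16]]]]]]]]]]]]]]])
    have o: "s16 0 = w0 @ con_word (con_of W (Border, 0, False) 0) @ out W ?L1 1 B @ inp W x (1 + B) @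
       out W ?L2 (1 + B + n) (poly Q n + poly T n + 1) @ out W ?L3 (B + 1) (poly Q n) @
       out W ?L4 (B + 1 + poly Q n) (n + poly T n + 1) @ out W ?L5 0 F @ con_word (con_of W (Accept, 0, False) F) @
       out W ?L5 F W @ [False]"
      using r1(1) unfolding s16_def s15_def s14_def s13_def s12_def s11_def s10_def s9_def s8_def s7_def s6_def s5_def s4_def s3_def s2_def
      by (simp del: con_word.simps con_of.simps)
    have singles: "concat (map (\<lambda>i. [g i]) xs) = map g xs" for g :: "nat \<Rightarrow> nat \<times> label \<times> nat" and xs
      by (induction xs) auto
    have "concat (map con_word (constraints x (poly Q n) (poly T n))) =
       con_word (con_of W (Border, 0, False) 0) @ out W ?L1 1 B @ inp W x (1 + B) @
       out W ?L2 (1 + B + n) (poly Q n + poly T n + 1) @ out W ?L3 (B + 1) (poly Q n) @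
       out W ?L4 (B + 1 + poly Q n) (n + poly T n + 1) @ out W ?L5 0 F @ con_word (con_of W (Accept, 0, False) F) @
       out W ?L5 F W"
      unfolding constraints_def Let_def n_def[symmetric] B_def[symmetric] W_def[symmetric] F_def[symmetric] out_def inp_def
      by (simp add: singles add.commute[of B 1] add.assoc del: con_word.simps)
    with o have "s16 0 = w0 @ concat (map con_word (constraints x (poly Q n) (poly T n))) @ [False]" by simp
    then show "\<exists>s'. ex prog (input ws) (time (sum_list (map length ws))) s' \<and>
       s' 0 = w0 @ concat (map con_word (constraints (ws ! 0) (poly Q (length (ws ! 0))) (poly T (length (ws ! 0))))) @ [False]"
      using run by (auto simp: ws n_def s0_def)
  qed
qed

theorem entailment_problem_NP_hard:
  assumes "A \<in> NP" shows "poly_reducible A entailment_problem"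
proof -
  obtain R and q :: "nat poly" where R: "polytime 2 (\<lambda>ws. [R (ws ! 0) (ws ! 1)])"
    "\<And>x. x \<in> A \<longleftrightarrow> (\<exists>y. length y \<le> poly q (length x) \<and> R x y)"
    using assms unfolding NP_def by blast
  obtain M and p :: "nat poly" where M: "is_tm M" "2 \<le> tapes M"
    "\<And>ws. length ws = 2 \<Longrightarrow> \<exists>t\<le>poly p (sum_list (map length ws)). yields_in M ws t [R (ws ! 0) (ws ! 1)]"
    using R(1) unfolding polytime_def by blast
  interpret tiling M using M by unfold_locales
  have M': "\<exists>t\<le>poly p (length x + length y). yields_in M [x, y] t [R x y]" for x y
    using M(3)[of "[x, y]"] by simp
  have "finite template" using template_graph(1) by (simp add: is_graph_def)
  then obtain gs where gs: "set gs = template" using finite_list by blast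
  \<comment> \<open>The time bound of the verifier as a polynomial in the length of \<open>x\<close>
    alone, with certificates of maximal length.\<close>
  define T where "T = pcompose p ([:0, 1:] + q) + [:1:]"
  have T: "poly T n = poly p (n + poly q n) + 1" for n by (simp add: T_def poly_pcompose)
  \<comment> \<open>The machine is fixed, so the code of the template is a constant prefix and only
    the constraints depend on \<open>x\<close>.\<close>
  define f where "f x = (enc_triples gs @ [False]) @ concat (map con_word
    (constraints x (poly q (length x)) (poly T (length x)))) @ [False]" for x
  have "f x = enc_instance gs (map con_triple (constraints x (poly q (length x)) (poly T (length x))))" for x
    by (simp add: f_def enc_instance_eq enc_triples_con)
  then have "x \<in> A \<longleftrightarrow> f x \<in> entailment_problem" for x
    using tiling_reduction[OF M' gs T] R(2) by simp
  moreover have "polytime 1 (\<lambda>ws. f (ws ! 0))" unfolding f_def by (rule polytime_constraints)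
  ultimately show ?thesis unfolding poly_reducible_def by blast
qed

theorem theorem5p2:
  shows "NP_complete entailment_problem \<and>
    (\<forall>G H :: ('u, 'b, 'l) triples.
       is_graph G \<and> is_graph H \<and> ground H \<longrightarrow> (entails G H \<longleftrightarrow> H \<subseteq> Cl_B G)) \<and>
    (\<exists>c :: nat. \<forall>G :: ('u, 'b, 'l) triples.
       is_graph G \<longrightarrow> finite (Cl_B G) \<and> card (Cl_B G) \<le> c * (card G)\<^sup>2)"
  using NP_complete_def entailment_problem_NP entailment_problem_NP_hard entails_ground_iff card_Cl_B
  by blast

end
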